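(* Let $\Gamma$ be a finite group and $\xi\in R(\Gamma)$ a self-dual class function. The characteristic map $\mathrm{ch}$ is an isometry from the space $(R_\Gamma^-,\langle\ ,\ \rangle_\xi)$ to the space $(S_\Gamma^-,\langle\ ,\ \rangle'_\xi)$.
   Context: Groups. $\Gamma^*$ is the set of irreducible complex characters of $\Gamma$, $\Gamma_*$ the set of conjugacy classes, $\zeta_c$ the order of the centralizer of an element of $c\in\Gamma_*$, $c^{-1}=\{x^{-1}:x\in c\}$, $R(\Gamma)$ the complex class functions; $\xi$ self-dual means $\xi(c)=\xi(c^{-1})$. For $n\ge0$, $\widetilde S_n$ is the group generated by $z,t_1,\dots,t_{n-1}$ with relations $z^2=1$, $zt_i=t_iz$, $t_i^2=(t_it_{i+1})^3=z$, $t_it_j=zt_jt_i$ for $i>j+1$; it maps onto $S_n$ by $t_i\mapsto(i,i+1)$, $z\mapsto1$. It acts on $\Gamma^n$ through $S_n$ by $s(g_1,\dots,g_n)=(g_{s^{-1}(1)},\dots,g_{s^{-1}(n)})$, and $\widetilde\Gamma_n=\Gamma^n\rtimes\widetilde S_n$ with $(g,t)(h,s)=(g\,t(h),ts)$; $\Gamma_n=\Gamma\wr S_n=\widetilde\Gamma_n/\{1,z\}$. The parity is the homomorphism $d:\widetilde\Gamma_n\to\mathbb Z/2$ with $d(g,t_i)=1$, $d(g,z)=0$. Types. For a partition-valued function $\rho=(\rho(c))_{c\in\Gamma_*}$, $l(\rho)=\sum_cl(\rho(c))$. The type of $(g,\sigma)\in\Gamma_n$ is the $\rho$ obtained by letting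 each cycle $(i_1\cdots i_k)$ of $\sigma$ with $g_{i_k}\cdots g_{i_1}\in c$ contribute a part $k$ to $\rho(c)$. $\mathcal{OP}_n(\Gamma_* )$ is the set of $\rho$ with $\sum_c|\rho(c)|=n$ and all parts odd. $Z_\rho=\prod_cz_{\rho(c)}\zeta_c^{l(\rho(c))}$ with $z_\lambda=\prod_ii^{m_i}m_i!$ for $\lambda=(1^{m_1}2^{m_2}\cdots)$. Fix an order $c^0=\{1\},\dots,c^r$ of $\Gamma_*$. For $\rho\in\mathcal{OP}_n(\Gamma_* )$ cut $1,\dots,n$ into consecutive intervals whose lengths are the parts of $\rho(c^0)$ (decreasing), then of $\rho(c^1)$, etc.; $t^\rho$ is the product in this order of $t_at_{a+1}\cdots t_{b-1}$ over the intervals $\{a,\dots,b\}$ ($1$ if $a=b$). $D_\rho^+$ is the conjugacy class of $(g,t^\rho)$ in $\widetilde\Gamma_n$, where the cycle product of $g$ over each interval coming from $\rho(c^i)$ lies in $c^i$. Write $f(\rho)=f(D_\rho^+)$. Spaces and forms. $R^-(\widetilde\Gamma_n)$ is the space of class functions $f$ on $\widetilde\Gamma_n$ with $f(zx)=-f(x)$ vanishing on odd elements (determined by the $f(\rho)$); $R_\Gamma^-=\bigoplus_{n\ge0}R^-(\widetilde\Gamma_n)$. On $R(\Gamma)$, $\langle f,g\rangle_\xi=\frac1{|\Gamma|}\sum_x\xi(x)f(x)g(x^{-1})$. On $R^-(\widetilde\Gamma_n)$, $\langle f,g\rangle_\xi=\frac1{|\widetilde\Gamma_n|}\sum_x\eta_n(\xi)(x)f(x)g(x^{-1})$,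 where $\eta_n(\xi)$ takes the value $\prod_c\xi(c)^{l(\rho(c))}$ on elements of type $\rho$; on $R_\Gamma^-$ different degrees $n$ are orthogonal. $S_\Gamma^-$ is the polynomial algebra over $\mathbb C$ on $a_{-n}(\gamma)$, $n>0$ odd, $\gamma\in\Gamma^*$; for odd $n>0$, $a_n(\gamma)$ acts on it as the derivation with $a_n(\gamma).a_{-m}(\beta)=\frac n2\delta_{n,m}\langle\gamma,\beta\rangle_\xi$. $\langle\ ,\ \rangle'_\xi$ is the bilinear form on $S_\Gamma^-$ with $\langle1,1\rangle'_\xi=1$ for which multiplication by $a_{-n}(\gamma)$ and the operator $a_n(\gamma)$ are adjoint. For $c\in\Gamma_*$, $a_{-n}(c)=\sum_{\gamma\in\Gamma^*}\gamma(c^{-1})a_{-n}(\gamma)$; $a'_{-\rho}=\prod_c\prod_ia_{-\rho_i(c)}(c)$. The characteristic map is the linear map $\mathrm{ch}:R_\Gamma^-\to S_\Gamma^-$, $\mathrm{ch}(f)=\sum_{\rho\in\mathcal{OP}_n(\Gamma_* )}\frac{2^{l(\rho)/2}}{Z_\rho}f(\rho)a'_{-\rho}$ for $f\in R^-(\widetilde\Gamma_n)$. *)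

theory Defs
  imports
    "HOL-Algebra.Sym_Groups"
    "HOL-Algebra.Product_Groups"
    "HOL-Combinatorics.Orbits"
    "HOL-Library.Multiset"
    "HOL-Library.Poly_Mapping"
    "Jordan_Normal_Form.VS_Connect"
begin

section \<open>Conjugacy classes, class functions and irreducible characters\<close>

definition conj_class :: "('a, 'b) monoid_scheme \<Rightarrow> 'a \<Rightarrow> 'a set" where
  "conj_class G x = {y \<otimes>\<^bsub>G\<^esub> x \<otimes>\<^bsub>G\<^esub> inv\<^bsub>G\<^esub> y | y. y \<in> carrier G}"

definition conj_classes :: "('a, 'b) monoid_scheme \<Rightarrow> 'a set set" where
  "conj_classes G = conj_class G ` carrier G"

definition centralizer_order :: "('a, 'b) monoid_scheme \<Rightarrow> 'a set \<Rightarrow> nat" where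
  "centralizer_order G c =
     card {y \<in> carrier G. y \<otimes>\<^bsub>G\<^esub> (SOME x. x \<in> c) = (SOME x. x \<in> c) \<otimes>\<^bsub>G\<^esub> y}"

text \<open>Functions on a group are extended by zero outside the carrier, so that the class
  functions are closed under pointwise linear operations.\<close>

definition class_functions :: "('a, 'b) monoid_scheme \<Rightarrow> ('a \<Rightarrow> complex) set" where
  "class_functions G =
     {f. (\<forall>x. x \<notin> carrier G \<longrightarrow> f x = 0) \<and>
         (\<forall>x\<in>carrier G. \<forall>y\<in>carrier G. f (y \<otimes>\<^bsub>G\<^esub> x \<otimes>\<^bsub>G\<^esub> inv\<^bsub>G\<^esub> y) = f x)}"

text \<open>The common value of \<open>f\<close> on the elements of \<open>c\<close>.\<close>

definition class_value :: "('a \<Rightarrow> complex) \<Rightarrow> 'a set \<Rightarrow> complex" where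
  "class_value f c = the_elem (f ` c)"

definition self_dual :: "('a, 'b) monoid_scheme \<Rightarrow> ('a \<Rightarrow> complex) \<Rightarrow> bool" where
  "self_dual G \<xi> \<longleftrightarrow>
     (\<forall>c\<in>conj_classes G. class_value \<xi> c = class_value \<xi> (set_inv\<^bsub>G\<^esub> c))"

definition irreducible_rep ::
  "('a, 'b) monoid_scheme \<Rightarrow> nat \<Rightarrow> ('a \<Rightarrow> complex mat) \<Rightarrow> bool" where
  "irreducible_rep G d \<pi> \<longleftrightarrow>
     0 < d \<and>
     \<pi> \<in> hom G (units_of (ring_mat TYPE(complex) d ())) \<and>
     (\<forall>W. VectorSpace.subspace class_ring W (module_vec TYPE(complex) d) \<longrightarrow>
          (\<forall>x\<in>carrier G. \<forall>w\<in>W. \<pi> x *\<^sub>v w \<in> W) \<longrightarrow>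
          W = {0\<^sub>v d} \<or> W = carrier_vec d)"

definition irr_chars :: "('a, 'b) monoid_scheme \<Rightarrow> ('a \<Rightarrow> complex) set" where
  "irr_chars G =
     {\<chi>. \<exists>d \<pi>. irreducible_rep G d \<pi> \<and>
          \<chi> = (\<lambda>x. if x \<in> carrier G then sum_list (diag_mat (\<pi> x)) else 0)}"

definition weighted_form ::
  "('a, 'b) monoid_scheme \<Rightarrow> ('a \<Rightarrow> complex) \<Rightarrow> ('a \<Rightarrow> complex) \<Rightarrow> ('a \<Rightarrow> complex) \<Rightarrow> complex" where
  "weighted_form G \<xi> f g =
     (\<Sum>x\<in>carrier G. \<xi> x * f x * g (inv\<^bsub>G\<^esub> x)) / of_nat (Coset.order G)"


section \<open>Groups given by generators and relations\<close>

text \<open>A word is a list of letters; \<open>(g, True)\<close> stands for the generator \<open>g\<close> and \<open>(g, False)\<close>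
  for its inverse.\<close>

type_synonym 'g word = "('g \<times> bool) list"

abbreviation pos_word :: "'g list \<Rightarrow> 'g word" where
  "pos_word gs \<equiv> map (\<lambda>g. (g, True)) gs"

inductive pres_eq :: "'g set \<Rightarrow> ('g word \<times> 'g word) set \<Rightarrow> 'g word \<Rightarrow> 'g word \<Rightarrow> bool"
  for X R where
  pres_refl: "set u \<subseteq> X \<times> UNIV \<Longrightarrow> pres_eq X R u u"
| pres_sym: "pres_eq X R u v \<Longrightarrow> pres_eq X R v u"
| pres_trans: "pres_eq X R u v \<Longrightarrow> pres_eq X R v w \<Longrightarrow> pres_eq X R u w"
| pres_rel: "(u, v) \<in> R \<Longrightarrow> set u \<subseteq> X \<times> UNIV \<Longrightarrow> set v \<subseteq> X \<times> UNIV \<Longrightarrow> pres_eq X R u v"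
| pres_cancel: "g \<in> X \<Longrightarrow> pres_eq X R [(g, b), (g, \<not> b)] []"
| pres_append: "pres_eq X R u u' \<Longrightarrow> pres_eq X R v v' \<Longrightarrow> pres_eq X R (u @ v) (u' @ v')"

definition pres_class :: "'g set \<Rightarrow> ('g word \<times> 'g word) set \<Rightarrow> 'g word \<Rightarrow> 'g word set" where
  "pres_class X R u = {v. pres_eq X R u v}"

definition presented_group ::
  "'g set \<Rightarrow> ('g word \<times> 'g word) set \<Rightarrow> 'g word set monoid" where
  "presented_group X R =
     \<lparr>carrier = pres_class X R ` {u. set u \<subseteq> X \<times> UNIV},
      mult = (\<lambda>A B. {w. \<exists>u\<in>A. \<exists>v\<in>B. pres_eq X R (u @ v) w}),
      one = pres_class X R []\<rparr>"

definition word_eval :: "('h, 'b) monoid_scheme \<Rightarrow> ('g \<Rightarrow> 'h) \<Rightarrow> 'g word \<Rightarrow> 'h" where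
  "word_eval H \<phi> w =
     foldr (\<lambda>(g, b) h. (if b then \<phi> g else inv\<^bsub>H\<^esub> \<phi> g) \<otimes>\<^bsub>H\<^esub> h) w \<one>\<^bsub>H\<^esub>"

text \<open>The homomorphism from a presented group to \<open>H\<close> given on generators by \<open>\<phi>\<close>.\<close>

definition pres_lift :: "('h, 'b) monoid_scheme \<Rightarrow> ('g \<Rightarrow> 'h) \<Rightarrow> 'g word set \<Rightarrow> 'h" where
  "pres_lift H \<phi> A = the_elem (word_eval H \<phi> ` A)"

lemma pres_eq_lists:
  "pres_eq X R u v \<Longrightarrow> set u \<subseteq> X \<times> UNIV \<and> set v \<subseteq> X \<times> UNIV"
  by (induction rule: pres_eq.induct) auto

lemma pres_class_eq_iff:
  assumes "set u \<subseteq> X \<times> UNIV" "set v \<subseteq> X \<times> UNIV"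
  shows "pres_class X R u = pres_class X R v \<longleftrightarrow> pres_eq X R u v"
  using assms unfolding pres_class_def
  by (metis (mono_tags, lifting) Collect_cong mem_Collect_eq pres_refl pres_sym pres_trans)

lemma presented_mult:
  assumes "set u \<subseteq> X \<times> UNIV" "set v \<subseteq> X \<times> UNIV"
  shows "pres_class X R u \<otimes>\<^bsub>presented_group X R\<^esub> pres_class X R v = pres_class X R (u @ v)"
proof -
  have "pres_eq X R (u @ v) w"
    if "pres_eq X R u u'" "pres_eq X R v v'" "pres_eq X R (u' @ v') w" for u' v' w
    using that by (meson pres_append pres_trans)
  then show ?thesis
    using assms by (auto simp: presented_group_def pres_class_def intro: pres_refl)
qed

lemma pres_inverse:
  assumes "set u \<subseteq> X \<times> UNIV"
  shows "pres_eq X R (rev (map (\<lambda>(g, b). (g, \<not> b)) u) @ u) []"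
  using assms
proof (induction u)
  case Nil
  then show ?case by (simp add: pres_refl)
next
  case (Cons a u)
  obtain g b where a: "a = (g, b)" by force
  have g: "g \<in> X" and u: "set u \<subseteq> X \<times> UNIV" using Cons.prems a by auto
  let ?i = "rev (map (\<lambda>(g, b). (g, \<not> b)) u)"
  have i: "set ?i \<subseteq> X \<times> UNIV" using u by auto
  have "pres_eq X R ([(g, \<not> b), (g, \<not> \<not> b)] @ u) ([] @ u)"
    by (intro pres_append pres_cancel pres_refl g u)
  then have "pres_eq X R (?i @ [(g, \<not> b), (g, b)] @ u) (?i @ u)"
    using pres_append[OF pres_refl[OF i]] by simp
  then show ?case
    using Cons.IH u a by (auto intro: pres_trans)
qed

lemma presented_group_group: "group (presented_group X R)"
proof (rule groupI)
  let ?P = "presented_group X R"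
  have C: "carrier ?P = pres_class X R ` {u. set u \<subseteq> X \<times> UNIV}"
    and one: "\<one>\<^bsub>?P\<^esub> = pres_class X R []"
    by (simp_all add: presented_group_def)
  show "x \<otimes>\<^bsub>?P\<^esub> y \<in> carrier ?P" if "x \<in> carrier ?P" "y \<in> carrier ?P" for x y
    using that by (auto simp: C presented_mult)
  show "\<one>\<^bsub>?P\<^esub> \<in> carrier ?P"
    by (auto simp: C one)
  show "x \<otimes>\<^bsub>?P\<^esub> y \<otimes>\<^bsub>?P\<^esub> z = x \<otimes>\<^bsub>?P\<^esub> (y \<otimes>\<^bsub>?P\<^esub> z)"
    if "x \<in> carrier ?P" "y \<in> carrier ?P" "z \<in> carrier ?P" for x y z
    using that by (auto simp: C presented_mult)
  show "\<one>\<^bsub>?P\<^esub> \<otimes>\<^bsub>?P\<^esub> x = x" if "x \<in> carrier ?P" for x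
    using that by (auto simp: C one presented_mult)
  show "\<exists>y\<in>carrier ?P. y \<otimes>\<^bsub>?P\<^esub> x = \<one>\<^bsub>?P\<^esub>" if x: "x \<in> carrier ?P" for x
  proof -
    obtain u where u: "set u \<subseteq> X \<times> UNIV" "x = pres_class X R u"
      using x by (auto simp: C)
    let ?i = "rev (map (\<lambda>(g, b). (g, \<not> b)) u)"
    have i: "set ?i \<subseteq> X \<times> UNIV" using u(1) by auto
    have "pres_class X R ?i \<otimes>\<^bsub>?P\<^esub> x = pres_class X R (?i @ u)"
      unfolding u(2) by (rule presented_mult[OF i u(1)])
    also have "\<dots> = pres_class X R []"
      using pres_inverse[OF u(1)] pres_eq_lists pres_class_eq_iff by blast
    finally show ?thesis unfolding C one by (rule bexI) (intro imageI CollectI i)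
  qed
qed

lemma word_eval_closed:
  assumes "group H" "\<phi> \<in> X \<rightarrow> carrier H" "set u \<subseteq> X \<times> UNIV"
  shows "word_eval H \<phi> u \<in> carrier H"
proof -
  interpret group H by fact
  show ?thesis
    using assms(2,3) by (induction u) (auto simp: word_eval_def Pi_iff)
qed

lemma word_eval_append:
  assumes "group H" "\<phi> \<in> X \<rightarrow> carrier H" "set u \<subseteq> X \<times> UNIV" "set v \<subseteq> X \<times> UNIV"
  shows "word_eval H \<phi> (u @ v) = word_eval H \<phi> u \<otimes>\<^bsub>H\<^esub> word_eval H \<phi> v"
proof -
  interpret group H by fact
  have v: "word_eval H \<phi> v \<in> carrier H" using word_eval_closed assms by blast
  have cl: "word_eval H \<phi> u \<in> carrier H" if "set u \<subseteq> X \<times> UNIV" for u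
    using word_eval_closed assms(1,2) that by blast
  show ?thesis
    using assms(3)
  proof (induction u)
    case Nil
    then show ?case using v by (simp add: word_eval_def)
  next
    case (Cons a u)
    obtain g b where a: "a = (g, b)" by force
    have g: "\<phi> g \<in> carrier H" and u: "set u \<subseteq> X \<times> UNIV"
      using Cons.prems a assms(2) by auto
    have "word_eval H \<phi> ((a # u) @ v)
        = (if b then \<phi> g else inv\<^bsub>H\<^esub> \<phi> g) \<otimes>\<^bsub>H\<^esub> word_eval H \<phi> (u @ v)"
      by (simp add: word_eval_def a)
    also have "\<dots> = (if b then \<phi> g else inv\<^bsub>H\<^esub> \<phi> g) \<otimes>\<^bsub>H\<^esub> word_eval H \<phi> u \<otimes>\<^bsub>H\<^esub> word_eval H \<phi> v"
      using Cons.IH u cl[OF u] v g by (simp add: m_assoc)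
    also have "\<dots> = word_eval H \<phi> (a # u) \<otimes>\<^bsub>H\<^esub> word_eval H \<phi> v"
      by (simp add: word_eval_def a)
    finally show ?case .
  qed
qed

lemma word_eval_cong:
  assumes H: "group H" and \<phi>: "\<phi> \<in> X \<rightarrow> carrier H"
    and R: "\<And>u v. (u, v) \<in> R \<Longrightarrow> word_eval H \<phi> u = word_eval H \<phi> v"
    and "pres_eq X R u v"
  shows "word_eval H \<phi> u = word_eval H \<phi> v"
  using assms(4)
proof (induction rule: pres_eq.induct)
  case (pres_cancel g b)
  interpret group H by fact
  have "\<phi> g \<in> carrier H" using pres_cancel \<phi> by auto
  then show ?case by (simp add: word_eval_def)
next
  case (pres_append u u' v v')
  then show ?case
    using word_eval_append[OF H \<phi>] pres_eq_lists by metis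
qed (use R in auto)

lemma pres_lift_class:
  assumes "group H" "\<phi> \<in> X \<rightarrow> carrier H"
    and "\<And>u v. (u, v) \<in> R \<Longrightarrow> word_eval H \<phi> u = word_eval H \<phi> v"
    and u: "set u \<subseteq> X \<times> UNIV"
  shows "pres_lift H \<phi> (pres_class X R u) = word_eval H \<phi> u"
proof -
  have "word_eval H \<phi> ` pres_class X R u = {word_eval H \<phi> u}"
    using word_eval_cong[OF assms(1-3)] pres_refl[OF u] by (force simp: pres_class_def)
  then show ?thesis by (simp add: pres_lift_def)
qed

lemma pres_lift_hom:
  assumes "group H" "\<phi> \<in> X \<rightarrow> carrier H"
    and "\<And>u v. (u, v) \<in> R \<Longrightarrow> word_eval H \<phi> u = word_eval H \<phi> v"
  shows "pres_lift H \<phi> \<in> hom (presented_group X R) H"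
proof (rule homI)
  have C: "carrier (presented_group X R) = pres_class X R ` {u. set u \<subseteq> X \<times> UNIV}"
    by (simp add: presented_group_def)
  note lift = pres_lift_class[OF assms]
  show "pres_lift H \<phi> A \<in> carrier H" if "A \<in> carrier (presented_group X R)" for A
    using that lift word_eval_closed[OF assms(1,2)]
    by (auto simp: C)
  show "pres_lift H \<phi> (A \<otimes>\<^bsub>presented_group X R\<^esub> B) = pres_lift H \<phi> A \<otimes>\<^bsub>H\<^esub> pres_lift H \<phi> B"
    if AB: "A \<in> carrier (presented_group X R)" "B \<in> carrier (presented_group X R)" for A B
  proof -
    obtain u v where uv: "set u \<subseteq> X \<times> UNIV" "set v \<subseteq> X \<times> UNIV"
      "A = pres_class X R u" "B = pres_class X R v"
      using AB by (auto simp: C)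
    have "set (u @ v) \<subseteq> X \<times> UNIV" using uv by auto
    then show ?thesis
      using uv by (simp add: presented_mult lift word_eval_append[OF assms(1,2)])
  qed
qed


section \<open>The double cover of the symmetric group and of the wreath product\<close>

datatype spin_gen = Zgen | Tgen nat

type_synonym spin_elt = "spin_gen word set"

definition spin_gens :: "nat \<Rightarrow> spin_gen set" where
  "spin_gens n = insert Zgen (Tgen ` {1..<n})"

definition spin_rels :: "nat \<Rightarrow> (spin_gen word \<times> spin_gen word) set" where
  "spin_rels n = (\<lambda>(u, v). (pos_word u, pos_word v)) `
     ({([Zgen, Zgen], [])} \<union>
      {([Zgen, Tgen i], [Tgen i, Zgen]) | i. i \<in> {1..<n}} \<union>
      {([Tgen i, Tgen i], [Zgen]) | i. i \<in> {1..<n}} \<union>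
      {(concat (replicate 3 [Tgen i, Tgen (i + 1)]), [Zgen]) | i. i \<in> {1..<n} \<and> i + 1 \<in> {1..<n}} \<union>
      {([Tgen i, Tgen j], [Zgen, Tgen j, Tgen i]) | i j.
          i \<in> {1..<n} \<and> j \<in> {1..<n} \<and> i > j + 1})"

definition spin_group :: "nat \<Rightarrow> spin_elt monoid" where
  "spin_group n = presented_group (spin_gens n) (spin_rels n)"

definition spin_word :: "nat \<Rightarrow> spin_gen list \<Rightarrow> spin_elt" where
  "spin_word n gs = pres_class (spin_gens n) (spin_rels n) (pos_word gs)"

definition spin_perm :: "nat \<Rightarrow> spin_elt \<Rightarrow> nat \<Rightarrow> nat" where
  "spin_perm n = pres_lift (sym_group n)
     (\<lambda>g. case g of Zgen \<Rightarrow> id | Tgen i \<Rightarrow> transpose i (i + 1))"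

definition spin_parity :: "spin_elt \<Rightarrow> int" where
  "spin_parity = pres_lift (integer_mod_group 2) (\<lambda>g. case g of Zgen \<Rightarrow> 0 | Tgen i \<Rightarrow> 1)"

definition spin_act :: "nat \<Rightarrow> spin_elt \<Rightarrow> (nat \<Rightarrow> 'a) \<Rightarrow> (nat \<Rightarrow> 'a)" where
  "spin_act n t g = (\<lambda>i\<in>{1..n}. g (inv' (spin_perm n t) i))"

abbreviation power_group :: "('a, 'b) monoid_scheme \<Rightarrow> nat \<Rightarrow> (nat \<Rightarrow> 'a) monoid" where
  "power_group G n \<equiv> product_group {1..n} (\<lambda>_. G)"

type_synonym 'a spin_wreath_elt = "(nat \<Rightarrow> 'a) \<times> spin_elt"

definition spin_wreath :: "('a, 'b) monoid_scheme \<Rightarrow> nat \<Rightarrow> 'a spin_wreath_elt monoid" where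
  "spin_wreath G n =
     \<lparr>carrier = carrier (power_group G n) \<times> carrier (spin_group n),
      mult = (\<lambda>(g, t) (h, s).
        (g \<otimes>\<^bsub>power_group G n\<^esub> spin_act n t h, t \<otimes>\<^bsub>spin_group n\<^esub> s)),
      one = (\<one>\<^bsub>power_group G n\<^esub>, \<one>\<^bsub>spin_group n\<^esub>)\<rparr>"

definition spin_z :: "('a, 'b) monoid_scheme \<Rightarrow> nat \<Rightarrow> 'a spin_wreath_elt" where
  "spin_z G n = (\<one>\<^bsub>power_group G n\<^esub>, spin_word n [Zgen])"

lemma spin_perm_hom: "spin_perm n \<in> hom (spin_group n) (sym_group n)"
  unfolding spin_perm_def spin_group_def
proof (rule pres_lift_hom)
  let ?\<phi> = "\<lambda>g. case g of Zgen \<Rightarrow> id | Tgen i \<Rightarrow> transpose i (i + 1)"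
  show "group (sym_group n)" by (rule sym_group_is_group)
  show "?\<phi> \<in> spin_gens n \<rightarrow> carrier (sym_group n)"
    by (auto simp: spin_gens_def sym_group_carrier permutes_id intro!: permutes_swap_id)
  show "word_eval (sym_group n) ?\<phi> u = word_eval (sym_group n) ?\<phi> v"
    if "(u, v) \<in> spin_rels n" for u v
    using that
    by (auto simp: spin_rels_def word_eval_def sym_group_mult sym_group_one numeral_3_eq_3
        fun_eq_iff transpose_def)
qed

lemma spin_parity_hom: "spin_parity \<in> hom (spin_group n) (integer_mod_group 2)"
  unfolding spin_parity_def spin_group_def
proof (rule pres_lift_hom)
  let ?\<phi> = "\<lambda>g. case g of Zgen \<Rightarrow> 0 | Tgen i \<Rightarrow> 1"
  show "group (integer_mod_group 2)" by simp
  show "?\<phi> \<in> spin_gens n \<rightarrow> carrier (integer_mod_group 2)"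
    by (auto simp: spin_gens_def carrier_integer_mod_group)
  show "word_eval (integer_mod_group 2) ?\<phi> u = word_eval (integer_mod_group 2) ?\<phi> v"
    if "(u, v) \<in> spin_rels n" for u v
    using that by (auto simp: spin_rels_def word_eval_def numeral_3_eq_3)
qed

lemma spin_wreath_group:
  assumes "group G"
  shows "group (spin_wreath G n)"
proof (rule groupI)
  let ?W = "spin_wreath G n"
  interpret G: group G by fact
  interpret N: group "power_group G n" by (simp add: assms)
  interpret S: group "spin_group n" unfolding spin_group_def by (rule presented_group_group)
  have perm: "spin_perm n t permutes {1..n}" if "t \<in> carrier (spin_group n)" for t
    using hom_in_carrier[OF spin_perm_hom that] by (simp add: sym_group_carrier)
  have act_closed: "spin_act n t h \<in> carrier (power_group G n)"
    if "t \<in> carrier (spin_group n)" "h \<in> carrier (power_group G n)" for t h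
    using that permutes_in_image[OF permutes_inv[OF perm[OF that(1)]]]
    by (auto simp: spin_act_def)
  have act_mult: "spin_act n t (g \<otimes>\<^bsub>power_group G n\<^esub> h)
      = spin_act n t g \<otimes>\<^bsub>power_group G n\<^esub> spin_act n t h"
    if "t \<in> carrier (spin_group n)" for t g h
    using permutes_in_image[OF permutes_inv[OF perm[OF that]]]
    by (auto simp: spin_act_def fun_eq_iff)
  have act_act: "spin_act n (t \<otimes>\<^bsub>spin_group n\<^esub> s) h = spin_act n t (spin_act n s h)"
    if "t \<in> carrier (spin_group n)" "s \<in> carrier (spin_group n)" for t s h
  proof -
    have eq: "spin_perm n (t \<otimes>\<^bsub>spin_group n\<^esub> s) = spin_perm n t \<circ> spin_perm n s"
      using hom_mult[OF spin_perm_hom that] by (simp add: sym_group_mult)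
    have "inv' (spin_perm n t \<circ> spin_perm n s) = inv' (spin_perm n s) \<circ> inv' (spin_perm n t)"
      using permutes_bij[OF perm[OF that(1)]] permutes_bij[OF perm[OF that(2)]]
      by (rule o_inv_distrib)
    then show ?thesis
      using permutes_in_image[OF permutes_inv[OF perm[OF that(1)]]]
      by (auto simp: spin_act_def fun_eq_iff eq)
  qed
  have act_one: "spin_act n \<one>\<^bsub>spin_group n\<^esub> h = h" if "h \<in> carrier (power_group G n)" for h
  proof -
    have "spin_perm n \<one>\<^bsub>spin_group n\<^esub> = id"
      using hom_one[OF spin_perm_hom S.is_group sym_group_is_group] by (simp add: sym_group_one)
    then show ?thesis using that
      by (simp only: spin_act_def inv_id id_apply) (auto simp: PiE_iff extensional_def)
  qed
  note W = spin_wreath_def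
  show "x \<otimes>\<^bsub>?W\<^esub> y \<in> carrier ?W" if "x \<in> carrier ?W" "y \<in> carrier ?W" for x y
    using that act_closed N.m_closed S.m_closed
    by (auto simp: W simp del: carrier_product_group mult_product_group)
  show "\<one>\<^bsub>?W\<^esub> \<in> carrier ?W"
    using N.one_closed S.one_closed
    by (auto simp: W simp del: carrier_product_group one_product_group)
  show "x \<otimes>\<^bsub>?W\<^esub> y \<otimes>\<^bsub>?W\<^esub> z = x \<otimes>\<^bsub>?W\<^esub> (y \<otimes>\<^bsub>?W\<^esub> z)"
    if "x \<in> carrier ?W" "y \<in> carrier ?W" "z \<in> carrier ?W" for x y z
    using that act_closed N.m_assoc S.m_assoc S.m_closed
    by (auto simp: W act_mult act_act
        simp del: carrier_product_group mult_product_group One_nat_def)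
  show "\<one>\<^bsub>?W\<^esub> \<otimes>\<^bsub>?W\<^esub> x = x" if "x \<in> carrier ?W" for x
    using that N.l_one S.l_one act_one
    by (auto simp: W simp del: carrier_product_group mult_product_group one_product_group)
  show "\<exists>y\<in>carrier ?W. y \<otimes>\<^bsub>?W\<^esub> x = \<one>\<^bsub>?W\<^esub>" if x: "x \<in> carrier ?W" for x
  proof -
    obtain g t where gt: "x = (g, t)" "g \<in> carrier (power_group G n)" "t \<in> carrier (spin_group n)"
      using x by (auto simp: W simp del: carrier_product_group)
    let ?s = "inv\<^bsub>spin_group n\<^esub> t"
    let ?h = "inv\<^bsub>power_group G n\<^esub> (spin_act n ?s g)"
    have a: "spin_act n ?s g \<in> carrier (power_group G n)" using act_closed gt by simp
    have "(?h, ?s) \<in> carrier ?W"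
      using N.inv_closed[OF a] gt by (simp add: W del: carrier_product_group inv_product_group)
    moreover have "(?h, ?s) \<otimes>\<^bsub>?W\<^esub> x = \<one>\<^bsub>?W\<^esub>"
      using N.l_inv[OF a] gt
      by (simp add: W del: carrier_product_group inv_product_group mult_product_group
          one_product_group)
    ultimately show ?thesis by blast
  qed
qed


section \<open>Types and the classes indexed by odd partition-valued functions\<close>

text \<open>A partition is the multiset of its (positive) parts; a partition-valued function on the
  conjugacy classes is extended by the empty partition to other sets.\<close>

type_synonym 'a part_fun = "'a set \<Rightarrow> nat multiset"

definition ordered_prod :: "('a, 'b) monoid_scheme \<Rightarrow> (nat \<Rightarrow> 'a) \<Rightarrow> nat list \<Rightarrow> 'a" where
  "ordered_prod G g is = foldr (\<lambda>i h. g i \<otimes>\<^bsub>G\<^esub> h) is \<one>\<^bsub>G\<^esub>"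

text \<open>The product $g_{i_k} \cdots g_{i_1}$ over the cycle $(i_1 \cdots i_k)$ of \<open>\<sigma>\<close> with
  $i_1 = i$.\<close>

definition cycle_prod :: "('a, 'b) monoid_scheme \<Rightarrow> (nat \<Rightarrow> 'a) \<Rightarrow> (nat \<Rightarrow> nat) \<Rightarrow> nat \<Rightarrow> 'a" where
  "cycle_prod G g \<sigma> i =
     ordered_prod G g (rev (map (\<lambda>j. (\<sigma> ^^ j) i) [0..<card (orbit \<sigma> i)]))"

text \<open>Changing the starting point of a cycle conjugates its cycle product, so each cycle
  contributes to exactly one class.\<close>

definition wreath_type ::
  "('a, 'b) monoid_scheme \<Rightarrow> nat \<Rightarrow> (nat \<Rightarrow> 'a) \<Rightarrow> (nat \<Rightarrow> nat) \<Rightarrow> 'a part_fun" where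
  "wreath_type G n g \<sigma> = (\<lambda>c. if c \<in> conj_classes G
     then image_mset card (mset_set {orbit \<sigma> i | i. i \<in> {1..n} \<and> cycle_prod G g \<sigma> i \<in> c})
     else {#})"

definition spin_type :: "('a, 'b) monoid_scheme \<Rightarrow> nat \<Rightarrow> 'a spin_wreath_elt \<Rightarrow> 'a part_fun" where
  "spin_type G n = (\<lambda>(g, t). wreath_type G n g (spin_perm n t))"

definition odd_part_funs :: "('a, 'b) monoid_scheme \<Rightarrow> nat \<Rightarrow> 'a part_fun set" where
  "odd_part_funs G n =
     {\<rho>. (\<forall>c. c \<notin> conj_classes G \<longrightarrow> \<rho> c = {#}) \<and> (\<forall>c. \<forall>k\<in>#\<rho> c. odd k) \<and>
         (\<Sum>c\<in>conj_classes G. sum_mset (\<rho> c)) = n}"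

definition part_fun_length :: "('a, 'b) monoid_scheme \<Rightarrow> 'a part_fun \<Rightarrow> nat" where
  "part_fun_length G \<rho> = (\<Sum>c\<in>conj_classes G. size (\<rho> c))"

definition z_part :: "nat multiset \<Rightarrow> nat" where
  "z_part \<mu> = (\<Prod>i\<in>set_mset \<mu>. i ^ count \<mu> i * fact (count \<mu> i))"

definition Z_part_fun :: "('a, 'b) monoid_scheme \<Rightarrow> 'a part_fun \<Rightarrow> nat" where
  "Z_part_fun G \<rho> =
     (\<Prod>c\<in>conj_classes G. z_part (\<rho> c) * centralizer_order G c ^ size (\<rho> c))"

text \<open>The consecutive intervals \<open>{a..b}\<close>, starting at a given point, with the lengths in the
  list; each is recorded with its label as a triple \<open>(a, b, c)\<close>.\<close>

fun cut_intervals :: "nat \<Rightarrow> (nat \<times> 'c) list \<Rightarrow> (nat \<times> nat \<times> 'c) list" where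
  "cut_intervals a [] = []"
| "cut_intervals a ((k, c) # ps) = (a, a + k - 1, c) # cut_intervals (a + k) ps"

text \<open>The list \<open>cs\<close> is the chosen order of the conjugacy classes.\<close>

definition part_intervals :: "'a set list \<Rightarrow> 'a part_fun \<Rightarrow> (nat \<times> nat \<times> 'a set) list" where
  "part_intervals cs \<rho> = cut_intervals 1
     (concat (map (\<lambda>c. map (\<lambda>k. (k, c)) (rev (sorted_list_of_multiset (\<rho> c)))) cs))"

definition t_elt :: "'a set list \<Rightarrow> nat \<Rightarrow> 'a part_fun \<Rightarrow> spin_elt" where
  "t_elt cs n \<rho> =
     spin_word n (concat (map (\<lambda>(a, b, c). map Tgen [a..<b]) (part_intervals cs \<rho>)))"

text \<open>The cycle of the permutation below \<open>t_elt cs n \<rho>\<close> on the interval \<open>{a..b}\<close> is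
  $(a, a+1, \ldots, b)$.\<close>

definition D_plus ::
  "('a, 'b) monoid_scheme \<Rightarrow> 'a set list \<Rightarrow> nat \<Rightarrow> 'a part_fun \<Rightarrow> 'a spin_wreath_elt set" where
  "D_plus G cs n \<rho> =
     (\<Union>g \<in> {g \<in> carrier (power_group G n).
               \<forall>(a, b, c) \<in> set (part_intervals cs \<rho>). ordered_prod G g (rev [a..<Suc b]) \<in> c}.
        conj_class (spin_wreath G n) (g, t_elt cs n \<rho>))"


section \<open>The space of spin class functions\<close>

definition spin_functions :: "('a, 'b) monoid_scheme \<Rightarrow> nat \<Rightarrow> ('a spin_wreath_elt \<Rightarrow> complex) set" where
  "spin_functions G n =
     {f \<in> class_functions (spin_wreath G n).
        (\<forall>x\<in>carrier (spin_wreath G n). f (spin_z G n \<otimes>\<^bsub>spin_wreath G n\<^esub> x) = - f x) \<and>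
        (\<forall>x\<in>carrier (spin_wreath G n). spin_parity (snd x) = 1 \<longrightarrow> f x = 0)}"

definition eta :: "('a, 'b) monoid_scheme \<Rightarrow> nat \<Rightarrow> ('a \<Rightarrow> complex) \<Rightarrow> 'a spin_wreath_elt \<Rightarrow> complex" where
  "eta G n \<xi> x = (\<Prod>c\<in>conj_classes G. class_value \<xi> c ^ size (spin_type G n x c))"

text \<open>Elements of the direct sum over all degrees are finitely supported families.\<close>

type_synonym 'a spin_family = "nat \<Rightarrow> 'a spin_wreath_elt \<Rightarrow> complex"

definition spin_space :: "('a, 'b) monoid_scheme \<Rightarrow> 'a spin_family set" where
  "spin_space G = {F. (\<forall>n. F n \<in> spin_functions G n) \<and> finite {n. F n \<noteq> (\<lambda>_. 0)}}"

definition spin_form ::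
  "('a, 'b) monoid_scheme \<Rightarrow> ('a \<Rightarrow> complex) \<Rightarrow> 'a spin_family \<Rightarrow> 'a spin_family \<Rightarrow> complex" where
  "spin_form G \<xi> F H =
     (\<Sum>n | F n \<noteq> (\<lambda>_. 0) \<and> H n \<noteq> (\<lambda>_. 0).
        weighted_form (spin_wreath G n) (eta G n \<xi>) (F n) (H n))"


section \<open>The polynomial algebra and its bilinear form\<close>

text \<open>Polynomials in variables indexed by all pairs \<open>(n, \<gamma>)\<close>; the variable \<open>(n, \<gamma>)\<close> is
  $a_{-n}(\gamma)$. The algebra of interest is the subalgebra \<open>fock\<close> in the variables with \<open>n\<close>
  odd and \<open>\<gamma>\<close> an irreducible character.\<close>

type_synonym 'a fock_poly = "((nat \<times> ('a \<Rightarrow> complex)) \<Rightarrow>\<^sub>0 nat) \<Rightarrow>\<^sub>0 complex"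

definition pconst :: "complex \<Rightarrow> ('v \<Rightarrow>\<^sub>0 nat) \<Rightarrow>\<^sub>0 complex" where
  "pconst = Poly_Mapping.single 0"

definition pvar :: "'v \<Rightarrow> ('v \<Rightarrow>\<^sub>0 nat) \<Rightarrow>\<^sub>0 complex" where
  "pvar v = Poly_Mapping.single (Poly_Mapping.single v 1) 1"

definition pdiff :: "'v \<Rightarrow> (('v \<Rightarrow>\<^sub>0 nat) \<Rightarrow>\<^sub>0 complex) \<Rightarrow> ('v \<Rightarrow>\<^sub>0 nat) \<Rightarrow>\<^sub>0 complex" where
  "pdiff v p = (\<Sum>m\<in>Poly_Mapping.keys p.
     Poly_Mapping.single (m - Poly_Mapping.single v 1)
       (of_nat (Poly_Mapping.lookup m v) * Poly_Mapping.lookup p m))"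

definition fock_vars :: "('a, 'b) monoid_scheme \<Rightarrow> (nat \<times> ('a \<Rightarrow> complex)) set" where
  "fock_vars G = {n. odd n} \<times> irr_chars G"

definition fock :: "('a, 'b) monoid_scheme \<Rightarrow> 'a fock_poly set" where
  "fock G = {p. \<forall>m\<in>Poly_Mapping.keys p. Poly_Mapping.keys m \<subseteq> fock_vars G}"

text \<open>The derivation $a_n(\gamma)$, written through partial derivatives; the lemmas
  \<open>annihilation_linear\<close>, \<open>annihilation_derivation\<close> and \<open>annihilation_var\<close> below show that it is
  the derivation with the prescribed values on the variables.\<close>

definition annihilation ::
  "('a, 'b) monoid_scheme \<Rightarrow> ('a \<Rightarrow> complex) \<Rightarrow> nat \<Rightarrow> ('a \<Rightarrow> complex) \<Rightarrow> 'a fock_poly \<Rightarrow> 'a fock_poly"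
  where
  "annihilation G \<xi> n \<gamma> p =
     (\<Sum>\<beta>\<in>irr_chars G. pconst (of_nat n / 2 * weighted_form G \<xi> \<gamma> \<beta>) * pdiff (n, \<beta>) p)"

definition is_fock_form ::
  "('a, 'b) monoid_scheme \<Rightarrow> ('a \<Rightarrow> complex) \<Rightarrow> ('a fock_poly \<Rightarrow> 'a fock_poly \<Rightarrow> complex) \<Rightarrow> bool" where
  "is_fock_form G \<xi> B \<longleftrightarrow>
     (\<forall>p\<in>fock G. \<forall>q\<in>fock G. \<forall>r\<in>fock G. B (p + q) r = B p r + B q r \<and> B r (p + q) = B r p + B r q) \<and>
     (\<forall>a. \<forall>p\<in>fock G. \<forall>q\<in>fock G. B (pconst a * p) q = a * B p q \<and> B p (pconst a * q) = a * B p q) \<and>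
     B 1 1 = 1 \<and>
     (\<forall>n \<gamma>. odd n \<longrightarrow> \<gamma> \<in> irr_chars G \<longrightarrow> (\<forall>p\<in>fock G. \<forall>q\<in>fock G.
        B (pvar (n, \<gamma>) * p) q = B p (annihilation G \<xi> n \<gamma> q) \<and>
        B (annihilation G \<xi> n \<gamma> p) q = B p (pvar (n, \<gamma>) * q)))"

text \<open>The conditions determine the form on \<open>fock G\<close>; its values elsewhere are irrelevant.\<close>

definition fock_form ::
  "('a, 'b) monoid_scheme \<Rightarrow> ('a \<Rightarrow> complex) \<Rightarrow> 'a fock_poly \<Rightarrow> 'a fock_poly \<Rightarrow> complex" where
  "fock_form G \<xi> = (SOME B. is_fock_form G \<xi> B)"

text \<open>$a_{-n}(c)$ and $a'_{-\rho}$.\<close>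

definition a_class :: "('a, 'b) monoid_scheme \<Rightarrow> nat \<Rightarrow> 'a set \<Rightarrow> 'a fock_poly" where
  "a_class G n c =
     (\<Sum>\<gamma>\<in>irr_chars G. pconst (class_value \<gamma> (set_inv\<^bsub>G\<^esub> c)) * pvar (n, \<gamma>))"

definition a_part_fun :: "('a, 'b) monoid_scheme \<Rightarrow> 'a part_fun \<Rightarrow> 'a fock_poly" where
  "a_part_fun G \<rho> = (\<Prod>c\<in>conj_classes G. \<Prod>k\<in>#\<rho> c. a_class G k c)"

lemma pdiff_eq:
  assumes "finite A" "Poly_Mapping.keys p \<subseteq> A"
  shows "pdiff v p = (\<Sum>m\<in>A. Poly_Mapping.single (m - Poly_Mapping.single v 1)
       (of_nat (Poly_Mapping.lookup m v) * Poly_Mapping.lookup p m))"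
  unfolding pdiff_def
  by (rule sum.mono_neutral_left) (use assms in \<open>auto simp: in_keys_iff\<close>)

lemma pdiff_add: "pdiff v (p + q) = pdiff v p + pdiff v q"
proof -
  let ?A = "Poly_Mapping.keys p \<union> Poly_Mapping.keys q"
  have "finite ?A" "Poly_Mapping.keys (p + q) \<subseteq> ?A" by (auto dest: keys_add[THEN subsetD])
  then show ?thesis
    by (subst (1 2 3) pdiff_eq[where A = ?A])
      (auto simp: lookup_add distrib_left single_add sum.distrib)
qed

lemma pdiff_single:
  "pdiff v (Poly_Mapping.single m a) =
     Poly_Mapping.single (m - Poly_Mapping.single v 1) (of_nat (Poly_Mapping.lookup m v) * a)"
  by (subst pdiff_eq[where A = "{m}"]) auto

lemma pdiff_zero [simp]: "pdiff v 0 = 0"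
  by (simp add: pdiff_def)

lemma pdiff_sum: "pdiff v (\<Sum>i\<in>I. p i) = (\<Sum>i\<in>I. pdiff v (p i))"
  by (induction I rule: infinite_finite_induct) (auto simp: pdiff_add)

lemma poly_mapping_sum_monomials:
  "p = (\<Sum>m\<in>Poly_Mapping.keys p. Poly_Mapping.single m (Poly_Mapping.lookup p m))"
  by (rule poly_mapping_eqI)
    (auto simp: lookup_sum lookup_single when_def in_keys_iff sum.delta)

lemma pdiff_mult_single:
  fixes m k :: "'v \<Rightarrow>\<^sub>0 nat" and a b :: complex
  shows "pdiff v (Poly_Mapping.single m a * Poly_Mapping.single k b) =
     pdiff v (Poly_Mapping.single m a) * Poly_Mapping.single k b +
     Poly_Mapping.single m a * pdiff v (Poly_Mapping.single k b)"
proof -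
  let ?v = "Poly_Mapping.single v (1::nat)"
  have shift: "m - ?v + k = m + k - ?v" if "Poly_Mapping.lookup m v \<noteq> 0" for m k :: "'v \<Rightarrow>\<^sub>0 nat"
    using that
    by (intro poly_mapping_eqI) (auto simp: lookup_add lookup_minus lookup_single when_def)
  have L: "Poly_Mapping.single (m - ?v + k) (of_nat (Poly_Mapping.lookup m v) * a * b)
      = Poly_Mapping.single (m + k - ?v) (of_nat (Poly_Mapping.lookup m v) * a * b)"
    by (cases "Poly_Mapping.lookup m v = 0") (simp_all add: shift del: One_nat_def)
  have R: "Poly_Mapping.single (m + (k - ?v)) (a * (of_nat (Poly_Mapping.lookup k v) * b))
      = Poly_Mapping.single (m + k - ?v) (a * (of_nat (Poly_Mapping.lookup k v) * b))"
    using shift[of k m] by (cases "Poly_Mapping.lookup k v = 0") (simp_all add: add.commute del: One_nat_def)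
  have "pdiff v (Poly_Mapping.single m a * Poly_Mapping.single k b)
      = Poly_Mapping.single (m + k - ?v) (of_nat (Poly_Mapping.lookup m v) * a * b)
        + Poly_Mapping.single (m + k - ?v) (a * (of_nat (Poly_Mapping.lookup k v) * b))"
    by (simp add: mult_single pdiff_single lookup_add single_add[symmetric] distrib_right
        distrib_left mult.assoc mult.left_commute del: One_nat_def)
  then show ?thesis
    unfolding L[symmetric] R[symmetric] by (simp only: mult_single pdiff_single)
qed

lemma pdiff_mult: "pdiff v (p * q) = pdiff v p * q + p * pdiff v q"
proof -
  let ?s = "Poly_Mapping.single :: _ \<Rightarrow> complex \<Rightarrow> _"
  let ?P = "\<lambda>m. ?s m (Poly_Mapping.lookup p m)" and ?Q = "\<lambda>k. ?s k (Poly_Mapping.lookup q k)"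
  have "pdiff v ((\<Sum>m\<in>Poly_Mapping.keys p. ?P m) * (\<Sum>k\<in>Poly_Mapping.keys q. ?Q k))
      = pdiff v (\<Sum>m\<in>Poly_Mapping.keys p. ?P m) * (\<Sum>k\<in>Poly_Mapping.keys q. ?Q k)
        + (\<Sum>m\<in>Poly_Mapping.keys p. ?P m) * pdiff v (\<Sum>k\<in>Poly_Mapping.keys q. ?Q k)"
    unfolding sum_product pdiff_sum pdiff_mult_single sum.distrib ..
  then show ?thesis
    by (simp only: poly_mapping_sum_monomials[symmetric])
qed

lemma pdiff_var: "pdiff v (pvar w) = (if v = w then 1 else 0)"
  by (auto simp: pvar_def pdiff_single lookup_single when_def)

lemma pdiff_const: "pdiff v (pconst a) = 0"
  by (simp add: pconst_def pdiff_single)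

lemma annihilation_linear:
  "annihilation G \<xi> n \<gamma> (p + q) = annihilation G \<xi> n \<gamma> p + annihilation G \<xi> n \<gamma> q"
  "annihilation G \<xi> n \<gamma> (pconst a * p) = pconst a * annihilation G \<xi> n \<gamma> p"
  by (simp_all add: annihilation_def pdiff_add pdiff_mult pdiff_const distrib_left sum.distrib
      sum_distrib_left mult.left_commute)

lemma annihilation_derivation:
  "annihilation G \<xi> n \<gamma> (p * q) =
     annihilation G \<xi> n \<gamma> p * q + p * annihilation G \<xi> n \<gamma> q"
  by (simp add: annihilation_def pdiff_mult distrib_left sum.distrib sum_distrib_left
      sum_distrib_right mult.assoc mult.left_commute)

lemma annihilation_var:
  assumes "finite (irr_chars G)" "\<beta> \<in> irr_chars G"
  shows "annihilation G \<xi> n \<gamma> (pvar (m, \<beta>)) =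
     (if n = m then pconst (of_nat n / 2 * weighted_form G \<xi> \<gamma> \<beta>) else 0)"
  using assms by (simp add: annihilation_def pdiff_var if_distrib sum.delta cong: if_cong)


section \<open>The characteristic map and isometries\<close>

definition ch :: "('a, 'b) monoid_scheme \<Rightarrow> 'a set list \<Rightarrow> 'a spin_family \<Rightarrow> 'a fock_poly" where
  "ch G cs F =
     (\<Sum>n | F n \<noteq> (\<lambda>_. 0). \<Sum>\<rho>\<in>odd_part_funs G n.
        pconst (complex_of_real (2 powr (real (part_fun_length G \<rho>) / 2))
                / of_nat (Z_part_fun G \<rho>) * class_value (F n) (D_plus G cs n \<rho>))
        * a_part_fun G \<rho>)"

text \<open>An isometry of spaces with (possibly degenerate) bilinear forms is a linear bijection that
  preserves the forms.\<close>

definition is_isometry ::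
  "'a spin_family set \<Rightarrow> ('a spin_family \<Rightarrow> 'a spin_family \<Rightarrow> complex) \<Rightarrow>
   'a fock_poly set \<Rightarrow> ('a fock_poly \<Rightarrow> 'a fock_poly \<Rightarrow> complex) \<Rightarrow>
   ('a spin_family \<Rightarrow> 'a fock_poly) \<Rightarrow> bool" where
  "is_isometry V B W B' \<phi> \<longleftrightarrow>
     (\<forall>F\<in>V. \<forall>H\<in>V. \<phi> (\<lambda>n x. F n x + H n x) = \<phi> F + \<phi> H) \<and>
     (\<forall>a. \<forall>F\<in>V. \<phi> (\<lambda>n x. a * F n x) = pconst a * \<phi> F) \<and>
     bij_betw \<phi> V W \<and>
     (\<forall>F\<in>V. \<forall>H\<in>V. B' (\<phi> F) (\<phi> H) = B F H)"

end

theory Submission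
  imports Defs "Jordan_Normal_Form.Spectral_Radius" "HOL-Library.Function_Algebras"
begin

text \<open>By the two orthogonality relations for the irreducible characters of \<open>\<Gamma>\<close>, the elements
  \<open>a\<^sub>-\<^sub>n(c)\<close> span the same space as the variables, and the annihilation operator adjoint to
  \<open>a\<^sub>-\<^sub>n(c)\<close> kills every \<open>a\<^sub>-\<^sub>m(c')\<close> except for \<open>m = n\<close>, \<open>c' = c\<^sup>-\<^sup>1\<close>. Hence the \<open>a'\<^sub>-\<^sub>\<rho>\<close> form a
  basis, and \<open>a'\<^sub>-\<^sub>\<rho>\<close> pairs nontrivially only with \<open>a'\<^sub>-\<^sub>\<mu>\<close> for \<open>\<mu>(c) = \<rho>(c\<^sup>-\<^sup>1)\<close>, the value being
  \<open>Z\<^sub>\<rho> \<Prod>\<^sub>c \<xi>(c)\<close> (with exponents the lengths of the \<open>\<rho>(c)\<close>) divided by the power of 2 with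
  exponent the length of \<open>\<rho>\<close>.

  On the group side, an even element \<open>x\<close> whose type has an even part is conjugate to \<open>zx\<close>: it is
  a product \<open>AB\<close> of two odd elements with disjoint supports, and \<open>BA = zAB\<close>. So a spin function
  vanishes off the types in \<open>OP\<^sub>n\<close>. On an element of a type in \<open>OP\<^sub>n\<close> it equals its value on
  \<open>D\<^sup>+\<close> up to a sign, and this sign is that of the trace of the element in the Clifford algebra; in
  particular it does not change under inversion. Since there are \<open>|\<Gamma>\<^sub>n| / Z\<^sub>\<rho>\<close> elements of type \<open>\<rho>\<close> in the
  wreath product, both forms become the same sum over \<open>\<rho>\<close>.\<close>

section \<open>Irreducible characters\<close>

text \<open>Rewriting with the relations only shows that the kernel of \<open>spin_perm\<close> is
  contained in {1, z}; that z differs from 1 needs a model. The Clifford algebra supplies one, with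
  t_i acting as (e_i - e_{i+1}) / sqrt 2 and z as -1. Its trace also settles all signs without any
  module of the double cover: it is real, odd under z, invariant under conjugation and inversion,
  and positive on every D+. Hence in f(x) g(x^-1) its sign occurs twice and cancels, and multiplying
  prescribed values by that sign produces spin functions, which gives surjectivity.

  Since \<xi> may vanish on some classes, both forms may be degenerate, and injectivity cannot be
  read off from the isometry. The linear independence of the \<open>a_part_fun G \<rho>\<close> is
  therefore proved with the constant weight 1, for which every \<rho> pairs nontrivially with its
  dual.

  The exponent l(\<rho>)/2 in the characteristic map has its origin in the factor n/2 of the
  commutation relation: pairing two monomials of length l yields 2^-l, and the two arguments of the
  form contribute 2^(l/2) each.\<close>

locale finite_group = group G for G (structure) +
  assumes fin: "finite (carrier G)"

lemma subspace_vecI: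
  assumes "W \<subseteq> carrier_vec d" "0\<^sub>v d \<in> W" "\<And>v w. v \<in> W \<Longrightarrow> w \<in> W \<Longrightarrow> v + w \<in> W"
    "\<And>a v. v \<in> W \<Longrightarrow> a \<cdot>\<^sub>v v \<in> W"
  shows "VectorSpace.subspace class_ring W (module_vec TYPE(complex) d)"
  unfolding VectorSpace.subspace_def LinearCombinations.submodule_def
  using assms vec_vs[of d, where 'a=complex] vec_module[of d, where 'a=complex] by (auto simp: module_vec_simps)

lemma subspace_vecD:
  assumes "VectorSpace.subspace class_ring W (module_vec TYPE(complex) d)"
  shows "W \<subseteq> carrier_vec d" "0\<^sub>v d \<in> W" "\<And>v w. v \<in> W \<Longrightarrow> w \<in> W \<Longrightarrow> v + w \<in> W"
    "\<And>a v. v \<in> W \<Longrightarrow> a \<cdot>\<^sub>v v \<in> W"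
  using assms unfolding VectorSpace.subspace_def LinearCombinations.submodule_def
  by (auto simp: module_vec_simps)

lemma mult_unit_vec_index:
  assumes "A \<in> carrier_mat m n" "i < m" "j < n"
  shows "(A *\<^sub>v unit_vec n j) $ i = (A $$ (i, j) :: complex)"
  using assms by (simp add: scalar_prod_right_unit)

section \<open>Irreducible matrix representations and Schur's lemma\<close>

context finite_group
begin

lemma irreducible_repD:
  assumes "irreducible_rep G d \<pi>"
  shows "0 < d" "\<And>x. x \<in> carrier G \<Longrightarrow> \<pi> x \<in> carrier_mat d d"
    "\<And>x y. x \<in> carrier G \<Longrightarrow> y \<in> carrier G \<Longrightarrow> \<pi> (x \<otimes> y) = \<pi> x * \<pi> y"
    "\<pi> \<one> = 1\<^sub>m d"
proof -
  let ?R = "ring_mat TYPE(complex) d ()"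
  interpret R: ring ?R by (rule ring_mat)
  have h: "\<pi> \<in> hom G (units_of ?R)" and "0 < d"
    using assms by (auto simp: irreducible_rep_def)
  show "0 < d" by fact
  show "\<pi> x \<in> carrier_mat d d" if "x \<in> carrier G" for x
    using hom_in_carrier[OF h that] by (auto simp: units_of_def Units_def ring_mat_simps)
  show "\<pi> (x \<otimes> y) = \<pi> x * \<pi> y" if "x \<in> carrier G" "y \<in> carrier G" for x y
    using hom_mult[OF h that] by (auto simp: units_of_def ring_mat_simps)
  show "\<pi> \<one> = 1\<^sub>m d"
    using hom_one[OF h is_group R.units_group] by (auto simp: units_of_def ring_mat_simps)
qed

lemma irreducible_rep_inv:
  assumes "irreducible_rep G d \<pi>" "x \<in> carrier G"
  shows "\<pi> (inv x) * \<pi> x = 1\<^sub>m d" "\<pi> x * \<pi> (inv x) = 1\<^sub>m d"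
  using irreducible_repD(3)[OF assms(1), of "inv x" x] irreducible_repD(3)[OF assms(1), of x "inv x"]
    irreducible_repD(4)[OF assms(1)] assms(2) by auto

lemma irreducible_rep_subspace:
  assumes "irreducible_rep G d \<pi>"
    and "W \<subseteq> carrier_vec d" "0\<^sub>v d \<in> W" "\<And>v w. v \<in> W \<Longrightarrow> w \<in> W \<Longrightarrow> v + w \<in> W"
    and "\<And>a v. v \<in> W \<Longrightarrow> a \<cdot>\<^sub>v v \<in> W"
    and "\<And>x w. x \<in> carrier G \<Longrightarrow> w \<in> W \<Longrightarrow> \<pi> x *\<^sub>v w \<in> W"
  shows "W = {0\<^sub>v d} \<or> W = carrier_vec d"
  using assms(1) subspace_vecI[OF assms(2-5)] assms(6) unfolding irreducible_rep_def by blast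

text \<open>Kernel and image of an intertwiner are invariant subspaces, so a nonzero one is
  injective and onto. The inverse is built directly, without comparing the dimensions
  \<open>d\<close> and \<open>e\<close>.\<close>

lemma schur_invertible:
  assumes P: "irreducible_rep G d \<pi>" and S: "irreducible_rep G e \<sigma>"
    and A: "A \<in> carrier_mat d e" and "A \<noteq> 0\<^sub>m d e"
    and com: "\<And>x. x \<in> carrier G \<Longrightarrow> \<pi> x * A = A * \<sigma> x"
  obtains B where "B \<in> carrier_mat e d" "A * B = 1\<^sub>m d" "B * A = 1\<^sub>m e"
proof -
  note Pc = irreducible_repD(2)[OF P] and Sc = irreducible_repD(2)[OF S]
  let ?K = "{v \<in> carrier_vec e. A *\<^sub>v v = 0\<^sub>v d}"
  let ?I = "(\<lambda>v. A *\<^sub>v v) ` carrier_vec e"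
  have "\<exists>z. z \<in> carrier_vec e \<and> A *\<^sub>v z \<noteq> 0\<^sub>v d"
  proof (rule ccontr)
    assume "\<not> ?thesis"
    then have z: "A *\<^sub>v unit_vec e j = 0\<^sub>v d" for j
      by (meson unit_vec_carrier)
    have "A = 0\<^sub>m d e"
    proof (rule eq_matI)
      fix i j assume ij: "i < dim_row (0\<^sub>m d e)" "j < dim_col (0\<^sub>m d e)"
      have "A $$ (i, j) = (A *\<^sub>v unit_vec e j) $ i"
        using ij A by (simp add: scalar_prod_right_unit)
      then show "A $$ (i, j) = 0\<^sub>m d e $$ (i, j)" using z ij by simp
    qed (use A in auto)
    then show False using assms(4) by simp
  qed
  then obtain z where z: "z \<in> carrier_vec e" "A *\<^sub>v z \<noteq> 0\<^sub>v d" by blast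
  have K: "?K = {0\<^sub>v e}"
  proof -
    have "?K = {0\<^sub>v e} \<or> ?K = carrier_vec e"
    proof (rule irreducible_rep_subspace[OF S])
      show "\<sigma> x *\<^sub>v w \<in> ?K" if "x \<in> carrier G" "w \<in> ?K" for x w
      proof -
        have "A *\<^sub>v (\<sigma> x *\<^sub>v w) = (A * \<sigma> x) *\<^sub>v w"
          using assoc_mult_mat_vec[OF A Sc[OF that(1)]] that by simp
        also have "\<dots> = \<pi> x *\<^sub>v (A *\<^sub>v w)"
          using assoc_mult_mat_vec[OF Pc[OF that(1)] A] that com by simp
        also have "\<dots> = 0\<^sub>v d" using that Pc[OF that(1)] by auto
        finally show ?thesis using that Sc[OF that(1)] by auto
      qed
    qed (use A in \<open>auto simp: mult_add_distrib_mat_vec mult_mat_vec\<close>)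
    moreover have "z \<notin> ?K" using z by simp
    ultimately show ?thesis using z by metis
  qed
  have I: "?I = carrier_vec d"
  proof -
    have "?I = {0\<^sub>v d} \<or> ?I = carrier_vec d"
    proof (rule irreducible_rep_subspace[OF P])
      show "?I \<subseteq> carrier_vec d" using A by auto
      show "0\<^sub>v d \<in> ?I" using A by (intro image_eqI[of _ _ "0\<^sub>v e"]) auto
      show "v + w \<in> ?I" if vw: "v \<in> ?I" "w \<in> ?I" for v w
      proof -
        obtain v' w' where v': "v' \<in> carrier_vec e" "v = A *\<^sub>v v'"
          and w': "w' \<in> carrier_vec e" "w = A *\<^sub>v w'" using vw by auto
        then show ?thesis
          using mult_add_distrib_mat_vec[OF A v'(1) w'(1)] by (intro image_eqI[of _ _ "v' + w'"]) auto
      qed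
      show "a \<cdot>\<^sub>v v \<in> ?I" if v: "v \<in> ?I" for a v
      proof -
        obtain v' where v': "v' \<in> carrier_vec e" "v = A *\<^sub>v v'" using v by auto
        then show ?thesis
          using mult_mat_vec[OF A v'(1)] by (intro image_eqI[of _ _ "a \<cdot>\<^sub>v v'"]) auto
      qed
      show "\<pi> x *\<^sub>v w \<in> ?I" if x: "x \<in> carrier G" and w: "w \<in> ?I" for x w
      proof -
        obtain v where v: "v \<in> carrier_vec e" "w = A *\<^sub>v v" using w by auto
        have "\<pi> x *\<^sub>v (A *\<^sub>v v) = A *\<^sub>v (\<sigma> x *\<^sub>v v)"
          using assoc_mult_mat_vec[OF Pc[OF x] A v(1)] assoc_mult_mat_vec[OF A Sc[OF x] v(1)] com x
          by simp
        then show ?thesis using v Sc[OF x] by (intro image_eqI[of _ _ "\<sigma> x *\<^sub>v v"]) auto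
      qed
    qed
    moreover have "A *\<^sub>v z \<in> ?I" using z by simp
    ultimately show ?thesis using z by (metis singletonD)
  qed
  have "\<exists>v\<in>carrier_vec e. A *\<^sub>v v = unit_vec d j" for j
  proof -
    have "unit_vec d j \<in> ?I" unfolding I by simp
    then show ?thesis by auto
  qed
  then have "\<forall>j. \<exists>v. v \<in> carrier_vec e \<and> A *\<^sub>v v = unit_vec d j" by blast
  then obtain b where b: "\<And>j. b j \<in> carrier_vec e" "\<And>j. A *\<^sub>v b j = unit_vec d j"
    using choice[of "\<lambda>j v. v \<in> carrier_vec e \<and> A *\<^sub>v v = unit_vec d j"] by blast
  \<comment> \<open>The columns of the right inverse are preimages of the unit vectors.\<close>
  define B where "B = mat e d (\<lambda>(i, j). b j $ i)"
  have B: "B \<in> carrier_mat e d" by (simp add: B_def)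
  have colB: "col B j = b j" if "j < d" for j
    using that b(1)[of j] by (intro eq_vecI) (auto simp: B_def)
  have AB: "A * B = 1\<^sub>m d"
  proof (rule eq_matI)
    fix i j assume "i < dim_row (1\<^sub>m d)" "j < dim_col (1\<^sub>m d)"
    then have ij: "i < d" "j < d" by auto
    have "(A * B) $$ (i, j) = (A *\<^sub>v b j) $ i"
      using ij A B colB by (simp add: index_mult_mat)
    then show "(A * B) $$ (i, j) = 1\<^sub>m d $$ (i, j)" using ij b(2)[of j] by auto
  qed (use A B in auto)
  \<comment> \<open>A right inverse of an injective map is two-sided: A (B A u - u) = 0, and the
    kernel of A is trivial.\<close>
  have BA: "B * A = 1\<^sub>m e"
  proof (rule eq_matI)
    fix i j assume "i < dim_row (1\<^sub>m e)" "j < dim_col (1\<^sub>m e)"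
    then have ij: "i < e" "j < e" by auto
    let ?u = "unit_vec e j"
    have u: "?u \<in> carrier_vec e" by simp
    have BAc: "B * A \<in> carrier_mat e e" using A B by simp
    have "A *\<^sub>v ((B * A) *\<^sub>v ?u) = (A * (B * A)) *\<^sub>v ?u"
      using assoc_mult_mat_vec[OF A BAc u] by simp
    also have "\<dots> = A *\<^sub>v ?u"
      using assoc_mult_mat[OF A B A] AB A by simp
    finally have "A *\<^sub>v ((B * A) *\<^sub>v ?u) = A *\<^sub>v ?u" .
    then have "A *\<^sub>v ((B * A) *\<^sub>v ?u - ?u) = 0\<^sub>v d"
      using mult_minus_distrib_mat_vec[OF A mult_mat_vec_carrier[OF BAc u] u] A u by simp
    then have "(B * A) *\<^sub>v ?u - ?u \<in> ?K" using BAc u by simp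
    then have "(B * A) *\<^sub>v ?u - ?u = 0\<^sub>v e" unfolding K by simp
    moreover have "((B * A) *\<^sub>v ?u - ?u) $ i = ((B * A) *\<^sub>v ?u) $ i - ?u $ i"
      using ij BAc by simp
    ultimately have eq: "((B * A) *\<^sub>v ?u) $ i = ?u $ i" using ij by simp
    have "((B * A) *\<^sub>v ?u) $ i = (B * A) $$ (i, j)"
      using mult_unit_vec_index[OF BAc ij] .
    then show "(B * A) $$ (i, j) = 1\<^sub>m e $$ (i, j)"
      using eq ij by auto
  qed (use A B in auto)
  show ?thesis by (rule that[OF B AB BA])
qed

text \<open>A has an eigenvalue c over the complex numbers. Then A - c is an intertwiner that kills
  a nonzero vector, so it is not invertible and must be 0.\<close>

lemma schur_scalar:
  assumes P: "irreducible_rep G d \<pi>" and A: "A \<in> carrier_mat d d"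
    and com: "\<And>x. x \<in> carrier G \<Longrightarrow> \<pi> x * A = A * \<pi> x"
  obtains c where "A = c \<cdot>\<^sub>m 1\<^sub>m d"
proof -
  obtain c where "c \<in> spectrum A"
    using spectrum_non_empty[OF A irreducible_repD(1)[OF P]] by auto
  then obtain v where v: "v \<in> carrier_vec d" "v \<noteq> 0\<^sub>v d" "A *\<^sub>v v = c \<cdot>\<^sub>v v"
    using A by (auto simp: spectrum_def eigenvalue_def eigenvector_def)
  let ?C = "A - c \<cdot>\<^sub>m 1\<^sub>m d"
  have C: "?C \<in> carrier_mat d d" by (intro minus_carrier_mat) simp
  have "?C = 0\<^sub>m d d"
  proof (rule ccontr)
    assume nz: "?C \<noteq> 0\<^sub>m d d"
    have comC: "\<pi> x * ?C = ?C * \<pi> x" if x: "x \<in> carrier G" for x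
    proof -
      have p: "\<pi> x \<in> carrier_mat d d" using irreducible_repD(2)[OF P x] .
      have "\<pi> x * ?C = \<pi> x * A - \<pi> x * (c \<cdot>\<^sub>m 1\<^sub>m d)"
        by (rule mult_minus_distrib_mat[OF p A]) simp
      moreover have "?C * \<pi> x = A * \<pi> x - (c \<cdot>\<^sub>m 1\<^sub>m d) * \<pi> x"
        by (rule minus_mult_distrib_mat[OF A _ p]) simp
      moreover have "\<pi> x * (c \<cdot>\<^sub>m 1\<^sub>m d) = c \<cdot>\<^sub>m \<pi> x"
        using p by (simp add: mult_smult_distrib[OF p one_carrier_mat])
      moreover have "(c \<cdot>\<^sub>m 1\<^sub>m d) * \<pi> x = c \<cdot>\<^sub>m \<pi> x"
        using p by (simp add: mult_smult_assoc_mat[OF one_carrier_mat p])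
      ultimately show ?thesis by (simp only: com[OF x])
    qed
    obtain B where B: "B \<in> carrier_mat d d" "B * ?C = 1\<^sub>m d"
      by (rule schur_invertible[OF P P C nz comC])
    have "?C *\<^sub>v v = A *\<^sub>v v - (c \<cdot>\<^sub>m 1\<^sub>m d) *\<^sub>v v"
      by (rule minus_mult_distrib_mat_vec[OF A _ v(1)]) simp
    also have "(c \<cdot>\<^sub>m 1\<^sub>m d) *\<^sub>v v = c \<cdot>\<^sub>v v"
      using v(1) by (intro eq_vecI) (auto simp: smult_scalar_prod_distrib[of _ d])
    finally have "?C *\<^sub>v v = 0\<^sub>v d" using v by simp
    then have "B *\<^sub>v (?C *\<^sub>v v) = 0\<^sub>v d" using B by auto
    then have "1\<^sub>m d *\<^sub>v v = 0\<^sub>v d" using assoc_mult_mat_vec[OF B(1) C v(1)] B by simp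
    then show False using v by simp
  qed
  then have "A = c \<cdot>\<^sub>m 1\<^sub>m d"
  proof -
    have "A $$ (i, j) = (c \<cdot>\<^sub>m 1\<^sub>m d) $$ (i, j)" if "i < d" "j < d" for i j
    proof -
      have "?C $$ (i, j) = 0" using \<open>?C = 0\<^sub>m d d\<close> that by simp
      then show ?thesis using that A by simp
    qed
    then show ?thesis using A by (intro eq_matI) auto
  qed
  then show ?thesis by (rule that)
qed

end

section \<open>Traces and row orthogonality\<close>

definition mat_tr :: "complex mat \<Rightarrow> complex" where
  "mat_tr A = sum_list (diag_mat A)"

lemma mat_tr_eq: "A \<in> carrier_mat d e \<Longrightarrow> mat_tr A = (\<Sum>i<d. A $$ (i, i))"
  by (simp add: mat_tr_def diag_mat_def interv_sum_list_conv_sum_set_nat atLeast0LessThan)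

lemma mult_mat_entry:
  "A \<in> carrier_mat m n \<Longrightarrow> B \<in> carrier_mat n k \<Longrightarrow> i < m \<Longrightarrow> j < k \<Longrightarrow>
     (A * B) $$ (i, j) = (\<Sum>l<n. A $$ (i, l) * (B $$ (l, j) :: complex))"
  by (simp add: scalar_prod_def atLeast0LessThan)

lemma mat_tr_comm:
  assumes "A \<in> carrier_mat d e" "B \<in> carrier_mat e d"
  shows "mat_tr (A * B) = mat_tr (B * A)"
proof -
  have "mat_tr (A * B) = (\<Sum>i<d. \<Sum>l<e. A $$ (i, l) * B $$ (l, i))"
    using assms by (simp add: mat_tr_eq[OF mult_carrier_mat[OF assms]] mult_mat_entry[OF assms] del: index_mult_mat)
  also have "\<dots> = (\<Sum>l<e. \<Sum>i<d. B $$ (l, i) * A $$ (i, l))"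
    by (subst sum.swap) (simp add: mult.commute)
  also have "\<dots> = mat_tr (B * A)"
    using assms by (simp add: mat_tr_eq[OF mult_carrier_mat[OF assms(2,1)]] mult_mat_entry[OF assms(2,1)] del: index_mult_mat)
  finally show ?thesis .
qed

context finite_group
begin

lemma irr_charE:
  assumes "\<gamma> \<in> irr_chars G"
  obtains d \<pi> where "irreducible_rep G d \<pi>" "\<gamma> = (\<lambda>x. if x \<in> carrier G then mat_tr (\<pi> x) else 0)"
  using assms unfolding irr_chars_def mat_tr_def by blast

lemma sum_left_translate:
  "y \<in> carrier G \<Longrightarrow> (\<Sum>x\<in>carrier G. f (y \<otimes> x)) = (\<Sum>x\<in>carrier G. f x :: complex)"
  by (rule sum.reindex_bij_witness[where i = "\<lambda>x. inv y \<otimes> x" and j = "\<lambda>x. y \<otimes> x"])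
    (auto simp: m_assoc[symmetric])

lemma sum_right_translate:
  "y \<in> carrier G \<Longrightarrow> (\<Sum>x\<in>carrier G. f (x \<otimes> y)) = (\<Sum>x\<in>carrier G. f x :: complex)"
  by (rule sum.reindex_bij_witness[where i = "\<lambda>x. x \<otimes> inv y" and j = "\<lambda>x. x \<otimes> y"])
    (auto simp: m_assoc)

lemma sum_inv: "(\<Sum>x\<in>carrier G. f (inv x)) = (\<Sum>x\<in>carrier G. f x :: complex)"
  by (rule sum.reindex_bij_witness[where i = "\<lambda>x. inv x" and j = "\<lambda>x. inv x"]) auto

lemma irr_char_class_function: "\<gamma> \<in> irr_chars G \<Longrightarrow> \<gamma> \<in> class_functions G"
proof -
  assume "\<gamma> \<in> irr_chars G"
  then obtain d \<pi> where P: "irreducible_rep G d \<pi>"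
    and g: "\<gamma> = (\<lambda>x. if x \<in> carrier G then mat_tr (\<pi> x) else 0)" by (rule irr_charE)
  have "mat_tr (\<pi> (y \<otimes> x \<otimes> inv y)) = mat_tr (\<pi> x)" if xy: "x \<in> carrier G" "y \<in> carrier G" for x y
  proof -
    note c = irreducible_repD(2)[OF P]
    have "mat_tr (\<pi> (y \<otimes> x \<otimes> inv y)) = mat_tr ((\<pi> y * \<pi> x) * \<pi> (inv y))"
      using xy by (simp add: irreducible_repD(3)[OF P])
    also have "\<dots> = mat_tr (\<pi> (inv y) * (\<pi> y * \<pi> x))"
      using xy by (intro mat_tr_comm[OF mult_carrier_mat[OF c c] c]) auto
    also have "\<pi> (inv y) * (\<pi> y * \<pi> x) = \<pi> (inv y) * \<pi> y * \<pi> x"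
      using assoc_mult_mat[OF c c c] xy by simp
    also have "\<dots> = \<pi> x" using irreducible_rep_inv[OF P xy(2)] c[OF xy(1)] by simp
    finally show ?thesis .
  qed
  then show ?thesis by (auto simp: class_functions_def g)
qed

text \<open>A is the sum over G of \<pi>(x) E \<sigma>(x^-1), where E is the matrix unit at (j, k);
  translating the summation variable shows that it intertwines.\<close>

lemma rep_intertwiner:
  assumes P: "irreducible_rep G d \<pi>" and S: "irreducible_rep G e \<sigma>" and "j < d" "k < e"
    and A: "A = mat d e (\<lambda>(i, l). \<Sum>x\<in>carrier G. \<pi> x $$ (i, j) * \<sigma> (inv x) $$ (k, l))"
    and y: "y \<in> carrier G"
  shows "\<pi> y * A = A * \<sigma> y"
proof (rule eq_matI)
  note Pc = irreducible_repD(2)[OF P] and Sc = irreducible_repD(2)[OF S]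
  have Ac: "A \<in> carrier_mat d e" by (simp add: A)
  fix i l assume "i < dim_row (A * \<sigma> y)" "l < dim_col (A * \<sigma> y)"
  then have il: "i < d" "l < e" using Ac Sc[OF y] by auto
  have "(\<pi> y * A) $$ (i, l) = (\<Sum>m<d. \<pi> y $$ (i, m) * (\<Sum>x\<in>carrier G. \<pi> x $$ (m, j) * \<sigma> (inv x) $$ (k, l)))"
    using il by (subst mult_mat_entry[OF Pc[OF y] Ac il]) (simp add: A)
  also have "\<dots> = (\<Sum>x\<in>carrier G. (\<Sum>m<d. \<pi> y $$ (i, m) * \<pi> x $$ (m, j)) * \<sigma> (inv x) $$ (k, l))"
    by (subst sum_distrib_left, subst sum.swap) (simp add: sum_distrib_right mult.assoc)
  also have "\<dots> = (\<Sum>x\<in>carrier G. \<pi> (y \<otimes> x) $$ (i, j) * \<sigma> (inv x) $$ (k, l))"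
    by (rule sum.cong[OF refl])
      (simp only: irreducible_repD(3)[OF P y] mult_mat_entry[OF Pc[OF y] Pc il(1) assms(3)])
  also have "\<dots> = (\<Sum>x\<in>carrier G. \<pi> (y \<otimes> x) $$ (i, j) * \<sigma> (inv (y \<otimes> x) \<otimes> y) $$ (k, l))"
    using y by (intro sum.cong refl) (simp add: inv_mult_group m_assoc)
  also have "\<dots> = (\<Sum>x\<in>carrier G. \<pi> x $$ (i, j) * \<sigma> (inv x \<otimes> y) $$ (k, l))"
    by (rule sum_left_translate[OF y])
  also have "\<dots> = (\<Sum>x\<in>carrier G. \<Sum>m<e. \<pi> x $$ (i, j) * (\<sigma> (inv x) $$ (k, m) * \<sigma> y $$ (m, l)))"
    unfolding sum_distrib_left[symmetric]
    by (rule sum.cong[OF refl])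
      (simp only: irreducible_repD(3)[OF S _ y] inv_closed mult_mat_entry[OF Sc Sc[OF y] assms(4) il(2)])
  also have "\<dots> = (\<Sum>m<e. (\<Sum>x\<in>carrier G. \<pi> x $$ (i, j) * \<sigma> (inv x) $$ (k, m)) * \<sigma> y $$ (m, l))"
    by (subst sum.swap) (simp add: sum_distrib_right mult.assoc)
  also have "\<dots> = (A * \<sigma> y) $$ (i, l)"
    using il by (subst mult_mat_entry[OF Ac Sc[OF y] il]) (simp add: A)
  finally show "(\<pi> y * A) $$ (i, l) = (A * \<sigma> y) $$ (i, l)" .
qed (use irreducible_repD(2)[OF P y] irreducible_repD(2)[OF S y] in \<open>simp_all add: A\<close>)

lemma char_sum_expand:
  assumes P: "irreducible_rep G d \<pi>" and S: "irreducible_rep G e \<sigma>"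
  shows "(\<Sum>x\<in>carrier G. mat_tr (\<pi> x) * mat_tr (\<sigma> (inv x))) =
     (\<Sum>i<d. \<Sum>k<e. \<Sum>x\<in>carrier G. \<pi> x $$ (i, i) * \<sigma> (inv x) $$ (k, k))"
proof -
  have "(\<Sum>x\<in>carrier G. mat_tr (\<pi> x) * mat_tr (\<sigma> (inv x))) =
      (\<Sum>x\<in>carrier G. \<Sum>i<d. \<Sum>k<e. \<pi> x $$ (i, i) * \<sigma> (inv x) $$ (k, k))"
    by (rule sum.cong[OF refl])
      (simp add: mat_tr_eq[OF irreducible_repD(2)[OF P]] mat_tr_eq[OF irreducible_repD(2)[OF S]] sum_product)
  also have "\<dots> = (\<Sum>i<d. \<Sum>x\<in>carrier G. \<Sum>k<e. \<pi> x $$ (i, i) * \<sigma> (inv x) $$ (k, k))"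
    by (rule sum.swap)
  also have "\<dots> = (\<Sum>i<d. \<Sum>k<e. \<Sum>x\<in>carrier G. \<pi> x $$ (i, i) * \<sigma> (inv x) $$ (k, k))"
    by (rule sum.cong[OF refl], rule sum.swap)
  finally show ?thesis .
qed

text \<open>Schur's lemma is applied to the sums of \<open>rep_intertwiner\<close>. An invertible
  intertwiner would make the two traces equal, so distinct characters leave only the zero matrix;
  equal characters are both read off one representation, where these sums are scalars.\<close>

theorem irr_chars_orthogonal:
  assumes "\<gamma> \<in> irr_chars G" "\<beta> \<in> irr_chars G"
  shows "(\<Sum>x\<in>carrier G. \<gamma> x * \<beta> (inv x)) = (if \<gamma> = \<beta> then of_nat (Coset.order G) else 0)"
proof (cases "\<gamma> = \<beta>")
  case False
  obtain d \<pi> where P: "irreducible_rep G d \<pi>"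
    and g: "\<gamma> = (\<lambda>x. if x \<in> carrier G then mat_tr (\<pi> x) else 0)" by (rule irr_charE[OF assms(1)])
  obtain e \<sigma> where S: "irreducible_rep G e \<sigma>"
    and b: "\<beta> = (\<lambda>x. if x \<in> carrier G then mat_tr (\<sigma> x) else 0)" by (rule irr_charE[OF assms(2)])
  note Pc = irreducible_repD(2)[OF P] and Sc = irreducible_repD(2)[OF S]
  have no: "A = 0\<^sub>m d e" if A: "A \<in> carrier_mat d e" "\<And>y. y \<in> carrier G \<Longrightarrow> \<pi> y * A = A * \<sigma> y" for A
  proof (rule ccontr)
    assume nz: "A \<noteq> 0\<^sub>m d e"
    obtain B where B: "B \<in> carrier_mat e d" "A * B = 1\<^sub>m d" "B * A = 1\<^sub>m e"
      by (rule schur_invertible[OF P S A(1) nz A(2)])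
    have "mat_tr (\<pi> y) = mat_tr (\<sigma> y)" if y: "y \<in> carrier G" for y
    proof -
      have "\<pi> y = \<pi> y * (A * B)" using Pc[OF y] B by simp
      also have "\<dots> = (\<pi> y * A) * B" using assoc_mult_mat[OF Pc[OF y] A(1) B(1)] by simp
      also have "\<dots> = (A * \<sigma> y) * B" using A(2)[OF y] by simp
      also have "mat_tr \<dots> = mat_tr (B * (A * \<sigma> y))"
        using mat_tr_comm[OF mult_carrier_mat[OF A(1) Sc[OF y]] B(1)] .
      also have "B * (A * \<sigma> y) = \<sigma> y"
        using assoc_mult_mat[OF B(1) A(1) Sc[OF y]] B Sc[OF y] by simp
      finally show ?thesis .
    qed
    then have "\<gamma> = \<beta>" by (auto simp: g b)
    then show False using False by simp
  qed
  have "(\<Sum>x\<in>carrier G. \<pi> x $$ (i, i) * \<sigma> (inv x) $$ (k, k)) = 0" if ik: "i < d" "k < e" for i k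
  proof -
    let ?A = "mat d e (\<lambda>(i', l). \<Sum>x\<in>carrier G. \<pi> x $$ (i', i) * \<sigma> (inv x) $$ (k, l))"
    have "?A = 0\<^sub>m d e" by (rule no) (simp, rule rep_intertwiner[OF P S ik refl])
    then have "?A $$ (i, k) = 0" using ik by simp
    then show ?thesis using ik by simp
  qed
  then have "(\<Sum>x\<in>carrier G. mat_tr (\<pi> x) * mat_tr (\<sigma> (inv x))) = 0"
    unfolding char_sum_expand[OF P S] by simp
  then show ?thesis using False by (simp add: g b)
next
  case True
  obtain d \<pi> where P: "irreducible_rep G d \<pi>"
    and g: "\<gamma> = (\<lambda>x. if x \<in> carrier G then mat_tr (\<pi> x) else 0)" by (rule irr_charE[OF assms(1)])
  note Pc = irreducible_repD(2)[OF P] and d = irreducible_repD(1)[OF P]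
  have key: "(\<Sum>x\<in>carrier G. \<pi> x $$ (i, i) * \<pi> (inv x) $$ (k, k)) = (if i = k then of_nat (Coset.order G) / of_nat d else 0)"
    if ik: "i < d" "k < d" for i k
  proof -
    let ?A = "mat d d (\<lambda>(i', l). \<Sum>x\<in>carrier G. \<pi> x $$ (i', i) * \<pi> (inv x) $$ (k, l))"
    obtain c where c: "?A = c \<cdot>\<^sub>m 1\<^sub>m d"
      by (rule schur_scalar[OF P _ rep_intertwiner[OF P P ik refl]]) simp
    \<comment> \<open>The scalar is found from the trace: the sum of \<pi>(x) E \<pi>(x^-1) has |G|
      times the trace of E.\<close>
    have "?A $$ (j, j) = c" if "j < d" for j using that unfolding c by simp
    then have "of_nat d * c = (\<Sum>j<d. ?A $$ (j, j))" by simp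
    also have "\<dots> = (\<Sum>x\<in>carrier G. \<Sum>j<d. \<pi> (inv x) $$ (k, j) * \<pi> x $$ (j, i))"
      by (subst sum.swap) (simp add: mult.commute)
    also have "\<dots> = (\<Sum>x\<in>carrier G. (\<pi> (inv x) * \<pi> x) $$ (k, i))"
      by (rule sum.cong[OF refl]) (simp only: mult_mat_entry[OF Pc Pc ik(2,1)] inv_closed)
    also have "\<dots> = (\<Sum>x\<in>carrier G. 1\<^sub>m d $$ (k, i))"
      by (rule sum.cong[OF refl]) (simp only: irreducible_rep_inv(1)[OF P])
    also have "\<dots> = (if i = k then of_nat (Coset.order G) else 0)"
      using ik by (simp add: Coset.order_def)
    finally have "c = (if i = k then of_nat (Coset.order G) / of_nat d else 0)"
      using d by (auto simp: field_simps)
    moreover have "?A $$ (i, k) = (if i = k then c else 0)" using ik unfolding c by simp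
    ultimately show ?thesis using ik by (simp split: if_splits)
  qed
  have "(\<Sum>x\<in>carrier G. mat_tr (\<pi> x) * mat_tr (\<pi> (inv x))) = (\<Sum>i<d. \<Sum>k<d. if i = k then of_nat (Coset.order G) / of_nat d else 0)"
    unfolding char_sum_expand[OF P P] by (intro sum.cong refl) (simp add: key)
  also have "\<dots> = of_nat (Coset.order G)" using d by simp
  finally show ?thesis by (simp add: True[symmetric]) (simp add: g)
qed

end

section \<open>Completeness of the characters through the left regular representation\<close>

interpretation cfun: vector_space "\<lambda>(c::complex) (f :: 'x \<Rightarrow> complex). (\<lambda>x. c * f x)"
  by unfold_locales (auto simp: fun_eq_iff algebra_simps)

context finite_group
begin

text \<open>The left regular representation on functions; the value 0 off the carrier keeps all
  translates in \<open>supported\<close>.\<close>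

definition translate :: "'a \<Rightarrow> ('a \<Rightarrow> complex) \<Rightarrow> 'a \<Rightarrow> complex" where
  "translate x \<phi> = (\<lambda>y. if y \<in> carrier G then \<phi> (inv x \<otimes> y) else 0)"

text \<open>The action of the group algebra element with coefficients \<open>h\<close>.\<close>

definition convolve :: "('a \<Rightarrow> complex) \<Rightarrow> ('a \<Rightarrow> complex) \<Rightarrow> 'a \<Rightarrow> complex" where
  "convolve h \<phi> = (\<lambda>y. \<Sum>x\<in>carrier G. h x * translate x \<phi> y)"

definition supported :: "('a \<Rightarrow> complex) set" where
  "supported = {\<phi>. \<forall>y. y \<notin> carrier G \<longrightarrow> \<phi> y = 0}"

definition submod :: "('a \<Rightarrow> complex) set \<Rightarrow> bool" where
  "submod M \<longleftrightarrow> cfun.subspace M \<and> M \<subseteq> supported \<and> (\<forall>x\<in>carrier G. \<forall>\<phi>\<in>M. translate x \<phi> \<in> M)"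

lemma supported_span: "\<exists>B. finite B \<and> supported \<subseteq> cfun.span B"
proof (intro exI conjI)
  let ?B = "(\<lambda>x y. if y = x then 1 else 0 :: complex) ` carrier G"
  show "finite ?B" using fin by simp
  show "supported \<subseteq> cfun.span ?B"
  proof
    fix \<phi> :: "'a \<Rightarrow> complex" assume p: "\<phi> \<in> supported"
    have "\<phi> = (\<Sum>x\<in>carrier G. (\<lambda>y. \<phi> x * (if y = x then 1 else 0)))"
    proof
      fix y
      have "(\<Sum>x\<in>carrier G. (\<lambda>y. \<phi> x * (if y = x then 1 else 0))) y = (\<Sum>x\<in>carrier G. \<phi> x * (if y = x then 1 else 0))"
        using fin by (induction rule: finite_induct) auto
      also have "\<dots> = (if y \<in> carrier G then \<phi> y else 0)"
        using fin by (simp add: if_distrib cong: if_cong)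
      finally show "\<phi> y = (\<Sum>x\<in>carrier G. (\<lambda>y. \<phi> x * (if y = x then 1 else 0))) y"
        using p by (auto simp: supported_def)
    qed
    also have "\<dots> \<in> cfun.span ?B"
      by (intro cfun.span_sum cfun.span_scale cfun.span_base) auto
    finally show "\<phi> \<in> cfun.span ?B" .
  qed
qed

text \<open>A nonzero submodule of least dimension is minimal: a vector of M outside N would enlarge
  a basis of N to an independent set in M with more than dim M elements.
  \<open>supported_span\<close> makes all bases finite.\<close>

lemma minimal_submod:
  assumes "submod W" "W \<noteq> {0}"
  obtains M where "submod M" "M \<subseteq> W" "M \<noteq> {0}" "\<And>N. submod N \<Longrightarrow> N \<subseteq> M \<Longrightarrow> N \<noteq> {0} \<Longrightarrow> N = M"
proof -
  let ?P = "\<lambda>M. submod M \<and> M \<subseteq> W \<and> M \<noteq> {0}"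
  obtain M where M: "?P M" "\<And>N. ?P N \<Longrightarrow> cfun.dim M \<le> cfun.dim N"
    using assms ex_has_least_nat[of ?P W cfun.dim] by blast
  have "N = M" if N: "submod N" "N \<subseteq> M" "N \<noteq> {0}" for N
  proof (rule ccontr)
    assume ne: "N \<noteq> M"
    obtain F where F: "finite F" "supported \<subseteq> cfun.span F" using supported_span by blast
    obtain B where B: "B \<subseteq> N" "cfun.independent B" "N \<subseteq> cfun.span B" "card B = cfun.dim N"
      by (rule cfun.basis_exists)
    have sB: "cfun.span B = N"
      using B N(1) by (metis cfun.span_minimal submod_def subset_antisym)
    obtain v where v: "v \<in> M" "v \<notin> cfun.span B" using ne N(2) sB by blast
    have "insert v B \<subseteq> M" using v B N by auto
    moreover have ind: "cfun.independent (insert v B)" using cfun.independent_insertI v B by blast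
    ultimately have fi: "finite (insert v B)" using cfun.independent_span_bound[OF F(1) ind] F M(1)
      by (meson submod_def subset_trans)
    obtain C where C: "C \<subseteq> M" "cfun.independent C" "M \<subseteq> cfun.span C" "card C = cfun.dim M"
      by (rule cfun.basis_exists)
    have fC: "finite C" using cfun.independent_span_bound[OF F(1) C(2)] F M(1) C(1)
      by (meson submod_def subset_trans)
    have "card (insert v B) \<le> card C"
      using cfun.independent_span_bound[OF fC ind] \<open>insert v B \<subseteq> M\<close> C by blast
    moreover have "v \<notin> B" using v cfun.span_base by blast
    moreover have "cfun.dim M \<le> cfun.dim N" using M N by blast
    ultimately show False using fi B C by simp
  qed
  then show ?thesis using M(1) that by blast
qed

lemma translate_lincomb:
  "translate x (\<lambda>y. \<Sum>i\<in>I. c i * b i y) = (\<lambda>y. \<Sum>i\<in>I. c i * translate x (b i) y)"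
  by (auto simp: translate_def fun_eq_iff)

lemma translate_mult:
  assumes "x \<in> carrier G" "y \<in> carrier G"
  shows "translate (x \<otimes> y) \<phi> = translate x (translate y \<phi>)"
  using assms by (auto simp: translate_def fun_eq_iff inv_mult_group m_assoc)

lemma sum_fun_apply: "(\<Sum>i\<in>I. f i) x = (\<Sum>i\<in>I. f i x)"
  by (induction I rule: infinite_finite_induct) auto

text \<open>The matrices of the translations in a basis b of M. An invariant subspace of coordinate
  vectors corresponds to a submodule of M, so minimality of M becomes irreducibility in the sense of
  \<open>irreducible_rep\<close>.\<close>

lemma minimal_submod_rep:
  assumes M: "submod M" "M \<noteq> {0}"
    and min: "\<And>N. submod N \<Longrightarrow> N \<subseteq> M \<Longrightarrow> N \<noteq> {0} \<Longrightarrow> N = M"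
  obtains d \<pi> b where "irreducible_rep G d \<pi>"
    and "\<And>x j. x \<in> carrier G \<Longrightarrow> j < d \<Longrightarrow> translate x (b j) = (\<lambda>y. \<Sum>i<d. \<pi> x $$ (i, j) * b i y)"
    and "\<And>\<phi>. \<phi> \<in> M \<Longrightarrow> \<exists>c. \<phi> = (\<lambda>y. \<Sum>i<d. c i * b i y)"
proof -
  have sub: "cfun.subspace M" and sup: "M \<subseteq> supported"
    and inv: "\<And>x \<phi>. x \<in> carrier G \<Longrightarrow> \<phi> \<in> M \<Longrightarrow> translate x \<phi> \<in> M"
    using M(1) by (auto simp: submod_def)
  obtain F where F: "finite F" "supported \<subseteq> cfun.span F" using supported_span by blast
  obtain B where B: "B \<subseteq> M" "cfun.independent B" "M \<subseteq> cfun.span B"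
    by (rule cfun.maximal_independent_subset)
  have fB: "finite B" using cfun.independent_span_bound[OF F(1) B(2)] F B(1) sup by blast
  define d where "d = card B"
  obtain b where b: "bij_betw b {..<d} B"
    using ex_bij_betw_nat_finite[OF fB] by (auto simp: d_def atLeast0LessThan)
  have bM: "b i \<in> M" if "i < d" for i using bij_betwE[OF b] B(1) that by auto
  have comb_eq: "(\<Sum>v\<in>B. (\<lambda>y. u v * v y)) = (\<lambda>y. \<Sum>i<d. u (b i) * b i y)" for u
  proof
    fix y
    show "(\<Sum>v\<in>B. (\<lambda>y. u v * v y)) y = (\<Sum>i<d. u (b i) * b i y)"
      unfolding sum_fun_apply by (rule sum.reindex_bij_betw[OF b, symmetric])
  qed
  have spanB: "\<exists>c. \<phi> = (\<lambda>y. \<Sum>i<d. c i * b i y)" if p: "\<phi> \<in> M" for \<phi>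
  proof -
    obtain u where "\<phi> = (\<Sum>v\<in>B. (\<lambda>y. u v * v y))"
      using p B(3) unfolding cfun.span_finite[OF fB] by blast
    then show ?thesis unfolding comb_eq by (intro exI[of _ "\<lambda>i. u (b i)"])
  qed
  have indep: "c i = 0" if z: "(\<lambda>y. \<Sum>i<d. c i * b i y) = (\<lambda>_. 0)" and i: "i < d" for c i
  proof -
    define u where "u v = c (the_inv_into {..<d} b v)" for v
    have inj: "inj_on b {..<d}" using b by (simp add: bij_betw_def)
    have ub: "u (b i) = c i" if "i < d" for i
      unfolding u_def using the_inv_into_f_f[OF inj] that by simp
    have "(\<Sum>v\<in>B. (\<lambda>y. u v * v y)) = 0"
      unfolding comb_eq using z ub by (simp add: fun_eq_iff)
    then have "u (b i) = 0"
      using cfun.independentD[OF B(2) fB order_refl] bij_betwE[OF b] i by blast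
    then show ?thesis using ub[OF i] by simp
  qed
  have combM: "(\<lambda>y. \<Sum>i<d. c i * b i y) \<in> M" for c
  proof -
    have "(\<lambda>y. \<Sum>i<d. c i * b i y) = (\<Sum>i<d. (\<lambda>y. c i * b i y))" by (auto simp: sum_fun_apply)
    also have "\<dots> \<in> M" using bM by (intro cfun.subspace_sum[OF sub] cfun.subspace_scale[OF sub]) auto
    finally show ?thesis .
  qed
  have "\<forall>x\<in>carrier G. \<forall>j\<in>{..<d}. \<exists>c. translate x (b j) = (\<lambda>y. \<Sum>i<d. c i * b i y)"
    using spanB inv bM by blast
  then obtain c where c: "\<And>x j. x \<in> carrier G \<Longrightarrow> j < d \<Longrightarrow> translate x (b j) = (\<lambda>y. \<Sum>i<d. c x j i * b i y)"
    by (metis lessThan_iff)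
  define \<pi> where "\<pi> x = mat d d (\<lambda>(i, j). c x j i)" for x
  have \<pi>c: "\<pi> x \<in> carrier_mat d d" for x by (simp add: \<pi>_def)
  have tr: "translate x (b j) = (\<lambda>y. \<Sum>i<d. \<pi> x $$ (i, j) * b i y)" if "x \<in> carrier G" "j < d" for x j
    using c[OF that] that by (simp add: \<pi>_def)
  have act: "translate x (\<lambda>y. \<Sum>j<d. w $ j * b j y) = (\<lambda>y. \<Sum>i<d. (\<pi> x *\<^sub>v w) $ i * b i y)"
    if x: "x \<in> carrier G" and w: "w \<in> carrier_vec d" for x w
  proof -
    have "translate x (\<lambda>y. \<Sum>j<d. w $ j * b j y) = (\<lambda>y. \<Sum>j<d. w $ j * (\<Sum>i<d. \<pi> x $$ (i, j) * b i y))"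
      unfolding translate_lincomb using tr[OF x] by (auto simp: fun_eq_iff)
    also have "\<dots> = (\<lambda>y. \<Sum>i<d. (\<Sum>j<d. \<pi> x $$ (i, j) * w $ j) * b i y)"
      unfolding sum_distrib_left sum_distrib_right
      by (subst sum.swap) (simp add: mult_ac)
    also have "\<dots> = (\<lambda>y. \<Sum>i<d. (\<pi> x *\<^sub>v w) $ i * b i y)"
      using \<pi>c[of x] w by (auto simp: fun_eq_iff scalar_prod_def atLeast0LessThan intro!: sum.cong)
    finally show ?thesis .
  qed
  have uniq: "v = w" if v: "v \<in> carrier_vec d" "w \<in> carrier_vec d"
    and e: "(\<lambda>y. \<Sum>i<d. v $ i * b i y) = (\<lambda>y. \<Sum>i<d. w $ i * b i y)" for v w
  proof (rule eq_vecI)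
    fix i assume i: "i < dim_vec w"
    have "(\<lambda>y. \<Sum>i<d. (v $ i - w $ i) * b i y) = (\<lambda>_. 0)"
      using fun_cong[OF e] by (auto simp: fun_eq_iff algebra_simps sum_subtractf)
    then have "v $ i - w $ i = 0" by (rule indep) (use i v in auto)
    then show "v $ i = w $ i" by simp
  qed (use v in auto)
  have unit: "(\<lambda>y. \<Sum>i<d. unit_vec d j $ i * b i y) = b j" if "j < d" for j
  proof
    fix y
    have "(\<Sum>i<d. unit_vec d j $ i * b i y) = (\<Sum>i<d. if i = j then b i y else 0)"
      using that by (intro sum.cong) auto
    then show "(\<Sum>i<d. unit_vec d j $ i * b i y) = b j y" using that by simp
  qed
  have matI: "P = Q" if PQ: "P \<in> carrier_mat d d" "Q \<in> carrier_mat d d"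
    "\<And>j. j < d \<Longrightarrow> P *\<^sub>v unit_vec d j = Q *\<^sub>v unit_vec d j" for P Q :: "complex mat"
  proof (rule eq_matI)
    fix i j assume "i < dim_row Q" "j < dim_col Q"
    then have ij: "i < d" "j < d" using PQ by auto
    then show "P $$ (i, j) = Q $$ (i, j)"
      using mult_unit_vec_index[OF PQ(1) ij] mult_unit_vec_index[OF PQ(2) ij] PQ(3)[OF ij(2)] by metis
  qed (use PQ in auto)
  have mult: "\<pi> (x \<otimes> y) = \<pi> x * \<pi> y" if xy: "x \<in> carrier G" "y \<in> carrier G" for x y
  proof (rule matI)
    fix j assume j: "j < d"
    have "(\<lambda>z. \<Sum>i<d. (\<pi> (x \<otimes> y) *\<^sub>v unit_vec d j) $ i * b i z) = translate (x \<otimes> y) (b j)"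
      using act[of "x \<otimes> y" "unit_vec d j"] xy unit[OF j] by simp
    also have "\<dots> = translate x (translate y (b j))" by (rule translate_mult[OF xy])
    also have "translate y (b j) = (\<lambda>z. \<Sum>i<d. (\<pi> y *\<^sub>v unit_vec d j) $ i * b i z)"
      using act[of y "unit_vec d j"] xy unit[OF j] by simp
    also have "translate x \<dots> = (\<lambda>z. \<Sum>i<d. (\<pi> x *\<^sub>v (\<pi> y *\<^sub>v unit_vec d j)) $ i * b i z)"
      by (rule act[OF xy(1)]) (rule mult_mat_vec_carrier[OF \<pi>c], simp)
    finally have "\<pi> (x \<otimes> y) *\<^sub>v unit_vec d j = \<pi> x *\<^sub>v (\<pi> y *\<^sub>v unit_vec d j)"
      by (intro uniq mult_mat_vec_carrier[OF \<pi>c]) auto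
    then show "\<pi> (x \<otimes> y) *\<^sub>v unit_vec d j = \<pi> x * \<pi> y *\<^sub>v unit_vec d j"
      using assoc_mult_mat_vec[OF \<pi>c \<pi>c, of "unit_vec d j"] by simp
  qed (use \<pi>c in \<open>auto intro: mult_carrier_mat\<close>)
  have one: "\<pi> \<one> = 1\<^sub>m d"
  proof (rule matI)
    fix j assume j: "j < d"
    have "translate \<one> (b j) = b j"
      using bM[OF j] sup by (auto simp: translate_def supported_def fun_eq_iff)
    then have "(\<lambda>z. \<Sum>i<d. (\<pi> \<one> *\<^sub>v unit_vec d j) $ i * b i z) = (\<lambda>z. \<Sum>i<d. unit_vec d j $ i * b i z)"
      using act[of \<one> "unit_vec d j"] unit[OF j] by simp
    then have "\<pi> \<one> *\<^sub>v unit_vec d j = unit_vec d j"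
      by (intro uniq mult_mat_vec_carrier[OF \<pi>c]) auto
    then show "\<pi> \<one> *\<^sub>v unit_vec d j = 1\<^sub>m d *\<^sub>v unit_vec d j" by simp
  qed (use \<pi>c in auto)
  have "0 < d"
  proof (rule ccontr)
    assume "\<not> 0 < d"
    then have "M \<subseteq> {0}" using spanB by (auto simp: fun_eq_iff)
    then show False using M(2) cfun.subspace_0[OF sub] by blast
  qed
  moreover have "\<pi> \<in> hom G (units_of (ring_mat TYPE(complex) d ()))"
  proof (rule homI)
    show "\<pi> x \<in> carrier (units_of (ring_mat TYPE(complex) d ()))" if x: "x \<in> carrier G" for x
    proof -
      have "\<pi> (inv x) * \<pi> x = 1\<^sub>m d" "\<pi> x * \<pi> (inv x) = 1\<^sub>m d"
        using mult[of "inv x" x] mult[of x "inv x"] x one by auto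
      then show ?thesis using \<pi>c by (auto simp: units_of_def Units_def ring_mat_simps)
    qed
    show "\<pi> (x \<otimes> y) = \<pi> x \<otimes>\<^bsub>units_of (ring_mat TYPE(complex) d ())\<^esub> \<pi> y"
      if "x \<in> carrier G" "y \<in> carrier G" for x y
      using mult[OF that] by (simp add: units_of_def ring_mat_simps)
  qed
  moreover have "W = {0\<^sub>v d} \<or> W = carrier_vec d"
    if W: "VectorSpace.subspace class_ring W (module_vec TYPE(complex) d)"
      and Wi: "\<forall>x\<in>carrier G. \<forall>w\<in>W. \<pi> x *\<^sub>v w \<in> W" for W
  proof -
    note W = subspace_vecD[OF W]
    let ?f = "\<lambda>w y. \<Sum>i<d. w $ i * b i y"
    let ?N = "?f ` W"
    have N: "submod ?N"
      unfolding submod_def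
    proof (intro conjI ballI cfun.subspaceI)
      show "0 \<in> ?N" using W(2) by (intro image_eqI[of _ _ "0\<^sub>v d"]) (auto simp: fun_eq_iff)
      show "\<phi> + \<psi> \<in> ?N" if pq: "\<phi> \<in> ?N" "\<psi> \<in> ?N" for \<phi> \<psi>
      proof -
        obtain v w where vw: "v \<in> W" "\<phi> = ?f v" "w \<in> W" "\<psi> = ?f w" using pq by auto
        moreover have "v \<in> carrier_vec d" "w \<in> carrier_vec d" using W(1) vw by auto
        ultimately show ?thesis using W(3)[of v w]
          by (intro image_eqI[of _ _ "v + w"]) (auto simp: fun_eq_iff algebra_simps sum.distrib)
      qed
      show "(\<lambda>x. a * \<phi> x) \<in> ?N" if p: "\<phi> \<in> ?N" for a \<phi>
      proof -
        obtain v where v: "v \<in> W" "\<phi> = ?f v" using p by auto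
        moreover have "v \<in> carrier_vec d" using W(1) v by auto
        ultimately show ?thesis using W(4)[of v a]
          by (intro image_eqI[of _ _ "a \<cdot>\<^sub>v v"]) (auto simp: fun_eq_iff sum_distrib_left mult.assoc)
      qed
      show "?N \<subseteq> supported" using combM sup by blast
      show "translate x \<phi> \<in> ?N" if x: "x \<in> carrier G" and p: "\<phi> \<in> ?N" for x \<phi>
      proof -
        obtain v where v: "v \<in> W" "\<phi> = ?f v" using p by auto
        have "v \<in> carrier_vec d" using W(1) v by auto
        then have "translate x \<phi> = ?f (\<pi> x *\<^sub>v v)" using act[OF x] v by simp
        then show ?thesis using Wi x v by blast
      qed
    qed
    have NM: "?N \<subseteq> M" using combM by blast
    show ?thesis
    proof (cases "?N = {0}")
      case True
      have "w = 0\<^sub>v d" if w: "w \<in> W" for w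
      proof -
        have "?f w = 0" using True w by blast
        then show ?thesis using W(1) w by (intro uniq) (auto simp: fun_eq_iff)
      qed
      then show ?thesis using W(2) by blast
    next
      case False
      then have NM: "?N = M" using min[OF N NM] by simp
      have "v \<in> W" if v: "v \<in> carrier_vec d" for v
      proof -
        have "?f v \<in> ?N" unfolding NM by (rule combM)
        then obtain w where w: "w \<in> W" "?f v = ?f w" by auto
        then have "v = w" using uniq[OF v] W(1) by blast
        then show ?thesis using w by simp
      qed
      then show ?thesis using W(1) by blast
    qed
  qed
  ultimately have "irreducible_rep G d \<pi>" unfolding irreducible_rep_def by blast
  then show ?thesis using tr spanB by (rule that)
qed

lemma class_function_conj:
  assumes "f \<in> class_functions G" "x \<in> carrier G" "y \<in> carrier G"
  shows "f (x \<otimes> y) = f (y \<otimes> x)"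
proof -
  have "f (x \<otimes> (y \<otimes> x) \<otimes> inv x) = f (y \<otimes> x)"
    using assms unfolding class_functions_def by blast
  then show ?thesis using assms by (simp add: m_assoc)
qed

text \<open>On M the convolution acts by the matrix \<open>?E\<close>, which commutes with the
  representation because f is a class function. By Schur's lemma it is a scalar, and d times this
  scalar is the pairing of f with the character of M, which vanishes by hypothesis.\<close>

lemma convolve_irr:
  assumes f: "f \<in> class_functions G"
    and orth: "\<And>\<gamma>. \<gamma> \<in> irr_chars G \<Longrightarrow> (\<Sum>x\<in>carrier G. f x * \<gamma> (inv x)) = 0"
    and M: "submod M" "M \<noteq> {0}"
    and min: "\<And>N. submod N \<Longrightarrow> N \<subseteq> M \<Longrightarrow> N \<noteq> {0} \<Longrightarrow> N = M"
    and m: "m \<in> M"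
  shows "convolve (\<lambda>x. f (inv x)) m = (\<lambda>_. 0)"
proof -
  obtain d \<pi> b where P: "irreducible_rep G d \<pi>"
    and tr: "\<And>x j. x \<in> carrier G \<Longrightarrow> j < d \<Longrightarrow> translate x (b j) = (\<lambda>y. \<Sum>i<d. \<pi> x $$ (i, j) * b i y)"
    and sp: "\<And>\<phi>. \<phi> \<in> M \<Longrightarrow> \<exists>c. \<phi> = (\<lambda>y. \<Sum>i<d. c i * b i y)"
    by (rule minimal_submod_rep[OF M min]) blast+
  note Pc = irreducible_repD(2)[OF P]
  let ?E = "mat d d (\<lambda>(i, j). \<Sum>x\<in>carrier G. f (inv x) * \<pi> x $$ (i, j))"
  have Ec: "?E \<in> carrier_mat d d" by simp
  have comE: "\<pi> y * ?E = ?E * \<pi> y" if y: "y \<in> carrier G" for y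
  proof (rule eq_matI)
    fix i j assume "i < dim_row (?E * \<pi> y)" "j < dim_col (?E * \<pi> y)"
    then have ij: "i < d" "j < d" using Pc[OF y] by auto
    have "(\<pi> y * ?E) $$ (i, j) = (\<Sum>l<d. \<Sum>x\<in>carrier G. f (inv x) * (\<pi> y $$ (i, l) * \<pi> x $$ (l, j)))"
      using ij by (subst mult_mat_entry[OF Pc[OF y] Ec ij]) (simp add: sum_distrib_left mult_ac)
    also have "\<dots> = (\<Sum>x\<in>carrier G. f (inv x) * (\<pi> y * \<pi> x) $$ (i, j))"
      by (subst sum.swap, rule sum.cong[OF refl])
        (simp only: mult_mat_entry[OF Pc[OF y] Pc ij] sum_distrib_left)
    also have "\<dots> = (\<Sum>x\<in>carrier G. f (inv (y \<otimes> x) \<otimes> y) * \<pi> (y \<otimes> x) $$ (i, j))"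
      using y by (intro sum.cong refl) (simp add: irreducible_repD(3)[OF P] inv_mult_group m_assoc)
    also have "\<dots> = (\<Sum>x\<in>carrier G. f (inv x \<otimes> y) * \<pi> x $$ (i, j))"
      by (rule sum_left_translate[OF y])
    also have "\<dots> = (\<Sum>x\<in>carrier G. f (inv (x \<otimes> y) \<otimes> y) * \<pi> (x \<otimes> y) $$ (i, j))"
      by (rule sum_right_translate[OF y, symmetric])
    also have "\<dots> = (\<Sum>x\<in>carrier G. f (inv x) * (\<pi> x * \<pi> y) $$ (i, j))"
    proof (rule sum.cong[OF refl])
      fix x assume x: "x \<in> carrier G"
      have "f (inv (x \<otimes> y) \<otimes> y) = f (y \<otimes> inv (x \<otimes> y))"
        using x y by (intro class_function_conj[OF f]) auto
      also have "y \<otimes> inv (x \<otimes> y) = inv x" using x y by (simp add: inv_mult_group m_assoc[symmetric])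
      finally show "f (inv (x \<otimes> y) \<otimes> y) * \<pi> (x \<otimes> y) $$ (i, j) = f (inv x) * (\<pi> x * \<pi> y) $$ (i, j)"
        using x y by (simp add: irreducible_repD(3)[OF P])
    qed
    also have "\<dots> = (\<Sum>l<d. \<Sum>x\<in>carrier G. f (inv x) * (\<pi> x $$ (i, l) * \<pi> y $$ (l, j)))"
      by (subst sum.swap, rule sum.cong[OF refl])
        (simp only: mult_mat_entry[OF Pc Pc[OF y] ij] sum_distrib_left)
    also have "\<dots> = (?E * \<pi> y) $$ (i, j)"
      using ij by (subst mult_mat_entry[OF Ec Pc[OF y] ij]) (simp add: sum_distrib_right mult.assoc)
    finally show "(\<pi> y * ?E) $$ (i, j) = (?E * \<pi> y) $$ (i, j)" .
  qed (use Pc[OF y] in auto)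
  obtain c where c: "?E = c \<cdot>\<^sub>m 1\<^sub>m d"
    by (rule schur_scalar[OF P Ec comE])
  let ?g = "\<lambda>x. if x \<in> carrier G then mat_tr (\<pi> x) else 0"
  have g: "?g \<in> irr_chars G"
    using P unfolding irr_chars_def mat_tr_def by blast
  have "of_nat d * c = (\<Sum>i<d. ?E $$ (i, i))" unfolding c by simp
  also have "\<dots> = (\<Sum>x\<in>carrier G. f (inv x) * ?g x)"
    by (simp, subst sum.swap) (simp add: mat_tr_eq[OF Pc] sum_distrib_left)
  also have "\<dots> = (\<Sum>x\<in>carrier G. f x * ?g (inv x))"
    by (subst sum_inv[symmetric]) simp
  also have "\<dots> = 0" by (rule orth[OF g])
  finally have "c = 0" using irreducible_repD(1)[OF P] by simp
  then have E0: "(\<Sum>x\<in>carrier G. f (inv x) * \<pi> x $$ (i, j)) = 0" if "i < d" "j < d" for i j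
  proof -
    have "?E $$ (i, j) = (c \<cdot>\<^sub>m 1\<^sub>m d) $$ (i, j)" by (simp only: c)
    then show ?thesis using that \<open>c = 0\<close> by simp
  qed
  obtain a where a: "m = (\<lambda>y. \<Sum>i<d. a i * b i y)" using sp[OF m] by blast
  show ?thesis
  proof
    fix y
    have "convolve (\<lambda>x. f (inv x)) m y = (\<Sum>x\<in>carrier G. f (inv x) * (\<Sum>j<d. a j * (\<Sum>i<d. \<pi> x $$ (i, j) * b i y)))"
      unfolding convolve_def a translate_lincomb by (rule sum.cong[OF refl]) (simp add: tr)
    also have "\<dots> = (\<Sum>x\<in>carrier G. \<Sum>j<d. \<Sum>i<d. f (inv x) * \<pi> x $$ (i, j) * (a j * b i y))"
      by (simp add: sum_distrib_left mult_ac)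
    also have "\<dots> = (\<Sum>j<d. \<Sum>x\<in>carrier G. \<Sum>i<d. f (inv x) * \<pi> x $$ (i, j) * (a j * b i y))"
      by (rule sum.swap)
    also have "\<dots> = (\<Sum>j<d. \<Sum>i<d. (\<Sum>x\<in>carrier G. f (inv x) * \<pi> x $$ (i, j)) * (a j * b i y))"
      by (rule sum.cong[OF refl], subst sum.swap) (simp only: sum_distrib_right)
    also have "\<dots> = 0" by (simp add: E0)
    finally show "convolve (\<lambda>x. f (inv x)) m y = 0" .
  qed
qed

text \<open>Such an h is central in the group algebra; this makes the image of
  \<open>convolve h\<close> stable under translations.\<close>

lemma translate_convolve:
  assumes h: "\<And>x y. x \<in> carrier G \<Longrightarrow> y \<in> carrier G \<Longrightarrow> h (x \<otimes> y) = h (y \<otimes> x)" and y: "y \<in> carrier G"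
  shows "translate y (convolve h a) = convolve h (translate y a)"
proof -
  have "translate y (convolve h a) = (\<lambda>z. \<Sum>x\<in>carrier G. h x * translate (y \<otimes> x) a z)"
    unfolding convolve_def translate_lincomb by (auto simp: translate_mult[OF y] intro!: ext sum.cong)
  also have "\<dots> = (\<lambda>z. \<Sum>x\<in>carrier G. h (inv y \<otimes> (y \<otimes> x)) * translate (y \<otimes> x) a z)"
    using y by (intro ext sum.cong refl) (simp add: m_assoc[symmetric])
  also have "\<dots> = (\<lambda>z. \<Sum>x\<in>carrier G. h (inv y \<otimes> x) * translate x a z)"
    using sum_left_translate[OF y] by (rule ext)
  also have "\<dots> = (\<lambda>z. \<Sum>x\<in>carrier G. h (x \<otimes> inv y) * translate x a z)"
    using h y by (intro ext sum.cong refl) simp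
  also have "\<dots> = (\<lambda>z. \<Sum>x\<in>carrier G. h ((x \<otimes> y) \<otimes> inv y) * translate (x \<otimes> y) a z)"
    using sum_right_translate[OF y, symmetric] by (rule ext)
  also have "\<dots> = convolve h (translate y a)"
    using y unfolding convolve_def by (intro ext sum.cong refl) (simp add: m_assoc translate_mult)
  finally show ?thesis .
qed

lemma convolve_add: "convolve h (\<lambda>x. a x + b x) = (\<lambda>y. convolve h a y + convolve h b y)"
  unfolding convolve_def translate_def sum.distrib[symmetric] by (intro ext sum.cong) (auto simp: distrib_left)

lemma convolve_scale: "convolve h (\<lambda>x. c * a x) = (\<lambda>y. c * convolve h a y)"
  unfolding convolve_def translate_def sum_distrib_left by (intro ext sum.cong) (auto simp: mult_ac)

text \<open>If a class function \<open>f\<close> is orthogonal to all characters, then convolution with \<open>f\<close> kills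
  every irreducible submodule of the image of the adjoint convolution, so that image is zero.\<close>

theorem irr_chars_complete:
  assumes f: "f \<in> class_functions G"
    and orth: "\<And>\<gamma>. \<gamma> \<in> irr_chars G \<Longrightarrow> (\<Sum>x\<in>carrier G. f x * \<gamma> (inv x)) = 0"
  shows "f = (\<lambda>_. 0)"
proof -
  \<comment> \<open>For the Hermitian inner product, convolution with the conjugate of f is adjoint
    to convolution with f(x^-1).\<close>
  let ?h = "\<lambda>x. cnj (f x)"
  let ?W = "convolve ?h ` supported"
  have hc: "?h (x \<otimes> y) = ?h (y \<otimes> x)" if "x \<in> carrier G" "y \<in> carrier G" for x y
    using class_function_conj[OF f that] by simp
  have W: "submod ?W"
    unfolding submod_def
  proof (intro conjI ballI cfun.subspaceI)
    show "0 \<in> ?W"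
      by (rule image_eqI[of _ _ "\<lambda>_. 0"]) (auto simp: convolve_def translate_def supported_def fun_eq_iff)
    show "\<phi> + \<psi> \<in> ?W" if pq: "\<phi> \<in> ?W" "\<psi> \<in> ?W" for \<phi> \<psi>
    proof -
      obtain a b where ab: "a \<in> supported" "\<phi> = convolve ?h a" "b \<in> supported" "\<psi> = convolve ?h b"
        using pq by auto
      show ?thesis
        by (rule image_eqI[of _ _ "\<lambda>x. a x + b x"])
          (use ab in \<open>auto simp: convolve_add supported_def fun_eq_iff\<close>)
    qed
    show "(\<lambda>x. c * \<phi> x) \<in> ?W" if p: "\<phi> \<in> ?W" for c \<phi>
    proof -
      obtain a where a: "a \<in> supported" "\<phi> = convolve ?h a" using p by auto
      show ?thesis
        by (rule image_eqI[of _ _ "\<lambda>x. c * a x"]) (use a in \<open>auto simp: convolve_scale supported_def\<close>)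
    qed
    show "?W \<subseteq> supported" by (auto simp: supported_def convolve_def translate_def)
    show "translate x \<phi> \<in> ?W" if x: "x \<in> carrier G" and p: "\<phi> \<in> ?W" for x \<phi>
    proof -
      obtain a where a: "a \<in> supported" "\<phi> = convolve ?h a" using p by auto
      have "translate x \<phi> = convolve ?h (translate x a)"
        unfolding a(2) by (rule translate_convolve[of ?h, OF hc x])
      moreover have "translate x a \<in> supported" by (auto simp: translate_def supported_def)
      ultimately show ?thesis by blast
    qed
  qed
  have W0: "?W = {0}"
  proof (rule ccontr)
    assume "?W \<noteq> {0}"
    then obtain M where M: "submod M" "M \<subseteq> ?W" "M \<noteq> {0}"
      and min: "\<And>N. submod N \<Longrightarrow> N \<subseteq> M \<Longrightarrow> N \<noteq> {0} \<Longrightarrow> N = M"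
      by (rule minimal_submod[OF W]) blast+
    have "0 \<in> M" using M(1) cfun.subspace_0 by (auto simp: submod_def)
    then obtain m where m: "m \<in> M" "m \<noteq> 0" using M(3) by blast
    then obtain a where a: "m = convolve ?h a" using M(2) by auto
    have Tm: "convolve (\<lambda>x. f (inv x)) m = (\<lambda>_. 0)"
      by (rule convolve_irr[OF f orth M(1,3) min m(1)])
    have z: "(\<Sum>x\<in>carrier G. f x * m (x \<otimes> z)) = 0" if z: "z \<in> carrier G" for z
    proof -
      have "(\<Sum>x\<in>carrier G. f x * m (x \<otimes> z)) = (\<Sum>x\<in>carrier G. f (inv x) * m (inv x \<otimes> z))"
        by (rule sum_inv[symmetric])
      also have "\<dots> = convolve (\<lambda>x. f (inv x)) m z"
        using z by (simp add: convolve_def translate_def)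
      finally show ?thesis unfolding Tm .
    qed
    \<comment> \<open>Moving the convolution across the inner product: since m is the convolution of
      \<open>a\<close> with \<open>?h\<close>, the square norm of m pairs \<open>a\<close> with the
      convolution of m, which is zero by \<open>Tm\<close>.\<close>
    have "(\<Sum>y\<in>carrier G. m y * cnj (m y)) = (\<Sum>y\<in>carrier G. \<Sum>x\<in>carrier G. cnj (f x) * a (inv x \<otimes> y) * cnj (m y))"
      unfolding a by (rule sum.cong[OF refl]) (simp add: convolve_def translate_def sum_distrib_right)
    also have "\<dots> = (\<Sum>x\<in>carrier G. \<Sum>y\<in>carrier G. cnj (f x) * a (inv x \<otimes> y) * cnj (m y))"
      by (rule sum.swap)
    also have "\<dots> = (\<Sum>x\<in>carrier G. \<Sum>y\<in>carrier G. cnj (f x) * a (inv x \<otimes> (x \<otimes> y)) * cnj (m (x \<otimes> y)))"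
      by (rule sum.cong[OF refl], rule sum_left_translate[symmetric])
    also have "\<dots> = (\<Sum>x\<in>carrier G. \<Sum>y\<in>carrier G. a y * (cnj (f x * m (x \<otimes> y))))"
      by (intro sum.cong refl) (simp add: m_assoc[symmetric])
    also have "\<dots> = (\<Sum>y\<in>carrier G. a y * cnj (\<Sum>x\<in>carrier G. f x * m (x \<otimes> y)))"
      by (subst sum.swap) (simp only: sum_distrib_left cnj_sum)
    also have "\<dots> = 0" by (simp add: z)
    finally have "(\<Sum>y\<in>carrier G. (cmod (m y))\<^sup>2) = 0"
      unfolding complex_norm_square[symmetric] of_real_sum[symmetric] of_real_eq_0_iff .
    then have "m y = 0" if "y \<in> carrier G" for y
      using that fin by (subst (asm) sum_nonneg_eq_0_iff) auto
    moreover have "m y = 0" if "y \<notin> carrier G" for y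
      using m(1) M(1) that by (auto simp: submod_def supported_def)
    ultimately show False using m(2) by (auto simp: fun_eq_iff)
  qed
  show ?thesis
  proof
    fix y
    show "f y = 0"
    proof (cases "y \<in> carrier G")
      case True
      \<comment> \<open>Convolving with the point mass at the identity returns \<open>?h\<close>
        itself, so a zero image forces f = 0.\<close>
      let ?\<delta> = "\<lambda>x. if x = \<one> then 1 else 0 :: complex"
      have "?\<delta> \<in> supported" by (auto simp: supported_def)
      then have "convolve ?h ?\<delta> = 0" using W0 by blast
      then have "convolve ?h ?\<delta> y = 0" by (simp add: fun_eq_iff)
      then have "(\<Sum>x\<in>carrier G. cnj (f x) * (if inv x \<otimes> y = \<one> then 1 else 0)) = 0"
        using True by (simp add: convolve_def translate_def)
      also have "(\<Sum>x\<in>carrier G. cnj (f x) * (if inv x \<otimes> y = \<one> then 1 else 0)) =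
          (\<Sum>x\<in>carrier G. if x = y then cnj (f x) else 0)"
      proof (rule sum.cong[OF refl])
        fix x assume x: "x \<in> carrier G"
        have "inv x \<otimes> y = \<one> \<longleftrightarrow> x = y"
          using x True inv_solve_left'[of \<one> x y] by auto
        then show "cnj (f x) * (if inv x \<otimes> y = \<one> then 1 else 0) = (if x = y then cnj (f x) else 0)" by simp
      qed
      also have "\<dots> = cnj (f y)" using fin True by simp
      finally show ?thesis by simp
    next
      case False
      then show ?thesis using f by (auto simp: class_functions_def)
    qed
  qed
qed

text \<open>By orthogonality the characters are linearly independent in the finite-dimensional space
  of functions on G.\<close>

lemma finite_irr_chars: "finite (irr_chars G)"
proof -
  obtain F where F: "finite F" "supported \<subseteq> cfun.span F" using supported_span by blast
  have sup: "irr_chars G \<subseteq> supported" by (auto simp: irr_chars_def supported_def)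
  have "cfun.independent (irr_chars G)"
    unfolding cfun.independent_explicit_module
  proof (intro allI impI)
    fix t u v assume t: "finite t" "t \<subseteq> irr_chars G" and z: "(\<Sum>v\<in>t. (\<lambda>x. u v * v x)) = 0" and v: "v \<in> t"
    have z': "(\<Sum>w\<in>t. u w * w x) = 0" for x
      using fun_cong[OF z, of x] by (simp add: sum_fun_apply)
    have "0 = (\<Sum>x\<in>carrier G. (\<Sum>w\<in>t. u w * w x) * v (inv x))" by (simp add: z')
    also have "\<dots> = (\<Sum>w\<in>t. u w * (\<Sum>x\<in>carrier G. w x * v (inv x)))"
      by (simp only: sum_distrib_left sum_distrib_right, subst sum.swap) (simp add: mult.assoc)
    also have "\<dots> = (\<Sum>w\<in>t. if w = v then u w * of_nat (Coset.order G) else 0)"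
      using t v by (intro sum.cong refl) (simp add: irr_chars_orthogonal subset_iff)
    also have "\<dots> = u v * of_nat (Coset.order G)" using t v by simp
    finally show "u v = 0" using fin order_gt_0_iff_finite by force
  qed
  then show ?thesis using cfun.independent_span_bound[OF F(1) _ subset_trans[OF sup F(2)]] by simp
qed

section \<open>Conjugacy classes and column orthogonality\<close>

lemma conj_class_mem:
  assumes "x \<in> carrier G" "y \<in> carrier G" and that: "u \<in> carrier G"
  shows "y \<otimes> u \<otimes> inv y \<in> conj_class G x \<longleftrightarrow> u \<in> conj_class G x"
proof
  assume "u \<in> conj_class G x"
  then obtain v where v: "v \<in> carrier G" "u = v \<otimes> x \<otimes> inv v" by (auto simp: conj_class_def)
  then have "y \<otimes> u \<otimes> inv y = (y \<otimes> v) \<otimes> x \<otimes> inv (y \<otimes> v)"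
    using assms by (simp add: inv_mult_group m_assoc)
  then show "y \<otimes> u \<otimes> inv y \<in> conj_class G x" using v assms unfolding conj_class_def by blast
next
  assume "y \<otimes> u \<otimes> inv y \<in> conj_class G x"
  then obtain v where v: "v \<in> carrier G" "y \<otimes> u \<otimes> inv y = v \<otimes> x \<otimes> inv v" by (auto simp: conj_class_def)
  have "u = inv y \<otimes> (y \<otimes> u \<otimes> inv y) \<otimes> y" using assms that by (simp add: m_assoc inv_solve_left)
  also have "\<dots> = (inv y \<otimes> v) \<otimes> x \<otimes> inv (inv y \<otimes> v)"
    unfolding v(2) using assms v(1) by (simp add: inv_mult_group m_assoc)
  finally show "u \<in> conj_class G x" using v(1) assms unfolding conj_class_def by blast
qed

lemma conj_class_sub: "x \<in> carrier G \<Longrightarrow> conj_class G x \<subseteq> carrier G"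
  by (auto simp: conj_class_def)

lemma conj_class_self: "x \<in> carrier G \<Longrightarrow> x \<in> conj_class G x"
  unfolding conj_class_def by (intro CollectI exI[of _ \<one>]) auto

text \<open>The indicator function of the class of x, minus its expansion in characters, is a class
  function orthogonal to all characters, so \<open>irr_chars_complete\<close> makes it 0. Everything
  is scaled by |G| to avoid fractions.\<close>

lemma irr_chars_column_orthogonal:
  assumes x: "x \<in> carrier G" and y: "y \<in> carrier G"
  shows "of_nat (card (conj_class G x)) * (\<Sum>\<gamma>\<in>irr_chars G. \<gamma> (inv x) * \<gamma> y) =
     (if y \<in> conj_class G x then of_nat (Coset.order G) else 0)"
proof -
  let ?c = "conj_class G x" and ?N = "of_nat (Coset.order G) :: complex"
  let ?k = "of_nat (card ?c) :: complex"
  let ?f = "\<lambda>u. (if u \<in> ?c then ?N else 0) - (\<Sum>\<gamma>\<in>irr_chars G. ?k * \<gamma> (inv x) * \<gamma> u)"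
  have csub: "?c \<subseteq> carrier G" by (rule conj_class_sub[OF x])
  have gcl: "\<gamma> (v \<otimes> u \<otimes> inv v) = \<gamma> u" if "\<gamma> \<in> irr_chars G" "u \<in> carrier G" "v \<in> carrier G" for \<gamma> u v
    using irr_char_class_function[OF that(1)] that by (auto simp: class_functions_def)
  have g0: "\<gamma> u = 0" if "\<gamma> \<in> irr_chars G" "u \<notin> carrier G" for \<gamma> u
    using irr_char_class_function[OF that(1)] that by (auto simp: class_functions_def)
  have "?f \<in> class_functions G"
    unfolding class_functions_def using csub
    by (auto simp: g0 gcl conj_class_mem[OF x])
  moreover have "(\<Sum>u\<in>carrier G. ?f u * \<beta> (inv u)) = 0" if b: "\<beta> \<in> irr_chars G" for \<beta>
  proof -
    have "(\<Sum>u\<in>carrier G. (if u \<in> ?c then ?N else 0) * \<beta> (inv u)) = (\<Sum>u\<in>?c. ?N * \<beta> (inv u))"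
    proof -
      have "(\<Sum>u\<in>carrier G. (if u \<in> ?c then ?N else 0) * \<beta> (inv u)) = (\<Sum>u\<in>carrier G. if u \<in> ?c then ?N * \<beta> (inv u) else 0)"
        by (intro sum.cong) auto
      also have "\<dots> = (\<Sum>u\<in>carrier G \<inter> ?c. ?N * \<beta> (inv u))"
        using fin by (simp add: sum.inter_restrict)
      also have "carrier G \<inter> ?c = ?c" using csub by auto
      finally show ?thesis .
    qed
    also have "\<dots> = (\<Sum>u\<in>?c. ?N * \<beta> (inv x))"
    proof (rule sum.cong[OF refl])
      fix u assume "u \<in> ?c"
      then obtain v where v: "v \<in> carrier G" "u = v \<otimes> x \<otimes> inv v" by (auto simp: conj_class_def)
      then have "inv u = v \<otimes> inv x \<otimes> inv v" using x by (simp add: inv_mult_group m_assoc)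
      then show "?N * \<beta> (inv u) = ?N * \<beta> (inv x)" using gcl[OF b] x v by simp
    qed
    also have "\<dots> = ?k * ?N * \<beta> (inv x)" by simp
    finally have 1: "(\<Sum>u\<in>carrier G. (if u \<in> ?c then ?N else 0) * \<beta> (inv u)) = ?k * ?N * \<beta> (inv x)" .
    have "(\<Sum>u\<in>carrier G. (\<Sum>\<gamma>\<in>irr_chars G. ?k * \<gamma> (inv x) * \<gamma> u) * \<beta> (inv u)) =
        (\<Sum>\<gamma>\<in>irr_chars G. ?k * \<gamma> (inv x) * (\<Sum>u\<in>carrier G. \<gamma> u * \<beta> (inv u)))"
      by (simp only: sum_distrib_right sum_distrib_left, subst sum.swap) (simp add: mult.assoc)
    also have "\<dots> = (\<Sum>\<gamma>\<in>irr_chars G. if \<gamma> = \<beta> then ?k * \<gamma> (inv x) * ?N else 0)"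
      using b by (intro sum.cong refl) (simp add: irr_chars_orthogonal)
    also have "\<dots> = ?k * ?N * \<beta> (inv x)" using finite_irr_chars b by simp
    finally have 2: "(\<Sum>u\<in>carrier G. (\<Sum>\<gamma>\<in>irr_chars G. ?k * \<gamma> (inv x) * \<gamma> u) * \<beta> (inv u)) = ?k * ?N * \<beta> (inv x)" .
    show ?thesis using 1 2 by (simp only: left_diff_distrib sum_subtractf diff_self)
  qed
  ultimately have "?f = (\<lambda>_. 0)" by (rule irr_chars_complete)
  then have "?f y = 0" by (rule fun_cong)
  then show ?thesis by (simp add: sum_distrib_left mult.assoc split: if_splits)
qed

text \<open>Orbit and stabilizer for conjugation: each fibre of y -> y x y^-1 over the class is a
  left coset of the centralizer of the representative x chosen in
  \<open>centralizer_order\<close>.\<close>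

lemma card_conj_class_centralizer:
  assumes c: "c \<in> conj_classes G"
  shows "card c * centralizer_order G c = Coset.order G"
proof -
  obtain x0 where x0: "x0 \<in> carrier G" "c = conj_class G x0" using c by (auto simp: conj_classes_def)
  define x where "x = (SOME x. x \<in> c)"
  have xc: "x \<in> c" unfolding x_def using conj_class_self[OF x0(1)] x0(2) by (metis someI)
  have x: "x \<in> carrier G" using xc conj_class_sub[OF x0(1)] x0(2) by auto
  let ?C = "{y \<in> carrier G. y \<otimes> x = x \<otimes> y}"
  let ?\<phi> = "\<lambda>y. y \<otimes> x \<otimes> inv y"
  have img: "?\<phi> ` carrier G = c"
  proof -
    obtain v where v: "v \<in> carrier G" "x = v \<otimes> x0 \<otimes> inv v" using xc x0 by (auto simp: conj_class_def)
    have A1: "?\<phi> y \<in> c" if "y \<in> carrier G" for y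
      using conj_class_mem[OF x0(1) that x] xc x0(2) by simp
    have A2: "u \<in> ?\<phi> ` carrier G" if u: "u \<in> c" for u
    proof -
      obtain w where w: "w \<in> carrier G" "u = w \<otimes> x0 \<otimes> inv w" using u x0 by (auto simp: conj_class_def)
      have "x0 = inv v \<otimes> x \<otimes> v" using v x0 by (simp add: m_assoc inv_solve_left)
      then have "u = ?\<phi> (w \<otimes> inv v)" using w v(1) x by (simp add: inv_mult_group m_assoc)
      then show ?thesis by (rule image_eqI) (use w v(1) in simp)
    qed
    show ?thesis by (intro equalityI image_subsetI subsetI A1 A2)
  qed
  have fib: "card {y \<in> carrier G. ?\<phi> y = u} = card ?C" if u: "u \<in> c" for u
  proof -
    obtain w where w: "w \<in> carrier G" "u = ?\<phi> w" using u img by blast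
    have "bij_betw (\<lambda>y. w \<otimes> y) ?C {y \<in> carrier G. ?\<phi> y = u}"
    proof (rule bij_betw_byWitness[where f' = "\<lambda>y. inv w \<otimes> y"])
      show "(\<otimes>) w ` ?C \<subseteq> {y \<in> carrier G. ?\<phi> y = u}"
      proof clarsimp
        fix y assume y: "y \<in> carrier G" "y \<otimes> x = x \<otimes> y"
        have "w \<otimes> y \<otimes> x \<otimes> inv (w \<otimes> y) = w \<otimes> (y \<otimes> x) \<otimes> inv y \<otimes> inv w"
          using w(1) y(1) x by (simp add: m_assoc inv_mult_group)
        also have "\<dots> = u" unfolding w(2) y(2) using w(1) y(1) x by (simp add: m_assoc)
        finally show "w \<otimes> y \<in> carrier G \<and> w \<otimes> y \<otimes> x \<otimes> inv (w \<otimes> y) = u" using w y by simp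
      qed
      show "(\<lambda>y. inv w \<otimes> y) ` {y \<in> carrier G. ?\<phi> y = u} \<subseteq> ?C"
      proof (rule image_subsetI)
        fix y assume "y \<in> {y \<in> carrier G. ?\<phi> y = u}"
        then have y: "y \<in> carrier G" "y \<otimes> x \<otimes> inv y = u" by auto
        have "y \<otimes> x = u \<otimes> y" using y x by (auto simp: m_assoc)
        then have "inv w \<otimes> y \<otimes> x = inv w \<otimes> (w \<otimes> x \<otimes> inv w) \<otimes> y"
          using w y x by (simp add: m_assoc)
        also have "\<dots> = x \<otimes> (inv w \<otimes> y)" using w(1) y(1) x by (simp add: m_assoc[symmetric])
        finally show "inv w \<otimes> y \<in> ?C" using w y by simp
      qed
    qed (use w(1) in \<open>auto simp: m_assoc[symmetric]\<close>)
    then show ?thesis by (simp add: bij_betw_same_card)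
  qed
  have fc: "finite c" using img fin by auto
  have "Coset.order G = card (\<Union>u\<in>c. {y \<in> carrier G. ?\<phi> y = u})"
    unfolding Coset.order_def using img by (intro arg_cong[of _ _ card]) auto
  also have "\<dots> = (\<Sum>u\<in>c. card {y \<in> carrier G. ?\<phi> y = u})"
    using fin fc by (intro card_UN_disjoint) auto
  also have "\<dots> = card c * card ?C" by (simp add: fib)
  also have "card ?C = centralizer_order G c" by (simp add: centralizer_order_def x_def)
  finally show ?thesis by simp
qed

end

section \<open>Types of elements of the wreath product\<close>

lemma fun_upd_add_mset_cancel:
  "f(c := add_mset k (f c)) = g(c := add_mset k (g c)) \<Longrightarrow> f = g"
  by (metis (no_types, lifting) add_mset_eq_singleton_iff add_mset_add_mset_same_iff ext fun_upd_def fun_upd_apply)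

lemma orbit_card:
  assumes "x \<in> orbit f x"
  shows "bij_betw (\<lambda>m. (f ^^ m) x) {..<card (orbit f x)} (orbit f x)"
    and "(f ^^ card (orbit f x)) x = x" and "0 < card (orbit f x)"
proof -
  have k: "card (orbit f x) = funpow_dist1 f x x"
    using arg_cong[OF orbit_conv_funpow_dist1[OF assms], of card]
      card_image[OF inj_on_funpow_dist1[OF assms]] by simp
  show "bij_betw (\<lambda>m. (f ^^ m) x) {..<card (orbit f x)} (orbit f x)"
    unfolding k bij_betw_def
    using inj_on_funpow_dist1[OF assms] orbit_conv_funpow_dist1[OF assms] by (simp add: atLeast0LessThan)
  show "(f ^^ card (orbit f x)) x = x" unfolding k by (rule funpow_dist1_prop[OF assms])
  show "0 < card (orbit f x)" unfolding k by simp
qed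

context finite_group
begin

lemma inv_cancel [simp]:
  assumes "x \<in> carrier G" "y \<in> carrier G"
  shows "inv x \<otimes> (x \<otimes> y) = y" "x \<otimes> (inv x \<otimes> y) = y"
  using assms by (simp_all add: m_assoc[symmetric])

lemma conj_class_eq:
  assumes "x \<in> carrier G" "y \<in> conj_class G x"
  shows "conj_class G y = conj_class G x"
proof -
  obtain v where v: "v \<in> carrier G" "y = v \<otimes> x \<otimes> inv v" using assms by (auto simp: conj_class_def)
  have 1: "w \<otimes> y \<otimes> inv w = (w \<otimes> v) \<otimes> x \<otimes> inv (w \<otimes> v)" if "w \<in> carrier G" for w
    using that v assms by (simp add: inv_mult_group m_assoc)
  have 2: "w \<otimes> x \<otimes> inv w = (w \<otimes> inv v) \<otimes> y \<otimes> inv (w \<otimes> inv v)" if "w \<in> carrier G" for w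
    unfolding v(2) using that v(1) assms(1) by (simp add: inv_mult_group m_assoc)
  show ?thesis
  proof (intro equalityI subsetI)
    fix u assume "u \<in> conj_class G y"
    then obtain w where "w \<in> carrier G" "u = w \<otimes> y \<otimes> inv w" by (auto simp: conj_class_def)
    then show "u \<in> conj_class G x" unfolding conj_class_def using 1 v(1) by blast
  next
    fix u assume "u \<in> conj_class G x"
    then obtain w where w: "w \<in> carrier G" "u = w \<otimes> x \<otimes> inv w" by (auto simp: conj_class_def)
    have "u = (w \<otimes> inv v) \<otimes> y \<otimes> inv (w \<otimes> inv v)" unfolding w(2) by (rule 2[OF w(1)])
    moreover have "w \<otimes> inv v \<in> carrier G" using w(1) v(1) by simp
    ultimately show "u \<in> conj_class G y" unfolding conj_class_def by blast
  qed
qed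

lemma conj_classes_eq:
  assumes "c \<in> conj_classes G" "x \<in> c"
  shows "x \<in> carrier G" "c = conj_class G x"
proof -
  obtain y where y: "y \<in> carrier G" "c = conj_class G y" using assms(1) unfolding conj_classes_def by blast
  show "x \<in> carrier G" using assms(2) conj_class_sub[OF y(1)] y(2) by blast
  show "c = conj_class G x" using conj_class_eq[OF y(1)] assms(2) y(2) by simp
qed

lemma conj_class_in: "x \<in> carrier G \<Longrightarrow> conj_class G x \<in> conj_classes G"
  by (auto simp: conj_classes_def)

lemma finite_conj_classes: "finite (conj_classes G)"
  using fin by (simp add: conj_classes_def)

lemma conj_classes_disjoint:
  "c \<in> conj_classes G \<Longrightarrow> c' \<in> conj_classes G \<Longrightarrow> x \<in> c \<Longrightarrow> x \<in> c' \<Longrightarrow> c = c'"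
  using conj_classes_eq by blast

text \<open>The transporter from x to y is the centralizer of z translated on both sides, where z is
  the representative that \<open>centralizer_order\<close> picks: w carries x to z and
  \<open>?s\<close> carries z to y.\<close>

lemma card_transporter:
  assumes "x \<in> carrier G" "y \<in> conj_class G x"
  shows "card {v \<in> carrier G. v \<otimes> x = y \<otimes> v} = centralizer_order G (conj_class G x)"
proof -
  let ?c = "conj_class G x"
  define z where "z = (SOME z. z \<in> ?c)"
  have z: "z \<in> ?c" unfolding z_def using conj_class_self[OF assms(1)] by (rule someI)
  obtain w where w: "w \<in> carrier G" "z = w \<otimes> x \<otimes> inv w" using z by (auto simp: conj_class_def)
  obtain t where t: "t \<in> carrier G" "y = t \<otimes> x \<otimes> inv t" using assms by (auto simp: conj_class_def)
  have zc: "z \<in> carrier G" and yc: "y \<in> carrier G" using w t assms by auto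
  let ?s = "t \<otimes> inv w"
  have s: "?s \<in> carrier G" using w t by simp
  have xw: "x = inv w \<otimes> z \<otimes> w" using w assms(1) by (simp add: m_assoc inv_mult_group)
  have sz: "?s \<otimes> z = y \<otimes> ?s"
  proof -
    have "y \<otimes> ?s = t \<otimes> x \<otimes> inv w" unfolding t(2) using t(1) w(1) assms(1) by (simp add: m_assoc inv_mult_group)
    also have "\<dots> = ?s \<otimes> z" unfolding w(2) using t(1) w(1) assms(1) by (simp add: m_assoc inv_mult_group)
    finally show ?thesis by simp
  qed
  have wx: "w \<otimes> x = z \<otimes> w" unfolding w(2) using w(1) assms(1) by (simp add: m_assoc)
  let ?C = "{u \<in> carrier G. u \<otimes> z = z \<otimes> u}" and ?V = "{v \<in> carrier G. v \<otimes> x = y \<otimes> v}"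
  have "bij_betw (\<lambda>u. ?s \<otimes> u \<otimes> w) ?C ?V"
  proof (rule bij_betw_byWitness[where f' = "\<lambda>v. inv ?s \<otimes> v \<otimes> inv w"])
    show "(\<lambda>u. ?s \<otimes> u \<otimes> w) ` ?C \<subseteq> ?V"
    proof (rule image_subsetI)
      fix u assume "u \<in> ?C"
      then have u: "u \<in> carrier G" "u \<otimes> z = z \<otimes> u" by auto
      have "?s \<otimes> u \<otimes> w \<otimes> x = ?s \<otimes> (u \<otimes> z) \<otimes> w"
        using u(1) w(1) assms(1) s zc wx by (simp add: m_assoc)
      also have "\<dots> = (?s \<otimes> z) \<otimes> u \<otimes> w" unfolding u(2) using u(1) w(1) s zc t(1) by (simp add: m_assoc)
      also have "\<dots> = y \<otimes> (?s \<otimes> u \<otimes> w)" unfolding sz using u(1) w(1) s yc t(1) by (simp add: m_assoc)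
      finally show "?s \<otimes> u \<otimes> w \<in> ?V" using u(1) w(1) s by simp
    qed
    show "(\<lambda>v. inv ?s \<otimes> v \<otimes> inv w) ` ?V \<subseteq> ?C"
    proof (rule image_subsetI)
      fix v assume "v \<in> ?V"
      then have v: "v \<in> carrier G" "v \<otimes> x = y \<otimes> v" by auto
      have "inv w \<otimes> z = x \<otimes> inv w" unfolding w(2) using w(1) assms(1) by (simp add: m_assoc[symmetric])
      then have "inv ?s \<otimes> v \<otimes> inv w \<otimes> z = inv ?s \<otimes> (v \<otimes> x) \<otimes> inv w"
        using v(1) w(1) s zc assms(1) t(1) by (simp add: m_assoc)
      also have "\<dots> = (inv ?s \<otimes> y) \<otimes> v \<otimes> inv w" unfolding v(2) using v(1) w(1) s yc by (simp add: m_assoc)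
      also have "inv ?s \<otimes> y = z \<otimes> inv ?s"
      proof -
        have "inv ?s \<otimes> (?s \<otimes> z) \<otimes> inv ?s = inv ?s \<otimes> (y \<otimes> ?s) \<otimes> inv ?s" using sz by simp
        moreover have "inv ?s \<otimes> (?s \<otimes> z) = z" using s zc by (metis inv_closed l_inv l_one m_assoc)
        moreover have "inv ?s \<otimes> (y \<otimes> ?s) \<otimes> inv ?s = inv ?s \<otimes> y"
          using s yc by (metis inv_closed m_assoc m_closed r_inv r_one)
        ultimately show ?thesis by simp
      qed
      also have "z \<otimes> inv ?s \<otimes> v \<otimes> inv w = z \<otimes> (inv ?s \<otimes> v \<otimes> inv w)"
        using v(1) w(1) s zc by (simp add: m_assoc)
      finally show "inv ?s \<otimes> v \<otimes> inv w \<in> ?C" using v(1) w(1) s by simp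
    qed
    show "\<forall>u\<in>?C. inv ?s \<otimes> (?s \<otimes> u \<otimes> w) \<otimes> inv w = u"
    proof
      fix u assume "u \<in> ?C" then have "u \<in> carrier G" by simp
      then show "inv ?s \<otimes> (?s \<otimes> u \<otimes> w) \<otimes> inv w = u"
        using s w(1) by (metis inv_closed inv_solve_left' inv_solve_right m_assoc m_closed)
    qed
    show "\<forall>v\<in>?V. ?s \<otimes> (inv ?s \<otimes> v \<otimes> inv w) \<otimes> w = v"
    proof
      fix v assume "v \<in> ?V" then have "v \<in> carrier G" by simp
      then show "?s \<otimes> (inv ?s \<otimes> v \<otimes> inv w) \<otimes> w = v"
        using s w(1) by (metis inv_closed inv_solve_left inv_solve_right' m_assoc m_closed)
    qed
  qed
  then have "card ?V = card ?C" by (simp add: bij_betw_same_card)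
  then show ?thesis by (simp add: centralizer_order_def z_def)
qed

section \<open>Partial cycle products and types on unions of cycles\<close>

definition seg :: "(nat \<Rightarrow> 'a) \<Rightarrow> (nat \<Rightarrow> nat) \<Rightarrow> nat \<Rightarrow> nat \<Rightarrow> 'a" where
  "seg g \<sigma> i m = ordered_prod G g (rev (map (\<lambda>j. (\<sigma> ^^ j) i) [0..<m]))"

lemma seg_0 [simp]: "seg g \<sigma> i 0 = \<one>" by (simp add: seg_def ordered_prod_def)

lemma seg_Suc: "seg g \<sigma> i (Suc m) = g ((\<sigma> ^^ m) i) \<otimes> seg g \<sigma> i m"
  by (simp add: seg_def ordered_prod_def)

lemma cycle_prod_seg: "cycle_prod G g \<sigma> i = seg g \<sigma> i (card (orbit \<sigma> i))"
  by (simp add: cycle_prod_def seg_def)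

definition wr_elt :: "(nat \<Rightarrow> 'a) \<Rightarrow> (nat \<Rightarrow> nat) \<Rightarrow> nat set \<Rightarrow> bool" where
  "wr_elt g \<sigma> X \<longleftrightarrow> finite X \<and> \<sigma> permutes X \<and> g \<in> X \<rightarrow> carrier G"

lemma wr_orbit_self: "wr_elt g \<sigma> X \<Longrightarrow> i \<in> orbit \<sigma> i"
  unfolding wr_elt_def by (metis permutation_permutes permutation_self_in_orbit)

lemma wr_orbit_step: "wr_elt g \<sigma> X \<Longrightarrow> orbit \<sigma> (\<sigma> i) = orbit \<sigma> i"
  by (rule self_in_orbit_step, rule wr_orbit_self)

lemma wr_orbit_eq: "wr_elt g \<sigma> X \<Longrightarrow> j \<in> orbit \<sigma> i \<Longrightarrow> orbit \<sigma> j = orbit \<sigma> i"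
  by (rule orbit_cyclic_eq3[of \<sigma> "orbit \<sigma> i" j]) (auto intro!: cyclic_on_orbit simp: wr_elt_def)

lemma wr_funpow: "wr_elt g \<sigma> X \<Longrightarrow> i \<in> X \<Longrightarrow> (\<sigma> ^^ m) i \<in> X"
  by (induction m) (auto simp: wr_elt_def permutes_in_image)

lemma seg_closed: "wr_elt g \<sigma> X \<Longrightarrow> i \<in> X \<Longrightarrow> seg g \<sigma> i m \<in> carrier G"
proof (induction m)
  case (Suc m)
  then have "g ((\<sigma> ^^ m) i) \<in> carrier G" using wr_funpow[of g \<sigma> X i m] by (auto simp: wr_elt_def)
  then show ?case using Suc by (simp add: seg_Suc)
qed simp

lemma cycle_prod_closed: "wr_elt g \<sigma> X \<Longrightarrow> i \<in> X \<Longrightarrow> cycle_prod G g \<sigma> i \<in> carrier G"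
  unfolding cycle_prod_seg by (rule seg_closed)

lemma seg_shift:
  assumes "wr_elt g \<sigma> X" "i \<in> X"
  shows "seg g \<sigma> (\<sigma> i) m \<otimes> g i = seg g \<sigma> i (Suc m)"
proof (induction m)
  case 0
  have "g i \<in> carrier G" using assms by (auto simp: wr_elt_def)
  then show ?case by (simp add: seg_Suc)
next
  case (Suc m)
  have c: "g ((\<sigma> ^^ m) (\<sigma> i)) \<in> carrier G" "g i \<in> carrier G" "seg g \<sigma> (\<sigma> i) m \<in> carrier G"
    using assms wr_funpow[OF assms, of "Suc m"] seg_closed[OF assms(1), of "\<sigma> i" m]
    by (auto simp: wr_elt_def permutes_in_image funpow_swap1)
  have "seg g \<sigma> (\<sigma> i) (Suc m) \<otimes> g i = g ((\<sigma> ^^ m) (\<sigma> i)) \<otimes> (seg g \<sigma> (\<sigma> i) m \<otimes> g i)"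
    using c by (simp add: seg_Suc m_assoc)
  also have "\<dots> = seg g \<sigma> i (Suc (Suc m))"
    unfolding Suc.IH by (simp add: seg_Suc[of _ _ _ "Suc m"] funpow_swap1)
  finally show ?case .
qed

text \<open>With k the length of the cycle, \<open>seg_shift\<close> and \<sigma>^k i = i show that
  moving the starting point one step conjugates the cycle product by g i.\<close>

lemma cycle_prod_step:
  assumes "wr_elt g \<sigma> X" "i \<in> X"
  shows "cycle_prod G g \<sigma> (\<sigma> i) \<in> conj_class G (cycle_prod G g \<sigma> i)"
proof -
  let ?k = "card (orbit \<sigma> i)"
  have c: "g i \<in> carrier G" "seg g \<sigma> i ?k \<in> carrier G" "seg g \<sigma> (\<sigma> i) ?k \<in> carrier G"
    using assms seg_closed[OF assms(1)] by (auto simp: wr_elt_def permutes_in_image)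
  have "seg g \<sigma> (\<sigma> i) ?k \<otimes> g i = g i \<otimes> seg g \<sigma> i ?k"
    unfolding seg_shift[OF assms] seg_Suc using orbit_card(2)[OF wr_orbit_self[OF assms(1)]] by simp
  then have "seg g \<sigma> (\<sigma> i) ?k = g i \<otimes> seg g \<sigma> i ?k \<otimes> inv (g i)"
    using c by (simp add: inv_solve_right)
  then show ?thesis
    unfolding cycle_prod_seg wr_orbit_step[OF assms(1)] conj_class_def using c by blast
qed

lemma cycle_prod_orbit:
  assumes "wr_elt g \<sigma> X" "i \<in> X" "j \<in> orbit \<sigma> i"
  shows "cycle_prod G g \<sigma> j \<in> conj_class G (cycle_prod G g \<sigma> i)" "j \<in> X"
proof -
  have "cycle_prod G g \<sigma> j \<in> conj_class G (cycle_prod G g \<sigma> i) \<and> j \<in> X"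
    using assms(3)
  proof (induction rule: orbit.induct)
    case base
    then show ?case using cycle_prod_step[OF assms(1,2)] assms by (auto simp: wr_elt_def permutes_in_image)
  next
    case (step y)
    then have y: "y \<in> X" by simp
    have "conj_class G (cycle_prod G g \<sigma> y) = conj_class G (cycle_prod G g \<sigma> i)"
      using step conj_class_eq[OF cycle_prod_closed[OF assms(1,2)]] by simp
    then show ?case using cycle_prod_step[OF assms(1) y] assms y by (auto simp: wr_elt_def permutes_in_image)
  qed
  then show "cycle_prod G g \<sigma> j \<in> conj_class G (cycle_prod G g \<sigma> i)" "j \<in> X" by auto
qed

lemma cycle_class_orbit:
  assumes "wr_elt g \<sigma> X" "i \<in> X" "j \<in> orbit \<sigma> i" "c \<in> conj_classes G"
  shows "cycle_prod G g \<sigma> j \<in> c \<longleftrightarrow> cycle_prod G g \<sigma> i \<in> c"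
  using cycle_prod_orbit[OF assms(1-3)] conj_class_self cycle_prod_closed[OF assms(1)] assms(2)
    conj_classes_eq[OF assms(4)] conj_class_eq by metis

text \<open>\<open>wreath_type\<close> is the case Y = {1..n}. A general Y lets cycles be removed
  one at a time while g and \<sigma> stay unchanged.\<close>

definition orbit_type :: "(nat \<Rightarrow> 'a) \<Rightarrow> (nat \<Rightarrow> nat) \<Rightarrow> nat set \<Rightarrow> 'a part_fun" where
  "orbit_type g \<sigma> Y = (\<lambda>c. if c \<in> conj_classes G
     then image_mset card (mset_set {orbit \<sigma> i | i. i \<in> Y \<and> cycle_prod G g \<sigma> i \<in> c})
     else {#})"

lemma wreath_type_orbit_type: "wreath_type G n g \<sigma> = orbit_type g \<sigma> {1..n}"
  unfolding wreath_type_def orbit_type_def ..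

text \<open>The elements of the wreath product that carry (g0, \<tau>) to (g, \<sigma>), restricted
  to Y0 and Y, with the conjugation equation written without inverses. Indexing v by the source
  points makes the equation local along the cycles of \<tau>; extensionality makes the pairs
  countable.\<close>

definition conjugators where
  "conjugators g0 \<tau> Y0 g \<sigma> Y = {(\<pi>, v). \<pi> \<in> extensional Y0 \<and> bij_betw \<pi> Y0 Y \<and> v \<in> Y0 \<rightarrow>\<^sub>E carrier G \<and>
     (\<forall>j\<in>Y0. \<pi> (\<tau> j) = \<sigma> (\<pi> j) \<and> v (\<tau> j) \<otimes> g0 j = g (\<pi> j) \<otimes> v j)}"

lemma stable_orbit:
  assumes "\<sigma> ` Y \<subseteq> Y" "i \<in> Y"
  shows "orbit \<sigma> i \<subseteq> Y"
proof
  fix j assume "j \<in> orbit \<sigma> i"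
  then show "j \<in> Y" by (induction rule: orbit.induct) (use assms in auto)
qed

lemma orbit_type_remove:
  assumes W: "wr_elt g \<sigma> X" and Y: "Y \<subseteq> X" "\<sigma> ` Y \<subseteq> Y" and s: "s \<in> Y"
    and c: "c \<in> conj_classes G" "cycle_prod G g \<sigma> s \<in> c"
  shows "orbit_type g \<sigma> Y = (orbit_type g \<sigma> (Y - orbit \<sigma> s))
     (c := add_mset (card (orbit \<sigma> s)) (orbit_type g \<sigma> (Y - orbit \<sigma> s) c))"
proof
  fix c'
  let ?A = "\<lambda>Y. {orbit \<sigma> i | i. i \<in> Y \<and> cycle_prod G g \<sigma> i \<in> c'}"
  have fY: "finite Y" using W Y(1) finite_subset by (auto simp: wr_elt_def)
  have eq: "orbit \<sigma> i = orbit \<sigma> s \<longleftrightarrow> i \<in> orbit \<sigma> s" for i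
    using wr_orbit_self[OF W] wr_orbit_eq[OF W] by blast
  show "orbit_type g \<sigma> Y c' = ((orbit_type g \<sigma> (Y - orbit \<sigma> s))
     (c := add_mset (card (orbit \<sigma> s)) (orbit_type g \<sigma> (Y - orbit \<sigma> s) c))) c'"
  proof (cases "c' = c")
    case True
    have "?A Y = insert (orbit \<sigma> s) (?A (Y - orbit \<sigma> s))"
    proof (intro equalityI subsetI)
      fix C assume "C \<in> ?A Y"
      then obtain i where i: "C = orbit \<sigma> i" "i \<in> Y" "cycle_prod G g \<sigma> i \<in> c'" by blast
      show "C \<in> insert (orbit \<sigma> s) (?A (Y - orbit \<sigma> s))"
      proof (cases "i \<in> orbit \<sigma> s")
        case True
        then show ?thesis using eq[of i] i(1) by simp
      next
        case False
        then show ?thesis using i by blast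
      qed
    next
      fix C assume "C \<in> insert (orbit \<sigma> s) (?A (Y - orbit \<sigma> s))"
      then show "C \<in> ?A Y" using s c(2) True by blast
    qed
    moreover have "orbit \<sigma> s \<notin> ?A (Y - orbit \<sigma> s)"
    proof
      assume "orbit \<sigma> s \<in> ?A (Y - orbit \<sigma> s)"
      then obtain i where "i \<notin> orbit \<sigma> s" "orbit \<sigma> i = orbit \<sigma> s" by auto
      then show False using eq by simp
    qed
    ultimately show ?thesis using fY c(1) True by (simp add: orbit_type_def)
  next
    case False
    have "?A Y = ?A (Y - orbit \<sigma> s)" if c': "c' \<in> conj_classes G"
    proof -
      have "i \<notin> orbit \<sigma> s" if i: "cycle_prod G g \<sigma> i \<in> c'" for i
      proof
        assume "i \<in> orbit \<sigma> s"
        then have "cycle_prod G g \<sigma> s \<in> c'"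
          using cycle_class_orbit[OF W _ _ c', of s i] i s Y(1) by blast
        then show False using conj_classes_disjoint[OF c' c(1)] c(2) False by blast
      qed
      then show ?thesis by blast
    qed
    then show ?thesis using False by (simp add: orbit_type_def)
  qed
qed

text \<open>Every cycle of length k in the class c offers k starting points. These are the possible
  images of a base point under a conjugator.\<close>

lemma card_base_points:
  assumes W: "wr_elt g \<sigma> X" and Y: "Y \<subseteq> X" "\<sigma> ` Y \<subseteq> Y" and c: "c \<in> conj_classes G"
  shows "card {s \<in> Y. card (orbit \<sigma> s) = k \<and> cycle_prod G g \<sigma> s \<in> c} = k * count (orbit_type g \<sigma> Y c) k"
proof -
  have fY: "finite Y" using W Y(1) finite_subset by (auto simp: wr_elt_def)
  let ?A = "{orbit \<sigma> i | i. i \<in> Y \<and> cycle_prod G g \<sigma> i \<in> c}"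
  let ?Ak = "{C \<in> ?A. card C = k}"
  have fA: "finite ?A" using fY by simp
  have orb: "orbit \<sigma> i \<subseteq> Y" if "i \<in> Y" for i using stable_orbit[OF Y(2) that] .
  have "{s \<in> Y. card (orbit \<sigma> s) = k \<and> cycle_prod G g \<sigma> s \<in> c} = \<Union>?Ak"
  proof (intro equalityI subsetI)
    fix s assume "s \<in> {s \<in> Y. card (orbit \<sigma> s) = k \<and> cycle_prod G g \<sigma> s \<in> c}"
    then show "s \<in> \<Union>?Ak" using wr_orbit_self[OF W, of s] by blast
  next
    fix s assume "s \<in> \<Union>?Ak"
    then obtain i where i: "i \<in> Y" "cycle_prod G g \<sigma> i \<in> c" "card (orbit \<sigma> i) = k" "s \<in> orbit \<sigma> i" by blast
    then show "s \<in> {s \<in> Y. card (orbit \<sigma> s) = k \<and> cycle_prod G g \<sigma> s \<in> c}"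
      using cycle_class_orbit[OF W _ i(4) c] wr_orbit_eq[OF W i(4)] orb[OF i(1)] Y(1) by auto
  qed
  moreover have "card (\<Union>?Ak) = k * card ?Ak"
  proof (rule card_partition[symmetric])
    have "\<Union>?Ak \<subseteq> Y" using orb by blast
    then show "finite (\<Union>?Ak)" using fY by (rule finite_subset)
    show "C \<inter> D = {}" if CD: "C \<in> ?Ak" "D \<in> ?Ak" "C \<noteq> D" for C D
    proof (rule ccontr)
      assume "C \<inter> D \<noteq> {}"
      then obtain x where x: "x \<in> C" "x \<in> D" by blast
      obtain i j where "C = orbit \<sigma> i" "D = orbit \<sigma> j" using CD by blast
      then show False using wr_orbit_eq[OF W, of x i] wr_orbit_eq[OF W, of x j] x CD(3) by simp
    qed
  qed (use fA in auto)
  moreover have "card ?Ak = count (orbit_type g \<sigma> Y c) k"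
  proof -
    have "count (image_mset card (mset_set ?A)) k = (\<Sum>C\<in>{C \<in> ?A. k = card C}. count (mset_set ?A) C)"
      using fA by (simp add: count_image_mset' )
    also have "\<dots> = (\<Sum>C\<in>?Ak. 1)" using fA by (intro sum.cong) auto
    finally show ?thesis using c by (simp add: orbit_type_def)
  qed
  ultimately show ?thesis by simp
qed

end

section \<open>Counting the conjugators between elements of the same type\<close>

lemma z_part_superset:
  assumes "finite A" "set_mset \<mu> \<subseteq> A"
  shows "z_part \<mu> = (\<Prod>i\<in>A. i ^ count \<mu> i * fact (count \<mu> i))"
  unfolding z_part_def by (rule prod.mono_neutral_left) (use assms in \<open>auto simp: not_in_iff\<close>)

lemma z_part_add: "z_part (add_mset k \<mu>) = z_part \<mu> * (k * Suc (count \<mu> k))"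
proof -
  let ?A = "insert k (set_mset \<mu>)" and ?f = "\<lambda>\<mu> i. i ^ count \<mu> i * fact (count \<mu> i)"
  have "z_part (add_mset k \<mu>) = ?f (add_mset k \<mu>) k * (\<Prod>i\<in>?A - {k}. ?f (add_mset k \<mu>) i)"
    by (subst z_part_superset[of ?A], simp, simp) (subst prod.remove[of ?A k], auto)
  also have "(\<Prod>i\<in>?A - {k}. ?f (add_mset k \<mu>) i) = (\<Prod>i\<in>?A - {k}. ?f \<mu> i)"
    by (rule prod.cong) auto
  also have "?f (add_mset k \<mu>) k = ?f \<mu> k * (k * Suc (count \<mu> k))"
    by (simp only: count_add_mset if_True refl power_Suc fact_Suc of_nat_id mult_ac)
  also have "\<dots> * (\<Prod>i\<in>?A - {k}. ?f \<mu> i) = (?f \<mu> k * (\<Prod>i\<in>?A - {k}. ?f \<mu> i)) * (k * Suc (count \<mu> k))"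
    by (simp only: mult_ac)
  also have "?f \<mu> k * (\<Prod>i\<in>?A - {k}. ?f \<mu> i) = z_part \<mu>"
    by (subst z_part_superset[of ?A], simp, simp add: subset_insertI) (subst prod.remove[of ?A k], auto)
  finally show ?thesis .
qed

context finite_group
begin

text \<open>The new factor counts the extensions of a conjugator over one more cycle: k times the
  new multiplicity for the image of a base point, and the centralizer order for the group component
  there.\<close>

lemma Z_part_fun_add:
  assumes "c \<in> conj_classes G"
  shows "Z_part_fun G (\<rho>(c := add_mset k (\<rho> c))) = Z_part_fun G \<rho> * (k * Suc (count (\<rho> c) k) * centralizer_order G c)"
proof -
  let ?f = "\<lambda>\<rho> c. z_part (\<rho> c) * centralizer_order G c ^ size (\<rho> c)"
  let ?\<rho> = "\<rho>(c := add_mset k (\<rho> c))"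
  have "Z_part_fun G ?\<rho> = ?f ?\<rho> c * (\<Prod>c'\<in>conj_classes G - {c}. ?f ?\<rho> c')"
    unfolding Z_part_fun_def using finite_conj_classes assms by (subst prod.remove[of _ c]) auto
  also have "(\<Prod>c'\<in>conj_classes G - {c}. ?f ?\<rho> c') = (\<Prod>c'\<in>conj_classes G - {c}. ?f \<rho> c')"
    by (rule prod.cong) auto
  also have "?f ?\<rho> c = ?f \<rho> c * (k * Suc (count (\<rho> c) k) * centralizer_order G c)"
    by (simp only: fun_upd_same z_part_add size_add_mset power_Suc mult_ac)
  also have "\<dots> * (\<Prod>c'\<in>conj_classes G - {c}. ?f \<rho> c') =
      (?f \<rho> c * (\<Prod>c'\<in>conj_classes G - {c}. ?f \<rho> c')) * (k * Suc (count (\<rho> c) k) * centralizer_order G c)"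
    by (simp only: mult_ac)
  also have "?f \<rho> c * (\<Prod>c'\<in>conj_classes G - {c}. ?f \<rho> c') = Z_part_fun G \<rho>"
    unfolding Z_part_fun_def using finite_conj_classes assms by (subst (2) prod.remove[of _ c]) auto
  finally show ?thesis .
qed

lemma Z_part_fun_empty: "Z_part_fun G (\<lambda>_. {#}) = 1"
  by (simp add: Z_part_fun_def z_part_def)

text \<open>On a cycle a conjugator is determined by its values at one point a: the relation gives
  v(\<tau> j) = g(\<pi> j) v(j) g0(j)^-1, and this is iterated.\<close>

lemma conjugator_funpow:
  assumes W0: "wr_elt g0 \<tau> X0" and W: "wr_elt g \<sigma> X"
    and Y0: "Y0 \<subseteq> X0" "\<tau> ` Y0 \<subseteq> Y0" and Y: "Y \<subseteq> X"
    and pv: "(\<pi>, v) \<in> conjugators g0 \<tau> Y0 g \<sigma> Y" and a: "a \<in> Y0"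
  shows "\<pi> ((\<tau> ^^ m) a) = (\<sigma> ^^ m) (\<pi> a)"
    and "v ((\<tau> ^^ m) a) \<otimes> seg g0 \<tau> a m = seg g \<sigma> (\<pi> a) m \<otimes> v a"
proof -
  have st: "(\<tau> ^^ m) a \<in> Y0" for m using Y0(2) a by (induction m) (auto intro: subsetD)
  have \<pi>: "\<pi> a \<in> X" using pv a Y by (auto simp: conjugators_def bij_betw_def)
  show 1: "\<pi> ((\<tau> ^^ m) a) = (\<sigma> ^^ m) (\<pi> a)" for m
    using pv st by (induction m) (auto simp: conjugators_def)
  show "v ((\<tau> ^^ m) a) \<otimes> seg g0 \<tau> a m = seg g \<sigma> (\<pi> a) m \<otimes> v a"
  proof (induction m)
    case 0
    have "v a \<in> carrier G" using pv a by (auto simp: conjugators_def)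
    then show ?case by simp
  next
    case (Suc m)
    let ?j = "(\<tau> ^^ m) a"
    have c: "v ?j \<in> carrier G" "v (\<tau> ?j) \<in> carrier G" "v a \<in> carrier G"
      using pv st[of m] st[of "Suc m"] a by (auto simp: conjugators_def)
    have c0: "g0 ?j \<in> carrier G" "seg g0 \<tau> a m \<in> carrier G"
      using W0 st[of m] Y0(1) seg_closed[OF W0, of a m] a by (auto simp: wr_elt_def)
    have c1: "g (\<pi> ?j) \<in> carrier G" "seg g \<sigma> (\<pi> a) m \<in> carrier G"
      using W seg_closed[OF W \<pi>] wr_funpow[OF W \<pi>] by (auto simp: wr_elt_def 1)
    have rel: "v (\<tau> ?j) \<otimes> g0 ?j = g (\<pi> ?j) \<otimes> v ?j"
      using pv st[of m] by (auto simp: conjugators_def)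
    have "v (\<tau> ?j) \<otimes> seg g0 \<tau> a (Suc m) = (v (\<tau> ?j) \<otimes> g0 ?j) \<otimes> seg g0 \<tau> a m"
      using c c0 by (simp add: seg_Suc m_assoc)
    also have "\<dots> = g (\<pi> ?j) \<otimes> (v ?j \<otimes> seg g0 \<tau> a m)"
      unfolding rel using c c0 c1 by (simp add: m_assoc)
    also have "\<dots> = seg g \<sigma> (\<pi> a) (Suc m) \<otimes> v a"
      unfolding Suc.IH using c c1 by (simp add: seg_Suc m_assoc 1)
    finally show ?case by simp
  qed
qed

lemma conjugator_orbit:
  assumes W0: "wr_elt g0 \<tau> X0" and W: "wr_elt g \<sigma> X"
    and Y0: "Y0 \<subseteq> X0" "\<tau> ` Y0 \<subseteq> Y0" and Y: "Y \<subseteq> X"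
    and pv: "(\<pi>, v) \<in> conjugators g0 \<tau> Y0 g \<sigma> Y" and a: "a \<in> Y0"
  shows "\<pi> ` orbit \<tau> a = orbit \<sigma> (\<pi> a)" "card (orbit \<sigma> (\<pi> a)) = card (orbit \<tau> a)"
    "v a \<otimes> cycle_prod G g0 \<tau> a = cycle_prod G g \<sigma> (\<pi> a) \<otimes> v a"
proof -
  have sub: "orbit \<tau> a \<subseteq> Y0" by (rule stable_orbit[OF Y0(2) a])
  show im: "\<pi> ` orbit \<tau> a = orbit \<sigma> (\<pi> a)"
    using pv sub by (intro orbit_inverse wr_orbit_self[OF W0]) (auto simp: conjugators_def)
  have "inj_on \<pi> (orbit \<tau> a)"
    using pv sub by (auto simp: conjugators_def bij_betw_def intro: inj_on_subset)
  then show k: "card (orbit \<sigma> (\<pi> a)) = card (orbit \<tau> a)"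
    unfolding im[symmetric] by (rule card_image)
  show "v a \<otimes> cycle_prod G g0 \<tau> a = cycle_prod G g \<sigma> (\<pi> a) \<otimes> v a"
    using conjugator_funpow(2)[OF assms, of "card (orbit \<tau> a)"] orbit_card(2)[OF wr_orbit_self[OF W0]]
    by (simp add: cycle_prod_seg k)
qed

lemma conjugator_cycle_class:
  assumes W0: "wr_elt g0 \<tau> X0" and W: "wr_elt g \<sigma> X"
    and Y0: "Y0 \<subseteq> X0" "\<tau> ` Y0 \<subseteq> Y0" and Y: "Y \<subseteq> X"
    and pv: "(\<pi>, v) \<in> conjugators g0 \<tau> Y0 g \<sigma> Y" and a: "a \<in> Y0"
  shows "cycle_prod G g \<sigma> (\<pi> a) \<in> conj_class G (cycle_prod G g0 \<tau> a)"
proof -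
  have c: "v a \<in> carrier G" "\<pi> a \<in> X" using pv a Y by (auto simp: conjugators_def bij_betw_def)
  have c0: "cycle_prod G g0 \<tau> a \<in> carrier G" using cycle_prod_closed[OF W0] a Y0(1) by blast
  have "cycle_prod G g \<sigma> (\<pi> a) = v a \<otimes> cycle_prod G g0 \<tau> a \<otimes> inv (v a)"
    using conjugator_orbit(3)[OF assms] c c0 cycle_prod_closed[OF W c(2)] by (simp add: m_assoc)
  then show ?thesis unfolding conj_class_def using c by blast
qed

text \<open>\<pi> maps cycles onto cycles of the same length, and v conjugates the cycle products,
  so each class receives the same parts.\<close>

lemma conjugators_type:
  assumes W0: "wr_elt g0 \<tau> X0" and W: "wr_elt g \<sigma> X"
    and Y0: "Y0 \<subseteq> X0" "\<tau> ` Y0 \<subseteq> Y0" and Y: "Y \<subseteq> X"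
    and pv: "(\<pi>, v) \<in> conjugators g0 \<tau> Y0 g \<sigma> Y"
  shows "orbit_type g \<sigma> Y = orbit_type g0 \<tau> Y0"
proof
  fix c
  let ?B = "{orbit \<tau> i | i. i \<in> Y0 \<and> cycle_prod G g0 \<tau> i \<in> c}"
  let ?A = "{orbit \<sigma> i | i. i \<in> Y \<and> cycle_prod G g \<sigma> i \<in> c}"
  note orb = conjugator_orbit[OF assms] and cls = conjugator_cycle_class[OF assms]
  have bij: "bij_betw \<pi> Y0 Y" using pv by (simp add: conjugators_def)
  have "?A = (\<lambda>C. \<pi> ` C) ` ?B" if c: "c \<in> conj_classes G"
  proof -
    have cl: "cycle_prod G g \<sigma> (\<pi> i) \<in> c \<longleftrightarrow> cycle_prod G g0 \<tau> i \<in> c" if i: "i \<in> Y0" for i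
      using cls[OF i] conj_classes_eq[OF c] conj_class_eq[of "cycle_prod G g0 \<tau> i" "cycle_prod G g \<sigma> (\<pi> i)"]
        conj_class_self cycle_prod_closed[OF W0] cycle_prod_closed[OF W] i Y0(1) Y bij_betwE[OF bij]
      by (metis subsetD)
    have "?A = orbit \<sigma> ` {i \<in> Y. cycle_prod G g \<sigma> i \<in> c}" by (rule setcompr_eq_image)
    also have "{i \<in> Y. cycle_prod G g \<sigma> i \<in> c} = \<pi> ` {i \<in> Y0. cycle_prod G g \<sigma> (\<pi> i) \<in> c}"
      unfolding bij_betw_imp_surj_on[OF bij, symmetric] by auto
    also have "{i \<in> Y0. cycle_prod G g \<sigma> (\<pi> i) \<in> c} = {i \<in> Y0. cycle_prod G g0 \<tau> i \<in> c}"
      by (intro Collect_cong conj_cong refl cl)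
    also have "orbit \<sigma> ` \<pi> ` {i \<in> Y0. cycle_prod G g0 \<tau> i \<in> c} = (\<lambda>i. \<pi> ` orbit \<tau> i) ` {i \<in> Y0. cycle_prod G g0 \<tau> i \<in> c}"
      unfolding image_image by (rule image_cong[OF refl]) (simp add: orb(1))
    also have "\<dots> = (\<lambda>C. \<pi> ` C) ` ?B" unfolding setcompr_eq_image image_image by simp
    finally show ?thesis .
  qed
  moreover have "image_mset card (mset_set ((\<lambda>C. \<pi> ` C) ` ?B)) = image_mset card (mset_set ?B)"
  proof -
    have sub: "C \<subseteq> Y0" if "C \<in> ?B" for C using that stable_orbit[OF Y0(2)] by blast
    have fB: "finite ?B" using W0 Y0(1) finite_subset[of Y0 X0] by (simp add: wr_elt_def)
    have inj: "inj_on \<pi> Y0" using bij by (simp add: bij_betw_def)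
    have "inj_on (\<lambda>C. \<pi> ` C) ?B"
      using inj_on_image_eq_iff[OF inj] sub by (intro inj_onI) blast
    then have "mset_set ((\<lambda>C. \<pi> ` C) ` ?B) = image_mset (\<lambda>C. \<pi> ` C) (mset_set ?B)"
      by (rule image_mset_mset_set[symmetric])
    then have "image_mset card (mset_set ((\<lambda>C. \<pi> ` C) ` ?B)) = image_mset (\<lambda>C. card (\<pi> ` C)) (mset_set ?B)"
      by (simp add: image_mset.compositionality o_def)
    also have "\<dots> = image_mset card (mset_set ?B)"
    proof (rule image_mset_cong)
      fix C assume "C \<in># mset_set ?B"
      then have "C \<in> ?B" by (simp only: elem_mset_set[OF fB])
      then have "inj_on \<pi> C" using inj_on_subset[OF inj sub] by blast
      then show "card (\<pi> ` C) = card C" by (rule card_image)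
    qed
    finally show ?thesis .
  qed
  ultimately show "orbit_type g \<sigma> Y c = orbit_type g0 \<tau> Y0 c" by (simp add: orbit_type_def)
qed

lemma orbit_type_empty: "orbit_type g \<sigma> {} = (\<lambda>_. {#})"
  by (auto simp: orbit_type_def)

lemma orbit_type_eq_empty:
  assumes W: "wr_elt g \<sigma> X" and Y: "Y \<subseteq> X" and z: "orbit_type g \<sigma> Y = (\<lambda>_. {#})"
  shows "Y = {}"
proof (rule ccontr)
  assume "Y \<noteq> {}"
  then obtain i where i: "i \<in> Y" by blast
  let ?c = "conj_class G (cycle_prod G g \<sigma> i)"
  have cp: "cycle_prod G g \<sigma> i \<in> carrier G" using cycle_prod_closed[OF W] i Y by blast
  have "finite Y" using W Y finite_subset by (auto simp: wr_elt_def)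
  then have "finite {orbit \<sigma> j | j. j \<in> Y \<and> cycle_prod G g \<sigma> j \<in> ?c}" by simp
  moreover have "orbit \<sigma> i \<in> {orbit \<sigma> j | j. j \<in> Y \<and> cycle_prod G g \<sigma> j \<in> ?c}"
    using i conj_class_self[OF cp] by blast
  ultimately have "card (orbit \<sigma> i) \<in># orbit_type g \<sigma> Y ?c"
    using conj_class_in[OF cp] by (auto simp: orbit_type_def)
  then show False by (simp add: z)
qed

definition cycle_index :: "(nat \<Rightarrow> nat) \<Rightarrow> nat \<Rightarrow> nat \<Rightarrow> nat" where
  "cycle_index \<tau> a j = the_inv_into {..<card (orbit \<tau> a)} (\<lambda>m. (\<tau> ^^ m) a) j"

lemma cycle_index:
  assumes W0: "wr_elt g0 \<tau> X0"
  shows "m < card (orbit \<tau> a) \<Longrightarrow> cycle_index \<tau> a ((\<tau> ^^ m) a) = m"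
    and "j \<in> orbit \<tau> a \<Longrightarrow> \<exists>m<card (orbit \<tau> a). j = (\<tau> ^^ m) a"
proof -
  note b = orbit_card(1)[OF wr_orbit_self[OF W0, of a]]
  show "cycle_index \<tau> a ((\<tau> ^^ m) a) = m" if "m < card (orbit \<tau> a)"
    unfolding cycle_index_def using b that by (intro the_inv_into_f_f) (auto simp: bij_betw_def)
  show "\<exists>m<card (orbit \<tau> a). j = (\<tau> ^^ m) a" if "j \<in> orbit \<tau> a"
    using that bij_betw_imp_surj_on[OF b] by auto
qed

text \<open>Extends a conjugator on the other cycles over the cycle of a, where s and w are
  prescribed as its values at a. The formula on the cycle is forced by
  \<open>conjugator_funpow\<close>.\<close>

definition glue where
  "glue g0 \<tau> a g \<sigma> = (\<lambda>((s, w), (\<pi>, v)).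
     ((\<lambda>j. if j \<in> orbit \<tau> a then (\<sigma> ^^ cycle_index \<tau> a j) s else \<pi> j),
      (\<lambda>j. if j \<in> orbit \<tau> a then seg g \<sigma> s (cycle_index \<tau> a j) \<otimes> w \<otimes> inv (seg g0 \<tau> a (cycle_index \<tau> a j)) else v j)))"

lemma glue_conjugator:
  assumes W0: "wr_elt g0 \<tau> X0" and W: "wr_elt g \<sigma> X"
    and Y0: "Y0 \<subseteq> X0" "\<tau> ` Y0 \<subseteq> Y0" and Y: "Y \<subseteq> X" "\<sigma> ` Y \<subseteq> Y" and a: "a \<in> Y0"
    and s: "s \<in> Y" "card (orbit \<sigma> s) = card (orbit \<tau> a)"
    and w: "w \<in> carrier G" "w \<otimes> cycle_prod G g0 \<tau> a = cycle_prod G g \<sigma> s \<otimes> w"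
    and pv: "(\<pi>, v) \<in> conjugators g0 \<tau> (Y0 - orbit \<tau> a) g \<sigma> (Y - orbit \<sigma> s)"
    and P: "(P, V) = glue g0 \<tau> a g \<sigma> ((s, w), (\<pi>, v))"
  shows "(P, V) \<in> conjugators g0 \<tau> Y0 g \<sigma> Y" "P a = s" "V a = w"
    "restrict P (Y0 - orbit \<tau> a) = \<pi>" "restrict V (Y0 - orbit \<tau> a) = v"
proof -
  let ?C = "orbit \<tau> a" and ?k = "card (orbit \<tau> a)"
  note ci = cycle_index[OF W0]
  have kpos: "0 < ?k" using orbit_card(3)[OF wr_orbit_self[OF W0]] .
  have aC: "a \<in> ?C" by (rule wr_orbit_self[OF W0])
  have Pd: "P j = (if j \<in> ?C then (\<sigma> ^^ cycle_index \<tau> a j) s else \<pi> j)"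
    and Vd: "V j = (if j \<in> ?C then seg g \<sigma> s (cycle_index \<tau> a j) \<otimes> w \<otimes> inv (seg g0 \<tau> a (cycle_index \<tau> a j)) else v j)" for j
    using P by (simp_all add: glue_def)
  have inC: "(\<tau> ^^ m) a \<in> ?C" for m by (rule funpow_in_orbit[OF aC])
  have Pm: "P ((\<tau> ^^ m) a) = (\<sigma> ^^ m) s" if "m < ?k" for m
    using inC that by (simp add: Pd ci(1))
  have Vm: "V ((\<tau> ^^ m) a) = seg g \<sigma> s m \<otimes> w \<otimes> inv (seg g0 \<tau> a m)" if "m < ?k" for m
    using inC that by (simp add: Vd ci(1))
  have CY: "?C \<subseteq> Y0" by (rule stable_orbit[OF Y0(2) a])
  have aX: "a \<in> X0" and sX: "s \<in> X" using a Y0 s Y by auto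
  have sc: "seg g \<sigma> s m \<in> carrier G" "seg g0 \<tau> a m \<in> carrier G" for m
    using seg_closed[OF W sX] seg_closed[OF W0 aX] .
  show Pa: "P a = s" using Pm[OF kpos] by simp
  show Va: "V a = w" using Vm[OF kpos] w(1) by simp
  have pv': "\<pi> \<in> extensional (Y0 - ?C)" "bij_betw \<pi> (Y0 - ?C) (Y - orbit \<sigma> s)" "v \<in> (Y0 - ?C) \<rightarrow>\<^sub>E carrier G"
    and rel: "\<And>j. j \<in> Y0 - ?C \<Longrightarrow> \<pi> (\<tau> j) = \<sigma> (\<pi> j) \<and> v (\<tau> j) \<otimes> g0 j = g (\<pi> j) \<otimes> v j"
    using pv by (auto simp: conjugators_def)
  show "restrict P (Y0 - ?C) = \<pi>"
    using pv'(1) by (auto simp: fun_eq_iff Pd restrict_def extensional_def)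
  show "restrict V (Y0 - ?C) = v"
    using pv'(3) by (auto simp: fun_eq_iff Vd restrict_def PiE_def extensional_def)
  have bC: "bij_betw P ?C (orbit \<sigma> s)"
  proof -
    have b: "bij_betw (\<lambda>m. (\<tau> ^^ m) a) {..<?k} ?C" by (rule orbit_card(1)[OF aC])
    have b': "bij_betw (\<lambda>m. (\<sigma> ^^ m) s) {..<?k} (orbit \<sigma> s)"
      using orbit_card(1)[OF wr_orbit_self[OF W, of s]] by (simp add: s(2))
    have "bij_betw (P \<circ> (\<lambda>m. (\<tau> ^^ m) a)) {..<?k} (orbit \<sigma> s)"
      using b' by (rule bij_betw_cong[THEN iffD1, rotated]) (simp add: Pm)
    then show ?thesis using bij_betw_comp_iff[OF b] by blast
  qed
  have "bij_betw P (Y0 - ?C) (Y - orbit \<sigma> s)"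
    using pv'(2) by (rule bij_betw_cong[THEN iffD1, rotated]) (simp add: Pd)
  then have "bij_betw P (?C \<union> (Y0 - ?C)) (orbit \<sigma> s \<union> (Y - orbit \<sigma> s))"
    by (intro bij_betw_combine bC) auto
  then have bP: "bij_betw P Y0 Y"
    using CY stable_orbit[OF Y(2) s(1)] by (simp add: Un_absorb1)
  have extP: "P \<in> extensional Y0"
    using pv'(1) CY by (auto simp: extensional_def Pd)
  have Vc: "V \<in> Y0 \<rightarrow>\<^sub>E carrier G"
    using pv'(3) CY sc w(1) by (auto simp: PiE_def extensional_def Vd)
  have "P (\<tau> j) = \<sigma> (P j) \<and> V (\<tau> j) \<otimes> g0 j = g (P j) \<otimes> V j" if j: "j \<in> Y0" for j
  proof (cases "j \<in> ?C")
    case False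
    have "orbit \<tau> j \<noteq> ?C" using False wr_orbit_self[OF W0, of j] by auto
    then have "\<tau> j \<notin> ?C" using wr_orbit_eq[OF W0, of "\<tau> j" a] wr_orbit_step[OF W0, of j] by auto
    then show ?thesis using False rel[of j] j by (simp add: Pd Vd)
  next
    case True
    then obtain m where m: "m < ?k" "j = (\<tau> ^^ m) a" using ci(2) by blast
    have gc: "g0 j \<in> carrier G" "g ((\<sigma> ^^ m) s) \<in> carrier G"
      using W0 W wr_funpow[OF W0 aX, of m] wr_funpow[OF W sX, of m] m(2) by (auto simp: wr_elt_def)
    have seg1: "seg g \<sigma> s (Suc m) = g ((\<sigma> ^^ m) s) \<otimes> seg g \<sigma> s m" by (rule seg_Suc)
    have seg2: "seg g0 \<tau> a (Suc m) = g0 j \<otimes> seg g0 \<tau> a m" by (simp add: seg_Suc m(2))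
    have key: "seg g \<sigma> s (Suc m) \<otimes> w \<otimes> inv (seg g0 \<tau> a (Suc m)) \<otimes> g0 j = g ((\<sigma> ^^ m) s) \<otimes> V j"
      unfolding seg1 seg2 m(2) Vm[OF m(1)] using gc sc w(1) m(2) by (simp add: inv_mult_group m_assoc)
    have Pj: "P j = (\<sigma> ^^ m) s" using Pm[OF m(1)] m(2) by simp
    show ?thesis
    proof (cases "Suc m < ?k")
      case True
      have "\<tau> j = (\<tau> ^^ Suc m) a" by (simp add: m(2))
      then show ?thesis using Pm[OF True] Vm[OF True] key Pj by simp
    next
      case False
      \<comment> \<open>The step that closes the cycle and returns to a: here, and only here, the
        relation between w and the two cycle products enters.\<close>
      then have mk: "Suc m = ?k" using m(1) by simp
      have tj: "\<tau> j = a"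
      proof -
        have "\<tau> j = (\<tau> ^^ Suc m) a" by (simp add: m(2))
        then show ?thesis unfolding mk orbit_card(2)[OF aC] .
      qed
      have "\<sigma> (P j) = (\<sigma> ^^ Suc m) s" by (simp add: Pj)
      also have "\<dots> = s" unfolding mk s(2)[symmetric] by (rule orbit_card(2)[OF wr_orbit_self[OF W]])
      finally have 1: "P (\<tau> j) = \<sigma> (P j)" by (simp add: tj Pa)
      have "seg g \<sigma> s ?k \<otimes> w = w \<otimes> seg g0 \<tau> a ?k"
        using w(2) s(2) by (simp add: cycle_prod_seg)
      then have "seg g \<sigma> s ?k \<otimes> w \<otimes> inv (seg g0 \<tau> a ?k) = w"
        using sc[of ?k] w(1) by (simp add: m_assoc)
      then have "V (\<tau> j) \<otimes> g0 j = g (P j) \<otimes> V j"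
        using key unfolding mk by (simp add: tj Va Pj)
      then show ?thesis using 1 by simp
    qed
  qed
  then show "(P, V) \<in> conjugators g0 \<tau> Y0 g \<sigma> Y"
    using bP extP Vc by (simp add: conjugators_def)
qed

text \<open>Together with \<open>glue_conjugator\<close> this identifies a conjugator with its
  values at a and a conjugator on the remaining cycles.\<close>

lemma conjugator_restrict:
  assumes W0: "wr_elt g0 \<tau> X0" and W: "wr_elt g \<sigma> X"
    and Y0: "Y0 \<subseteq> X0" "\<tau> ` Y0 \<subseteq> Y0" and Y: "Y \<subseteq> X" "\<sigma> ` Y \<subseteq> Y" and a: "a \<in> Y0"
    and pv: "(\<pi>, v) \<in> conjugators g0 \<tau> Y0 g \<sigma> Y"
  shows "(restrict \<pi> (Y0 - orbit \<tau> a), restrict v (Y0 - orbit \<tau> a)) \<in>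
      conjugators g0 \<tau> (Y0 - orbit \<tau> a) g \<sigma> (Y - orbit \<sigma> (\<pi> a))"
    and "(\<pi>, v) = glue g0 \<tau> a g \<sigma> ((\<pi> a, v a), (restrict \<pi> (Y0 - orbit \<tau> a), restrict v (Y0 - orbit \<tau> a)))"
proof -
  let ?C = "orbit \<tau> a"
  have CY: "?C \<subseteq> Y0" by (rule stable_orbit[OF Y0(2) a])
  have pv': "\<pi> \<in> extensional Y0" "bij_betw \<pi> Y0 Y" "v \<in> Y0 \<rightarrow>\<^sub>E carrier G"
    and rel: "\<And>j. j \<in> Y0 \<Longrightarrow> \<pi> (\<tau> j) = \<sigma> (\<pi> j) \<and> v (\<tau> j) \<otimes> g0 j = g (\<pi> j) \<otimes> v j"
    using pv by (auto simp: conjugators_def)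
  have im: "\<pi> ` ?C = orbit \<sigma> (\<pi> a)" by (rule conjugator_orbit(1)[OF W0 W Y0 Y(1) pv a])
  have st: "\<tau> j \<in> Y0 - ?C" if j: "j \<in> Y0 - ?C" for j
  proof -
    have "orbit \<tau> j \<noteq> ?C" using j wr_orbit_self[OF W0, of j] by auto
    then have "\<tau> j \<notin> ?C" using wr_orbit_eq[OF W0, of "\<tau> j" a] wr_orbit_step[OF W0, of j] by auto
    then show ?thesis using j Y0(2) by auto
  qed
  have "bij_betw \<pi> (Y0 - ?C) (Y - orbit \<sigma> (\<pi> a))"
    using inj_on_image_set_diff[of \<pi> Y0 Y0 ?C] pv'(2) CY inj_on_subset[of \<pi> Y0 "Y0 - ?C"]
    unfolding im[symmetric] bij_betw_def by auto
  then have "bij_betw (restrict \<pi> (Y0 - ?C)) (Y0 - ?C) (Y - orbit \<sigma> (\<pi> a))"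
    by (rule bij_betw_cong[THEN iffD1, rotated]) simp
  then show "(restrict \<pi> (Y0 - orbit \<tau> a), restrict v (Y0 - orbit \<tau> a)) \<in>
      conjugators g0 \<tau> (Y0 - orbit \<tau> a) g \<sigma> (Y - orbit \<sigma> (\<pi> a))"
    using pv'(3) rel st by (auto simp: conjugators_def)
  have aX: "a \<in> X0" and sX: "\<pi> a \<in> X" using a Y0 pv'(2) Y by (auto simp: bij_betw_def)
  have ci: "j = (\<tau> ^^ cycle_index \<tau> a j) a" if "j \<in> ?C" for j
  proof -
    obtain m where "m < card ?C" "j = (\<tau> ^^ m) a" using cycle_index(2)[OF W0 \<open>j \<in> ?C\<close>] by blast
    then show ?thesis using cycle_index(1)[OF W0, of m a] by simp
  qed
  have p: "\<pi> j = (\<sigma> ^^ cycle_index \<tau> a j) (\<pi> a)" if "j \<in> ?C" for j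
    using conjugator_funpow(1)[OF W0 W Y0 Y(1) pv a, of "cycle_index \<tau> a j"] ci[OF that] by simp
  have v: "v j = seg g \<sigma> (\<pi> a) (cycle_index \<tau> a j) \<otimes> v a \<otimes> inv (seg g0 \<tau> a (cycle_index \<tau> a j))" if j: "j \<in> ?C" for j
  proof -
    let ?m = "cycle_index \<tau> a j"
    have "v j \<otimes> seg g0 \<tau> a ?m = seg g \<sigma> (\<pi> a) ?m \<otimes> v a"
      using conjugator_funpow(2)[OF W0 W Y0 Y(1) pv a, of ?m] ci[OF j] by simp
    moreover have "v j \<in> carrier G" "v a \<in> carrier G" using pv'(3) CY j a by auto
    ultimately show ?thesis
      using seg_closed[OF W0 aX] seg_closed[OF W sX] by (simp add: inv_solve_right)
  qed
  show "(\<pi>, v) = glue g0 \<tau> a g \<sigma> ((\<pi> a, v a), (restrict \<pi> (Y0 - ?C), restrict v (Y0 - ?C)))"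
    unfolding glue_def split_conv prod.inject
  proof (intro conjI ext)
    fix j
    show "\<pi> j = (if j \<in> ?C then (\<sigma> ^^ cycle_index \<tau> a j) (\<pi> a) else restrict \<pi> (Y0 - ?C) j)"
      using p[of j] pv'(1) by (auto simp: extensional_def)
    show "v j = (if j \<in> ?C then seg g \<sigma> (\<pi> a) (cycle_index \<tau> a j) \<otimes> v a \<otimes> inv (seg g0 \<tau> a (cycle_index \<tau> a j))
        else restrict v (Y0 - ?C) j)"
      using v[of j] pv'(3) by (auto simp: PiE_def extensional_def)
  qed
qed

text \<open>Induction on the number of points. The choices for the image of a base point a are
  counted by \<open>card_base_points\<close>, those for the group component by
  \<open>card_transporter\<close>, and the product obeys the recursion
  \<open>Z_part_fun_add\<close>.\<close>

theorem card_conjugators: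
  assumes W0: "wr_elt g0 \<tau> X0" and W: "wr_elt g \<sigma> X"
    and "Y0 \<subseteq> X0" "\<tau> ` Y0 \<subseteq> Y0" "Y \<subseteq> X" "\<sigma> ` Y \<subseteq> Y"
    and "orbit_type g0 \<tau> Y0 = orbit_type g \<sigma> Y"
  shows "finite (conjugators g0 \<tau> Y0 g \<sigma> Y) \<and> card (conjugators g0 \<tau> Y0 g \<sigma> Y) = Z_part_fun G (orbit_type g \<sigma> Y)"
  using assms(3-)
proof (induction "card Y0" arbitrary: Y0 Y rule: less_induct)
  case less
  note Y0 = less.prems(1,2) and Y = less.prems(3,4) and ty = less.prems(5)
  have fY0: "finite Y0" using W0 Y0(1) finite_subset by (auto simp: wr_elt_def)
  have fY: "finite Y" using W Y(1) finite_subset by (auto simp: wr_elt_def)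
  show ?case
  proof (cases "Y0 = {}")
    case True
    then have z: "orbit_type g \<sigma> Y = (\<lambda>_. {#})" using ty orbit_type_empty by simp
    have "Y = {}" by (rule orbit_type_eq_empty[OF W Y(1) z])
    then have "conjugators g0 \<tau> Y0 g \<sigma> Y = {(\<lambda>_. undefined, \<lambda>_. undefined)}"
      using True by (auto simp: conjugators_def bij_betw_def)
    then show ?thesis using z by (simp add: Z_part_fun_empty)
  next
    case False
    then obtain a where a: "a \<in> Y0" by blast
    let ?C = "orbit \<tau> a" and ?k = "card (orbit \<tau> a)" and ?x = "cycle_prod G g0 \<tau> a"
    let ?c = "conj_class G ?x"
    have x: "?x \<in> carrier G" using cycle_prod_closed[OF W0] a Y0(1) by blast
    have c: "?c \<in> conj_classes G" by (rule conj_class_in[OF x])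
    have CY: "?C \<subseteq> Y0" by (rule stable_orbit[OF Y0(2) a])
    define S where "S = {s \<in> Y. card (orbit \<sigma> s) = ?k \<and> cycle_prod G g \<sigma> s \<in> ?c}"
    define V where "V s = {w \<in> carrier G. w \<otimes> ?x = cycle_prod G g \<sigma> s \<otimes> w}" for s
    define M where "M s = conjugators g0 \<tau> (Y0 - ?C) g \<sigma> (Y - orbit \<sigma> s)" for s
    define \<rho>' where "\<rho>' = orbit_type g0 \<tau> (Y0 - ?C)"
    have \<rho>: "orbit_type g0 \<tau> Y0 = \<rho>'(?c := add_mset ?k (\<rho>' ?c))"
      unfolding \<rho>'_def by (rule orbit_type_remove[OF W0 Y0 a c conj_class_self[OF x]])
    have lt: "card (Y0 - ?C) < card Y0"
      using fY0 a wr_orbit_self[OF W0, of a] by (intro psubset_card_mono) auto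
    have IH: "finite (M s) \<and> card (M s) = Z_part_fun G \<rho>'" if s: "s \<in> S" for s
    proof -
      have s': "s \<in> Y" "card (orbit \<sigma> s) = ?k" "cycle_prod G g \<sigma> s \<in> ?c" using s by (auto simp: S_def)
      have "\<rho>'(?c := add_mset ?k (\<rho>' ?c)) = (orbit_type g \<sigma> (Y - orbit \<sigma> s))(?c := add_mset ?k (orbit_type g \<sigma> (Y - orbit \<sigma> s) ?c))"
        using orbit_type_remove[OF W Y s'(1) c s'(3)] \<rho> ty s'(2) by simp
      \<comment> \<open>Removing the same part from equal types leaves equal types. So the induction
        hypothesis applies for every s, with a count that does not depend on s.\<close>
      then have e: "\<rho>' = orbit_type g \<sigma> (Y - orbit \<sigma> s)" by (rule fun_upd_add_mset_cancel)
      have st0: "\<tau> ` (Y0 - ?C) \<subseteq> Y0 - ?C"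
      proof (rule image_subsetI)
        fix j assume j: "j \<in> Y0 - ?C"
        have "orbit \<tau> j \<noteq> ?C" using j wr_orbit_self[OF W0, of j] by auto
        then have "\<tau> j \<notin> ?C" using wr_orbit_eq[OF W0, of "\<tau> j" a] wr_orbit_step[OF W0, of j] by auto
        then show "\<tau> j \<in> Y0 - ?C" using j Y0(2) by auto
      qed
      have st: "\<sigma> ` (Y - orbit \<sigma> s) \<subseteq> Y - orbit \<sigma> s"
      proof (rule image_subsetI)
        fix j assume j: "j \<in> Y - orbit \<sigma> s"
        have "orbit \<sigma> j \<noteq> orbit \<sigma> s" using j wr_orbit_self[OF W, of j] by auto
        then have "\<sigma> j \<notin> orbit \<sigma> s" using wr_orbit_eq[OF W, of "\<sigma> j" s] wr_orbit_step[OF W, of j] by auto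
        then show "\<sigma> j \<in> Y - orbit \<sigma> s" using j Y(2) by auto
      qed
      show ?thesis unfolding M_def e
        by (rule less.hyps[OF lt _ st0 _ st]) (use Y0 Y e \<rho>'_def in auto)
    qed
    have V: "card (V s) = centralizer_order G ?c" "finite (V s)" if "s \<in> S" for s
      using that card_transporter[OF x] fin by (auto simp: V_def S_def)
    \<comment> \<open>The input of \<open>glue\<close>: an image s of a, a group element w
      compatible with the cycle products, and a conjugator of the remaining cycles.\<close>
    let ?D = "SIGMA p:(SIGMA s:S. V s). M (fst p)"
    have D: "bij_betw (glue g0 \<tau> a g \<sigma>) ?D (conjugators g0 \<tau> Y0 g \<sigma> Y)"
    proof (rule bij_betw_byWitness[where f' = "\<lambda>(\<pi>, v). ((\<pi> a, v a), (restrict \<pi> (Y0 - ?C), restrict v (Y0 - ?C)))"])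
      show "\<forall>q\<in>?D. (case glue g0 \<tau> a g \<sigma> q of (\<pi>, v) \<Rightarrow> ((\<pi> a, v a), (restrict \<pi> (Y0 - ?C), restrict v (Y0 - ?C)))) = q"
      proof
        fix q assume "q \<in> ?D"
        then obtain s w \<pi> v where q: "q = ((s, w), (\<pi>, v))" "s \<in> S" "w \<in> V s" "(\<pi>, v) \<in> M s" by auto
        obtain P U where PU: "(P, U) = glue g0 \<tau> a g \<sigma> ((s, w), (\<pi>, v))" by (metis surj_pair)
        show "(case glue g0 \<tau> a g \<sigma> q of (\<pi>, v) \<Rightarrow> ((\<pi> a, v a), (restrict \<pi> (Y0 - ?C), restrict v (Y0 - ?C)))) = q"
          using glue_conjugator[OF W0 W Y0 Y a _ _ _ _ _ PU] q
          by (simp add: PU[symmetric] S_def V_def M_def)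
      qed
      show "glue g0 \<tau> a g \<sigma> ` ?D \<subseteq> conjugators g0 \<tau> Y0 g \<sigma> Y"
      proof (rule image_subsetI)
        fix q assume "q \<in> ?D"
        then obtain s w \<pi> v where q: "q = ((s, w), (\<pi>, v))" "s \<in> S" "w \<in> V s" "(\<pi>, v) \<in> M s" by auto
        obtain P U where PU: "(P, U) = glue g0 \<tau> a g \<sigma> ((s, w), (\<pi>, v))" by (metis surj_pair)
        show "glue g0 \<tau> a g \<sigma> q \<in> conjugators g0 \<tau> Y0 g \<sigma> Y"
          using glue_conjugator(1)[OF W0 W Y0 Y a _ _ _ _ _ PU] q
          by (simp add: PU[symmetric] S_def V_def M_def)
      qed
      show "\<forall>q\<in>conjugators g0 \<tau> Y0 g \<sigma> Y. glue g0 \<tau> a g \<sigma> (case q of (\<pi>, v) \<Rightarrow> ((\<pi> a, v a), (restrict \<pi> (Y0 - ?C), restrict v (Y0 - ?C)))) = q"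
        using conjugator_restrict(2)[OF W0 W Y0 Y a] by (auto simp del: restrict_apply)
      show "(\<lambda>(\<pi>, v). ((\<pi> a, v a), (restrict \<pi> (Y0 - ?C), restrict v (Y0 - ?C)))) ` conjugators g0 \<tau> Y0 g \<sigma> Y \<subseteq> ?D"
      proof (rule image_subsetI)
        fix q assume q: "q \<in> conjugators g0 \<tau> Y0 g \<sigma> Y"
        obtain \<pi> v where qe: "q = (\<pi>, v)" by (metis surj_pair)
        note pv = q[unfolded qe]
        have "\<pi> a \<in> S"
          using conjugator_orbit(2)[OF W0 W Y0 Y(1) pv a] conjugator_cycle_class[OF W0 W Y0 Y(1) pv a] pv a
          by (auto simp: S_def conjugators_def bij_betw_def)
        moreover have "v a \<in> V (\<pi> a)"
          using conjugator_orbit(3)[OF W0 W Y0 Y(1) pv a] pv a by (auto simp: V_def conjugators_def)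
        moreover have "(restrict \<pi> (Y0 - ?C), restrict v (Y0 - ?C)) \<in> M (\<pi> a)"
          unfolding M_def by (rule conjugator_restrict(1)[OF W0 W Y0 Y a pv])
        ultimately show "(\<lambda>(\<pi>, v). ((\<pi> a, v a), (restrict \<pi> (Y0 - ?C), restrict v (Y0 - ?C)))) q \<in> ?D"
          by (simp add: qe)
      qed
    qed
    have fS: "finite S" using fY by (simp add: S_def)
    have fD: "finite ?D" using fS V(2) IH by (intro finite_SigmaI) auto
    have "card (conjugators g0 \<tau> Y0 g \<sigma> Y) = card ?D" by (rule bij_betw_same_card[OF D, symmetric])
    also have "\<dots> = (\<Sum>p\<in>(SIGMA s:S. V s). card (M (fst p)))"
      using fS V(2) IH by (intro card_SigmaI finite_SigmaI) auto
    also have "\<dots> = (\<Sum>p\<in>(SIGMA s:S. V s). Z_part_fun G \<rho>')"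
      using IH by (intro sum.cong) auto
    also have "\<dots> = card (SIGMA s:S. V s) * Z_part_fun G \<rho>'" by simp
    also have "card (SIGMA s:S. V s) = card S * centralizer_order G ?c"
      using fS V by (subst card_SigmaI) auto
    also have "card S = ?k * count (orbit_type g \<sigma> Y ?c) ?k"
      unfolding S_def by (rule card_base_points[OF W Y c])
    also have "count (orbit_type g \<sigma> Y ?c) ?k = Suc (count (\<rho>' ?c) ?k)"
      unfolding ty[symmetric] \<rho> by simp
    also have "?k * Suc (count (\<rho>' ?c) ?k) * centralizer_order G ?c * Z_part_fun G \<rho>' = Z_part_fun G (orbit_type g \<sigma> Y)"
      unfolding ty[symmetric] \<rho> Z_part_fun_add[OF c] by (simp only: mult_ac)
    finally show ?thesis using bij_betw_finite[OF D] fD by simp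
  qed
qed

end

section \<open>The double cover of the symmetric group\<close>

context
  fixes n :: nat
begin

interpretation S: group "spin_group n"
  unfolding spin_group_def by (rule presented_group_group)

lemma carrier_spin_group:
  "carrier (spin_group n) = pres_class (spin_gens n) (spin_rels n) ` {u. set u \<subseteq> spin_gens n \<times> UNIV}"
  by (simp add: spin_group_def presented_group_def)

lemma spin_word_closed: "set gs \<subseteq> spin_gens n \<Longrightarrow> spin_word n gs \<in> carrier (spin_group n)"
  unfolding carrier_spin_group spin_word_def by (intro imageI) auto

lemma spin_word_append:
  assumes "set gs \<subseteq> spin_gens n" "set hs \<subseteq> spin_gens n"
  shows "spin_word n (gs @ hs) = spin_word n gs \<otimes>\<^bsub>spin_group n\<^esub> spin_word n hs"
proof -
  have "set (pos_word gs) \<subseteq> spin_gens n \<times> UNIV" "set (pos_word hs) \<subseteq> spin_gens n \<times> UNIV"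
    using assms by auto
  from presented_mult[OF this] show ?thesis by (simp add: spin_group_def spin_word_def)
qed

lemma spin_one: "\<one>\<^bsub>spin_group n\<^esub> = spin_word n []"
  by (simp add: spin_group_def spin_word_def presented_group_def)

lemma spin_word_rel:
  assumes "(pos_word gs, pos_word hs) \<in> spin_rels n" "set gs \<subseteq> spin_gens n" "set hs \<subseteq> spin_gens n"
  shows "spin_word n gs = spin_word n hs"
proof -
  have s: "set (pos_word gs) \<subseteq> spin_gens n \<times> UNIV" "set (pos_word hs) \<subseteq> spin_gens n \<times> UNIV"
    using assms by auto
  show ?thesis unfolding spin_word_def pres_class_eq_iff[OF s] by (rule pres_rel[OF assms(1) s])
qed

section \<open>Words in the presented group and their normal form modulo z\<close>

abbreviation "Zs \<equiv> spin_word n [Zgen]"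

definition tw :: "nat list \<Rightarrow> spin_elt" where "tw is = spin_word n (map Tgen is)"

lemma Zgen_in [simp]: "Zgen \<in> spin_gens n" by (simp add: spin_gens_def)

lemma Tgen_in [simp]: "Tgen i \<in> spin_gens n \<longleftrightarrow> 1 \<le> i \<and> i < n" by (auto simp: spin_gens_def)

lemma Zs_closed [simp]: "Zs \<in> carrier (spin_group n)" by (rule spin_word_closed) simp

lemma tw_closed: "set is \<subseteq> {1..<n} \<Longrightarrow> tw is \<in> carrier (spin_group n)"
  unfolding tw_def by (rule spin_word_closed) auto

lemma tw_append:
  assumes "set is \<subseteq> {1..<n}" "set js \<subseteq> {1..<n}"
  shows "tw (is @ js) = tw is \<otimes>\<^bsub>spin_group n\<^esub> tw js"
proof -
  have "set (map Tgen is) \<subseteq> spin_gens n" "set (map Tgen js) \<subseteq> spin_gens n" using assms by auto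
  from spin_word_append[OF this] show ?thesis by (simp add: tw_def)
qed

lemma tw_Nil: "tw [] = \<one>\<^bsub>spin_group n\<^esub>" by (simp add: tw_def spin_one)

lemma Zs_sq: "Zs \<otimes>\<^bsub>spin_group n\<^esub> Zs = \<one>\<^bsub>spin_group n\<^esub>"
proof -
  have "spin_word n [Zgen, Zgen] = spin_word n []"
    by (rule spin_word_rel) (auto simp: spin_rels_def)
  then show ?thesis using spin_word_append[of "[Zgen]" "[Zgen]"] by (simp add: spin_one)
qed

lemma T_sq: assumes "i \<in> {1..<n}" shows "tw [i, i] = Zs"
proof -
  have "(pos_word [Tgen i, Tgen i], pos_word [Zgen]) \<in> spin_rels n"
    unfolding spin_rels_def by (rule image_eqI[of _ _ "([Tgen i, Tgen i], [Zgen])"]) (use assms in auto)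
  from spin_word_rel[OF this] show ?thesis using assms by (simp add: tw_def)
qed

lemma T_cube:
  assumes "i \<in> {1..<n}" "i + 1 \<in> {1..<n}"
  shows "tw [i, i + 1, i, i + 1, i, i + 1] = Zs"
proof -
  let ?g = "concat (replicate 3 [Tgen i, Tgen (i + 1)])"
  have "(pos_word ?g, pos_word [Zgen]) \<in> spin_rels n"
    unfolding spin_rels_def by (rule image_eqI[of _ _ "(?g, [Zgen])"]) (use assms in auto)
  from spin_word_rel[OF this] show ?thesis using assms by (simp add: tw_def numeral_3_eq_3)
qed

lemma T_far:
  assumes "i \<in> {1..<n}" "j \<in> {1..<n}" "i > j + 1"
  shows "tw [i, j] = Zs \<otimes>\<^bsub>spin_group n\<^esub> tw [j, i]"
proof -
  have "(pos_word [Tgen i, Tgen j], pos_word [Zgen, Tgen j, Tgen i]) \<in> spin_rels n"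
    unfolding spin_rels_def by (rule image_eqI[of _ _ "([Tgen i, Tgen j], [Zgen, Tgen j, Tgen i])"]) (use assms in auto)
  from spin_word_rel[OF this] show ?thesis using assms spin_word_append[of "[Zgen]" "[Tgen j, Tgen i]"] by (simp add: tw_def)
qed

lemma Z_T: assumes "i \<in> {1..<n}" shows "Zs \<otimes>\<^bsub>spin_group n\<^esub> tw [i] = tw [i] \<otimes>\<^bsub>spin_group n\<^esub> Zs"
proof -
  have "(pos_word [Zgen, Tgen i], pos_word [Tgen i, Zgen]) \<in> spin_rels n"
    unfolding spin_rels_def by (rule image_eqI[of _ _ "([Zgen, Tgen i], [Tgen i, Zgen])"]) (use assms in auto)
  from spin_word_rel[OF this] show ?thesis using assms spin_word_append[of "[Zgen]" "[Tgen i]"] spin_word_append[of "[Tgen i]" "[Zgen]"]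
    by (simp add: tw_def)
qed

lemma spin_inv_letter:
  assumes "g \<in> spin_gens n"
  shows "pres_class (spin_gens n) (spin_rels n) [(g, False)] = inv\<^bsub>spin_group n\<^esub> spin_word n [g]"
proof -
  let ?c = "pres_class (spin_gens n) (spin_rels n)"
  have "?c [(g, False)] \<otimes>\<^bsub>spin_group n\<^esub> ?c [(g, True)] = ?c ([(g, False)] @ [(g, True)])"
    unfolding spin_group_def by (rule presented_mult) (use assms in auto)
  also have "\<dots> = ?c []"
  proof -
    have "pres_eq (spin_gens n) (spin_rels n) [(g, False), (g, True)] []"
      using pres_cancel[OF assms, of _ False] by simp
    then show ?thesis using assms by (subst pres_class_eq_iff) auto
  qed
  also have "\<dots> = \<one>\<^bsub>spin_group n\<^esub>" by (simp add: spin_one spin_word_def)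
  finally have e: "?c [(g, False)] \<otimes>\<^bsub>spin_group n\<^esub> spin_word n [g] = \<one>\<^bsub>spin_group n\<^esub>"
    by (simp add: spin_word_def)
  have "?c [(g, False)] \<in> carrier (spin_group n)" unfolding carrier_spin_group using assms by (intro imageI) auto
  then show ?thesis using S.inv_equality[OF e] spin_word_closed[of "[g]"] assms by simp
qed

text \<open>Because t_k^2 = z, the inverse of t_k is z t_k. Inverse letters thus cost only a factor
  z, which commutes with every generator and can be collected in front.\<close>

lemma spin_elt_cases:
  assumes "A \<in> carrier (spin_group n)"
  obtains "is" where "set is \<subseteq> {1..<n}" "A = tw is \<or> A = Zs \<otimes>\<^bsub>spin_group n\<^esub> tw is"
proof -
  let ?c = "pres_class (spin_gens n) (spin_rels n)"
  let ?P = "\<lambda>A. \<exists>is. set is \<subseteq> {1..<n} \<and> (A = tw is \<or> A = Zs \<otimes>\<^bsub>spin_group n\<^esub> tw is)"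
  have Zstep: "?P (Zs \<otimes>\<^bsub>spin_group n\<^esub> A)" if PA: "?P A" for A
  proof -
    obtain "is" where i: "set is \<subseteq> {1..<n}" "A = tw is \<or> A = Zs \<otimes>\<^bsub>spin_group n\<^esub> tw is" using PA by blast
    have "Zs \<otimes>\<^bsub>spin_group n\<^esub> (Zs \<otimes>\<^bsub>spin_group n\<^esub> tw is) = tw is"
      using tw_closed[OF i(1)] Zs_sq by (simp add: S.m_assoc[symmetric])
    then show ?thesis using i by auto
  qed
  have Tstep: "?P (tw [k] \<otimes>\<^bsub>spin_group n\<^esub> A)" if PA: "?P A" and k: "k \<in> {1..<n}" for A k
  proof -
    obtain "is" where i: "set is \<subseteq> {1..<n}" "A = tw is \<or> A = Zs \<otimes>\<^bsub>spin_group n\<^esub> tw is" using PA by blast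
    have cl: "tw [k] \<in> carrier (spin_group n)" "tw is \<in> carrier (spin_group n)" using tw_closed i k by auto
    have a: "tw [k] \<otimes>\<^bsub>spin_group n\<^esub> tw is = tw (k # is)"
      using tw_append[of "[k]" "is"] i k by simp
    have b: "tw [k] \<otimes>\<^bsub>spin_group n\<^esub> (Zs \<otimes>\<^bsub>spin_group n\<^esub> tw is) = Zs \<otimes>\<^bsub>spin_group n\<^esub> tw (k # is)"
      unfolding a[symmetric] using cl Z_T[OF k] by (simp add: S.m_assoc[symmetric])
    have "set (k # is) \<subseteq> {1..<n}" using i k by simp
    then show ?thesis using i(2) a b by metis
  qed
  have "?P (?c u)" if "set u \<subseteq> spin_gens n \<times> UNIV" for u
    using that
  proof (induction u)
    case Nil
    have "?c [] = tw []" by (simp add: tw_def spin_word_def)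
    then show ?case by (intro exI[of _ "[]"]) simp
  next
    case (Cons l u)
    obtain g b where l: "l = (g, b)" by force
    have g: "g \<in> spin_gens n" and u: "set u \<subseteq> spin_gens n \<times> UNIV" using Cons.prems l by auto
    have split: "?c (l # u) = ?c [l] \<otimes>\<^bsub>spin_group n\<^esub> ?c u"
    proof -
      have "set [l] \<subseteq> spin_gens n \<times> UNIV" using g l by simp
      from presented_mult[OF this u] show ?thesis by (simp add: spin_group_def)
    qed
    have IH: "?P (?c u)" by (rule Cons.IH[OF u])
    have uc: "?c u \<in> carrier (spin_group n)" unfolding carrier_spin_group using u by blast
    show ?case
    proof (cases g)
      case Zgen
      have "inv\<^bsub>spin_group n\<^esub> Zs = Zs" by (rule S.inv_equality[OF Zs_sq]) simp_all
      then have "?c [l] = Zs"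
        using spin_inv_letter[OF g] unfolding l Zgen by (cases b) (auto simp: spin_word_def)
      then show ?thesis unfolding split using Zstep[OF IH] by simp
    next
      case (Tgen k)
      have k: "k \<in> {1..<n}" using g Tgen by simp
      have kc: "tw [k] \<in> carrier (spin_group n)" using tw_closed k by simp
      have "inv\<^bsub>spin_group n\<^esub> tw [k] = Zs \<otimes>\<^bsub>spin_group n\<^esub> tw [k]"
      proof (rule S.inv_equality)
        show "Zs \<otimes>\<^bsub>spin_group n\<^esub> tw [k] \<otimes>\<^bsub>spin_group n\<^esub> tw [k] = \<one>\<^bsub>spin_group n\<^esub>"
          using tw_append[of "[k]" "[k]"] T_sq[OF k] k kc Zs_sq by (simp add: S.m_assoc)
      qed (use kc in simp_all)
      then have "?c [l] = (if b then tw [k] else Zs \<otimes>\<^bsub>spin_group n\<^esub> tw [k])"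
        using spin_inv_letter[OF g] unfolding l Tgen by (cases b) (auto simp: spin_word_def tw_def)
      then show ?thesis unfolding split using Tstep[OF IH k] Zstep[OF Tstep[OF IH k]] kc uc
        by (cases b) (simp_all add: S.m_assoc)
    qed
  qed
  then show ?thesis using assms that unfolding carrier_spin_group by blast
qed

lemma Zs_central:
  assumes "A \<in> carrier (spin_group n)"
  shows "Zs \<otimes>\<^bsub>spin_group n\<^esub> A = A \<otimes>\<^bsub>spin_group n\<^esub> Zs"
proof -
  have t: "Zs \<otimes>\<^bsub>spin_group n\<^esub> tw is = tw is \<otimes>\<^bsub>spin_group n\<^esub> Zs" if "set is \<subseteq> {1..<n}" for "is"
    using that
  proof (induction "is")
    case (Cons k "is")
    have cl: "tw [k] \<in> carrier (spin_group n)" "tw is \<in> carrier (spin_group n)" using tw_closed Cons.prems by auto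
    have e: "tw (k # is) = tw [k] \<otimes>\<^bsub>spin_group n\<^esub> tw is" using tw_append[of "[k]" "is"] Cons.prems by simp
    have "Zs \<otimes>\<^bsub>spin_group n\<^esub> tw (k # is) = tw [k] \<otimes>\<^bsub>spin_group n\<^esub> (Zs \<otimes>\<^bsub>spin_group n\<^esub> tw is)"
      unfolding e using cl Z_T[of k] Cons.prems by (simp add: S.m_assoc[symmetric])
    also have "\<dots> = tw (k # is) \<otimes>\<^bsub>spin_group n\<^esub> Zs"
      unfolding e using Cons cl by (simp add: S.m_assoc)
    finally show ?case .
  qed (simp add: tw_Nil)
  obtain "is" where i: "set is \<subseteq> {1..<n}" "A = tw is \<or> A = Zs \<otimes>\<^bsub>spin_group n\<^esub> tw is"
    by (rule spin_elt_cases[OF assms])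
  have c: "tw is \<in> carrier (spin_group n)" by (rule tw_closed[OF i(1)])
  have "Zs \<otimes>\<^bsub>spin_group n\<^esub> tw is \<otimes>\<^bsub>spin_group n\<^esub> Zs = Zs \<otimes>\<^bsub>spin_group n\<^esub> (Zs \<otimes>\<^bsub>spin_group n\<^esub> tw is)"
    using S.m_assoc[OF Zs_closed c Zs_closed] t[OF i(1)] by simp
  then show ?thesis using i(2) t[OF i(1)] by auto
qed

text \<open>Equality in the quotient by z, where the relations become the Coxeter relations of the
  symmetric group.\<close>

definition eqz :: "nat list \<Rightarrow> nat list \<Rightarrow> bool" where
  "eqz is js \<longleftrightarrow> set is \<subseteq> {1..<n} \<and> set js \<subseteq> {1..<n} \<and> (tw is = tw js \<or> tw is = Zs \<otimes>\<^bsub>spin_group n\<^esub> tw js)"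

lemma Zs_Zs: "A \<in> carrier (spin_group n) \<Longrightarrow> Zs \<otimes>\<^bsub>spin_group n\<^esub> (Zs \<otimes>\<^bsub>spin_group n\<^esub> A) = A"
  using Zs_sq by (simp add: S.m_assoc[symmetric])

lemma eqz_refl: "set is \<subseteq> {1..<n} \<Longrightarrow> eqz is is" by (simp add: eqz_def)

lemma eqz_sym: "eqz is js \<Longrightarrow> eqz js is"
  using Zs_Zs tw_closed by (auto simp: eqz_def)

lemma eqz_trans [trans]: "eqz is js \<Longrightarrow> eqz js ks \<Longrightarrow> eqz is ks"
  using Zs_Zs tw_closed by (auto simp: eqz_def)

lemma eqz_append:
  assumes "eqz is js" "eqz is' js'" shows "eqz (is @ is') (js @ js')"
proof -
  have s: "set is \<subseteq> {1..<n}" "set js \<subseteq> {1..<n}" "set is' \<subseteq> {1..<n}" "set js' \<subseteq> {1..<n}"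
    using assms by (auto simp: eqz_def)
  note c = s[THEN tw_closed]
  have z: "tw js \<otimes>\<^bsub>spin_group n\<^esub> (Zs \<otimes>\<^bsub>spin_group n\<^esub> tw js') = Zs \<otimes>\<^bsub>spin_group n\<^esub> (tw js \<otimes>\<^bsub>spin_group n\<^esub> tw js')"
    using c Zs_central[OF c(2)] by (simp add: S.m_assoc[symmetric])
  show ?thesis unfolding eqz_def tw_append[OF s(1,3)] tw_append[OF s(2,4)]
    using assms s c z Zs_Zs by (auto simp: eqz_def S.m_assoc)
qed

lemma eqz_context:
  assumes "eqz is js" "set as \<subseteq> {1..<n}" "set bs \<subseteq> {1..<n}"
  shows "eqz (as @ is @ bs) (as @ js @ bs)"
  by (intro eqz_append eqz_refl assms)

lemma eqz_sq: "i \<in> {1..<n} \<Longrightarrow> eqz [i, i] []"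
  using T_sq by (simp add: eqz_def tw_Nil)

lemma eqz_far:
  assumes "i \<in> {1..<n}" "j \<in> {1..<n}" "i > j + 1 \<or> j > i + 1"
  shows "eqz [i, j] [j, i]"
proof (cases "i > j + 1")
  case True
  then show ?thesis using T_far[OF assms(1,2)] assms by (simp add: eqz_def)
next
  case False
  then have "eqz [j, i] [i, j]" using T_far[OF assms(2,1)] assms by (simp add: eqz_def)
  then show ?thesis by (rule eqz_sym)
qed

text \<open>Write a, b for the two letters. Multiplying a b a by (a b)^3, which is z, and cancelling
  adjacent equal letters from the inside leaves b a b.\<close>

lemma eqz_braid:
  assumes "i \<in> {1..<n}" "i + 1 \<in> {1..<n}"
  shows "eqz [i + 1, i, i + 1] [i, i + 1, i]"
proof -
  let ?a = i and ?b = "i + 1"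
  have ab: "set [?a] \<subseteq> {1..<n}" "set [?b] \<subseteq> {1..<n}" using assms by auto
  have c: "eqz [?a, ?b, ?a, ?b, ?a, ?b] []"
    using T_cube[OF assms] assms by (simp add: eqz_def tw_Nil)
  have "eqz [?a, ?b, ?a] ([?a, ?b, ?a] @ [?a, ?b, ?a, ?b, ?a, ?b])"
    using eqz_append[OF eqz_refl eqz_sym[OF c], of "[?a, ?b, ?a]"] assms by simp
  also have "eqz ([?a, ?b] @ [?a, ?a] @ [?b, ?a, ?b, ?a, ?b]) ([?a, ?b] @ [] @ [?b, ?a, ?b, ?a, ?b])"
    by (rule eqz_context[OF eqz_sq]) (use assms in auto)
  then have "eqz ([?a, ?b, ?a] @ [?a, ?b, ?a, ?b, ?a, ?b]) ([?a] @ [?b, ?b] @ [?a, ?b, ?a, ?b])" by simp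
  also have "eqz ([?a] @ [?b, ?b] @ [?a, ?b, ?a, ?b]) ([?a] @ [] @ [?a, ?b, ?a, ?b])"
    by (rule eqz_context[OF eqz_sq]) (use assms in auto)
  also have "eqz ([] @ [?a, ?a] @ [?b, ?a, ?b]) ([] @ [] @ [?b, ?a, ?b])"
    by (rule eqz_context[OF eqz_sq]) (use assms in auto)
  then have "eqz ([?a] @ [] @ [?a, ?b, ?a, ?b]) [?b, ?a, ?b]" by simp
  finally show ?thesis by (rule eqz_sym)
qed

lemma eqz_move:
  assumes "set is \<subseteq> {1..<n}" "j \<in> {1..<n}" "\<And>i. i \<in> set is \<Longrightarrow> i > j + 1 \<or> j > i + 1"
  shows "eqz (is @ [j]) (j # is)"
  using assms
proof (induction "is")
  case Nil
  then show ?case by (simp add: eqz_refl)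
next
  case (Cons i "is")
  have "eqz ([i] @ (is @ [j])) ([i] @ (j # is))"
    using Cons by (intro eqz_append eqz_refl Cons.IH) auto
  moreover have "eqz ([i, j] @ is) ([j, i] @ is)"
    using Cons.prems by (intro eqz_append eqz_refl eqz_far) auto
  ultimately show ?case using eqz_trans[of "i # is @ [j]" "i # j # is" "j # i # is"] by simp
qed

text \<open>The coset decomposition of S_{m+1} over S_m on the level of words: the descending run
  t_m ... t_k represents the coset and is empty for k = m + 1. Appending a letter t_j shortens the
  run, lengthens it, or passes through it into the shorter word.\<close>

lemma spin_normal_form:
  assumes "m < n" "set u \<subseteq> {1..m}"
  shows "\<exists>w k. set w \<subseteq> {1..<m} \<and> 1 \<le> k \<and> k \<le> m + 1 \<and> eqz u (w @ rev [k..<m + 1])"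
  using assms(2)
proof (induction u rule: rev_induct)
  case Nil
  show ?case by (intro exI[of _ "[]"] exI[of _ "m + 1"]) (simp add: eqz_refl)
next
  case (snoc j u)
  obtain w k where w: "set w \<subseteq> {1..<m}" "1 \<le> k" "k \<le> m + 1" "eqz u (w @ rev [k..<m + 1])"
    using snoc by auto
  have j: "1 \<le> j" "j \<le> m" "j \<in> {1..<n}" using snoc.prems assms(1) by auto
  have wn: "set w \<subseteq> {1..<n}" using w(1) assms(1) by auto
  have e0: "eqz (u @ [j]) (w @ (rev [k..<m + 1] @ [j]))"
    using eqz_append[OF w(4) eqz_refl, of "[j]"] j(3) by simp
  consider "j = k" | "j + 1 = k" | "j + 1 < k" | "k < j" by linarith
  then show ?case
  proof cases
    case 1
    have r: "rev [k..<m + 1] = rev [k + 1..<m + 1] @ [k]" using 1 j upt_conv_Cons[of k "m + 1"] by simp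
    have "eqz ((w @ rev [k + 1..<m + 1]) @ [k, k] @ []) ((w @ rev [k + 1..<m + 1]) @ [] @ [])"
      by (rule eqz_context[OF eqz_sq]) (use 1 j wn assms(1) in auto)
    then have "eqz (w @ (rev [k..<m + 1] @ [j])) (w @ rev [k + 1..<m + 1])" unfolding r using 1 by simp
    then have "eqz (u @ [j]) (w @ rev [k + 1..<m + 1])" by (rule eqz_trans[OF e0])
    then show ?thesis using w 1 j by (intro exI[of _ w] exI[of _ "k + 1"]) auto
  next
    case 2
    have "rev [k..<m + 1] @ [j] = rev [j..<m + 1]" using 2 j upt_conv_Cons[of j "m + 1"] by simp
    then have "eqz (u @ [j]) (w @ rev [j..<m + 1])" using e0 by (simp only:)
    then show ?thesis using w(1) j by (intro exI[of _ w] exI[of _ j]) auto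
  next
    case 3
    have "eqz (w @ (rev [k..<m + 1] @ [j])) (w @ (j # rev [k..<m + 1]))"
      by (intro eqz_append eqz_refl wn eqz_move j) (use 3 assms(1) w in auto)
    then have "eqz (u @ [j]) ((w @ [j]) @ rev [k..<m + 1])" using eqz_trans[OF e0] by simp
    then show ?thesis using w 3 j by (intro exI[of _ "w @ [j]"] exI[of _ k]) auto
  next
    case 4
    \<comment> \<open>For k < j the letter t_j first passes the letters below j - 1. The braid
      relation then turns t_j t_{j-1} t_j into t_{j-1} t_j t_{j-1}, and t_{j-1} moves on past the
      letters above j. The run is restored and the letter leaves it with its index lowered by
      one.\<close>
    have s: "[k..<m + 1] = [k..<j - 1] @ [j - 1, j] @ [j + 1..<m + 1]"
    proof -
      have "[k..<m + 1] = [k..<j - 1] @ [j - 1..<m + 1]"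
        using 4 j upt_add_eq_append[of k "j - 1" "m + 2 - j"] by simp
      also have "[j - 1..<m + 1] = (j - 1) # j # [j + 1..<m + 1]"
        using 4 j upt_conv_Cons[of "j - 1" "m + 1"] upt_conv_Cons[of j "m + 1"] by simp
      finally show ?thesis by simp
    qed
    let ?h = "rev [j + 1..<m + 1]" and ?l = "rev [k..<j - 1]"
    have r: "rev [k..<m + 1] = ?h @ [j, j - 1] @ ?l" unfolding s by simp
    have sub: "set ?h \<subseteq> {1..<n}" "set ?l \<subseteq> {1..<n}" "j - 1 \<in> {1..<n}" using w j assms(1) 4 by auto
    have "eqz (?l @ [j]) (j # ?l)" by (rule eqz_move[OF sub(2) j(3)]) auto
    then have "eqz (?h @ [j, j - 1] @ ?l @ [j]) (?h @ [j, j - 1] @ (j # ?l))"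
      by (intro eqz_append eqz_refl sub) (use j sub in auto)
    also have "?h @ [j, j - 1] @ (j # ?l) = ?h @ [(j - 1) + 1, j - 1, (j - 1) + 1] @ ?l" using 4 by simp
    also have "eqz \<dots> (?h @ [j - 1, (j - 1) + 1, j - 1] @ ?l)"
      by (rule eqz_context[OF eqz_braid]) (use sub j 4 in auto)
    also have "?h @ [j - 1, (j - 1) + 1, j - 1] @ ?l = (?h @ [j - 1]) @ [j, j - 1] @ ?l" using 4 by simp
    also have "eqz \<dots> (((j - 1) # ?h) @ [j, j - 1] @ ?l)"
      by (intro eqz_append eqz_move eqz_refl sub) (use j sub in auto)
    finally have "eqz (rev [k..<m + 1] @ [j]) ((j - 1) # rev [k..<m + 1])" unfolding r by simp
    then have "eqz (w @ (rev [k..<m + 1] @ [j])) (w @ ((j - 1) # rev [k..<m + 1]))"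
      by (intro eqz_append eqz_refl wn)
    then have "eqz (u @ [j]) ((w @ [j - 1]) @ rev [k..<m + 1])" using eqz_trans[OF e0] by simp
    then show ?thesis using w 4 j by (intro exI[of _ "w @ [j - 1]"] exI[of _ k]) auto
  qed
qed

end

section \<open>Kernel and image of the projection to the symmetric group\<close>

definition tperm :: "nat list \<Rightarrow> nat \<Rightarrow> nat" where
  "tperm is = foldr (\<lambda>i f. transpose i (i + 1) \<circ> f) is id"

lemma tperm_simps [simp]:
  "tperm [] = id" "tperm (i # is) = transpose i (i + 1) \<circ> tperm is"
  by (simp_all add: tperm_def)

lemma tperm_append: "tperm (is @ js) = tperm is \<circ> tperm js"
  by (induction "is") (auto simp: o_assoc)

context
  fixes n :: nat
begin

interpretation S: group "spin_group n"
  unfolding spin_group_def by (rule presented_group_group)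

lemma spin_perm_word:
  assumes "set gs \<subseteq> spin_gens n"
  shows "spin_perm n (spin_word n gs) = foldr (\<lambda>g f. (case g of Zgen \<Rightarrow> id | Tgen i \<Rightarrow> transpose i (i + 1)) \<circ> f) gs id"
proof -
  let ?\<phi> = "\<lambda>g. case g of Zgen \<Rightarrow> id | Tgen i \<Rightarrow> transpose i (i + 1)"
  have 1: "?\<phi> \<in> spin_gens n \<rightarrow> carrier (sym_group n)"
    by (auto simp: spin_gens_def sym_group_carrier permutes_id intro!: permutes_swap_id)
  have 2: "word_eval (sym_group n) ?\<phi> u = word_eval (sym_group n) ?\<phi> v" if "(u, v) \<in> spin_rels n" for u v
    using that by (auto simp: spin_rels_def word_eval_def sym_group_mult sym_group_one numeral_3_eq_3
        fun_eq_iff transpose_def)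
  have "spin_perm n (spin_word n gs) = word_eval (sym_group n) ?\<phi> (pos_word gs)"
    unfolding spin_perm_def spin_word_def
    by (rule pres_lift_class[OF sym_group_is_group 1 2]) (use assms in auto)
  also have "\<dots> = foldr (\<lambda>g f. ?\<phi> g \<circ> f) gs id"
    by (induction gs) (simp_all add: word_eval_def sym_group_mult sym_group_one)
  finally show ?thesis .
qed

lemma spin_perm_tw: "set is \<subseteq> {1..<n} \<Longrightarrow> spin_perm n (tw n is) = tperm is"
  unfolding tw_def
  by (subst spin_perm_word, force) (induction "is", simp_all)

lemma spin_perm_Zs: "spin_perm n (Zs n) = id"
  by (subst spin_perm_word) (simp_all)

lemma spin_perm_mult:
  "A \<in> carrier (spin_group n) \<Longrightarrow> B \<in> carrier (spin_group n) \<Longrightarrow>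
     spin_perm n (A \<otimes>\<^bsub>spin_group n\<^esub> B) = spin_perm n A \<circ> spin_perm n B"
  using hom_mult[OF spin_perm_hom] by (simp add: sym_group_mult)

lemma spin_perm_permutes: "A \<in> carrier (spin_group n) \<Longrightarrow> spin_perm n A permutes {1..n}"
  using hom_in_carrier[OF spin_perm_hom] by (simp add: sym_group_carrier)

lemma spin_perm_inv:
  assumes "A \<in> carrier (spin_group n)"
  shows "spin_perm n (inv\<^bsub>spin_group n\<^esub> A) = inv' (spin_perm n A)"
proof -
  have 1: "spin_perm n (inv\<^bsub>spin_group n\<^esub> A) \<circ> spin_perm n A = id"
    using spin_perm_mult[of "inv\<^bsub>spin_group n\<^esub> A" A] assms spin_perm_tw[of "[]"] by (simp add: tw_Nil)
  have 2: "spin_perm n A \<circ> spin_perm n (inv\<^bsub>spin_group n\<^esub> A) = id"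
    using spin_perm_mult[of A "inv\<^bsub>spin_group n\<^esub> A"] assms spin_perm_tw[of "[]"] by (simp add: tw_Nil)
  show ?thesis using inv_unique_comp[OF 2 1] by simp
qed

lemma tperm_rev_desc: "k \<le> m \<Longrightarrow> tperm (rev [k..<m + 1]) k = m + 1"
proof (induction m)
  case (Suc m)
  show ?case
  proof (cases "k = Suc m")
    case False
    then show ?thesis using Suc by (simp add: transpose_def)
  qed simp
qed simp

lemma tperm_fix: "\<forall>i\<in>set is. x \<noteq> i \<and> x \<noteq> i + 1 \<Longrightarrow> tperm is x = x"
  by (induction "is") (auto simp: transpose_def)

lemma eqz_tperm:
  assumes "eqz n is js" shows "tperm is = tperm js"
proof -
  have s: "set is \<subseteq> {1..<n}" "set js \<subseteq> {1..<n}" using assms by (auto simp: eqz_def)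
  have "spin_perm n (tw n is) = spin_perm n (tw n js)"
    using assms tw_closed[OF s(2)] by (auto simp: eqz_def spin_perm_mult spin_perm_Zs)
  then show ?thesis using s by (simp add: spin_perm_tw)
qed

text \<open>A nonempty descending run carries k to the top point, which the shorter word fixes. If
  the product is the identity, the run must be empty, and the induction hypothesis applies to the
  shorter word.\<close>

lemma tperm_id_eqz: "m < n \<Longrightarrow> set u \<subseteq> {1..m} \<Longrightarrow> tperm u = id \<Longrightarrow> eqz n u []"
proof (induction m arbitrary: u)
  case 0
  then show ?case by (simp add: eqz_refl)
next
  case (Suc m)
  obtain w k where w: "set w \<subseteq> {1..<Suc m}" "1 \<le> k" "k \<le> Suc m + 1" "eqz n u (w @ rev [k..<Suc m + 1])"
    using spin_normal_form[OF Suc.prems(1,2)] by blast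
  have id: "tperm w (tperm (rev [k..<Suc m + 1]) k) = k"
    using eqz_tperm[OF w(4)] Suc.prems(3) by (simp add: tperm_append fun_eq_iff del: upt_Suc)
  have "k = Suc m + 1"
  proof (rule ccontr)
    assume "k \<noteq> Suc m + 1"
    then have k: "k \<le> Suc m" using w by simp
    have "tperm w (Suc m + 1) = Suc m + 1" by (rule tperm_fix) (use w(1) in auto)
    then show False using id tperm_rev_desc[OF k] k by simp
  qed
  then have u: "eqz n u w" using w(4) by simp
  have "eqz n w []"
  proof (rule Suc.IH)
    show "tperm w = id" by (rule trans[OF eqz_tperm[OF u, symmetric] Suc.prems(3)])
    have "{1..<Suc m} \<subseteq> {1..m}" by auto
    then show "set w \<subseteq> {1..m}" using w(1) by (rule subset_trans[rotated])
  qed (use Suc.prems in simp)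
  then show ?case using eqz_trans[OF u] by simp
qed

lemma spin_perm_kernel:
  assumes A: "A \<in> carrier (spin_group n)" and "spin_perm n A = id"
  shows "A = \<one>\<^bsub>spin_group n\<^esub> \<or> A = Zs n"
proof -
  obtain "is" where i: "set is \<subseteq> {1..<n}" "A = tw n is \<or> A = Zs n \<otimes>\<^bsub>spin_group n\<^esub> tw n is"
    by (rule spin_elt_cases[OF A])
  have c: "tw n is \<in> carrier (spin_group n)" by (rule tw_closed[OF i(1)])
  have "tperm is = id" using i assms(2) c by (auto simp: spin_perm_mult spin_perm_Zs spin_perm_tw)
  have "eqz n is []"
  proof (cases "n = 0")
    case True
    then show ?thesis using i(1) by (simp add: eqz_refl)
  next
    case False
    have "{1..<n} \<subseteq> {1..n - 1}" by auto
    then have "set is \<subseteq> {1..n - 1}" using i(1) by (rule subset_trans[rotated])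
    then show ?thesis using False \<open>tperm is = id\<close> by (intro tperm_id_eqz[of "n - 1"]) auto
  qed
  then have "tw n is = \<one>\<^bsub>spin_group n\<^esub> \<or> tw n is = Zs n" by (auto simp: eqz_def tw_Nil)
  then show ?thesis using i(2) Zs_sq by auto
qed

lemma spin_perm_eq:
  assumes A: "A \<in> carrier (spin_group n)" and B: "B \<in> carrier (spin_group n)"
    and e: "spin_perm n A = spin_perm n B"
  shows "A = B \<or> A = Zs n \<otimes>\<^bsub>spin_group n\<^esub> B"
proof -
  let ?C = "A \<otimes>\<^bsub>spin_group n\<^esub> inv\<^bsub>spin_group n\<^esub> B"
  have "spin_perm n ?C = id"
    using A B e permutes_bij[OF spin_perm_permutes[OF B]]
    by (simp add: spin_perm_mult spin_perm_inv permutes_inv_o[OF spin_perm_permutes[OF B]])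
  then have "?C = \<one>\<^bsub>spin_group n\<^esub> \<or> ?C = Zs n" using A B by (intro spin_perm_kernel) auto
  moreover have "A = ?C \<otimes>\<^bsub>spin_group n\<^esub> B" using A B by (simp add: S.m_assoc)
  ultimately show ?thesis using B by auto
qed

lemma spin_perm_surj:
  assumes "\<pi> permutes {1..n}"
  shows "\<exists>A\<in>carrier (spin_group n). spin_perm n A = \<pi>"
proof -
  let ?I = "spin_perm n ` carrier (spin_group n)"
  have mult: "f \<circ> h \<in> ?I" if fh: "f \<in> ?I" "h \<in> ?I" for f h
  proof -
    obtain A B where "A \<in> carrier (spin_group n)" "f = spin_perm n A" "B \<in> carrier (spin_group n)" "h = spin_perm n B"
      using fh by auto
    then show ?thesis using spin_perm_mult[of A B]
      by (intro image_eqI[of _ _ "A \<otimes>\<^bsub>spin_group n\<^esub> B"]) auto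
  qed
  have adj: "transpose i (i + 1) \<in> ?I" if i: "i \<in> {1..<n}" for i
    using spin_perm_tw[of "[i]"] tw_closed[of "[i]" n] i by (intro image_eqI[of _ _ "tw n [i]"]) auto
  have tr: "transpose i (i + d) \<in> ?I" if "1 \<le> i" "i + d \<le> n" for i d
    using that
  proof (induction d)
    case 0
    have "id \<in> ?I" using spin_perm_tw[of "[]"] tw_closed[of "[]" n] by (intro image_eqI[of _ _ "tw n []"]) auto
    then show ?case by (simp add: id_def)
  next
    case (Suc d)
    show ?case
    proof (cases "d = 0")
      case True
      then show ?thesis using adj[of i] Suc.prems by simp
    next
      case False
      have a: "transpose (i + d) (i + d + 1) \<in> ?I" using Suc.prems False by (intro adj) auto
      \<comment> \<open>Conjugating by an adjacent transposition moves the upper point up by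
        one.\<close>
      have "transpose i (i + Suc d) = transpose (i + d) (i + d + 1) \<circ> transpose i (i + d) \<circ> transpose (i + d) (i + d + 1)"
        using False by (auto simp: fun_eq_iff transpose_def)
      moreover have "transpose i (i + d) \<in> ?I" using Suc by simp
      ultimately show ?thesis using mult[OF mult[OF a _] a, of "transpose i (i + d)"] by (simp only:)
    qed
  qed
  have tr': "transpose i j \<in> ?I" if ij: "i \<in> {1..n}" "j \<in> {1..n}" for i j
  proof (cases "i \<le> j")
    case True
    then show ?thesis using tr[of i "j - i"] ij by simp
  next
    case False
    then show ?thesis using tr[of j "i - j"] ij by (simp add: transpose_commute)
  qed
  have "\<pi> \<in> ?I"
    using assms finite_atLeastAtMost
  proof (induction rule: permutes_induct)
    show "id \<in> ?I" using tr[of 1 0] spin_perm_tw[of "[]"] tw_closed[of "[]" n] by (intro image_eqI[of _ _ "tw n []"]) auto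
    show "transpose a b \<circ> p \<in> ?I" if "a \<in> {1..n}" "b \<in> {1..n}" "p \<in> ?I" for a b p
      using mult[OF tr'[OF that(1,2)] that(3)] .
  qed
  then show ?thesis by auto
qed

lemma finite_spin_group: "finite (carrier (spin_group n))"
proof -
  let ?P = "{\<pi>. \<pi> permutes {1..n}}"
  let ?L = "\<lambda>\<pi>. SOME A. A \<in> carrier (spin_group n) \<and> spin_perm n A = \<pi>"
  have "carrier (spin_group n) \<subseteq> ?L ` ?P \<union> (\<lambda>\<pi>. Zs n \<otimes>\<^bsub>spin_group n\<^esub> ?L \<pi>) ` ?P"
  proof
    fix A assume A: "A \<in> carrier (spin_group n)"
    let ?p = "spin_perm n A"
    have p: "?p \<in> ?P" using spin_perm_permutes[OF A] by simp
    have "?L ?p \<in> carrier (spin_group n) \<and> spin_perm n (?L ?p) = ?p"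
      by (rule someI[of "\<lambda>B. B \<in> carrier (spin_group n) \<and> spin_perm n B = ?p" A]) (use A in simp)
    then have "A = ?L ?p \<or> A = Zs n \<otimes>\<^bsub>spin_group n\<^esub> ?L ?p" by (intro spin_perm_eq[OF A]) auto
    then show "A \<in> ?L ` ?P \<union> (\<lambda>\<pi>. Zs n \<otimes>\<^bsub>spin_group n\<^esub> ?L \<pi>) ` ?P"
      using imageI[OF p, of ?L] imageI[OF p, of "\<lambda>\<pi>. Zs n \<otimes>\<^bsub>spin_group n\<^esub> ?L \<pi>"] by auto
  qed
  moreover have "finite ?P" by (rule finite_permutations) simp
  ultimately show ?thesis by (meson finite_UnI finite_imageI finite_subset)
qed

end

section \<open>The Clifford algebra and its normalised trace\<close>

definition tog :: "nat \<Rightarrow> nat set \<Rightarrow> nat set" where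
  "tog i B = (if i \<in> B then B - {i} else insert i B)"

lemma tog_tog [simp]: "tog i (tog i B) = B" by (auto simp: tog_def)

lemma tog_commute: "tog i (tog j B) = tog j (tog i B)" by (auto simp: tog_def)

lemma tog_mem [simp]: "j \<in> tog i B \<longleftrightarrow> (if j = i then i \<notin> B else j \<in> B)" by (auto simp: tog_def)

text \<open>The sign for moving e_i from the left to its place in an ordered monomial, past the
  smaller generators.\<close>

definition lsgn :: "nat \<Rightarrow> nat set \<Rightarrow> real" where
  "lsgn i B = (-1) ^ card {a \<in> B. a < i}"

text \<open>The counterpart for multiplication from the right. The bound n keeps the counted set
  finite, since B is an arbitrary set of naturals.\<close>

definition rsgn :: "nat \<Rightarrow> nat \<Rightarrow> nat set \<Rightarrow> real" where
  "rsgn n i B = (-1) ^ card {a \<in> B. i < a \<and> a \<le> n}"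

lemma parity_tog:
  assumes "finite {a \<in> B. P a}"
  shows "(-1 :: real) ^ card {a \<in> tog j B. P a} = (if P j then - ((-1) ^ card {a \<in> B. P a}) else (-1) ^ card {a \<in> B. P a})"
proof (cases "P j")
  case False
  then have "{a \<in> tog j B. P a} = {a \<in> B. P a}" by auto
  then show ?thesis using False by simp
next
  case True
  show ?thesis
  proof (cases "j \<in> B")
    case j: True
    let ?S = "{a \<in> B. P a}"
    have e: "{a \<in> tog j B. P a} = ?S - {j}" using j by auto
    have "card ?S = Suc (card (?S - {j}))"
      using assms j True by (intro card.remove) auto
    then show ?thesis using True unfolding e by simp
  next
    case j: False
    have e: "{a \<in> tog j B. P a} = insert j {a \<in> B. P a}" using j True by auto
    show ?thesis using assms j True unfolding e by simp
  qed
qed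

lemma lsgn_tog: "lsgn i (tog j B) = (if j < i then - lsgn i B else lsgn i B)"
  unfolding lsgn_def by (rule parity_tog) simp

lemma rsgn_tog: "rsgn n i (tog j B) = (if i < j \<and> j \<le> n then - rsgn n i B else rsgn n i B)"
  unfolding rsgn_def by (rule parity_tog) simp

lemma lsgn_sq [simp]: "lsgn i B * lsgn i B = 1" "lsgn i B * (lsgn i B * x) = x"
  by (simp_all add: lsgn_def power_add[symmetric] mult.assoc[symmetric])

text \<open>Left and right multiplication by the generator \<open>e\<^sub>i\<close> (with \<open>e\<^sub>i\<^sup>2 = -1\<close>) of the Clifford
  algebra, in the basis of monomials indexed by sets.\<close>

definition cl :: "nat \<Rightarrow> (nat set \<Rightarrow> real) \<Rightarrow> nat set \<Rightarrow> real" where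
  "cl i f B = lsgn i B * (if i \<in> B then 1 else -1) * f (tog i B)"

definition cr :: "nat \<Rightarrow> nat \<Rightarrow> (nat set \<Rightarrow> real) \<Rightarrow> nat set \<Rightarrow> real" where
  "cr n i f B = rsgn n i B * (if i \<in> B then 1 else -1) * f (tog i B)"

lemma cl_sq: "cl i (cl i f) B = - f B"
  by (simp add: cl_def lsgn_tog)

lemma cl_anti: "i \<noteq> j \<Longrightarrow> cl i (cl j f) B = - cl j (cl i f) B"
  by (auto simp: cl_def lsgn_tog tog_commute[of i j])

text \<open>Associativity of the Clifford product. The bound on i ensures that
  \<open>rsgn n j\<close> notices when i is toggled.\<close>

lemma cl_cr: "i \<le> n \<Longrightarrow> cl i (cr n j f) B = cr n j (cl i f) B"
  by (auto simp: cl_def cr_def lsgn_tog rsgn_tog tog_commute[of i j])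

text \<open>Left multiplication by (e_i - e_{i+1}) / sqrt 2, the unit normal of the reflection that
  exchanges i and i + 1. Its square is -1, in accordance with t_i^2 = z and z = -1.\<close>

definition ct :: "nat \<Rightarrow> (nat set \<Rightarrow> real) \<Rightarrow> nat set \<Rightarrow> real" where
  "ct i f B = (cl i f B - cl (i + 1) f B) / sqrt 2"

definition rt :: "nat \<Rightarrow> nat \<Rightarrow> (nat set \<Rightarrow> real) \<Rightarrow> nat set \<Rightarrow> real" where
  "rt n i f B = (cr n i f B - cr n (i + 1) f B) / sqrt 2"

lemma cl_linear:
  "cl i (\<lambda>B. f B + g B) B = cl i f B + cl i g B" "cl i (\<lambda>B. f B - g B) B = cl i f B - cl i g B"
  "cl i (\<lambda>B. - f B) B = - cl i f B" "cl i (\<lambda>B. f B / c) B = cl i f B / c"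
  by (simp_all add: cl_def algebra_simps add_divide_distrib)

lemma cr_linear:
  "cr n i (\<lambda>B. f B - g B) B = cr n i f B - cr n i g B" "cr n i (\<lambda>B. f B / c) B = cr n i f B / c"
  by (simp_all add: cr_def algebra_simps)

lemma ct_linear:
  "ct i (\<lambda>B. f B + g B) B = ct i f B + ct i g B" "ct i (\<lambda>B. f B - g B) B = ct i f B - ct i g B"
  "ct i (\<lambda>B. - f B) B = - ct i f B"
  by (simp_all add: ct_def cl_linear diff_divide_distrib add_divide_distrib)

lemma ct_fun: "ct i f = (\<lambda>B. (cl i f B - cl (i + 1) f B) / sqrt 2)"
  by (rule ext) (simp add: ct_def)

lemma rt_fun: "rt n i f = (\<lambda>B. (cr n i f B - cr n (i + 1) f B) / sqrt 2)"
  by (rule ext) (simp add: rt_def)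

lemma ct_ct: "ct i (ct j f) B = (cl i (cl j f) B - cl i (cl (j + 1) f) B - cl (i + 1) (cl j f) B + cl (i + 1) (cl (j + 1) f) B) / 2"
  unfolding ct_def[of i] unfolding ct_fun[of j] cl_linear by (simp add: field_simps)

lemma ct_sq: "ct i (ct i f) B = - f B"
  unfolding ct_ct cl_sq using cl_anti[of i "i + 1" f B] by simp

lemma ct_anti: "i > j + 1 \<or> j > i + 1 \<Longrightarrow> ct i (ct j f) B = - ct j (ct i f) B"
  unfolding ct_ct using cl_anti[of i j f B] cl_anti[of i "j + 1" f B] cl_anti[of "i + 1" j f B] cl_anti[of "i + 1" "j + 1" f B]
  by (auto simp: field_simps)

text \<open>The anticommutator of two vectors is -2 times their inner product, and the unit normals
  of adjacent reflections have inner product -1/2.\<close>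

lemma ct_adj: "ct i (ct (i + 1) f) B + ct (i + 1) (ct i f) B = f B"
  unfolding ct_ct cl_sq
  using cl_anti[of i "i + 1" f B] cl_anti[of i "i + 2" f B] cl_anti[of "i + 1" "i + 2" f B] by (simp add: field_simps)

text \<open>From XY + YX = 1 and X^2 = Y^2 = -1 follows (XY)^2 = XY - 1, hence (XY)^3 = (XY)^2 - XY
  = -1.\<close>

lemma ct_cube: "ct i (ct (i + 1) (ct i (ct (i + 1) (ct i (ct (i + 1) f))))) = (\<lambda>B. - f B)"
proof -
  let ?X = "ct i" and ?Y = "ct (i + 1)"
  have sqX: "?X (?X f) = (\<lambda>B. - f B)" and sqY: "?Y (?Y f) = (\<lambda>B. - f B)" for f
    by (rule ext, rule ct_sq)+
  have a: "?X (?Y (?X (?Y f))) = (\<lambda>B. ?X (?Y f) B - f B)" for f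
  proof -
    have 1: "?Y (?X (?Y f)) = (\<lambda>B. ?Y f B + ?X f B)"
    proof
      fix B
      have "?Y (?X (?Y f)) B = ?Y f B - ?X (?Y (?Y f)) B" using ct_adj[of i "?Y f" B] by simp
      also have "\<dots> = ?Y f B + ?X f B" unfolding sqY ct_linear by simp
      finally show "?Y (?X (?Y f)) B = ?Y f B + ?X f B" .
    qed
    show ?thesis
    proof
      fix B
      have "?X (?Y (?X (?Y f))) B = ?X (?Y f) B + ?X (?X f) B" unfolding 1 ct_linear ..
      then show "?X (?Y (?X (?Y f))) B = ?X (?Y f) B - f B" unfolding sqX by simp
    qed
  qed
  have "?X (?Y (?X (?Y (?X (?Y f))))) = (\<lambda>B. ?X (?Y (?X (?Y f))) B - ?X (?Y f) B)"
    by (rule a)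
  then show ?thesis unfolding a by simp
qed

lemma ct_rt:
  assumes "i + 1 \<le> n"
  shows "ct i (rt n j f) = rt n j (ct i f)"
proof
  fix B
  show "ct i (rt n j f) B = rt n j (ct i f) B"
    unfolding ct_def[of i "rt n j f"] rt_def[of n j "ct i f"] unfolding ct_fun rt_fun cl_linear cr_linear
    using assms by (simp add: cl_cr diff_divide_distrib)
qed

fun letter_act :: "spin_gen \<times> bool \<Rightarrow> (nat set \<Rightarrow> real) \<Rightarrow> nat set \<Rightarrow> real" where
  "letter_act (Zgen, b) f = (\<lambda>B. - f B)"
| "letter_act (Tgen i, True) f = ct i f"
| "letter_act (Tgen i, False) f = (\<lambda>B. - ct i f B)"

definition word_act :: "spin_gen word \<Rightarrow> (nat set \<Rightarrow> real) \<Rightarrow> nat set \<Rightarrow> real" where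
  "word_act u f = foldr letter_act u f"

lemma word_act_simps [simp]: "word_act [] f = f" "word_act (l # u) f = letter_act l (word_act u f)"
  by (simp_all add: word_act_def)

lemma word_act_append: "word_act (u @ v) f = word_act u (word_act v f)"
  by (simp add: word_act_def)

text \<open>All defining relations hold in the Clifford algebra with z = -1. In particular the
  inverse letter of t_i acts by the negative of \<open>ct i\<close>, because the square of
  \<open>ct i\<close> is -1.\<close>

lemma word_act_cong:
  assumes "pres_eq (spin_gens n) (spin_rels n) u v"
  shows "word_act u = word_act v"
  using assms
proof (induction rule: pres_eq.induct)
  case (pres_rel u v)
  have sq: "ct i (ct i f) = (\<lambda>B. - f B)" for i f by (rule ext, rule ct_sq)
  have neg: "ct i (\<lambda>B. - f B) = (\<lambda>B. - ct i f B)" for i f by (rule ext, rule ct_linear)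
  have far: "ct i (ct j f) = (\<lambda>B. - ct j (ct i f) B)" if "j + 1 < i" for i j f
    using that by (intro ext ct_anti) simp
  show ?case
    using pres_rel(1) ct_cube by (auto simp: spin_rels_def fun_eq_iff[of "word_act _"] numeral_3_eq_3 sq neg far)
next
  case (pres_cancel g b)
  have sq: "ct i (ct i f) = (\<lambda>B. - f B)" for i f by (rule ext, rule ct_sq)
  have neg: "ct i (\<lambda>B. - f B) = (\<lambda>B. - ct i f B)" for i f by (rule ext, rule ct_linear)
  show ?case by (rule ext, cases g; cases b) (simp_all add: sq neg)
next
  case (pres_append u u' v v')
  then show ?case by (simp add: fun_eq_iff[of "word_act _"] word_act_append)
qed simp_all

text \<open>The unit of the Clifford algebra.\<close>

definition vac :: "nat set \<Rightarrow> real" where "vac B = (if B = {} then 1 else 0)"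

text \<open>The normalised trace of an element of the spin group in the Clifford algebra.\<close>

definition spin_tr :: "spin_elt \<Rightarrow> real" where
  "spin_tr A = word_act (SOME u. u \<in> A) vac {}"

context
  fixes n :: nat
begin

interpretation S: group "spin_group n"
  unfolding spin_group_def by (rule presented_group_group)

abbreviation "pc \<equiv> pres_class (spin_gens n) (spin_rels n)"

lemma spin_tr_class:
  assumes "set u \<subseteq> spin_gens n \<times> UNIV"
  shows "spin_tr (pc u) = word_act u vac {}"
proof -
  have "(SOME v. v \<in> pc u) \<in> pc u"
    by (rule someI[of _ u]) (simp add: pres_class_def pres_refl[OF assms])
  then have "pres_eq (spin_gens n) (spin_rels n) u (SOME v. v \<in> pc u)" by (simp add: pres_class_def)
  from word_act_cong[OF this] show ?thesis by (simp add: spin_tr_def)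
qed

lemma vac_tog: "vac (tog i B) = (if B = {i} then 1 else 0)"
  by (auto simp: vac_def tog_def)

lemma sgn_single: "lsgn i {i} = 1" "rsgn n i {i} = 1"
proof -
  have "{a \<in> {i}. a < i} = {}" "{a \<in> {i}. i < a \<and> a \<le> n} = {}" by auto
  then show "lsgn i {i} = 1" "rsgn n i {i} = 1" unfolding lsgn_def rsgn_def by (simp_all only: card.empty power_0)
qed

text \<open>Left and right multiplication agree on the unit, and by \<open>ct_rt_empty\<close> they
  also agree in the coefficient of the unit. These two facts give the trace property.\<close>

lemma ct_vac: "ct i vac = rt n i vac"
  by (rule ext) (auto simp: ct_def rt_def cl_def cr_def vac_tog sgn_single)

lemma ct_rt_empty: "ct i f {} = rt n i f {}"
  by (simp add: ct_def rt_def cl_def cr_def lsgn_def rsgn_def)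

lemma rt_linear: "rt n i (\<lambda>B. - f B) = (\<lambda>B. - rt n i f B)"
  by (rule ext) (simp add: rt_def cr_def algebra_simps diff_divide_distrib)

lemma word_act_rt:
  assumes "set u \<subseteq> spin_gens n \<times> UNIV"
  shows "word_act u (rt n i f) = rt n i (word_act u f)"
  using assms
proof (induction u)
  case (Cons l u)
  obtain g b where l: "l = (g, b)" by force
  show ?case
    using Cons unfolding l by (cases g; cases b) (auto simp: ct_rt rt_linear)
qed simp

text \<open>The letters of v are moved one at a time. For a letter t, left and right multiplications
  commute, so u (t 1) = u (1 t) = (u 1) t, and the coefficient of the unit is the same in (u 1) t
  and t (u 1).\<close>

lemma spin_tr_swap:
  assumes u: "set u \<subseteq> spin_gens n \<times> UNIV" and v: "set v \<subseteq> spin_gens n \<times> UNIV"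
  shows "word_act (u @ v) vac {} = word_act (v @ u) vac {}"
  using u v
proof (induction v arbitrary: u)
  case (Cons l v)
  obtain g b where l: "l = (g, b)" by force
  have step: "word_act (u @ [l]) vac {} = word_act (l # u) vac {}" if u: "set u \<subseteq> spin_gens n \<times> UNIV" for u
  proof (cases g)
    case Zgen
    have neg: "word_act u (\<lambda>B. - f B) = (\<lambda>B. - word_act u f B)" for f
    proof (induction u)
      case (Cons a u)
      have ctn: "ct i (\<lambda>B. - f B) = (\<lambda>B. - ct i f B)" for i f by (rule ext, rule ct_linear)
      obtain h c where "a = (h, c)" by force
      then show ?case using Cons by (cases h; cases c) (simp_all add: ctn)
    qed simp
    show ?thesis by (simp add: l Zgen word_act_append neg)
  next
    case (Tgen i)
    have neg: "word_act u (\<lambda>B. - f B) = (\<lambda>B. - word_act u f B)" for f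
    proof (induction u)
      case (Cons a u)
      have ctn: "ct i (\<lambda>B. - f B) = (\<lambda>B. - ct i f B)" for i f by (rule ext, rule ct_linear)
      obtain h c where "a = (h, c)" by force
      then show ?case using Cons by (cases h; cases c) (simp_all add: ctn)
    qed simp
    have "word_act u (ct i vac) {} = ct i (word_act u vac) {}"
      unfolding ct_vac word_act_rt[OF u] ct_rt_empty ..
    then show ?thesis by (cases b) (simp_all add: l Tgen word_act_append neg)
  qed
  have lv: "set [l] \<subseteq> spin_gens n \<times> UNIV" "set v \<subseteq> spin_gens n \<times> UNIV" using Cons.prems by auto
  have "word_act (u @ l # v) vac {} = word_act ((u @ [l]) @ v) vac {}" by simp
  also have "\<dots> = word_act (v @ (u @ [l])) vac {}" by (rule Cons.IH) (use Cons.prems in auto)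
  also have "\<dots> = word_act ((v @ u) @ [l]) vac {}" by simp
  also have "\<dots> = word_act (l # (v @ u)) vac {}" by (rule step) (use Cons.prems in auto)
  finally show ?case by simp
qed simp

lemma spin_tr_mult_commute:
  assumes "A \<in> carrier (spin_group n)" "B \<in> carrier (spin_group n)"
  shows "spin_tr (A \<otimes>\<^bsub>spin_group n\<^esub> B) = spin_tr (B \<otimes>\<^bsub>spin_group n\<^esub> A)"
proof -
  obtain u v where uv: "set u \<subseteq> spin_gens n \<times> UNIV" "A = pc u" "set v \<subseteq> spin_gens n \<times> UNIV" "B = pc v"
    using assms unfolding carrier_spin_group by blast
  have "A \<otimes>\<^bsub>spin_group n\<^esub> B = pc (u @ v)" "B \<otimes>\<^bsub>spin_group n\<^esub> A = pc (v @ u)"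
    unfolding uv spin_group_def by (intro presented_mult uv)+
  then show ?thesis using uv spin_tr_swap[OF uv(1,3)] by (simp add: spin_tr_class)
qed

lemma spin_tr_conj:
  assumes "A \<in> carrier (spin_group n)" "B \<in> carrier (spin_group n)"
  shows "spin_tr (B \<otimes>\<^bsub>spin_group n\<^esub> A \<otimes>\<^bsub>spin_group n\<^esub> inv\<^bsub>spin_group n\<^esub> B) = spin_tr A"
proof -
  have "spin_tr (B \<otimes>\<^bsub>spin_group n\<^esub> A \<otimes>\<^bsub>spin_group n\<^esub> inv\<^bsub>spin_group n\<^esub> B)
      = spin_tr (inv\<^bsub>spin_group n\<^esub> B \<otimes>\<^bsub>spin_group n\<^esub> (B \<otimes>\<^bsub>spin_group n\<^esub> A))"
    using assms by (intro spin_tr_mult_commute) auto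
  also have "inv\<^bsub>spin_group n\<^esub> B \<otimes>\<^bsub>spin_group n\<^esub> (B \<otimes>\<^bsub>spin_group n\<^esub> A) = A"
    using assms by (simp add: S.m_assoc[symmetric])
  finally show ?thesis .
qed

lemma spin_tr_Zs:
  assumes "A \<in> carrier (spin_group n)"
  shows "spin_tr (Zs n \<otimes>\<^bsub>spin_group n\<^esub> A) = - spin_tr A"
proof -
  obtain u where u: "set u \<subseteq> spin_gens n \<times> UNIV" "A = pc u"
    using assms unfolding carrier_spin_group by blast
  have "Zs n \<otimes>\<^bsub>spin_group n\<^esub> A = pc ([(Zgen, True)] @ u)"
    unfolding u spin_group_def spin_word_def using u(1) by (subst presented_mult) auto
  then show ?thesis using u by (simp add: spin_tr_class)
qed

text \<open>The inner product for which the monomials in e_1, ..., e_n are orthonormal. Each e_i is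
  skew-adjoint, so inverting a word amounts to taking the adjoint; this yields
  \<open>spin_tr_inv\<close>.\<close>

definition pairing :: "(nat set \<Rightarrow> real) \<Rightarrow> (nat set \<Rightarrow> real) \<Rightarrow> real" where
  "pairing f g = (\<Sum>B\<in>Pow {1..n}. f B * g B)"

lemma pairing_cl: "i \<in> {1..n} \<Longrightarrow> pairing (cl i f) g = - pairing f (cl i g)"
proof -
  assume i: "i \<in> {1..n}"
  let ?h = "\<lambda>B. cl i f B * g B"
  have "pairing (cl i f) g = (\<Sum>B\<in>Pow {1..n}. ?h (tog i B))"
    unfolding pairing_def
    by (rule sum.reindex_bij_witness[where i = "tog i" and j = "tog i"])
      (use i in \<open>auto simp: tog_def insert_absorb split: if_splits\<close>)
  also have "\<dots> = - pairing f (cl i g)"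
    unfolding pairing_def cl_def sum_negf[symmetric] by (intro sum.cong) (simp_all add: lsgn_tog)
  finally show ?thesis .
qed

lemma pairing_ct:
  assumes "i \<in> {1..<n}" shows "pairing (ct i f) g = - pairing f (ct i g)"
proof -
  have "pairing (ct i f) g = (pairing (cl i f) g - pairing (cl (i + 1) f) g) / sqrt 2"
    by (simp add: pairing_def ct_def sum_subtractf[symmetric] sum_divide_distrib algebra_simps diff_divide_distrib)
  also have "\<dots> = - (pairing f (cl i g) - pairing f (cl (i + 1) g)) / sqrt 2"
    using assms by (simp add: pairing_cl)
  also have "\<dots> = - pairing f (ct i g)"
    by (simp add: pairing_def ct_def sum_subtractf[symmetric] sum_divide_distrib algebra_simps diff_divide_distrib)
  finally show ?thesis .
qed

lemma pairing_neg: "pairing (\<lambda>B. - f B) g = - pairing f g" "pairing f (\<lambda>B. - g B) = - pairing f g"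
  by (simp_all add: pairing_def sum_negf)

lemma pairing_word:
  "set u \<subseteq> spin_gens n \<times> UNIV \<Longrightarrow>
    pairing (word_act u f) g = pairing f (word_act (rev (map (\<lambda>(g, b). (g, \<not> b)) u)) g)"
proof (induction u arbitrary: g)
  case (Cons l u)
  obtain h b where l: "l = (h, b)" by force
  have "pairing (letter_act l f') g = pairing f' (letter_act (h, \<not> b) g)" for f'
    using Cons.prems unfolding l
    by (cases h; cases b) (auto simp: pairing_neg pairing_ct)
  then show ?case using Cons by (simp add: l word_act_append)
qed simp

lemma pairing_vac: "pairing f vac = f {}" "pairing vac f = f {}"
proof -
  have "pairing f vac = (\<Sum>B\<in>Pow {1..n}. if B = {} then f B else 0)"
    unfolding pairing_def vac_def by (intro sum.cong) auto
  then show "pairing f vac = f {}" by simp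
  then show "pairing vac f = f {}" by (simp add: pairing_def mult.commute)
qed

lemma spin_tr_inv:
  assumes "A \<in> carrier (spin_group n)"
  shows "spin_tr (inv\<^bsub>spin_group n\<^esub> A) = spin_tr A"
proof -
  obtain u where u: "set u \<subseteq> spin_gens n \<times> UNIV" "A = pc u"
    using assms unfolding carrier_spin_group by blast
  let ?i = "rev (map (\<lambda>(g, b). (g, \<not> b)) u)"
  have i: "set ?i \<subseteq> spin_gens n \<times> UNIV" using u(1) by auto
  have "pc ?i \<otimes>\<^bsub>spin_group n\<^esub> A = pc (?i @ u)"
    unfolding u(2) spin_group_def by (rule presented_mult[OF i u(1)])
  also have "\<dots> = \<one>\<^bsub>spin_group n\<^esub>"
    unfolding spin_one spin_word_def list.map using pres_inverse[OF u(1)] i u(1) by (subst pres_class_eq_iff) auto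
  finally have "inv\<^bsub>spin_group n\<^esub> A = pc ?i"
    using i assms by (intro S.inv_equality) (auto simp: carrier_spin_group)
  then have "spin_tr (inv\<^bsub>spin_group n\<^esub> A) = pairing vac (word_act ?i vac)"
    by (simp add: spin_tr_class[OF i] pairing_vac)
  also have "\<dots> = pairing (word_act u vac) vac" by (rule pairing_word[OF u(1), symmetric])
  also have "\<dots> = spin_tr A" by (simp add: u(2) spin_tr_class[OF u(1)] pairing_vac)
  finally show ?thesis .
qed

text \<open>The word lies in the subalgebra generated by e_s, e_{s+1}, ..., since t_i involves only
  e_i and e_{i+1}.\<close>

lemma word_act_support:
  assumes "\<forall>i\<in>set is. s \<le> i" "word_act (pos_word (map Tgen is)) vac B \<noteq> 0"
  shows "B \<subseteq> {s..}"
  using assms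
proof (induction "is" arbitrary: B)
  case Nil
  then show ?case by (simp add: vac_def split: if_splits)
next
  case (Cons i "is")
  let ?f = "word_act (pos_word (map Tgen is)) vac"
  have "cl i ?f B \<noteq> 0 \<or> cl (i + 1) ?f B \<noteq> 0"
    using Cons.prems(2) by (auto simp: ct_def)
  then have "?f (tog i B) \<noteq> 0 \<or> ?f (tog (i + 1) B) \<noteq> 0" unfolding cl_def by fastforce
  then obtain j where j: "j \<ge> i" "?f (tog j B) \<noteq> 0" by (metis le_add1 order_refl)
  have "tog j B \<subseteq> {s..}" using Cons j(2) by simp
  then show ?case using Cons.prems(1) j(1) by (force simp: tog_def split: if_splits)
qed

text \<open>t_a t_{a+1} = (1 + e_a e_{a+1} - e_a e_{a+2} + e_{a+1} e_{a+2}) / 2, and the remaining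
  letters involve neither e_a nor e_{a+1}. So only the constant term 1/2 contributes to the
  coefficient of the unit.\<close>

lemma word_act_pair:
  assumes "\<forall>i\<in>set is. a + 2 \<le> i"
  shows "word_act (pos_word (map Tgen (a # (a + 1) # is))) vac {} = word_act (pos_word (map Tgen is)) vac {} / 2"
proof -
  let ?f = "word_act (pos_word (map Tgen is)) vac"
  have z: "?f {a, a + 1} = 0" "?f {a, a + 2} = 0" "?f {a + 1, a + 2} = 0"
    using word_act_support[OF assms, of "{a, a + 1}"] word_act_support[OF assms, of "{a, a + 2}"]
      word_act_support[OF assms, of "{a + 1, a + 2}"] by fastforce+
  have t: "tog (a + 1) (tog a {}) = {a, a + 1}" "tog (a + 2) (tog a {}) = {a, a + 2}" "tog (a + 2) (tog (a + 1) {}) = {a + 1, a + 2}"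
    by (auto simp: tog_def)
  have "cl a (cl (a + 1) ?f) {} = 0" "cl a (cl (a + 2) ?f) {} = 0" "cl (a + 1) (cl (a + 2) ?f) {} = 0"
    unfolding cl_def t z by simp_all
  then have "ct a (ct (a + 1) ?f) {} = ?f {} / 2"
    unfolding ct_ct cl_sq by simp
  then show ?thesis by simp
qed

text \<open>An interval of odd length 2k + 1 carries 2k letters, that is k pairs, each of which
  contributes a factor 1/2. This is why odd parts lead to a positive trace.\<close>

lemma word_act_block:
  assumes "\<forall>i\<in>set is. a + 2 * k + 1 \<le> i"
  shows "word_act (pos_word (map Tgen ([a..<a + 2 * k] @ is))) vac {} = word_act (pos_word (map Tgen is)) vac {} / 2 ^ k"
  using assms
proof (induction k arbitrary: a)
  case (Suc k)
  have u: "[a..<a + 2 * Suc k] = a # (a + 1) # [a + 2..<(a + 2) + 2 * k]"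
    using upt_conv_Cons[of a "a + 2 * Suc k"] upt_conv_Cons[of "a + 1" "a + 2 * Suc k"] by simp
  have "word_act (pos_word (map Tgen ([a..<a + 2 * Suc k] @ is))) vac {}
      = word_act (pos_word (map Tgen ([a + 2..<(a + 2) + 2 * k] @ is))) vac {} / 2"
    unfolding u append_Cons by (rule word_act_pair) (use Suc.prems in auto)
  also have "\<dots> = word_act (pos_word (map Tgen is)) vac {} / 2 ^ Suc k"
    using Suc.IH[of "a + 2"] Suc.prems by simp
  finally show ?case .
qed simp

lemma spin_tr_tw: "set is \<subseteq> {1..<n} \<Longrightarrow> spin_tr (tw n is) = word_act (pos_word (map Tgen is)) vac {}"
  unfolding tw_def spin_word_def by (rule spin_tr_class) auto

end

section \<open>Permutations made of cycles on consecutive intervals\<close>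

definition block_word :: "(nat \<times> nat \<times> 'c) list \<Rightarrow> nat list" where
  "block_word ivs = concat (map (\<lambda>(a, b, c). [a..<b]) ivs)"

lemma block_word_simps [simp]:
  "block_word [] = []" "block_word ((a, b, c) # ivs) = [a..<b] @ block_word ivs"
  by (simp_all add: block_word_def)

definition block_total :: "(nat \<times> 'c) list \<Rightarrow> nat" where "block_total ps = sum_list (map fst ps)"

lemma block_total_simps [simp]: "block_total [] = 0" "block_total ((k, c) # ps) = k + block_total ps"
  by (simp_all add: block_total_def)

lemma block_word_range:
  assumes "\<forall>p\<in>set ps. 0 < fst p" "i \<in> set (block_word (cut_intervals a ps))"
  shows "a \<le> i \<and> i + 1 < a + block_total ps"
  using assms
proof (induction ps arbitrary: a)
  case (Cons p ps)
  obtain k c where p: "p = (k, c)" by force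
  have IH: "a + k \<le> i \<and> i + 1 < a + k + block_total ps" if "i \<in> set (block_word (cut_intervals (a + k) ps))"
    using Cons.IH[of "a + k"] Cons.prems that by simp
  then show ?case using Cons.prems by (auto simp: p)
qed simp

lemma intervals_range:
  assumes "\<forall>p\<in>set ps. 0 < fst p" "(a', b', c) \<in> set (cut_intervals a ps)"
  shows "a \<le> a' \<and> a' \<le> b' \<and> b' < a + block_total ps \<and> (b' + 1 - a', c) \<in> set ps"
  using assms
proof (induction ps arbitrary: a)
  case (Cons p ps)
  obtain k d where p: "p = (k, d)" by force
  have IH: "a + k \<le> a' \<and> a' \<le> b' \<and> b' < a + k + block_total ps \<and> (b' + 1 - a', c) \<in> set ps"
    if "(a', b', c) \<in> set (cut_intervals (a + k) ps)"
    using Cons.IH[of "a + k"] Cons.prems that by simp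
  then show ?case using Cons.prems by (auto simp: p)
qed simp

lemma tperm_upt:
  assumes "a \<le> b"
  shows "a \<le> i \<and> i < b \<Longrightarrow> tperm [a..<b] i = i + 1" "tperm [a..<b] b = a"
    "i < a \<or> b < i \<Longrightarrow> tperm [a..<b] i = i"
proof -
  show "tperm [a..<b] i = i" if "i < a \<or> b < i" by (rule tperm_fix) (use that in auto)
  have "(\<forall>i. a \<le> i \<and> i < a + d \<longrightarrow> tperm [a..<a + d] i = i + 1) \<and> tperm [a..<a + d] (a + d) = a" for d
  proof (induction d arbitrary: a)
    case (Suc d)
    have e: "a + Suc d = a + 1 + d" "Suc a = a + 1" by simp_all
    have "a < a + Suc d" by simp
    from upt_conv_Cons[OF this] have u: "[a..<a + Suc d] = a # [a + 1..<a + 1 + d]" unfolding e .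
    note IH = conjunct1[OF Suc.IH[of "a + 1"]] conjunct2[OF Suc.IH[of "a + 1"]]
    have "tperm [a..<a + Suc d] i = i + 1" if i: "a \<le> i" "i < a + Suc d" for i
    proof (cases "i = a")
      case True
      have "tperm [a + 1..<a + 1 + d] a = a" by (rule tperm_fix) auto
      then show ?thesis unfolding u using True by simp
    next
      case False
      then have "tperm [a + 1..<a + 1 + d] i = i + 1" using IH(1) i by simp
      then show ?thesis unfolding u using False i by (simp add: transpose_def)
    qed
    moreover have "tperm [a..<a + Suc d] (a + Suc d) = a"
    proof -
      have "tperm [a..<a + Suc d] (a + 1 + d) = a"
        unfolding u using IH(2) by (simp only: tperm_simps o_apply transpose_apply_second)
      then show ?thesis by (simp only: e(1))
    qed
    ultimately show ?case by blast
  qed simp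
  from this[of "b - a"] assms show "a \<le> i \<and> i < b \<Longrightarrow> tperm [a..<b] i = i + 1" "tperm [a..<b] b = a"
    by simp_all
qed

definition block_perm :: "(nat \<times> nat \<times> 'c) list \<Rightarrow> (nat \<Rightarrow> nat) \<Rightarrow> bool" where
  "block_perm ivs \<sigma> \<longleftrightarrow> (\<forall>(a, b, c)\<in>set ivs. (\<forall>i. a \<le> i \<and> i < b \<longrightarrow> \<sigma> i = i + 1) \<and> \<sigma> b = a)"

lemma tperm_block_perm:
  assumes "\<forall>p\<in>set ps. 0 < fst p"
  shows "block_perm (cut_intervals a ps) (tperm (block_word (cut_intervals a ps)))"
  using assms
proof (induction ps arbitrary: a)
  case (Cons p ps)
  obtain k d where p: "p = (k, d)" by force
  let ?b = "a + k - 1" and ?ivs = "cut_intervals (a + k) ps"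
  have k: "0 < k" using Cons.prems p by simp
  have pos: "\<forall>p\<in>set ps. 0 < fst p" using Cons.prems by simp
  have IH: "block_perm ?ivs (tperm (block_word ?ivs))" by (rule Cons.IH[OF pos])
  have fixl: "tperm (block_word ?ivs) i = i" if "i < a + k" for i
    by (rule tperm_fix) (use block_word_range[OF pos] that in fastforce)
  have fixr: "tperm [a..<?b] i = i" if "a + k \<le> i" for i
    by (rule tperm_fix) (use that in auto)
  have 1: "tperm ([a..<?b] @ block_word ?ivs) i = i + 1" if "a \<le> i" "i < ?b" for i
    using that fixl[of i] tperm_upt(1)[of a ?b i] by (simp add: tperm_append)
  have 2: "tperm ([a..<?b] @ block_word ?ivs) ?b = a"
    using fixl[of ?b] tperm_upt(2)[of a ?b] k by (simp add: tperm_append)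
  have 3: "(\<forall>i. a' \<le> i \<and> i < b' \<longrightarrow> tperm ([a..<?b] @ block_word ?ivs) i = i + 1) \<and> tperm ([a..<?b] @ block_word ?ivs) b' = a'"
    if m: "(a', b', c') \<in> set ?ivs" for a' b' c'
  proof -
    have r: "a + k \<le> a'" using intervals_range[OF pos m] by simp
    have q: "\<forall>i. a' \<le> i \<and> i < b' \<longrightarrow> tperm (block_word ?ivs) i = i + 1" "tperm (block_word ?ivs) b' = a'"
      using IH m by (auto simp: block_perm_def)
    then show ?thesis using r fixr by (simp add: tperm_append)
  qed
  show ?case unfolding p using 1 2 3 by (auto simp: block_perm_def)
qed (simp add: block_perm_def)

lemma block_cycle:
  assumes s: "\<And>i. a \<le> i \<Longrightarrow> i < a + k - 1 \<Longrightarrow> \<sigma> i = i + 1" "\<sigma> (a + k - 1) = a" and k: "0 < k"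
  shows "j < k \<Longrightarrow> (\<sigma> ^^ j) a = a + j" "orbit \<sigma> a = {a..<a + k}"
proof -
  show j: "(\<sigma> ^^ j) a = a + j" if "j < k" for j
    using that by (induction j) (simp_all add: s(1))
  have "(\<sigma> ^^ k) a = a"
  proof -
    obtain k' where k': "k = Suc k'" using k gr0_implies_Suc by blast
    then show ?thesis using j[of k'] s(2) by simp
  qed
  from orbit_altdef_bounded[OF this k] have "orbit \<sigma> a = (\<lambda>m. (\<sigma> ^^ m) a) ` {..<k}" by auto
  also have "\<dots> = (\<lambda>m. a + m) ` {..<k}" by (rule image_cong[OF refl]) (simp add: j)
  also have "\<dots> = {a..<a + k}" by (simp add: lessThan_atLeast0 add.commute)
  finally show "orbit \<sigma> a = {a..<a + k}" .
qed

section \<open>Classes of the double cover of the wreath product\<close>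

declare One_nat_def [simp del]

context finite_group
begin

lemma power_carrier: "carrier (power_group G n) = {1..n} \<rightarrow>\<^sub>E carrier G"
  by simp

lemma wreath_carrier:
  "x \<in> carrier (spin_wreath G n) \<longleftrightarrow> fst x \<in> {1..n} \<rightarrow>\<^sub>E carrier G \<and> snd x \<in> carrier (spin_group n)"
  by (cases x) (simp add: spin_wreath_def)

lemma wreath_mult:
  "x \<otimes>\<^bsub>spin_wreath G n\<^esub> y =
    ((\<lambda>i\<in>{1..n}. fst x i \<otimes> fst y (inv' (spin_perm n (snd x)) i)), snd x \<otimes>\<^bsub>spin_group n\<^esub> snd y)"
  by (cases x; cases y) (auto simp: spin_wreath_def spin_act_def fun_eq_iff)

lemma wreath_one: "\<one>\<^bsub>spin_wreath G n\<^esub> = ((\<lambda>i\<in>{1..n}. \<one>), \<one>\<^bsub>spin_group n\<^esub>)"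
  by (simp add: spin_wreath_def)

lemma wreath_group: "group (spin_wreath G n)"
  by (rule spin_wreath_group[OF is_group])

lemma finite_wreath: "finite (carrier (spin_wreath G n))"
proof -
  have "carrier (spin_wreath G n) = ({1..n} \<rightarrow>\<^sub>E carrier G) \<times> carrier (spin_group n)"
    by (auto simp: set_eq_iff wreath_carrier)
  moreover have "finite ({1..n} \<rightarrow>\<^sub>E carrier G)" by (rule finite_PiE) (use fin in auto)
  ultimately show ?thesis using finite_spin_group by (simp only: finite_cartesian_product)
qed

lemma wreath_wr_elt:
  "x \<in> carrier (spin_wreath G n) \<Longrightarrow> wr_elt (fst x) (spin_perm n (snd x)) {1..n}"
  unfolding wr_elt_def wreath_carrier using spin_perm_permutes by auto

section \<open>The projection of the cover to the wreath product and its fibres\<close>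

abbreviation proj :: "nat \<Rightarrow> 'a spin_wreath_elt \<Rightarrow> (nat \<Rightarrow> 'a) \<times> (nat \<Rightarrow> nat)" where
  "proj n x \<equiv> (fst x, spin_perm n (snd x))"

lemma spin_z_carrier: "spin_z G n \<in> carrier (spin_wreath G n)"
  by (simp add: wreath_carrier spin_z_def)

lemma spin_z_mult:
  assumes "x \<in> carrier (spin_wreath G n)"
  shows "spin_z G n \<otimes>\<^bsub>spin_wreath G n\<^esub> x = (fst x, Zs n \<otimes>\<^bsub>spin_group n\<^esub> snd x)"
proof -
  have "fst x \<in> {1..n} \<rightarrow>\<^sub>E carrier G" using assms wreath_carrier by blast
  then show ?thesis
    by (auto simp: wreath_mult spin_z_def spin_perm_Zs fun_eq_iff PiE_iff extensional_def restrict_def Pi_iff)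
qed

lemma spin_z_proj:
  "x \<in> carrier (spin_wreath G n) \<Longrightarrow> proj n (spin_z G n \<otimes>\<^bsub>spin_wreath G n\<^esub> x) = proj n x"
  by (simp add: spin_z_mult spin_perm_mult spin_perm_Zs wreath_carrier)

lemma proj_eq:
  assumes x: "x \<in> carrier (spin_wreath G n)" and y: "y \<in> carrier (spin_wreath G n)" and "proj n x = proj n y"
  shows "x = y \<or> x = spin_z G n \<otimes>\<^bsub>spin_wreath G n\<^esub> y"
  using assms spin_perm_eq[of "snd x" n "snd y"] by (simp add: spin_z_mult wreath_carrier prod_eq_iff)

text \<open>The trace separates z from 1: it is 1 at the identity and changes sign under
  multiplication by z.\<close>

lemma spin_z_neq:
  assumes "x \<in> carrier (spin_wreath G n)"
  shows "spin_z G n \<otimes>\<^bsub>spin_wreath G n\<^esub> x \<noteq> x"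
proof
  assume a: "spin_z G n \<otimes>\<^bsub>spin_wreath G n\<^esub> x = x"
  interpret W: group "spin_wreath G n" by (rule wreath_group)
  interpret S: group "spin_group n" unfolding spin_group_def by (rule presented_group_group)
  have "spin_z G n = \<one>\<^bsub>spin_wreath G n\<^esub>" using W.r_cancel_one[OF assms spin_z_carrier] a by simp
  then have "Zs n = \<one>\<^bsub>spin_group n\<^esub>" by (simp add: spin_z_def wreath_one)
  then have "spin_tr \<one>\<^bsub>spin_group n\<^esub> = - spin_tr \<one>\<^bsub>spin_group n\<^esub>"
    using spin_tr_Zs[of "\<one>\<^bsub>spin_group n\<^esub>" n] by simp
  moreover have "spin_tr \<one>\<^bsub>spin_group n\<^esub> = 1"
    using spin_tr_tw[of "[]" n] by (simp add: tw_Nil vac_def)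
  ultimately show False by simp
qed

lemma card_proj_fibre:
  assumes x: "x \<in> carrier (spin_wreath G n)"
  shows "card {y \<in> carrier (spin_wreath G n). proj n y = proj n x} = 2"
proof -
  interpret W: group "spin_wreath G n" by (rule wreath_group)
  let ?zx = "spin_z G n \<otimes>\<^bsub>spin_wreath G n\<^esub> x"
  have "{y \<in> carrier (spin_wreath G n). proj n y = proj n x} = {x, ?zx}"
  proof (intro equalityI subsetI)
    fix y assume "y \<in> {y \<in> carrier (spin_wreath G n). proj n y = proj n x}"
    then show "y \<in> {x, ?zx}" using proj_eq[OF _ x, of y] by simp
  next
    fix y assume "y \<in> {x, ?zx}"
    then show "y \<in> {y \<in> carrier (spin_wreath G n). proj n y = proj n x}"
      using x spin_z_proj[OF x] W.m_closed[OF spin_z_carrier x] by auto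
  qed
  then show ?thesis using spin_z_neq[OF x] by simp
qed

text \<open>The second component is indexed by \<open>j\<close> in the source permutation: it is \<open>h\<close> at the point
  that precedes \<open>\<pi> j\<close> in its cycle under the target permutation \<open>\<sigma>\<close>.\<close>

definition to_conj :: "nat \<Rightarrow> (nat \<Rightarrow> nat) \<Rightarrow> 'a spin_wreath_elt \<Rightarrow> (nat \<Rightarrow> nat) \<times> (nat \<Rightarrow> 'a)" where
  "to_conj n \<sigma> y = (restrict (spin_perm n (snd y)) {1..n},
     \<lambda>j\<in>{1..n}. fst y (inv' \<sigma> (spin_perm n (snd y) j)))"

text \<open>Put i = \<pi> j in the conjugation equation. The shift by the inverse of \<sigma> in
  \<open>to_conj\<close> turns h(\<pi> j) into v(\<tau> j), because \<pi> \<tau> = \<sigma> \<pi>,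
  and the equation becomes the local relation of \<open>conjugators\<close>.\<close>

lemma to_conj_iff:
  assumes x0: "x0 \<in> carrier (spin_wreath G n)" and x: "x \<in> carrier (spin_wreath G n)"
    and y: "y \<in> carrier (spin_wreath G n)"
  shows "to_conj n (spin_perm n (snd x)) y \<in> conjugators (fst x0) (spin_perm n (snd x0)) {1..n} (fst x) (spin_perm n (snd x)) {1..n}
    \<longleftrightarrow> proj n (y \<otimes>\<^bsub>spin_wreath G n\<^esub> x0) = proj n (x \<otimes>\<^bsub>spin_wreath G n\<^esub> y)"
proof -
  let ?X = "{1..n}" and ?\<pi> = "spin_perm n (snd y)" and ?\<tau> = "spin_perm n (snd x0)" and ?\<sigma> = "spin_perm n (snd x)"
  have p: "?\<pi> permutes ?X" "?\<tau> permutes ?X" "?\<sigma> permutes ?X"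
    using assms by (auto simp: wreath_carrier intro!: spin_perm_permutes)
  have hc: "fst y i \<in> carrier G" if "i \<in> ?X" for i using y that by (auto simp: wreath_carrier)
  have perm: "spin_perm n (snd y \<otimes>\<^bsub>spin_group n\<^esub> snd x0) = ?\<pi> \<circ> ?\<tau>"
    "spin_perm n (snd x \<otimes>\<^bsub>spin_group n\<^esub> snd y) = ?\<sigma> \<circ> ?\<pi>"
    using assms by (simp_all add: wreath_carrier spin_perm_mult)
  have R: "proj n (y \<otimes>\<^bsub>spin_wreath G n\<^esub> x0) = proj n (x \<otimes>\<^bsub>spin_wreath G n\<^esub> y) \<longleftrightarrow>
      (\<forall>i\<in>?X. fst y i \<otimes> fst x0 (inv' ?\<pi> i) = fst x i \<otimes> fst y (inv' ?\<sigma> i)) \<and> ?\<pi> \<circ> ?\<tau> = ?\<sigma> \<circ> ?\<pi>"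
    unfolding wreath_mult fst_conv snd_conv perm prod.inject fun_eq_iff[of "restrict _ _"] by (auto simp: restrict_def)
  have out: "?\<pi> \<circ> ?\<tau> = ?\<sigma> \<circ> ?\<pi> \<longleftrightarrow> (\<forall>j\<in>?X. ?\<pi> (?\<tau> j) = ?\<sigma> (?\<pi> j))"
  proof
    assume a: "\<forall>j\<in>?X. ?\<pi> (?\<tau> j) = ?\<sigma> (?\<pi> j)"
    show "?\<pi> \<circ> ?\<tau> = ?\<sigma> \<circ> ?\<pi>"
    proof
      fix j show "(?\<pi> \<circ> ?\<tau>) j = (?\<sigma> \<circ> ?\<pi>) j"
        using a permutes_not_in[OF p(1), of j] permutes_not_in[OF p(2), of j] permutes_not_in[OF p(3), of j]
        by (cases "j \<in> ?X") simp_all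
    qed
  qed (auto simp: fun_eq_iff)
  have mem: "?\<tau> j \<in> ?X" "?\<pi> j \<in> ?X" "inv' ?\<sigma> j \<in> ?X" if "j \<in> ?X" for j
    using that p permutes_in_image permutes_inv[OF p(3)] by (metis)+
  have L: "to_conj n ?\<sigma> y \<in> conjugators (fst x0) ?\<tau> ?X (fst x) ?\<sigma> ?X \<longleftrightarrow>
     (\<forall>j\<in>?X. ?\<pi> (?\<tau> j) = ?\<sigma> (?\<pi> j) \<and> fst y (inv' ?\<sigma> (?\<pi> (?\<tau> j))) \<otimes> fst x0 j = fst x (?\<pi> j) \<otimes> fst y (inv' ?\<sigma> (?\<pi> j)))"
  proof -
    have "bij_betw (restrict ?\<pi> ?X) ?X ?X"
      using permutes_imp_bij[OF p(1)] by (rule bij_betw_cong[THEN iffD1, rotated]) simp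
    moreover have "(\<lambda>j\<in>?X. fst y (inv' ?\<sigma> (?\<pi> j))) \<in> ?X \<rightarrow>\<^sub>E carrier G"
      by (rule restrict_PiE[THEN iffD2]) (use hc mem in auto)
    ultimately show ?thesis using mem by (simp add: to_conj_def conjugators_def)
  qed
  have "(\<forall>j\<in>?X. fst y (inv' ?\<sigma> (?\<pi> (?\<tau> j))) \<otimes> fst x0 j = fst x (?\<pi> j) \<otimes> fst y (inv' ?\<sigma> (?\<pi> j))) \<longleftrightarrow>
      (\<forall>i\<in>?X. fst y i \<otimes> fst x0 (inv' ?\<pi> i) = fst x i \<otimes> fst y (inv' ?\<sigma> i))"
    if a: "\<forall>j\<in>?X. ?\<pi> (?\<tau> j) = ?\<sigma> (?\<pi> j)"
  proof -
    have "(\<forall>j\<in>?X. fst y (inv' ?\<sigma> (?\<pi> (?\<tau> j))) \<otimes> fst x0 j = fst x (?\<pi> j) \<otimes> fst y (inv' ?\<sigma> (?\<pi> j))) \<longleftrightarrow>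
      (\<forall>j\<in>?X. fst y (?\<pi> j) \<otimes> fst x0 j = fst x (?\<pi> j) \<otimes> fst y (inv' ?\<sigma> (?\<pi> j)))"
      using a by (intro ball_cong refl) (simp add: permutes_inverses[OF p(3)])
    also have "\<dots> \<longleftrightarrow> (\<forall>i\<in>?\<pi> ` ?X. fst y i \<otimes> fst x0 (inv' ?\<pi> i) = fst x i \<otimes> fst y (inv' ?\<sigma> i))"
      by (simp add: permutes_inverses[OF p(1)] del: permutes_image)
    also have "?\<pi> ` ?X = ?X" by (rule permutes_image[OF p(1)])
    finally show ?thesis .
  qed
  then show ?thesis unfolding R L out by blast
qed

lemma proj_mult:
  assumes "x \<in> carrier (spin_wreath G n)" "y \<in> carrier (spin_wreath G n)" "x' \<in> carrier (spin_wreath G n)"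
    and "proj n x = proj n x'"
  shows "proj n (x \<otimes>\<^bsub>spin_wreath G n\<^esub> y) = proj n (x' \<otimes>\<^bsub>spin_wreath G n\<^esub> y)"
  using assms by (simp add: wreath_mult wreath_carrier spin_perm_mult)

lemma proj_conj_iff:
  assumes x0: "x0 \<in> carrier (spin_wreath G n)" and x: "x \<in> carrier (spin_wreath G n)"
    and y: "y \<in> carrier (spin_wreath G n)"
  shows "proj n (y \<otimes>\<^bsub>spin_wreath G n\<^esub> x0 \<otimes>\<^bsub>spin_wreath G n\<^esub> inv\<^bsub>spin_wreath G n\<^esub> y) = proj n x
    \<longleftrightarrow> proj n (y \<otimes>\<^bsub>spin_wreath G n\<^esub> x0) = proj n (x \<otimes>\<^bsub>spin_wreath G n\<^esub> y)"
proof -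
  interpret W: group "spin_wreath G n" by (rule wreath_group)
  let ?a = "y \<otimes>\<^bsub>spin_wreath G n\<^esub> x0" and ?yi = "inv\<^bsub>spin_wreath G n\<^esub> y"
  have a: "?a \<in> carrier (spin_wreath G n)" "x \<otimes>\<^bsub>spin_wreath G n\<^esub> y \<in> carrier (spin_wreath G n)" "?yi \<in> carrier (spin_wreath G n)"
    using assms by auto
  have e1: "?a \<otimes>\<^bsub>spin_wreath G n\<^esub> ?yi \<otimes>\<^bsub>spin_wreath G n\<^esub> y = ?a"
    using a(1) y by (simp add: W.m_assoc)
  have e2: "x \<otimes>\<^bsub>spin_wreath G n\<^esub> y \<otimes>\<^bsub>spin_wreath G n\<^esub> ?yi = x"
    using x y by (simp add: W.m_assoc)
  show ?thesis
  proof
    assume "proj n (?a \<otimes>\<^bsub>spin_wreath G n\<^esub> ?yi) = proj n x"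
    from proj_mult[OF W.m_closed[OF a(1,3)] y x this] show "proj n ?a = proj n (x \<otimes>\<^bsub>spin_wreath G n\<^esub> y)"
      unfolding e1 .
  next
    assume "proj n ?a = proj n (x \<otimes>\<^bsub>spin_wreath G n\<^esub> y)"
    from proj_mult[OF a(1,3,2) this] show "proj n (?a \<otimes>\<^bsub>spin_wreath G n\<^esub> ?yi) = proj n x"
      unfolding e2 .
  qed
qed

lemma spin_type_eq: "spin_type G n x = orbit_type (fst x) (spin_perm n (snd x)) {1..n}"
  by (cases x) (simp only: spin_type_def split_conv fst_conv snd_conv wreath_type_orbit_type)

lemma spin_type_proj: "proj n x = proj n y \<Longrightarrow> spin_type G n x = spin_type G n y"
  by (simp add: spin_type_eq)

lemma spin_type_conj:
  assumes x: "x \<in> carrier (spin_wreath G n)" and y: "y \<in> carrier (spin_wreath G n)"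
  shows "spin_type G n (y \<otimes>\<^bsub>spin_wreath G n\<^esub> x \<otimes>\<^bsub>spin_wreath G n\<^esub> inv\<^bsub>spin_wreath G n\<^esub> y) = spin_type G n x"
proof -
  interpret W: group "spin_wreath G n" by (rule wreath_group)
  let ?x = "y \<otimes>\<^bsub>spin_wreath G n\<^esub> x \<otimes>\<^bsub>spin_wreath G n\<^esub> inv\<^bsub>spin_wreath G n\<^esub> y"
  have c: "?x \<in> carrier (spin_wreath G n)" using assms by simp
  have "to_conj n (spin_perm n (snd ?x)) y \<in> conjugators (fst x) (spin_perm n (snd x)) {1..n} (fst ?x) (spin_perm n (snd ?x)) {1..n}"
    using to_conj_iff[OF x c y] proj_conj_iff[OF x c y] by blast
  moreover have "spin_perm n (snd x) ` {1..n} \<subseteq> {1..n}"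
    using permutes_image[OF spin_perm_permutes] x by (metis wreath_carrier order_refl)
  ultimately show ?thesis
    unfolding spin_type_eq
    using conjugators_type[OF wreath_wr_elt[OF x] wreath_wr_elt[OF c] order_refl _ order_refl] by (metis surj_pair)
qed

text \<open>\<open>to_conj\<close> depends only on the projection of y and is onto the conjugators,
  so it is two-to-one; \<open>card_conjugators\<close> supplies the count below.\<close>

lemma card_transporter_wreath:
  assumes x0: "x0 \<in> carrier (spin_wreath G n)" and x: "x \<in> carrier (spin_wreath G n)"
    and ty: "spin_type G n x0 = spin_type G n x"
  shows "card {y \<in> carrier (spin_wreath G n).
     proj n (y \<otimes>\<^bsub>spin_wreath G n\<^esub> x0 \<otimes>\<^bsub>spin_wreath G n\<^esub> inv\<^bsub>spin_wreath G n\<^esub> y) = proj n x} = 2 * Z_part_fun G (spin_type G n x)"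
proof -
  let ?X = "{1..n}" and ?\<tau> = "spin_perm n (snd x0)" and ?\<sigma> = "spin_perm n (snd x)"
  let ?T = "conjugators (fst x0) ?\<tau> ?X (fst x) ?\<sigma> ?X"
  let ?S = "{y \<in> carrier (spin_wreath G n). to_conj n ?\<sigma> y \<in> ?T}"
  have p: "?\<tau> permutes ?X" "?\<sigma> permutes ?X"
    using assms by (auto simp: wreath_carrier intro!: spin_perm_permutes)
  have T: "finite ?T" "card ?T = Z_part_fun G (spin_type G n x)"
    using card_conjugators[OF wreath_wr_elt[OF x0] wreath_wr_elt[OF x] order_refl _ order_refl]
      permutes_image[OF p(1)] permutes_image[OF p(2)] ty by (simp_all add: spin_type_eq del: permutes_image)
  have fib: "card {y \<in> ?S. to_conj n ?\<sigma> y = q} = 2" if q: "q \<in> ?T" for q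
  proof -
    obtain \<pi> v where q': "q = (\<pi>, v)" by (metis surj_pair)
    have pv: "\<pi> \<in> extensional ?X" "bij_betw \<pi> ?X ?X" "v \<in> ?X \<rightarrow>\<^sub>E carrier G"
      using q unfolding q' conjugators_def by auto
    define \<pi>' where "\<pi>' j = (if j \<in> ?X then \<pi> j else j)" for j
    have \<pi>': "\<pi>' permutes ?X"
    proof (rule bij_imp_permutes)
      show "bij_betw \<pi>' ?X ?X" using pv(2) by (rule bij_betw_cong[THEN iffD1, rotated]) (simp add: \<pi>'_def)
    qed (auto simp: \<pi>'_def)
    obtain s where s: "s \<in> carrier (spin_group n)" "spin_perm n s = \<pi>'" using spin_perm_surj[OF \<pi>'] by blast
    \<comment> \<open>Solves v(j) = h(\<sigma>^-1 (\<pi> j)) for h.\<close>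
    define h where "h = (\<lambda>i\<in>?X. v (inv' \<pi>' (?\<sigma> i)))"
    have hX: "h \<in> ?X \<rightarrow>\<^sub>E carrier G"
      unfolding h_def
    proof (rule restrict_PiE[THEN iffD2], rule Pi_I)
      fix i assume "i \<in> ?X"
      then have "inv' \<pi>' (?\<sigma> i) \<in> ?X" using permutes_in_image[OF permutes_inv[OF \<pi>']] permutes_in_image[OF p(2)] by blast
      then show "v (inv' \<pi>' (?\<sigma> i)) \<in> carrier G" using pv(3) by auto
    qed
    have y0: "(h, s) \<in> carrier (spin_wreath G n)" using hX s by (simp add: wreath_carrier)
    have toc: "to_conj n ?\<sigma> y = q \<longleftrightarrow> proj n y = proj n (h, s)" if y: "y \<in> carrier (spin_wreath G n)" for y
    proof
      assume a: "to_conj n ?\<sigma> y = q"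
      have py: "spin_perm n (snd y) permutes ?X" using y by (simp add: wreath_carrier spin_perm_permutes)
      have r: "restrict (spin_perm n (snd y)) ?X = \<pi>" and v: "(\<lambda>j\<in>?X. fst y (inv' ?\<sigma> (spin_perm n (snd y) j))) = v"
        using a unfolding to_conj_def q' by (auto)
      have e: "spin_perm n (snd y) = \<pi>'"
      proof
        fix j show "spin_perm n (snd y) j = \<pi>' j"
          using fun_cong[OF r, of j] permutes_not_in[OF py, of j] by (cases "j \<in> ?X") (auto simp: \<pi>'_def)
      qed
      have "fst y = h"
      proof
        fix i show "fst y i = h i"
        proof (cases "i \<in> ?X")
          case True
          let ?j = "inv' \<pi>' (?\<sigma> i)"
          have j: "?j \<in> ?X" using permutes_in_image[OF permutes_inv[OF \<pi>']] permutes_in_image[OF p(2)] True by blast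
          have "v ?j = fst y (inv' ?\<sigma> (\<pi>' ?j))" unfolding v[symmetric] e using j by simp
          also have "\<dots> = fst y i" by (simp add: permutes_inverses[OF \<pi>'] permutes_inverses[OF p(2)])
          finally show ?thesis using True by (simp add: h_def)
        next
          case False
          then show ?thesis using y by (auto simp: h_def wreath_carrier PiE_def extensional_def)
        qed
      qed
      then show "proj n y = proj n (h, s)" using e s by simp
    next
      assume "proj n y = proj n (h, s)"
      then have e: "fst y = h" "spin_perm n (snd y) = \<pi>'" using s by auto
      have 1: "restrict \<pi>' ?X = \<pi>" using pv(1) by (auto simp: fun_eq_iff \<pi>'_def restrict_def extensional_def)
      have 2: "(\<lambda>j\<in>?X. h (inv' ?\<sigma> (\<pi>' j))) = v"
      proof
        fix j show "(\<lambda>j\<in>?X. h (inv' ?\<sigma> (\<pi>' j))) j = v j"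
        proof (cases "j \<in> ?X")
          case True
          have "inv' ?\<sigma> (\<pi>' j) \<in> ?X" using permutes_in_image[OF permutes_inv[OF p(2)]] permutes_in_image[OF \<pi>'] True by blast
          then show ?thesis using True by (simp add: h_def permutes_inverses[OF \<pi>'] permutes_inverses[OF p(2)])
        next
          case False
          then show ?thesis using pv(3) by (auto simp: PiE_def extensional_def)
        qed
      qed
      show "to_conj n ?\<sigma> y = q" unfolding to_conj_def e q' 1 2 ..
    qed
    have "{y \<in> ?S. to_conj n ?\<sigma> y = q} = {y \<in> carrier (spin_wreath G n). proj n y = proj n (h, s)}"
      using toc q by auto
    then show ?thesis using card_proj_fibre[OF y0] by simp
  qed
  have "{y \<in> carrier (spin_wreath G n). proj n (y \<otimes>\<^bsub>spin_wreath G n\<^esub> x0 \<otimes>\<^bsub>spin_wreath G n\<^esub> inv\<^bsub>spin_wreath G n\<^esub> y) = proj n x} = ?S"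
    by (intro Collect_cong conj_cong refl) (simp only: to_conj_iff[OF x0 x] proj_conj_iff[OF x0 x])
  moreover have "card ?S = 2 * Z_part_fun G (spin_type G n x)"
  proof -
    have fS: "finite ?S" using finite_wreath by simp
    have "card ?S = (\<Sum>y\<in>?S. 1)" by simp
    also have "\<dots> = (\<Sum>q\<in>?T. \<Sum>y\<in>{y \<in> ?S. to_conj n ?\<sigma> y = q}. 1)"
      by (rule sum.group[symmetric, OF fS T(1)]) auto
    also have "\<dots> = (\<Sum>q\<in>?T. 2)"
      by (rule sum.cong[OF refl]) (simp only: sum_constant fib mult_1_right of_nat_id)
    finally show ?thesis using T(2) by simp
  qed
  ultimately show ?thesis by simp
qed

end

lemma double_count:
  assumes "finite A" "finite B"
  shows "(\<Sum>y\<in>A. card {x \<in> B. P y x}) = (\<Sum>x\<in>B. card {y \<in> A. P y x})"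
  unfolding card_eq_sum by (rule sum.swap_restrict[OF assms])

context finite_group
begin

text \<open>The pairs (y, x) for which y x0 y^-1 and x agree in the wreath product are counted in
  two ways: each y admits the two lifts of its conjugate, and each x of the given type admits 2 Z
  elements y.\<close>

lemma card_spin_type:
  assumes x0: "x0 \<in> carrier (spin_wreath G n)"
  shows "card {x \<in> carrier (spin_wreath G n). spin_type G n x = spin_type G n x0} * Z_part_fun G (spin_type G n x0)
    = card (carrier (spin_wreath G n))"
proof -
  interpret W: group "spin_wreath G n" by (rule wreath_group)
  let ?W = "carrier (spin_wreath G n)"
  let ?R = "{x \<in> ?W. spin_type G n x = spin_type G n x0}"
  let ?c = "\<lambda>y. y \<otimes>\<^bsub>spin_wreath G n\<^esub> x0 \<otimes>\<^bsub>spin_wreath G n\<^esub> inv\<^bsub>spin_wreath G n\<^esub> y"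
  have fW: "finite ?W" by (rule finite_wreath)
  have "(\<Sum>y\<in>?W. card {x \<in> ?R. proj n (?c y) = proj n x}) = (\<Sum>x\<in>?R. card {y \<in> ?W. proj n (?c y) = proj n x})"
    using fW by (intro double_count) auto
  moreover have "card {x \<in> ?R. proj n (?c y) = proj n x} = 2" if y: "y \<in> ?W" for y
  proof -
    have c: "?c y \<in> ?W" using x0 y by simp
    have "{x \<in> ?R. proj n (?c y) = proj n x} = {x \<in> ?W. proj n x = proj n (?c y)}"
    proof (intro equalityI subsetI)
      fix x assume x: "x \<in> {x \<in> ?W. proj n x = proj n (?c y)}"
      then have "spin_type G n x = spin_type G n (?c y)" by (intro spin_type_proj) simp
      then show "x \<in> {x \<in> ?R. proj n (?c y) = proj n x}"
        using x spin_type_conj[OF x0 y] by simp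
    next
      fix x assume "x \<in> {x \<in> ?R. proj n (?c y) = proj n x}"
      then show "x \<in> {x \<in> ?W. proj n x = proj n (?c y)}" by simp
    qed
    then show ?thesis using card_proj_fibre[OF c] by simp
  qed
  moreover have "card {y \<in> ?W. proj n (?c y) = proj n x} = 2 * Z_part_fun G (spin_type G n x0)" if "x \<in> ?R" for x
    using card_transporter_wreath[OF x0, of x] that by simp
  ultimately show ?thesis by simp
qed

text \<open>The number of transporters is positive, so one exists; an equality in the wreath product
  lifts to the cover up to z.\<close>

lemma spin_type_conjugate:
  assumes x0: "x0 \<in> carrier (spin_wreath G n)" and x: "x \<in> carrier (spin_wreath G n)"
    and ty: "spin_type G n x0 = spin_type G n x"
  obtains y where "y \<in> carrier (spin_wreath G n)"
    "y \<otimes>\<^bsub>spin_wreath G n\<^esub> x0 \<otimes>\<^bsub>spin_wreath G n\<^esub> inv\<^bsub>spin_wreath G n\<^esub> y = x \<or>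
     y \<otimes>\<^bsub>spin_wreath G n\<^esub> x0 \<otimes>\<^bsub>spin_wreath G n\<^esub> inv\<^bsub>spin_wreath G n\<^esub> y = spin_z G n \<otimes>\<^bsub>spin_wreath G n\<^esub> x"
proof -
  interpret W: group "spin_wreath G n" by (rule wreath_group)
  let ?c = "\<lambda>y. y \<otimes>\<^bsub>spin_wreath G n\<^esub> x0 \<otimes>\<^bsub>spin_wreath G n\<^esub> inv\<^bsub>spin_wreath G n\<^esub> y"
  have "0 < card (carrier (spin_wreath G n))"
    using finite_wreath x by (auto simp: card_gt_0_iff)
  then have "0 < Z_part_fun G (spin_type G n x)" using card_spin_type[OF x] by (metis mult_is_0 not_gr_zero)
  then have "card {y \<in> carrier (spin_wreath G n). proj n (?c y) = proj n x} \<noteq> 0"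
    unfolding card_transporter_wreath[OF x0 x ty] by simp
  then have "{y \<in> carrier (spin_wreath G n). proj n (?c y) = proj n x} \<noteq> {}" by (metis card.empty)
  then obtain y where y: "y \<in> carrier (spin_wreath G n)" "proj n (?c y) = proj n x" by auto
  have "?c y \<in> carrier (spin_wreath G n)" using y x0 by simp
  from proj_eq[OF this x y(2)] show ?thesis by (rule that[OF y(1)])
qed

section \<open>Types of inverse elements\<close>

lemma set_inv_conj_class:
  assumes "x \<in> carrier G" shows "set_inv (conj_class G x) = conj_class G (inv x)"
proof -
  have e: "inv (y \<otimes> x \<otimes> inv y) = y \<otimes> inv x \<otimes> inv y" if "y \<in> carrier G" for y
    using that assms by (simp add: inv_mult_group m_assoc)
  have "set_inv (conj_class G x) = (\<lambda>u. inv u) ` (\<lambda>y. y \<otimes> x \<otimes> inv y) ` carrier G"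
    by (auto simp: SET_INV_def conj_class_def)
  also have "\<dots> = (\<lambda>y. y \<otimes> inv x \<otimes> inv y) ` carrier G"
    unfolding image_image by (rule image_cong[OF refl e])
  also have "\<dots> = conj_class G (inv x)" by (auto simp: conj_class_def)
  finally show ?thesis .
qed

lemma set_inv_conj_classes: "c \<in> conj_classes G \<Longrightarrow> set_inv c \<in> conj_classes G"
proof -
  assume "c \<in> conj_classes G"
  then obtain x where x: "x \<in> carrier G" "c = conj_class G x" unfolding conj_classes_def by blast
  show "set_inv c \<in> conj_classes G"
    unfolding x(2) set_inv_conj_class[OF x(1)] by (rule conj_class_in) (rule inv_closed[OF x(1)])
qed

lemma mem_set_inv:
  assumes "c \<in> conj_classes G" "x \<in> carrier G"
  shows "inv x \<in> set_inv c \<longleftrightarrow> x \<in> c"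
proof
  assume "inv x \<in> set_inv c"
  then have "\<exists>u\<in>c. inv x = inv u" by (simp only: SET_INV_def UN_iff singleton_iff)
  then obtain u where u: "u \<in> c" "inv x = inv u" ..
  have "x = inv (inv u)" using inv_inv[OF assms(2)] u(2) by simp
  then have "x = u" using inv_inv[OF conj_classes_eq(1)[OF assms(1) u(1)]] by simp
  then show "x \<in> c" using u(1) by (simp only:)
qed (simp only: SET_INV_def UN_iff singleton_iff, rule bexI, rule refl)

lemma set_inv_set_inv:
  assumes "c \<in> conj_classes G" shows "set_inv (set_inv c) = c"
proof -
  obtain x where x: "x \<in> carrier G" "c = conj_class G x" using assms unfolding conj_classes_def by blast
  then show ?thesis using set_inv_conj_class[OF x(1)] set_inv_conj_class[OF inv_closed[OF x(1)]] by simp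
qed

text \<open>The hypothesis on h describes the first component of the inverse of (g, \<sigma>) in the
  wreath product.\<close>

lemma wr_elt_inverse:
  assumes W: "wr_elt g \<sigma> X" and h: "\<And>j. j \<in> X \<Longrightarrow> h j = inv (g (\<sigma> j))"
  shows "wr_elt h (inv' \<sigma>) X"
proof -
  have p: "\<sigma> permutes X" "finite X" "g \<in> X \<rightarrow> carrier G" using W by (simp_all add: wr_elt_def)
  have "h j \<in> carrier G" if j: "j \<in> X" for j
  proof -
    have "\<sigma> j \<in> X" using j permutes_in_image[OF p(1)] by simp
    then have "g (\<sigma> j) \<in> carrier G" using p(3) by (rule funcset_mem[rotated])
    then show ?thesis unfolding h[OF j] by (rule inv_closed)
  qed
  then show ?thesis using p permutes_inv[OF p(1)] by (simp add: wr_elt_def Pi_I)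
qed

text \<open>The starting point \<sigma>^(2-m) i is chosen so that both products involve g at the
  same points, ending at \<sigma> i; the factors then cancel from the middle outwards.\<close>

lemma seg_inverse:
  assumes W: "wr_elt g \<sigma> X" and i: "i \<in> X" and h: "\<And>j. j \<in> X \<Longrightarrow> h j = inv (g (\<sigma> j))"
  shows "seg g \<sigma> ((inv' \<sigma> ^^ m) (\<sigma> (\<sigma> i))) m \<otimes> seg h (inv' \<sigma>) i m = \<one>"
proof (induction m)
  case (Suc m)
  have p: "\<sigma> permutes X" using W by (simp add: wr_elt_def)
  have pi: "inv' \<sigma> permutes X" by (rule permutes_inv[OF p])
  have ixX: "(inv' \<sigma> ^^ l) j \<in> X" if "j \<in> X" for l j
    using that permutes_in_image[OF pi] by (induction l) auto
  have sX: "\<sigma> j \<in> X" if "j \<in> X" for j using that permutes_in_image[OF p] by simp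
  let ?b = "(inv' \<sigma> ^^ Suc m) (\<sigma> (\<sigma> i))"
  have b: "\<sigma> ?b = (inv' \<sigma> ^^ m) (\<sigma> (\<sigma> i))" by (simp add: permutes_inverses[OF p])
  have b': "?b = \<sigma> ((inv' \<sigma> ^^ m) i)"
  proof -
    have "(inv' \<sigma> ^^ l) (\<sigma> j) = \<sigma> ((inv' \<sigma> ^^ l) j)" for l j
      by (induction l) (simp_all add: permutes_inverses[OF p])
    then show ?thesis by (simp add: permutes_inverses[OF p])
  qed
  have bX: "?b \<in> X" "(inv' \<sigma> ^^ m) (\<sigma> (\<sigma> i)) \<in> X" "(inv' \<sigma> ^^ m) i \<in> X"
    using ixX[OF sX[OF sX[OF i]]] ixX[OF i] by (simp_all only:)
  have gb: "g ?b \<in> carrier G" using W bX by (auto simp: wr_elt_def)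
  have Wh: "wr_elt h (inv' \<sigma>) X" by (rule wr_elt_inverse[OF W h])
  have hm: "h ((inv' \<sigma> ^^ m) i) = inv (g ?b)" unfolding h[OF bX(3)] b' ..
  have "seg g \<sigma> ?b (Suc m) = seg g \<sigma> ((inv' \<sigma> ^^ m) (\<sigma> (\<sigma> i))) m \<otimes> g ?b"
    using seg_shift[OF W bX(1), of m] unfolding b by simp
  then show ?case
    unfolding seg_Suc[of h] hm using Suc.IH gb seg_closed[OF W bX(2)] seg_closed[OF Wh i] by (simp add: m_assoc)
qed simp

lemma orbit_type_inverse:
  assumes W: "wr_elt g \<sigma> X" and h: "\<And>j. j \<in> X \<Longrightarrow> h j = inv (g (\<sigma> j))" and c: "c \<in> conj_classes G"
  shows "orbit_type h (inv' \<sigma>) X (set_inv c) = orbit_type g \<sigma> X c"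
proof -
  have p: "\<sigma> permutes X" and pp: "permutation \<sigma>" using W permutation_permutes by (auto simp: wr_elt_def)
  have orb: "orbit (inv' \<sigma>) i = orbit \<sigma> i" for i by (rule orbit_inv_eq[OF pp])
  have cls: "cycle_prod G h (inv' \<sigma>) i \<in> set_inv c \<longleftrightarrow> cycle_prod G g \<sigma> i \<in> c" if i: "i \<in> X" for i
  proof -
    have sX: "\<sigma> i \<in> X" "\<sigma> (\<sigma> i) \<in> X" using i permutes_in_image[OF p] by auto
    let ?k = "card (orbit \<sigma> i)"
    have o2: "orbit \<sigma> (\<sigma> (\<sigma> i)) = orbit \<sigma> i" using wr_orbit_step[OF W] by simp
    have Wh: "wr_elt h (inv' \<sigma>) X" by (rule wr_elt_inverse[OF W h])
    have "(inv' \<sigma> ^^ card (orbit (inv' \<sigma>) (\<sigma> (\<sigma> i)))) (\<sigma> (\<sigma> i)) = \<sigma> (\<sigma> i)"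
      by (rule orbit_card(2)[OF wr_orbit_self[OF Wh]])
    then have "(inv' \<sigma> ^^ ?k) (\<sigma> (\<sigma> i)) = \<sigma> (\<sigma> i)" unfolding orb o2 .
    then have e: "cycle_prod G g \<sigma> (\<sigma> (\<sigma> i)) \<otimes> cycle_prod G h (inv' \<sigma>) i = \<one>"
      using seg_inverse[OF W i h, of ?k] unfolding cycle_prod_seg orb o2 by simp
    have ch: "cycle_prod G h (inv' \<sigma>) i \<in> carrier G" by (rule cycle_prod_closed[OF Wh i])
    have cg: "cycle_prod G g \<sigma> (\<sigma> (\<sigma> i)) \<in> carrier G" by (rule cycle_prod_closed[OF W sX(2)])
    have "cycle_prod G h (inv' \<sigma>) i = inv (cycle_prod G g \<sigma> (\<sigma> (\<sigma> i)))"
      using inv_equality[OF e ch cg] inv_inv[OF ch] by simp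
    then have "cycle_prod G h (inv' \<sigma>) i \<in> set_inv c \<longleftrightarrow> cycle_prod G g \<sigma> (\<sigma> (\<sigma> i)) \<in> c"
      using mem_set_inv[OF c cg] by simp
    also have "\<dots> \<longleftrightarrow> cycle_prod G g \<sigma> i \<in> c"
      by (rule cycle_class_orbit[OF W i _ c]) (use wr_orbit_self[OF W, of "\<sigma> (\<sigma> i)"] o2 in simp)
    finally show ?thesis .
  qed
  have "{orbit (inv' \<sigma>) i | i. i \<in> X \<and> cycle_prod G h (inv' \<sigma>) i \<in> set_inv c} = {orbit \<sigma> i | i. i \<in> X \<and> cycle_prod G g \<sigma> i \<in> c}"
    unfolding setcompr_eq_image orb by (rule image_cong[OF Collect_cong refl]) (use cls in auto)
  then show ?thesis using c set_inv_conj_classes[OF c] by (simp add: orbit_type_def)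
qed

lemma spin_type_inverse:
  assumes x: "x \<in> carrier (spin_wreath G n)" and c: "c \<in> conj_classes G"
  shows "spin_type G n (inv\<^bsub>spin_wreath G n\<^esub> x) (set_inv c) = spin_type G n x c"
proof -
  interpret W: group "spin_wreath G n" by (rule wreath_group)
  interpret S: group "spin_group n" unfolding spin_group_def by (rule presented_group_group)
  let ?y = "inv\<^bsub>spin_wreath G n\<^esub> x" and ?\<sigma> = "spin_perm n (snd x)"
  have y: "?y \<in> carrier (spin_wreath G n)" using x by simp
  have p: "?\<sigma> permutes {1..n}" using x by (simp add: wreath_carrier spin_perm_permutes)
  have e: "x \<otimes>\<^bsub>spin_wreath G n\<^esub> ?y = \<one>\<^bsub>spin_wreath G n\<^esub>" using x by simp
  have "snd x \<otimes>\<^bsub>spin_group n\<^esub> snd ?y = \<one>\<^bsub>spin_group n\<^esub>" using arg_cong[OF e, of snd] by (simp add: wreath_mult wreath_one)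
  moreover have sc: "snd x \<in> carrier (spin_group n)" "snd ?y \<in> carrier (spin_group n)"
    using x y unfolding wreath_carrier by blast+
  ultimately have "inv\<^bsub>spin_group n\<^esub> snd ?y = snd x" by (intro S.inv_equality)
  then have "snd ?y = inv\<^bsub>spin_group n\<^esub> snd x" using S.inv_inv[OF sc(2)] by simp
  then have \<sigma>: "spin_perm n (snd ?y) = inv' ?\<sigma>" using x by (simp add: spin_perm_inv wreath_carrier)
  have f: "(\<lambda>i\<in>{1..n}. fst x i \<otimes> fst ?y (inv' ?\<sigma> i)) = (\<lambda>i\<in>{1..n}. \<one>)"
    using arg_cong[OF e, of fst] by (simp only: wreath_mult wreath_one fst_conv)
  have h: "fst ?y j = inv (fst x (?\<sigma> j))" if j: "j \<in> {1..n}" for j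
  proof -
    have sj: "?\<sigma> j \<in> {1..n}" using j permutes_in_image[OF p] by blast
    have "fst x (?\<sigma> j) \<otimes> fst ?y (inv' ?\<sigma> (?\<sigma> j)) = \<one>"
      using fun_cong[OF f, of "?\<sigma> j"] sj by (simp only: restrict_apply if_True)
    then have 1: "fst x (?\<sigma> j) \<otimes> fst ?y j = \<one>" by (simp add: permutes_inverses[OF p])
    have c: "fst x (?\<sigma> j) \<in> carrier G" "fst ?y j \<in> carrier G"
      using x y j sj unfolding wreath_carrier by blast+
    show ?thesis using inv_equality[OF 1 c(2,1)] inv_inv[OF c(2)] by simp
  qed
  show ?thesis unfolding spin_type_eq \<sigma> by (rule orbit_type_inverse[OF wreath_wr_elt[OF x] h c])
qed

lemma spin_type_sum:
  assumes x: "x \<in> carrier (spin_wreath G n)"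
  shows "(\<Sum>c\<in>conj_classes G. sum_mset (spin_type G n x c)) = n"
    and "c \<notin> conj_classes G \<Longrightarrow> spin_type G n x c = {#}"
proof -
  let ?g = "fst x" and ?\<sigma> = "spin_perm n (snd x)"
  have W: "wr_elt ?g ?\<sigma> {1..n}" by (rule wreath_wr_elt[OF x])
  have sub: "orbit ?\<sigma> i \<subseteq> {1..n}" if "i \<in> {1..n}" for i
    using W that by (intro permutes_orbit_subset) (auto simp: wr_elt_def)
  let ?A = "\<lambda>c. {orbit ?\<sigma> i | i. i \<in> {1..n} \<and> cycle_prod G ?g ?\<sigma> i \<in> c}"
  have "sum_mset (spin_type G n x c) = card {i \<in> {1..n}. cycle_prod G ?g ?\<sigma> i \<in> c}" if c: "c \<in> conj_classes G" for c
  proof -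
    have "sum_mset (spin_type G n x c) = (\<Sum>C\<in>?A c. card C)"
      using c by (simp add: spin_type_eq orbit_type_def sum_unfold_sum_mset)
    also have "\<dots> = card (\<Union>(?A c))"
    proof (rule card_Union_disjoint[symmetric])
      show "pairwise disjnt (?A c)"
      proof (rule pairwiseI)
        fix C D assume CD: "C \<in> ?A c" "D \<in> ?A c" "C \<noteq> D"
        show "disjnt C D"
        proof (rule ccontr)
          assume "\<not> disjnt C D"
          then obtain z where z: "z \<in> C" "z \<in> D" by (auto simp: disjnt_def)
          obtain i j where "C = orbit ?\<sigma> i" "D = orbit ?\<sigma> j" using CD by blast
          then show False using wr_orbit_eq[OF W, of z i] wr_orbit_eq[OF W, of z j] z CD(3) by simp
        qed
      qed
      show "finite C" if "C \<in> ?A c" for C using that sub finite_subset[OF _ finite_atLeastAtMost] by blast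
    qed
    also have "\<Union>(?A c) = {i \<in> {1..n}. cycle_prod G ?g ?\<sigma> i \<in> c}"
    proof (intro equalityI subsetI)
      fix i assume "i \<in> {i \<in> {1..n}. cycle_prod G ?g ?\<sigma> i \<in> c}"
      then show "i \<in> \<Union>(?A c)" using wr_orbit_self[OF W, of i] by blast
    next
      fix j assume "j \<in> \<Union>(?A c)"
      then obtain i where i: "i \<in> {1..n}" "cycle_prod G ?g ?\<sigma> i \<in> c" "j \<in> orbit ?\<sigma> i" by blast
      then show "j \<in> {i \<in> {1..n}. cycle_prod G ?g ?\<sigma> i \<in> c}"
        using cycle_class_orbit[OF W i(1,3) c] sub[OF i(1)] by blast
    qed
    finally show ?thesis .
  qed
  then have "(\<Sum>c\<in>conj_classes G. sum_mset (spin_type G n x c)) = (\<Sum>c\<in>conj_classes G. card {i \<in> {1..n}. cycle_prod G ?g ?\<sigma> i \<in> c})"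
    by simp
  also have "\<dots> = card (\<Union>c\<in>conj_classes G. {i \<in> {1..n}. cycle_prod G ?g ?\<sigma> i \<in> c})"
  proof (rule card_UN_disjoint[symmetric, OF finite_conj_classes])
    show "\<forall>c\<in>conj_classes G. \<forall>d\<in>conj_classes G. c \<noteq> d \<longrightarrow>
        {i \<in> {1..n}. cycle_prod G ?g ?\<sigma> i \<in> c} \<inter> {i \<in> {1..n}. cycle_prod G ?g ?\<sigma> i \<in> d} = {}"
      using conj_classes_disjoint by blast
  qed simp
  also have "(\<Union>c\<in>conj_classes G. {i \<in> {1..n}. cycle_prod G ?g ?\<sigma> i \<in> c}) = {1..n}"
    using conj_class_in[OF cycle_prod_closed[OF W]] conj_class_self[OF cycle_prod_closed[OF W]] by blast
  finally show "(\<Sum>c\<in>conj_classes G. sum_mset (spin_type G n x c)) = n" by simp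
  show "c \<notin> conj_classes G \<Longrightarrow> spin_type G n x c = {#}" by (simp add: spin_type_eq orbit_type_def)
qed

section \<open>Standard elements for an ordered list of parts\<close>

definition block_prods :: "(nat \<Rightarrow> 'a) \<Rightarrow> (nat \<times> nat \<times> 'a set) list \<Rightarrow> bool" where
  "block_prods g ivs \<longleftrightarrow> (\<forall>(a, b, c)\<in>set ivs. ordered_prod G g (rev [a..<Suc b]) \<in> c)"

text \<open>The first interval is a single cycle, and its cycle product taken from the left end is
  the ordered product in \<open>block_prods\<close>. Removing it leaves the statement for the
  remaining intervals.\<close>

lemma block_orbit_type:
  assumes W: "wr_elt g \<sigma> X" and "{a..<a + block_total ps} \<subseteq> X"
    and "\<forall>p\<in>set ps. 0 < fst p \<and> snd p \<in> conj_classes G"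
    and "block_perm (cut_intervals a ps) \<sigma>" and "block_prods g (cut_intervals a ps)"
  shows "\<sigma> ` {a..<a + block_total ps} \<subseteq> {a..<a + block_total ps} \<and>
    orbit_type g \<sigma> {a..<a + block_total ps} = (\<lambda>c. image_mset fst (filter_mset (\<lambda>p. snd p = c) (mset ps)))"
  using assms(2-)
proof (induction ps arbitrary: a)
  case Nil
  then show ?case by (simp add: orbit_type_empty)
next
  case (Cons p ps)
  obtain k c where p: "p = (k, c)" by force
  let ?b = "a + k - 1" and ?ivs = "cut_intervals (a + k) ps" and ?Y = "{a..<a + block_total (p # ps)}" and ?Y' = "{a + k..<a + k + block_total ps}"
  have k: "0 < k" and c: "c \<in> conj_classes G" using Cons.prems(2) p by auto
  have s: "\<And>i. a \<le> i \<Longrightarrow> i < a + k - 1 \<Longrightarrow> \<sigma> i = i + 1" "\<sigma> (a + k - 1) = a"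
    using Cons.prems(3) by (auto simp: p block_perm_def)
  have IH: "\<sigma> ` ?Y' \<subseteq> ?Y'"
    "orbit_type g \<sigma> ?Y' = (\<lambda>c. image_mset fst (filter_mset (\<lambda>p. snd p = c) (mset ps)))"
  proof -
    have "?Y' \<subseteq> ?Y" by (auto simp: p)
    then have 1: "?Y' \<subseteq> X" using Cons.prems(1) by (rule subset_trans)
    have 2: "\<forall>p\<in>set ps. 0 < fst p \<and> snd p \<in> conj_classes G" using Cons.prems(2) by simp
    have 3: "block_perm ?ivs \<sigma>" "block_prods g ?ivs"
      using Cons.prems(3,4) by (simp_all add: p block_perm_def block_prods_def)
    show "\<sigma> ` ?Y' \<subseteq> ?Y'"
      "orbit_type g \<sigma> ?Y' = (\<lambda>c. image_mset fst (filter_mset (\<lambda>p. snd p = c) (mset ps)))"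
      using Cons.IH[OF 1 2 3] by simp_all
  qed
  have o1: "(\<sigma> ^^ j) a = a + j" if "j < k" for j
    by (rule block_cycle(1)[where \<sigma> = \<sigma> and k = k]) (use s k that in auto)
  have o2: "orbit \<sigma> a = {a..<a + k}"
    by (rule block_cycle(2)[where \<sigma> = \<sigma> and k = k]) (use s k in auto)
  have Y: "?Y = {a..<a + k} \<union> ?Y'" by (auto simp: p)
  have st0: "\<sigma> i \<in> {a..<a + k}" if i: "i \<in> {a..<a + k}" for i
  proof (cases "i = ?b")
    case True
    then show ?thesis using s(2) k by simp
  next
    case False
    then show ?thesis using s(1)[of i] i by auto
  qed
  have st: "\<sigma> ` ?Y \<subseteq> ?Y"
  proof (rule image_subsetI)
    fix i assume "i \<in> ?Y"
    then consider "i \<in> {a..<a + k}" | "i \<in> ?Y'" unfolding Y by blast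
    then show "\<sigma> i \<in> ?Y"
    proof cases
      case 1
      then show ?thesis unfolding Y using st0 by blast
    next
      case 2
      then show ?thesis unfolding Y using IH(1) by blast
    qed
  qed
  have cp: "cycle_prod G g \<sigma> a \<in> c"
  proof -
    have "map (\<lambda>j. (\<sigma> ^^ j) a) [0..<k] = map (\<lambda>j. a + j) [0..<k]" using o1 by simp
    also have "\<dots> = [a..<a + k]" by (rule nth_equalityI) simp_all
    finally have "cycle_prod G g \<sigma> a = ordered_prod G g (rev [a..<a + k])"
      by (simp add: cycle_prod_def o2)
    moreover have "ordered_prod G g (rev [a..<Suc ?b]) \<in> c"
      using Cons.prems(4) by (simp add: p block_prods_def del: upt_Suc)
    moreover have "Suc ?b = a + k" using k by simp
    ultimately show ?thesis by simp
  qed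
  have D: "?Y - orbit \<sigma> a = ?Y'" unfolding o2 by (auto simp: p)
  have aY: "a \<in> ?Y" using k by (simp add: p)
  have "orbit_type g \<sigma> ?Y = (orbit_type g \<sigma> ?Y')(c := add_mset k (orbit_type g \<sigma> ?Y' c))"
    using orbit_type_remove[OF W Cons.prems(1) st aY c cp] unfolding D by (simp add: o2)
  also have "\<dots> = (\<lambda>c. image_mset fst (filter_mset (\<lambda>p. snd p = c) (mset (p # ps))))"
    unfolding IH(2) by (auto simp: p fun_eq_iff)
  finally show ?case using st by blast
qed

lemma ordered_prod_cong: "(\<And>i. i \<in> set is \<Longrightarrow> g i = h i) \<Longrightarrow> ordered_prod G g is = ordered_prod G h is"
  unfolding ordered_prod_def by (rule foldr_cong) auto

lemma block_prods_exist:
  assumes "\<forall>p\<in>set ps. 0 < fst p \<and> snd p \<in> conj_classes G"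
  shows "\<exists>g. (\<forall>i. g i \<in> carrier G) \<and> block_prods g (cut_intervals a ps)"
  using assms
proof (induction ps arbitrary: a)
  case Nil
  show ?case by (intro exI[of _ "\<lambda>_. \<one>"]) (simp add: block_prods_def)
next
  case (Cons p ps)
  obtain k c where p: "p = (k, c)" by force
  have k: "0 < k" and c: "c \<in> conj_classes G" and pos: "\<forall>p\<in>set ps. 0 < fst p" using Cons.prems p by auto
  obtain u where u: "u \<in> carrier G" "u \<in> c" using c conj_class_self unfolding conj_classes_def by blast
  obtain g where g: "\<And>i. g i \<in> carrier G" "block_prods g (cut_intervals (a + k) ps)"
    using Cons.IH[of "a + k"] Cons.prems by auto
  \<comment> \<open>The first index of the interval carries a representative of the class and all
    others the identity, so the ordered product is that representative.\<close>
  let ?g = "\<lambda>i. if i = a then u else if i < a + k then \<one> else g i"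
  have gc: "?g i \<in> carrier G" for i using g u by simp
  have ones: "ordered_prod G h (is @ [j]) = h j" if "\<And>i. i \<in> set is \<Longrightarrow> h i = \<one>" "h j \<in> carrier G" for h "is" j
    using that by (induction "is") (auto simp: ordered_prod_def)
  have "rev [a..<Suc (a + k - 1)] = rev [Suc a..<a + k] @ [a]"
    using k upt_conv_Cons[of a "a + k"] by simp
  then have "ordered_prod G ?g (rev [a..<Suc (a + k - 1)]) = u"
    using ones[of "rev [Suc a..<a + k]" ?g a] u by simp
  moreover have "ordered_prod G ?g (rev [a'..<Suc b']) \<in> c'" if m: "(a', b', c') \<in> set (cut_intervals (a + k) ps)" for a' b' c'
  proof -
    have "a + k \<le> a'" using intervals_range[OF pos m] by simp
    then have "ordered_prod G ?g (rev [a'..<Suc b']) = ordered_prod G g (rev [a'..<Suc b'])"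
      using k by (intro ordered_prod_cong) auto
    then show ?thesis using g(2) m by (auto simp: block_prods_def simp del: upt_Suc)
  qed
  ultimately have "block_prods ?g (cut_intervals a (p # ps))"
    using u(2) unfolding p block_prods_def by (auto simp del: upt_Suc)
  then show ?case using gc by (intro exI[of _ ?g]) blast
qed

lemma standard_exists:
  assumes "\<forall>p\<in>set ps. 0 < fst p \<and> snd p \<in> conj_classes G" "block_total ps = n"
  shows "\<exists>g\<in>{1..n} \<rightarrow>\<^sub>E carrier G. block_prods g (cut_intervals 1 ps)"
proof -
  have pos: "\<forall>p\<in>set ps. 0 < fst p" using assms(1) by blast
  from block_prods_exist[OF assms(1), of 1]
  obtain g where g: "\<forall>i. g i \<in> carrier G" "block_prods g (cut_intervals 1 ps)" by (elim exE conjE)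
  have "block_prods (restrict g {1..n}) (cut_intervals 1 ps)"
    unfolding block_prods_def
  proof clarify
    fix a b c assume m: "(a, b, c) \<in> set (cut_intervals 1 ps)"
    have "ordered_prod G (restrict g {1..n}) (rev [a..<Suc b]) = ordered_prod G g (rev [a..<Suc b])"
      using intervals_range[OF pos m] assms(2) by (intro ordered_prod_cong) auto
    then show "ordered_prod G (restrict g {1..n}) (rev [a..<Suc b]) \<in> c"
      using g(2) m by (auto simp: block_prods_def simp del: upt_Suc)
  qed
  moreover have "restrict g {1..n} \<in> {1..n} \<rightarrow>\<^sub>E carrier G" using g(1) by auto
  ultimately show ?thesis by blast
qed

lemma standard_elt:
  assumes ps: "\<forall>p\<in>set ps. 0 < fst p \<and> snd p \<in> conj_classes G" "block_total ps = n"
    and g: "g \<in> {1..n} \<rightarrow>\<^sub>E carrier G" "block_prods g (cut_intervals 1 ps)"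
  shows "set (block_word (cut_intervals 1 ps)) \<subseteq> {1..<n}"
    and "(g, tw n (block_word (cut_intervals 1 ps))) \<in> carrier (spin_wreath G n)"
    and "spin_type G n (g, tw n (block_word (cut_intervals 1 ps))) = (\<lambda>c. image_mset fst (filter_mset (\<lambda>p. snd p = c) (mset ps)))"
proof -
  have pos: "\<forall>p\<in>set ps. 0 < fst p" using ps(1) by blast
  show r: "set (block_word (cut_intervals 1 ps)) \<subseteq> {1..<n}"
    using block_word_range[OF pos, of _ 1] ps(2) by fastforce
  show x: "(g, tw n (block_word (cut_intervals 1 ps))) \<in> carrier (spin_wreath G n)"
    using g(1) tw_closed[OF r] by (simp add: wreath_carrier)
  have "{1..<1 + block_total ps} = {1..n}" using ps(2) by auto
  then show "spin_type G n (g, tw n (block_word (cut_intervals 1 ps))) = (\<lambda>c. image_mset fst (filter_mset (\<lambda>p. snd p = c) (mset ps)))"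
    using block_orbit_type[OF wreath_wr_elt[OF x], of 1 ps] ps(1) tperm_block_perm[OF pos, of 1] g(2)
    by (simp add: spin_type_eq spin_perm_tw[OF r])
qed

definition parts_mset :: "'a part_fun \<Rightarrow> (nat \<times> 'a set) multiset" where
  "parts_mset \<rho> = (\<Sum>c\<in>conj_classes G. image_mset (\<lambda>k. (k, c)) (\<rho> c))"

lemma filter_parts_mset:
  assumes "\<And>c. c \<notin> conj_classes G \<Longrightarrow> \<rho> c = {#}"
  shows "image_mset fst (filter_mset (\<lambda>p. snd p = c) (parts_mset \<rho>)) = \<rho> c"
proof -
  have f: "filter_mset (\<lambda>p. snd p = c) (\<Sum>c'\<in>A. image_mset (\<lambda>k. (k, c')) (\<rho> c'))
      = (if c \<in> A then image_mset (\<lambda>k. (k, c)) (\<rho> c) else {#})" if "finite A" for A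
    using that
  proof (induction A rule: finite_induct)
    case (insert d A)
    have "filter_mset (\<lambda>p. snd p = c) (image_mset (\<lambda>k. (k, d)) (\<rho> d)) = (if d = c then image_mset (\<lambda>k. (k, c)) (\<rho> c) else {#})"
      by (auto simp: filter_mset_image_mset o_def)
    then show ?case using insert by auto
  qed simp
  show ?thesis unfolding parts_mset_def f[OF finite_conj_classes] using assms by (auto simp: image_mset.compositionality o_def)
qed

lemma sum_parts_mset: "sum_mset (image_mset fst (parts_mset \<rho>)) = (\<Sum>c\<in>conj_classes G. sum_mset (\<rho> c))"
proof -
  have "sum_mset (image_mset fst (\<Sum>c\<in>A. image_mset (\<lambda>k. (k, c)) (\<rho> c))) = (\<Sum>c\<in>A. sum_mset (\<rho> c))" if "finite A" for A
    using that by (induction A rule: finite_induct) (auto simp: image_mset.compositionality o_def)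
  then show ?thesis unfolding parts_mset_def by (simp add: finite_conj_classes)
qed

lemma mem_parts_mset: "(k, c) \<in># parts_mset \<rho> \<longleftrightarrow> c \<in> conj_classes G \<and> k \<in># \<rho> c"
  unfolding parts_mset_def by (auto simp: set_mset_sum finite_conj_classes)

lemma standard_of_parts:
  assumes \<rho>: "\<forall>c. c \<notin> conj_classes G \<longrightarrow> \<rho> c = {#}" "\<forall>c. \<forall>k\<in>#\<rho> c. 0 < k"
    "(\<Sum>c\<in>conj_classes G. sum_mset (\<rho> c)) = n" and ps: "mset ps = parts_mset \<rho>"
  shows "\<forall>p\<in>set ps. 0 < fst p \<and> snd p \<in> conj_classes G" "block_total ps = n"
    "(\<lambda>c. image_mset fst (filter_mset (\<lambda>p. snd p = c) (mset ps))) = \<rho>"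
proof -
  show "\<forall>p\<in>set ps. 0 < fst p \<and> snd p \<in> conj_classes G"
    using mem_parts_mset[of _ _ \<rho>] \<rho>(2) unfolding set_mset_mset[symmetric] ps by auto
  have "block_total ps = sum_mset (image_mset fst (mset ps))" by (simp add: block_total_def sum_mset_sum_list[symmetric])
  then show "block_total ps = n" unfolding ps sum_parts_mset \<rho>(3) .
  show "(\<lambda>c. image_mset fst (filter_mset (\<lambda>p. snd p = c) (mset ps))) = \<rho>"
    unfolding ps using filter_parts_mset[of \<rho>] \<rho>(1) by (intro ext) blast
qed

text \<open>By \<open>word_act_block\<close> the coefficient is a product of powers of 1/2, one for
  each interval. The positivity is what fixes the sign on D+.\<close>

lemma block_word_tr_pos:
  assumes "\<forall>p\<in>set ps. odd (fst p)"
  shows "0 < word_act (pos_word (map Tgen (block_word (cut_intervals a ps)))) vac {}"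
  using assms
proof (induction ps arbitrary: a)
  case Nil
  then show ?case by (simp add: vac_def)
next
  case (Cons p ps)
  obtain k c where p: "p = (k, c)" by force
  then obtain m where m: "k = 2 * m + 1" using Cons.prems by (auto elim: oddE)
  have pos: "\<forall>p\<in>set ps. 0 < fst p" using Cons.prems by (auto intro: odd_pos)
  let ?r = "block_word (cut_intervals (a + k) ps)"
  have "word_act (pos_word (map Tgen ([a..<a + 2 * m] @ ?r))) vac {} = word_act (pos_word (map Tgen ?r)) vac {} / 2 ^ m"
    by (rule word_act_block) (use block_word_range[OF pos] m in fastforce)
  then show ?case using Cons m by (simp add: p)
qed

end

section \<open>Signs of swapping words with separated supports, and the parity\<close>

context
  fixes n :: nat
begin

interpretation S: group "spin_group n"
  unfolding spin_group_def by (rule presented_group_group)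

definition zpow :: "nat \<Rightarrow> spin_elt \<Rightarrow> spin_elt" where
  "zpow e A = (if odd e then Zs n \<otimes>\<^bsub>spin_group n\<^esub> A else A)"

lemma zpow_zpow: "A \<in> carrier (spin_group n) \<Longrightarrow> zpow a (zpow b A) = zpow (a + b) A"
  by (simp add: zpow_def Zs_Zs)

lemma zpow_mult:
  assumes "A \<in> carrier (spin_group n)" "B \<in> carrier (spin_group n)"
  shows "zpow e A \<otimes>\<^bsub>spin_group n\<^esub> B = zpow e (A \<otimes>\<^bsub>spin_group n\<^esub> B)"
    "A \<otimes>\<^bsub>spin_group n\<^esub> zpow e B = zpow e (A \<otimes>\<^bsub>spin_group n\<^esub> B)"
proof -
  show "zpow e A \<otimes>\<^bsub>spin_group n\<^esub> B = zpow e (A \<otimes>\<^bsub>spin_group n\<^esub> B)"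
    using assms by (simp add: zpow_def S.m_assoc)
  have "A \<otimes>\<^bsub>spin_group n\<^esub> (Zs n \<otimes>\<^bsub>spin_group n\<^esub> B) = Zs n \<otimes>\<^bsub>spin_group n\<^esub> (A \<otimes>\<^bsub>spin_group n\<^esub> B)"
    using assms Zs_central[OF assms(1)] by (simp add: S.m_assoc[symmetric])
  then show "A \<otimes>\<^bsub>spin_group n\<^esub> zpow e B = zpow e (A \<otimes>\<^bsub>spin_group n\<^esub> B)" by (simp add: zpow_def)
qed

lemma T_far_zpow:
  assumes "i \<in> {1..<n}" "j \<in> {1..<n}" "i > j + 1 \<or> j > i + 1"
  shows "tw n [i] \<otimes>\<^bsub>spin_group n\<^esub> tw n [j] = zpow 1 (tw n [j] \<otimes>\<^bsub>spin_group n\<^esub> tw n [i])"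
proof -
  have c: "tw n [i] \<in> carrier (spin_group n)" "tw n [j] \<in> carrier (spin_group n)" using assms tw_closed by auto
  have a: "tw n [i] \<otimes>\<^bsub>spin_group n\<^esub> tw n [j] = tw n [i, j]" "tw n [j] \<otimes>\<^bsub>spin_group n\<^esub> tw n [i] = tw n [j, i]"
    using tw_append[of "[i]" n "[j]"] tw_append[of "[j]" n "[i]"] assms by simp_all
  show ?thesis
  proof (cases "i > j + 1")
    case True
    then show ?thesis unfolding a using T_far[OF assms(1,2)] by (simp add: zpow_def)
  next
    case False
    then have "tw n [j, i] = Zs n \<otimes>\<^bsub>spin_group n\<^esub> tw n [i, j]" using T_far[OF assms(2,1)] assms(3) by simp
    then show ?thesis unfolding a using Zs_Zs[of "tw n [i, j]"] c a by (simp add: zpow_def S.m_closed[of "tw n [i]" "tw n [j]", unfolded a])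
  qed
qed

lemma tw_move:
  assumes "j \<in> {1..<n}" "set is \<subseteq> {1..<n}" "\<forall>i\<in>set is. i > j + 1 \<or> j > i + 1"
  shows "tw n [j] \<otimes>\<^bsub>spin_group n\<^esub> tw n is = zpow (length is) (tw n is \<otimes>\<^bsub>spin_group n\<^esub> tw n [j])"
  using assms(2,3)
proof (induction "is")
  case Nil
  then show ?case using tw_closed[of "[j]" n] assms(1) by (simp add: tw_Nil zpow_def)
next
  case (Cons i "is")
  have c: "tw n [i] \<in> carrier (spin_group n)" "tw n [j] \<in> carrier (spin_group n)" "tw n is \<in> carrier (spin_group n)"
    using assms(1) Cons.prems tw_closed by auto
  have e: "tw n (i # is) = tw n [i] \<otimes>\<^bsub>spin_group n\<^esub> tw n is" using tw_append[of "[i]" n "is"] Cons.prems by simp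
  have "tw n [j] \<otimes>\<^bsub>spin_group n\<^esub> tw n (i # is) = (tw n [j] \<otimes>\<^bsub>spin_group n\<^esub> tw n [i]) \<otimes>\<^bsub>spin_group n\<^esub> tw n is"
    unfolding e using c by (simp add: S.m_assoc)
  also have "tw n [j] \<otimes>\<^bsub>spin_group n\<^esub> tw n [i] = zpow 1 (tw n [i] \<otimes>\<^bsub>spin_group n\<^esub> tw n [j])"
    by (rule T_far_zpow) (use assms(1) Cons.prems in auto)
  also have "zpow 1 (tw n [i] \<otimes>\<^bsub>spin_group n\<^esub> tw n [j]) \<otimes>\<^bsub>spin_group n\<^esub> tw n is
      = zpow 1 (tw n [i] \<otimes>\<^bsub>spin_group n\<^esub> (tw n [j] \<otimes>\<^bsub>spin_group n\<^esub> tw n is))"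
    using c by (simp add: zpow_mult S.m_assoc)
  also have "tw n [j] \<otimes>\<^bsub>spin_group n\<^esub> tw n is = zpow (length is) (tw n is \<otimes>\<^bsub>spin_group n\<^esub> tw n [j])"
    using Cons by simp
  also have "zpow 1 (tw n [i] \<otimes>\<^bsub>spin_group n\<^esub> zpow (length is) (tw n is \<otimes>\<^bsub>spin_group n\<^esub> tw n [j]))
      = zpow (length (i # is)) (tw n (i # is) \<otimes>\<^bsub>spin_group n\<^esub> tw n [j])"
    unfolding e using c by (simp add: zpow_mult zpow_zpow S.m_assoc Suc_eq_plus1 add.commute)
  finally show ?case .
qed

text \<open>Each letter of \<open>js\<close> passes each letter of \<open>is\<close> at the cost of
  one z, because their indices are neither equal nor adjacent; z has order dividing 2, so only the
  parity of the product of the lengths matters.\<close>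

lemma tw_swap:
  assumes "set js \<subseteq> {1..<n}" "set is \<subseteq> {1..<n}" "\<forall>j\<in>set js. \<forall>i\<in>set is. i > j + 1 \<or> j > i + 1"
  shows "tw n js \<otimes>\<^bsub>spin_group n\<^esub> tw n is = zpow (length js * length is) (tw n is \<otimes>\<^bsub>spin_group n\<^esub> tw n js)"
  using assms(1,3)
proof (induction js)
  case Nil
  then show ?case using tw_closed[OF assms(2)] by (simp add: tw_Nil zpow_def)
next
  case (Cons j js)
  have c: "tw n [j] \<in> carrier (spin_group n)" "tw n js \<in> carrier (spin_group n)" "tw n is \<in> carrier (spin_group n)"
    using assms(2) Cons.prems tw_closed by auto
  have e: "tw n (j # js) = tw n [j] \<otimes>\<^bsub>spin_group n\<^esub> tw n js" using tw_append[of "[j]" n js] Cons.prems by simp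
  have "tw n (j # js) \<otimes>\<^bsub>spin_group n\<^esub> tw n is = tw n [j] \<otimes>\<^bsub>spin_group n\<^esub> (tw n js \<otimes>\<^bsub>spin_group n\<^esub> tw n is)"
    unfolding e using c by (simp add: S.m_assoc)
  also have "\<dots> = zpow (length js * length is) ((tw n [j] \<otimes>\<^bsub>spin_group n\<^esub> tw n is) \<otimes>\<^bsub>spin_group n\<^esub> tw n js)"
    using Cons c by (simp add: zpow_mult S.m_assoc)
  also have "tw n [j] \<otimes>\<^bsub>spin_group n\<^esub> tw n is = zpow (length is) (tw n is \<otimes>\<^bsub>spin_group n\<^esub> tw n [j])"
    by (rule tw_move) (use Cons.prems assms(2) in auto)
  also have "zpow (length js * length is) (zpow (length is) (tw n is \<otimes>\<^bsub>spin_group n\<^esub> tw n [j]) \<otimes>\<^bsub>spin_group n\<^esub> tw n js)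
      = zpow (length (j # js) * length is) (tw n is \<otimes>\<^bsub>spin_group n\<^esub> tw n (j # js))"
    unfolding e using c by (simp add: zpow_mult zpow_zpow S.m_assoc add.commute)
  finally show ?case .
qed

lemma spin_parity_word:
  assumes "set gs \<subseteq> spin_gens n"
  shows "spin_parity (spin_word n gs) = foldr (\<lambda>g h. ((case g of Zgen \<Rightarrow> (0::int) | Tgen i \<Rightarrow> (1::int)) + h) mod 2) gs 0"
proof -
  let ?\<phi> = "\<lambda>g. case g of Zgen \<Rightarrow> (0::int) | Tgen i \<Rightarrow> (1::int)"
  have 0: "group (integer_mod_group 2)" by simp
  have 1: "?\<phi> \<in> spin_gens n \<rightarrow> carrier (integer_mod_group 2)"
    by (auto simp: spin_gens_def carrier_integer_mod_group)
  have 2: "word_eval (integer_mod_group 2) ?\<phi> u = word_eval (integer_mod_group 2) ?\<phi> v" if "(u, v) \<in> spin_rels n" for u v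
    using that by (auto simp: spin_rels_def word_eval_def numeral_3_eq_3)
  have "spin_parity (spin_word n gs) = word_eval (integer_mod_group 2) ?\<phi> (pos_word gs)"
    unfolding spin_parity_def spin_word_def by (rule pres_lift_class[OF 0 1 2]) (use assms in auto)
  also have "\<dots> = foldr (\<lambda>g h. (?\<phi> g + h) mod 2) gs 0"
    by (induction gs) (simp_all add: word_eval_def)
  finally show ?thesis .
qed

lemma spin_parity_tw: "set is \<subseteq> {1..<n} \<Longrightarrow> spin_parity (tw n is) = int (length is) mod 2"
  unfolding tw_def by (subst spin_parity_word, force) (induction "is", simp_all add: mod_simps)

lemma spin_parity_Zs: "spin_parity (Zs n) = 0"
  by (subst spin_parity_word) simp_all

lemma spin_parity_mult:
  "A \<in> carrier (spin_group n) \<Longrightarrow> B \<in> carrier (spin_group n) \<Longrightarrow>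
     spin_parity (A \<otimes>\<^bsub>spin_group n\<^esub> B) = (spin_parity A + spin_parity B) mod 2"
  using hom_mult[OF spin_parity_hom] by simp

lemma spin_parity_range: "A \<in> carrier (spin_group n) \<Longrightarrow> spin_parity A = 0 \<or> spin_parity A = 1"
  using hom_in_carrier[OF spin_parity_hom] by (fastforce simp: carrier_integer_mod_group)

lemma spin_parity_conj:
  assumes "A \<in> carrier (spin_group n)" "B \<in> carrier (spin_group n)"
  shows "spin_parity (B \<otimes>\<^bsub>spin_group n\<^esub> A \<otimes>\<^bsub>spin_group n\<^esub> inv\<^bsub>spin_group n\<^esub> B) = spin_parity A"
proof -
  let ?C = "B \<otimes>\<^bsub>spin_group n\<^esub> A \<otimes>\<^bsub>spin_group n\<^esub> inv\<^bsub>spin_group n\<^esub> B"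
  have c: "?C \<in> carrier (spin_group n)" using assms by simp
  have e: "?C \<otimes>\<^bsub>spin_group n\<^esub> B = B \<otimes>\<^bsub>spin_group n\<^esub> A" using assms by (simp add: S.m_assoc)
  have "(spin_parity ?C + spin_parity B) mod 2 = (spin_parity B + spin_parity A) mod 2"
    using arg_cong[OF e, of spin_parity] assms c by (simp only: spin_parity_mult)
  then show ?thesis using spin_parity_range[OF c] spin_parity_range[OF assms(1)] spin_parity_range[OF assms(2)] by auto
qed

end

lemma even_block_word:
  assumes "\<forall>p\<in>set ps. odd (fst p)" shows "even (length (block_word (cut_intervals a ps)))"
  using assms
proof (induction ps arbitrary: a)
  case (Cons p ps)
  obtain k c where p: "p = (k, c)" by force
  then show ?case using Cons by (auto elim!: oddE)
qed simp

section \<open>Values of spin functions\<close>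

context finite_group
begin

lemma wreath_conj_snd:
  assumes "x \<in> carrier (spin_wreath G n)" "y \<in> carrier (spin_wreath G n)"
  shows "snd (y \<otimes>\<^bsub>spin_wreath G n\<^esub> x \<otimes>\<^bsub>spin_wreath G n\<^esub> inv\<^bsub>spin_wreath G n\<^esub> y)
    = snd y \<otimes>\<^bsub>spin_group n\<^esub> snd x \<otimes>\<^bsub>spin_group n\<^esub> inv\<^bsub>spin_group n\<^esub> (snd y)"
    and "snd (inv\<^bsub>spin_wreath G n\<^esub> y) = inv\<^bsub>spin_group n\<^esub> (snd y)"
proof -
  interpret W: group "spin_wreath G n" by (rule wreath_group)
  interpret S: group "spin_group n" unfolding spin_group_def by (rule presented_group_group)
  have c: "snd y \<in> carrier (spin_group n)" "snd (inv\<^bsub>spin_wreath G n\<^esub> y) \<in> carrier (spin_group n)"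
    using assms(2) W.inv_closed[OF assms(2)] unfolding wreath_carrier by blast+
  have "snd (inv\<^bsub>spin_wreath G n\<^esub> y \<otimes>\<^bsub>spin_wreath G n\<^esub> y) = \<one>\<^bsub>spin_group n\<^esub>"
    using assms(2) by (simp add: wreath_one)
  then have "snd (inv\<^bsub>spin_wreath G n\<^esub> y) \<otimes>\<^bsub>spin_group n\<^esub> snd y = \<one>\<^bsub>spin_group n\<^esub>" by (simp add: wreath_mult)
  then show i: "snd (inv\<^bsub>spin_wreath G n\<^esub> y) = inv\<^bsub>spin_group n\<^esub> (snd y)"
    using S.inv_equality[OF _ c] by simp
  show "snd (y \<otimes>\<^bsub>spin_wreath G n\<^esub> x \<otimes>\<^bsub>spin_wreath G n\<^esub> inv\<^bsub>spin_wreath G n\<^esub> y)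
    = snd y \<otimes>\<^bsub>spin_group n\<^esub> snd x \<otimes>\<^bsub>spin_group n\<^esub> inv\<^bsub>spin_group n\<^esub> (snd y)"
    by (simp add: wreath_mult i)
qed

lemma spin_functionD:
  assumes "f \<in> spin_functions G n"
  shows "x \<in> carrier (spin_wreath G n) \<Longrightarrow> y \<in> carrier (spin_wreath G n) \<Longrightarrow>
      f (y \<otimes>\<^bsub>spin_wreath G n\<^esub> x \<otimes>\<^bsub>spin_wreath G n\<^esub> inv\<^bsub>spin_wreath G n\<^esub> y) = f x"
    "x \<in> carrier (spin_wreath G n) \<Longrightarrow> f (spin_z G n \<otimes>\<^bsub>spin_wreath G n\<^esub> x) = - f x"
    "x \<in> carrier (spin_wreath G n) \<Longrightarrow> spin_parity (snd x) = 1 \<Longrightarrow> f x = 0"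
    "x \<notin> carrier (spin_wreath G n) \<Longrightarrow> f x = 0"
  using assms unfolding spin_functions_def class_functions_def by blast+

text \<open>An element of the type of x0 is conjugate to x0 or to z x0. The trace and every spin
  function are invariant under conjugation and odd under z, so all of them change by one common
  sign; the parity does not see z.\<close>

lemma same_type_cases:
  assumes x0: "x0 \<in> carrier (spin_wreath G n)" and x: "x \<in> carrier (spin_wreath G n)"
    and ty: "spin_type G n x0 = spin_type G n x"
  obtains "spin_tr (snd x) = spin_tr (snd x0)" "spin_parity (snd x) = spin_parity (snd x0)"
      "\<And>f. f \<in> spin_functions G n \<Longrightarrow> f x = f x0"
    | "spin_tr (snd x) = - spin_tr (snd x0)" "spin_parity (snd x) = spin_parity (snd x0)"
      "\<And>f. f \<in> spin_functions G n \<Longrightarrow> f x = - f x0"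
proof -
  let ?c = "\<lambda>y. y \<otimes>\<^bsub>spin_wreath G n\<^esub> x0 \<otimes>\<^bsub>spin_wreath G n\<^esub> inv\<^bsub>spin_wreath G n\<^esub> y"
  obtain y where y: "y \<in> carrier (spin_wreath G n)" "?c y = x \<or> ?c y = spin_z G n \<otimes>\<^bsub>spin_wreath G n\<^esub> x"
    by (rule spin_type_conjugate[OF x0 x ty])
  have sc: "snd x0 \<in> carrier (spin_group n)" "snd x \<in> carrier (spin_group n)" "snd y \<in> carrier (spin_group n)"
    using x0 x y(1) unfolding wreath_carrier by blast+
  have t: "spin_tr (snd (?c y)) = spin_tr (snd x0)" "spin_parity (snd (?c y)) = spin_parity (snd x0)"
    unfolding wreath_conj_snd[OF x0 y(1)] by (rule spin_tr_conj[OF sc(1,3)], rule spin_parity_conj[OF sc(1,3)])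
  have f: "f (?c y) = f x0" if "f \<in> spin_functions G n" for f by (rule spin_functionD(1)[OF that x0 y(1)])
  show ?thesis
    using y(2)
  proof
    assume e: "?c y = x"
    show ?thesis using t f unfolding e by (rule that(1))
  next
    assume e: "?c y = spin_z G n \<otimes>\<^bsub>spin_wreath G n\<^esub> x"
    have "spin_tr (snd x) = - spin_tr (snd x0)"
      using t(1) unfolding e spin_z_mult[OF x] by (simp add: spin_tr_Zs[OF sc(2)])
    moreover have "spin_parity (snd x) = spin_parity (snd x0)"
      using t(2) spin_parity_range[OF sc(2)] unfolding e spin_z_mult[OF x]
      by (auto simp: spin_parity_mult[OF _ sc(2)] spin_parity_Zs)
    moreover have "f x = - f x0" if ff: "f \<in> spin_functions G n" for f
      using f[OF ff] spin_functionD(2)[OF ff x] unfolding e by (metis minus_minus)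
    ultimately show ?thesis by (rule that(2))
  qed
qed

lemma spin_type_pos:
  assumes x: "x \<in> carrier (spin_wreath G n)" and "k \<in># spin_type G n x c"
  shows "0 < k"
proof -
  have W: "wr_elt (fst x) (spin_perm n (snd x)) {1..n}" by (rule wreath_wr_elt[OF x])
  have "k \<in> card ` {orbit (spin_perm n (snd x)) i | i. i \<in> {1..n} \<and> cycle_prod G (fst x) (spin_perm n (snd x)) i \<in> c}"
    using assms(2) by (auto simp: spin_type_eq orbit_type_def split: if_splits)
  then obtain i where "k = card (orbit (spin_perm n (snd x)) i)" by blast
  then show ?thesis using orbit_card(3)[OF wr_orbit_self[OF W]] by simp
qed

theorem spin_function_vanishes:
  assumes f: "f \<in> spin_functions G n" and x: "x \<in> carrier (spin_wreath G n)"
    and k: "k \<in># spin_type G n x c" "even k"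
  shows "f x = 0"
proof (cases "spin_parity (snd x) = 1")
  case True
  then show ?thesis by (rule spin_functionD(3)[OF f x])
next
  case False
  interpret W: group "spin_wreath G n" by (rule wreath_group)
  interpret S: group "spin_group n" unfolding spin_group_def by (rule presented_group_group)
  let ?\<rho> = "spin_type G n x"
  have c: "c \<in> conj_classes G" by (rule ccontr) (use k(1) spin_type_sum(2)[OF x, of c] in simp)
  obtain qs where qs: "mset qs = parts_mset ?\<rho> - {#(k, c)#}" using ex_mset by blast
  \<comment> \<open>The even part is listed first, so that its word splits off on the left of the
    standard element.\<close>
  let ?ps = "(k, c) # qs"
  have ms: "mset ?ps = parts_mset ?\<rho>" using qs mem_parts_mset[of k c ?\<rho>] c k(1) by simp
  have \<rho>: "\<forall>c. c \<notin> conj_classes G \<longrightarrow> ?\<rho> c = {#}" "\<forall>c. \<forall>k\<in>#?\<rho> c. 0 < k"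
    "(\<Sum>c\<in>conj_classes G. sum_mset (?\<rho> c)) = n"
    using spin_type_sum[OF x] spin_type_pos[OF x] by simp_all
  note ps = standard_of_parts[OF \<rho> ms]
  from standard_exists[OF ps(1,2)] obtain g where
    g: "g \<in> {1..n} \<rightarrow>\<^sub>E carrier G" "block_prods g (cut_intervals 1 ?ps)" by (rule bexE)
  note std = standard_elt[OF ps(1,2) g]
  let ?l = "[1..<k]" and ?r = "block_word (cut_intervals (1 + k) qs)"
  have kpos: "0 < k" using spin_type_pos[OF x k(1)] .
  have wd: "block_word (cut_intervals 1 ?ps) = ?l @ ?r" by simp
  have sub: "set ?l \<subseteq> {1..<n}" "set ?r \<subseteq> {1..<n}" using std(1) unfolding wd set_append by simp_all
  have posq: "\<forall>p\<in>set qs. 0 < fst p" using ps(1) by simp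
  have rge: "k + 1 \<le> i" if "i \<in> set ?r" for i using block_word_range[OF posq that] by simp
  let ?u = "tw n ?l" and ?v = "tw n ?r"
  have uc: "?u \<in> carrier (spin_group n)" "?v \<in> carrier (spin_group n)" by (rule tw_closed[OF sub(1)], rule tw_closed[OF sub(2)])
  have xe: "tw n (?l @ ?r) = ?u \<otimes>\<^bsub>spin_group n\<^esub> ?v" by (rule tw_append[OF sub])
  let ?x0 = "(g, ?u \<otimes>\<^bsub>spin_group n\<^esub> ?v)"
  have x0: "?x0 \<in> carrier (spin_wreath G n)" "spin_type G n ?x0 = ?\<rho>"
    using std(2,3) unfolding wd xe ps(3) by - (assumption+)
  have par: "spin_parity (snd ?x0) = 0"
  proof -
    have sx: "snd x \<in> carrier (spin_group n)" using x unfolding wreath_carrier by blast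
    have "spin_parity (snd x) = 0" using False spin_parity_range[OF sx] by auto
    then show ?thesis by (rule_tac same_type_cases[OF x0(1) x x0(2)]) auto
  qed
  have "set (?l @ ?r) \<subseteq> {1..<n}" using sub by simp
  then have "int (length (?l @ ?r)) mod 2 = 0"
    using par spin_parity_tw unfolding snd_conv xe[symmetric] by metis
  \<comment> \<open>An interval of even length k carries k - 1 letters, an odd number. The element
    is even, so the remaining word is odd as well, and swapping the two words produces exactly one
    z.\<close>
  then have "even (length ?l + length ?r)" unfolding length_append by presburger
  then have lodd: "odd (length ?l)" "odd (length ?r)" using k(2) kpos by auto
  \<comment> \<open>The group components are split along the same two supports. Each of the two
    permutations preserves both supports, so these components commute and the order of A and B is
    felt only in the spin component.\<close>
  define gA where "gA = (\<lambda>i\<in>{1..n}. if i \<le> k then g i else \<one>)"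
  define gB where "gB = (\<lambda>i\<in>{1..n}. if i \<le> k then \<one> else g i)"
  let ?A = "(gA, ?u)" and ?B = "(gB, ?v)"
  have gc: "g i \<in> carrier G" if "i \<in> {1..n}" for i using g(1) that by auto
  have A: "?A \<in> carrier (spin_wreath G n)" and B: "?B \<in> carrier (spin_wreath G n)"
    using uc gc by (auto simp: wreath_carrier gA_def gB_def)
  have pu: "spin_perm n ?u permutes {1..n}" and pv: "spin_perm n ?v permutes {1..n}"
    using uc by (simp_all add: spin_perm_permutes)
  have up: "spin_perm n ?u i = i" if "k < i" for i
    unfolding spin_perm_tw[OF sub(1)] by (rule tperm_fix) (use that in auto)
  have vp: "spin_perm n ?v i = i" if "i \<le> k" for i
    unfolding spin_perm_tw[OF sub(2)] by (rule tperm_fix) (use that rge in fastforce)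
  have ufix: "inv' (spin_perm n ?u) i = i" if "k < i" for i
  proof -
    have "spin_perm n ?u i = i" by (rule up[OF that])
    then show ?thesis using permutes_inverses(2)[OF pu, of i] by simp
  qed
  have vfix: "inv' (spin_perm n ?v) i = i" if "i \<le> k" for i
  proof -
    have "spin_perm n ?v i = i" by (rule vp[OF that])
    then show ?thesis using permutes_inverses(2)[OF pv, of i] by simp
  qed
  have uim: "inv' (spin_perm n ?u) i \<le> k" if "i \<le> k" for i
  proof (rule ccontr)
    assume a: "\<not> ?thesis"
    then have "spin_perm n ?u (inv' (spin_perm n ?u) i) = inv' (spin_perm n ?u) i" by (intro up) simp
    then show False using permutes_inverses(1)[OF pu, of i] a that by simp
  qed
  have vim: "\<not> inv' (spin_perm n ?v) i \<le> k" if "k < i" for i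
  proof
    assume a: "inv' (spin_perm n ?v) i \<le> k"
    have "spin_perm n ?v (inv' (spin_perm n ?v) i) = inv' (spin_perm n ?v) i" by (rule vp[OF a])
    then show False using permutes_inverses(1)[OF pv, of i] a that by simp
  qed
  have uX: "inv' (spin_perm n ?u) i \<in> {1..n}" and vX: "inv' (spin_perm n ?v) i \<in> {1..n}" if "i \<in> {1..n}" for i
    using permutes_in_image[OF permutes_inv[OF pu]] permutes_in_image[OF permutes_inv[OF pv]] that by blast+
  have gext: "(\<lambda>i\<in>{1..n}. g i) = g" by (rule PiE_restrict[OF g(1)])
  have AB: "?A \<otimes>\<^bsub>spin_wreath G n\<^esub> ?B = ?x0"
  proof -
    have "gA i \<otimes> gB (inv' (spin_perm n ?u) i) = g i" if i: "i \<in> {1..n}" for i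
      using i uX[OF i] gc[OF i] uim[of i] ufix[of i] by (cases "i \<le> k") (simp_all add: gA_def gB_def)
    then have "(\<lambda>i\<in>{1..n}. gA i \<otimes> gB (inv' (spin_perm n ?u) i)) = g" by (subst gext[symmetric], intro restrict_ext)
    then show ?thesis unfolding wreath_mult fst_conv snd_conv by simp
  qed
  have BA: "?B \<otimes>\<^bsub>spin_wreath G n\<^esub> ?A = (g, ?v \<otimes>\<^bsub>spin_group n\<^esub> ?u)"
  proof -
    have "gB i \<otimes> gA (inv' (spin_perm n ?v) i) = g i" if i: "i \<in> {1..n}" for i
      using i vX[OF i] gc[OF i] vim[of i] vfix[of i] by (cases "i \<le> k") (simp_all add: gA_def gB_def)
    then have "(\<lambda>i\<in>{1..n}. gB i \<otimes> gA (inv' (spin_perm n ?v) i)) = g" by (subst gext[symmetric], intro restrict_ext)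
    then show ?thesis unfolding wreath_mult fst_conv snd_conv by simp
  qed
  have "?v \<otimes>\<^bsub>spin_group n\<^esub> ?u = zpow n (length ?r * length ?l) (?u \<otimes>\<^bsub>spin_group n\<^esub> ?v)"
    by (rule tw_swap[OF sub(2,1)]) (use rge in fastforce)
  also have "\<dots> = Zs n \<otimes>\<^bsub>spin_group n\<^esub> (?u \<otimes>\<^bsub>spin_group n\<^esub> ?v)" using lodd by (simp add: zpow_def)
  finally have "?B \<otimes>\<^bsub>spin_wreath G n\<^esub> ?A = spin_z G n \<otimes>\<^bsub>spin_wreath G n\<^esub> ?x0"
    unfolding BA spin_z_mult[OF x0(1)] by simp
  moreover have "f (?B \<otimes>\<^bsub>spin_wreath G n\<^esub> ?A) = f ?x0"
  proof -
    \<comment> \<open>BA is the conjugate of AB by B, so a class function takes the same value on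
      both, while BA = z AB reverses the sign.\<close>
    have "?B \<otimes>\<^bsub>spin_wreath G n\<^esub> (?A \<otimes>\<^bsub>spin_wreath G n\<^esub> ?B) \<otimes>\<^bsub>spin_wreath G n\<^esub> inv\<^bsub>spin_wreath G n\<^esub> ?B = ?B \<otimes>\<^bsub>spin_wreath G n\<^esub> ?A"
      using W.m_assoc[OF B W.m_closed[OF A B] W.inv_closed[OF B]] W.m_assoc[OF A B W.inv_closed[OF B]] W.r_inv[OF B] A by simp
    then show ?thesis using spin_functionD(1)[OF f x0(1) B] unfolding AB by simp
  qed
  ultimately have "f ?x0 = 0" using spin_functionD(2)[OF f x0(1)] by simp
  moreover have "f x = f ?x0 \<or> f x = - f ?x0"
  proof (rule same_type_cases[OF x0(1) x x0(2)])
    assume *: "\<And>f. f \<in> spin_functions G n \<Longrightarrow> f x = f ?x0"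
    show ?thesis using *[OF f] by simp
  next
    assume *: "\<And>f. f \<in> spin_functions G n \<Longrightarrow> f x = - f ?x0"
    show ?thesis using *[OF f] by simp
  qed
  ultimately show ?thesis by auto
qed

definition std_parts :: "'a set list \<Rightarrow> 'a part_fun \<Rightarrow> (nat \<times> 'a set) list" where
  "std_parts cs \<rho> = concat (map (\<lambda>c. map (\<lambda>k. (k, c)) (rev (sorted_list_of_multiset (\<rho> c)))) cs)"

lemma mset_std_parts:
  assumes "distinct cs" "set cs = conj_classes G"
  shows "mset (std_parts cs \<rho>) = parts_mset \<rho>"
proof -
  have "mset (std_parts cs \<rho>) = (\<Sum>c\<in>set cs. image_mset (\<lambda>k. (k, c)) (\<rho> c))"
    using assms(1) by (induction cs) (simp_all add: std_parts_def mset_map[symmetric])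
  then show ?thesis unfolding assms(2) parts_mset_def .
qed

lemma t_elt_eq: "t_elt cs n \<rho> = tw n (block_word (cut_intervals 1 (std_parts cs \<rho>)))"
  unfolding t_elt_def tw_def part_intervals_def std_parts_def block_word_def map_concat map_map
  by (intro arg_cong[of _ _ "spin_word n"] arg_cong[of _ _ concat] map_cong refl) auto

text \<open>Conjugation preserves type, trace and parity, so they can be computed at (g, t^\<rho>).
  The positive trace separates D+ from its translate by z, which has the same type.\<close>

lemma D_plus_props:
  assumes cs: "distinct cs" "set cs = conj_classes G" and \<rho>: "\<rho> \<in> odd_part_funs G n"
  shows "D_plus G cs n \<rho> \<noteq> {}"
    and "x \<in> D_plus G cs n \<rho> \<Longrightarrow> x \<in> carrier (spin_wreath G n) \<and> spin_type G n x = \<rho> \<and>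
      0 < spin_tr (snd x) \<and> spin_parity (snd x) = 0"
proof -
  interpret W: group "spin_wreath G n" by (rule wreath_group)
  let ?ps = "std_parts cs \<rho>"
  have r: "\<forall>c. c \<notin> conj_classes G \<longrightarrow> \<rho> c = {#}" "\<forall>c. \<forall>k\<in>#\<rho> c. 0 < k" "(\<Sum>c\<in>conj_classes G. sum_mset (\<rho> c)) = n"
    and od: "\<And>c k. k \<in># \<rho> c \<Longrightarrow> odd k"
    using \<rho> by (auto simp: odd_part_funs_def intro: odd_pos)
  note ps = standard_of_parts[OF r mset_std_parts[OF cs]]
  have odd: "\<forall>p\<in>set ?ps. odd (fst p)"
    using mem_parts_mset[of _ _ \<rho>] od unfolding set_mset_mset[symmetric] mset_std_parts[OF cs] by auto
  have pi: "part_intervals cs \<rho> = cut_intervals 1 ?ps" by (simp add: part_intervals_def std_parts_def)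
  let ?Gs = "{g \<in> carrier (power_group G n). \<forall>(a, b, c)\<in>set (part_intervals cs \<rho>). ordered_prod G g (rev [a..<Suc b]) \<in> c}"
  have Gs: "g \<in> ?Gs \<longleftrightarrow> g \<in> {1..n} \<rightarrow>\<^sub>E carrier G \<and> block_prods g (cut_intervals 1 ?ps)" for g
    unfolding power_carrier pi block_prods_def by blast
  from standard_exists[OF ps(1,2)] obtain g where
    g0: "g \<in> {1..n} \<rightarrow>\<^sub>E carrier G" "block_prods g (cut_intervals 1 ?ps)" by (rule bexE)
  have gG: "g \<in> ?Gs" by (rule Gs[THEN iffD2, OF conjI[OF g0]])
  have self: "x0 \<in> conj_class (spin_wreath G n) x0" if "x0 \<in> carrier (spin_wreath G n)" for x0
    unfolding conj_class_def using that by (intro CollectI exI[of _ "\<one>\<^bsub>spin_wreath G n\<^esub>"]) simp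
  have "(g, t_elt cs n \<rho>) \<in> D_plus G cs n \<rho>"
    unfolding D_plus_def by (rule UN_I[OF gG]) (rule self, unfold t_elt_eq, rule standard_elt(2)[OF ps(1,2) g0])
  then show "D_plus G cs n \<rho> \<noteq> {}" by (rule_tac notI) simp
  assume "x \<in> D_plus G cs n \<rho>"
  then obtain g where g: "g \<in> ?Gs" "x \<in> conj_class (spin_wreath G n) (g, t_elt cs n \<rho>)" unfolding D_plus_def by (rule UN_E)
  note std = standard_elt[OF ps(1,2) conjunct1[OF Gs[THEN iffD1, OF g(1)]] conjunct2[OF Gs[THEN iffD1, OF g(1)]]]
  let ?x0 = "(g, t_elt cs n \<rho>)"
  have x0: "?x0 \<in> carrier (spin_wreath G n)" "spin_type G n ?x0 = \<rho>" using std(2,3) unfolding t_elt_eq ps(3) by - (assumption+)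
  have tr: "0 < spin_tr (snd ?x0)" "spin_parity (snd ?x0) = 0"
    using spin_tr_tw[OF std(1)] block_word_tr_pos[OF odd, of 1] spin_parity_tw[OF std(1)] even_block_word[OF odd, of 1]
    unfolding t_elt_eq by (auto simp: even_iff_mod_2_eq_zero[symmetric])
  obtain y where y: "y \<in> carrier (spin_wreath G n)" "x = y \<otimes>\<^bsub>spin_wreath G n\<^esub> ?x0 \<otimes>\<^bsub>spin_wreath G n\<^esub> inv\<^bsub>spin_wreath G n\<^esub> y"
    using g(2) unfolding conj_class_def by blast
  have sc: "snd ?x0 \<in> carrier (spin_group n)" "snd y \<in> carrier (spin_group n)" using x0(1) y(1) unfolding wreath_carrier by blast+
  show "x \<in> carrier (spin_wreath G n) \<and> spin_type G n x = \<rho> \<and> 0 < spin_tr (snd x) \<and> spin_parity (snd x) = 0"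
    unfolding y(2) spin_type_conj[OF x0(1) y(1)] wreath_conj_snd[OF x0(1) y(1)] spin_tr_conj[OF sc] spin_parity_conj[OF sc]
    using x0 tr y(1) by simp
qed

text \<open>Within one type the trace and f change sign together, and the trace is positive on D+.
  Hence f is constant on \<open>D_plus\<close>, which gives \<open>class_value\<close> its meaning,
  and the sign of the trace recovers every other value.\<close>

lemma D_plus_value:
  assumes cs: "distinct cs" "set cs = conj_classes G" and \<rho>: "\<rho> \<in> odd_part_funs G n"
    and f: "f \<in> spin_functions G n" and x: "x \<in> carrier (spin_wreath G n)" "spin_type G n x = \<rho>"
  shows "f x = of_real (sgn (spin_tr (snd x))) * class_value f (D_plus G cs n \<rho>)" "spin_tr (snd x) \<noteq> 0" "spin_parity (snd x) = 0"
proof -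
  have key: "f x = of_real (sgn (spin_tr (snd x))) * f x0 \<and> spin_tr (snd x) \<noteq> 0 \<and> spin_parity (snd x) = 0"
    if x0: "x0 \<in> D_plus G cs n \<rho>" and x: "x \<in> carrier (spin_wreath G n)" "spin_type G n x = \<rho>" for x0 x
  proof -
    note p = D_plus_props(2)[OF cs \<rho> x0]
    have ty: "spin_type G n x0 = spin_type G n x" using p x(2) by simp
    show ?thesis
      by (rule same_type_cases[OF _ x(1) ty]) (use p f in auto)
  qed
  obtain x0 where x0: "x0 \<in> D_plus G cs n \<rho>" using D_plus_props(1)[OF cs \<rho>] by blast
  have "f y = f x0" if y: "y \<in> D_plus G cs n \<rho>" for y
    using key[OF x0, of y] D_plus_props(2)[OF cs \<rho> y] by simp
  then have "f ` D_plus G cs n \<rho> = {f x0}" using x0 by blast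
  then have "class_value f (D_plus G cs n \<rho>) = f x0" by (simp add: class_value_def)
  then show "f x = of_real (sgn (spin_tr (snd x))) * class_value f (D_plus G cs n \<rho>)" "spin_tr (snd x) \<noteq> 0" "spin_parity (snd x) = 0"
    using key[OF x0 x] by simp_all
qed

end

section \<open>The bilinear form on the polynomial algebra\<close>

text \<open>A monomial as a multiset of variables, so that commuting operators can be folded over
  it.\<close>

definition mono_mset :: "('v \<Rightarrow>\<^sub>0 nat) \<Rightarrow> 'v multiset" where
  "mono_mset m = Abs_multiset (Poly_Mapping.lookup m)"

lemma count_mono_mset [simp]: "count (mono_mset m) v = Poly_Mapping.lookup m v"
  unfolding mono_mset_def by (subst count_Abs_multiset) simp_all

lemma mono_mset_zero [simp]: "mono_mset 0 = {#}"
  by (rule multiset_eqI) simp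

lemma mono_mset_add_single: "mono_mset (Poly_Mapping.single v 1 + m) = add_mset v (mono_mset m)"
  by (rule multiset_eqI) (simp add: lookup_add lookup_single when_def)

lemma lookup_pconst_mult [simp]: "Poly_Mapping.lookup (pconst a * p) m = a * Poly_Mapping.lookup p m"
proof -
  have "pconst a * p = (\<Sum>k\<in>Poly_Mapping.keys p. Poly_Mapping.single k (a * Poly_Mapping.lookup p k))"
    by (subst (1) poly_mapping_sum_monomials[of p]) (simp add: pconst_def sum_distrib_left mult_single)
  then show ?thesis
    by (auto simp: lookup_sum lookup_single when_def in_keys_iff sum.delta)
qed

lemma pconst_simps [simp]: "pconst 0 = 0" "pconst 1 = 1"
  by (simp_all add: pconst_def)

lemma pconst_add: "pconst (a + b) = pconst a + pconst b"
  by (simp add: pconst_def single_add)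

lemma pconst_mult: "pconst (a * b) = pconst a * pconst b"
  by (simp add: pconst_def mult_single)

lemma pconst_sum: "pconst (\<Sum>i\<in>I. a i) = (\<Sum>i\<in>I. pconst (a i))"
  by (induction I rule: infinite_finite_induct) (simp_all add: pconst_add)

lemma pdiff_commute: "pdiff v (pdiff w p) = pdiff w (pdiff v p)"
proof -
  have "pdiff v (pdiff w (Poly_Mapping.single m a)) = pdiff w (pdiff v (Poly_Mapping.single m a))" for m a
  proof (cases "v = w")
    case False
    have "m - Poly_Mapping.single w 1 - Poly_Mapping.single v 1 = m - Poly_Mapping.single v 1 - Poly_Mapping.single w (1::nat)"
      by (rule poly_mapping_eqI) (simp add: lookup_minus)
    then show ?thesis using False
      by (simp add: pdiff_single lookup_minus lookup_single when_def mult.left_commute del: One_nat_def)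
  qed simp
  then show ?thesis
    by (subst (1 2) poly_mapping_sum_monomials[of p]) (simp only: pdiff_sum)
qed

lemma fock_induct [consumes 1, case_names one var add scale]:
  assumes "p \<in> fock G" and one: "P 1"
    and var: "\<And>v p. v \<in> fock_vars G \<Longrightarrow> p \<in> fock G \<Longrightarrow> P p \<Longrightarrow> P (pvar v * p)"
    and add: "\<And>p q. P p \<Longrightarrow> P q \<Longrightarrow> P (p + q)"
    and scale: "\<And>a p. P p \<Longrightarrow> P (pconst a * p)"
  shows "P p"
proof -
  have mono: "P (Poly_Mapping.single m 1)" if "Poly_Mapping.keys m \<subseteq> fock_vars G" for m
    using that
  proof (induction "mono_mset m" arbitrary: m)
    case empty
    have "Poly_Mapping.lookup m v = 0" for v
      using empty(1) count_mono_mset[of m v] by simp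
    then have "m = 0" by (intro poly_mapping_eqI) simp
    then show ?case using one by simp
  next
    case (add v M)
    let ?m = "m - Poly_Mapping.single v 1"
    have "count (add_mset v M) v = Poly_Mapping.lookup m v" unfolding add(2) by simp
    then have v: "0 < Poly_Mapping.lookup m v" by simp
    have e: "m = Poly_Mapping.single v 1 + ?m"
      using v by (intro poly_mapping_eqI) (auto simp: lookup_add lookup_minus lookup_single when_def)
    have "add_mset v M = add_mset v (mono_mset ?m)"
      unfolding mono_mset_add_single[symmetric] e[symmetric] by (rule add(2))
    then have M: "M = mono_mset ?m" by simp
    have k: "Poly_Mapping.keys ?m \<subseteq> fock_vars G"
      using add(3) by (auto simp: in_keys_iff lookup_minus)
    have vv: "v \<in> fock_vars G" using add(3) v by (auto simp: in_keys_iff)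
    have "Poly_Mapping.single ?m 1 \<in> fock G" using k by (simp add: fock_def)
    then have "P (pvar v * Poly_Mapping.single ?m 1)" by (rule var[OF vv _ add(1)[OF M k]])
    also have "pvar v * Poly_Mapping.single ?m 1 = Poly_Mapping.single m 1"
      by (subst (2) e) (simp add: pvar_def mult_single)
    finally show ?case .
  qed
  have zero: "P 0" using scale[OF one, of 0] by simp
  have s: "P (Poly_Mapping.single m (Poly_Mapping.lookup p m))" if "m \<in> Poly_Mapping.keys p" for m
  proof -
    have "Poly_Mapping.single m (Poly_Mapping.lookup p m) = pconst (Poly_Mapping.lookup p m) * Poly_Mapping.single m 1"
      by (simp add: pconst_def mult_single)
    then show ?thesis using scale[OF mono] that assms(1) by (simp add: fock_def)
  qed
  have "P (\<Sum>m\<in>S. Poly_Mapping.single m (Poly_Mapping.lookup p m))" if "finite S" "S \<subseteq> Poly_Mapping.keys p" for S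
    using that by (induction S rule: finite_induct) (auto intro!: add s zero)
  from this[OF finite_keys subset_refl] show ?thesis
    unfolding poly_mapping_sum_monomials[of p, symmetric] .
qed

lemma fock_zero [simp]: "0 \<in> fock G"
  by (simp add: fock_def)

lemma fock_one [simp]: "1 \<in> fock G"
  by (auto simp: fock_def single_one[symmetric] simp del: single_one)

lemma fock_add: "p \<in> fock G \<Longrightarrow> q \<in> fock G \<Longrightarrow> p + q \<in> fock G"
  using keys_add[of p q] by (auto simp: fock_def)

lemma fock_mult:
  assumes "p \<in> fock G" "q \<in> fock G"
  shows "p * q \<in> fock G"
proof -
  have "Poly_Mapping.keys (a + b) \<subseteq> fock_vars G" if "a \<in> Poly_Mapping.keys p" "b \<in> Poly_Mapping.keys q" for a b
    using that assms keys_add[of a b] by (fastforce simp: fock_def)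
  then show ?thesis using keys_mult[of p q] by (fastforce simp: fock_def)
qed

lemma fock_const [simp]: "pconst a \<in> fock G"
  by (auto simp: fock_def pconst_def)

lemma fock_var: "v \<in> fock_vars G \<Longrightarrow> pvar v \<in> fock G"
  by (auto simp: fock_def pvar_def)

lemma fock_sum: "(\<And>i. i \<in> I \<Longrightarrow> p i \<in> fock G) \<Longrightarrow> (\<Sum>i\<in>I. p i) \<in> fock G"
  by (induction I rule: infinite_finite_induct) (simp_all add: fock_add)

lemma class_value_eq:
  assumes "f ` c = {a}"
  shows "class_value f c = a"
  using assms by (simp add: class_value_def)

context finite_group
begin

lemma class_functionD:
  assumes "f \<in> class_functions G"
  shows "x \<in> carrier G \<Longrightarrow> y \<in> carrier G \<Longrightarrow> f (y \<otimes> x \<otimes> inv y) = f x" "x \<notin> carrier G \<Longrightarrow> f x = 0"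
  using assms by (simp_all add: class_functions_def)

lemma class_value_mem:
  assumes f: "f \<in> class_functions G" and c: "c \<in> conj_classes G" "x \<in> c"
  shows "class_value f c = f x"
proof (rule class_value_eq)
  have x: "x \<in> carrier G" "c = conj_class G x" using conj_classes_eq[OF c] by simp_all
  have "f y = f x" if "y \<in> c" for y
    using that x class_functionD(1)[OF f x(1)] unfolding x(2) conj_class_def by blast
  then show "f ` c = {f x}" using c(2) by blast
qed

end

section \<open>Existence of the bilinear form\<close>

locale weighted_group = finite_group G for G :: "('a, 'b) monoid_scheme" (structure) +
  fixes \<xi> :: "'a \<Rightarrow> complex"
  assumes weight_class: "\<xi> \<in> class_functions G" and weight_dual: "self_dual G \<xi>"
begin

lemma weight_inv:
  assumes x: "x \<in> carrier G"
  shows "\<xi> (inv x) = \<xi> x"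
proof -
  have c: "conj_class G x \<in> conj_classes G" "x \<in> conj_class G x"
    using x conj_class_self by (auto simp: conj_classes_def)
  have "set_inv (conj_class G x) \<in> conj_classes G"
    using x by (auto simp: conj_classes_def set_inv_conj_class intro!: imageI)
  moreover have "inv x \<in> set_inv (conj_class G x)" using c(2) by (auto simp: SET_INV_def)
  ultimately show ?thesis
    using weight_dual class_value_mem[OF weight_class c] class_value_mem[OF weight_class, of "set_inv (conj_class G x)" "inv x"] c(1)
    by (simp add: self_dual_def)
qed

text \<open>Substitute x^-1 for x; self-duality makes the weight invariant. Because of this
  symmetry, multiplication and annihilation can be adjoint in both arguments.\<close>

lemma weighted_form_commute: "weighted_form G \<xi> f g = weighted_form G \<xi> g f"
proof -
  have "(\<Sum>x\<in>carrier G. \<xi> x * f x * g (inv x)) = (\<Sum>x\<in>carrier G. \<xi> (inv x) * f (inv x) * g (inv (inv x)))"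
    by (rule sum_inv[symmetric])
  also have "\<dots> = (\<Sum>x\<in>carrier G. \<xi> x * g x * f (inv x))"
    by (rule sum.cong) (simp_all add: weight_inv mult.assoc mult.commute)
  finally show ?thesis by (simp add: weighted_form_def)
qed

abbreviation ann :: "nat \<times> ('a \<Rightarrow> complex) \<Rightarrow> 'a fock_poly \<Rightarrow> 'a fock_poly" where
  "ann v \<equiv> annihilation G \<xi> (fst v) (snd v)"

lemma ann_commute: "ann v (ann w p) = ann w (ann v p)"
proof -
  have "ann v (ann w p) = (\<Sum>\<beta>\<in>irr_chars G. \<Sum>\<gamma>\<in>irr_chars G.
      pconst (of_nat (fst v) / 2 * weighted_form G \<xi> (snd v) \<beta>) * (pconst (of_nat (fst w) / 2 * weighted_form G \<xi> (snd w) \<gamma>)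
        * pdiff (fst v, \<beta>) (pdiff (fst w, \<gamma>) p)))" for v w
    by (simp add: annihilation_def pdiff_sum pdiff_mult pdiff_const sum_distrib_left)
  note e = this
  show ?thesis
    unfolding e[of v w] e[of w v] by (subst sum.swap) (simp add: pdiff_commute mult.left_commute)
qed

lemma ann_comp_fun: "comp_fun_commute ann"
  by standard (simp add: fun_eq_iff ann_commute)

text \<open>The order of the operators is immaterial by \<open>ann_commute\<close>.\<close>

definition anns :: "(nat \<times> ('a \<Rightarrow> complex)) multiset \<Rightarrow> 'a fock_poly \<Rightarrow> 'a fock_poly" where
  "anns M q = fold_mset ann q M"

lemma anns_simps [simp]: "anns {#} q = q" "anns (add_mset v M) q = anns M (ann v q)"
  unfolding anns_def
  by (simp_all add: comp_fun_commute.fold_mset_add_mset[OF ann_comp_fun] comp_fun_commute.fold_mset_fun_left_comm[OF ann_comp_fun])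

lemma anns_linear: "anns M (p + q) = anns M p + anns M q" "anns M (pconst a * p) = pconst a * anns M p"
  by (induction M arbitrary: p q) (simp_all add: annihilation_linear)

text \<open>An analogue of the Fischer inner product: p acts on q as a differential operator through
  the annihilation operators, and the constant term is taken. One of the two adjointness relations
  is then built in, see \<open>mono_form_var\<close>.\<close>

definition mono_form :: "'a fock_poly \<Rightarrow> 'a fock_poly \<Rightarrow> complex" where
  "mono_form p q = (\<Sum>m\<in>Poly_Mapping.keys p. Poly_Mapping.lookup p m * Poly_Mapping.lookup (anns (mono_mset m) q) 0)"

lemma mono_form_eq:
  assumes "finite A" "Poly_Mapping.keys p \<subseteq> A"
  shows "mono_form p q = (\<Sum>m\<in>A. Poly_Mapping.lookup p m * Poly_Mapping.lookup (anns (mono_mset m) q) 0)"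
  unfolding mono_form_def by (rule sum.mono_neutral_left) (use assms in \<open>auto simp: in_keys_iff\<close>)

lemma mono_form_linear:
  "mono_form (p + q) r = mono_form p r + mono_form q r" "mono_form r (p + q) = mono_form r p + mono_form r q"
  "mono_form (pconst a * p) q = a * mono_form p q" "mono_form p (pconst a * q) = a * mono_form p q"
proof -
  let ?A = "Poly_Mapping.keys p \<union> Poly_Mapping.keys q"
  have "finite ?A" "Poly_Mapping.keys (p + q) \<subseteq> ?A" by (auto dest: keys_add[THEN subsetD])
  then show "mono_form (p + q) r = mono_form p r + mono_form q r"
    by (subst (1 2 3) mono_form_eq[where A = ?A]) (auto simp: lookup_add distrib_right sum.distrib)
  show "mono_form r (p + q) = mono_form r p + mono_form r q"
    by (simp add: mono_form_def anns_linear lookup_add distrib_left sum.distrib)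
  have "Poly_Mapping.keys (pconst a * p) \<subseteq> Poly_Mapping.keys p" by (auto simp: in_keys_iff)
  then show "mono_form (pconst a * p) q = a * mono_form p q"
    by (subst (1 2) mono_form_eq[where A = "Poly_Mapping.keys p"]) (auto simp: sum_distrib_left mult.assoc)
  show "mono_form p (pconst a * q) = a * mono_form p q"
    by (simp add: mono_form_def anns_linear sum_distrib_left mult.left_commute)
qed

lemma mono_form_sum: "mono_form (\<Sum>i\<in>I. p i) q = (\<Sum>i\<in>I. mono_form (p i) q)"
  by (induction I rule: infinite_finite_induct) (simp_all add: mono_form_linear, simp_all add: mono_form_def)

lemma mono_form_single: "mono_form (Poly_Mapping.single m c) q = c * Poly_Mapping.lookup (anns (mono_mset m) q) 0"
  by (subst mono_form_eq[where A = "{m}"]) simp_all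

lemma mono_form_var: "mono_form (pvar v * p) q = mono_form p (ann v q)"
proof -
  have "pvar v * p = (\<Sum>m\<in>Poly_Mapping.keys p. Poly_Mapping.single (Poly_Mapping.single v 1 + m) (Poly_Mapping.lookup p m))"
    by (subst (1) poly_mapping_sum_monomials[of p]) (simp add: pvar_def sum_distrib_left mult_single)
  then have "mono_form (pvar v * p) q = (\<Sum>m\<in>Poly_Mapping.keys p. Poly_Mapping.lookup p m * Poly_Mapping.lookup (anns (mono_mset m) (ann v q)) 0)"
    by (simp only: mono_form_sum mono_form_single mono_mset_add_single anns_simps)
  then show ?thesis by (simp only: mono_form_def)
qed

lemma ann_one: "annihilation G \<xi> n \<gamma> 1 = 0"
proof -
  have "pdiff v 1 = 0" for v :: "nat \<times> ('a \<Rightarrow> complex)" using pdiff_const[of v 1] by simp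
  then show ?thesis by (simp add: annihilation_def)
qed

lemma ann_var:
  assumes "w \<in> fock_vars G"
  shows "ann v (pvar w) = pconst (if fst v = fst w then of_nat (fst v) / 2 * weighted_form G \<xi> (snd v) (snd w) else 0)"
  using annihilation_var[OF finite_irr_chars, of "snd w" \<xi> "fst v" "snd v" "fst w"] assms
  by (auto simp: fock_vars_def)

lemma lookup_var_mult_zero: "Poly_Mapping.lookup (pvar v * p) 0 = (0 :: complex)"
proof -
  have "pvar v * p = (\<Sum>m\<in>Poly_Mapping.keys p. Poly_Mapping.single (Poly_Mapping.single v 1 + m) (Poly_Mapping.lookup p m))"
    by (subst (1) poly_mapping_sum_monomials[of p]) (simp add: pvar_def sum_distrib_left mult_single)
  moreover have "Poly_Mapping.single v (1::nat) + m \<noteq> 0" for m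
  proof
    assume "Poly_Mapping.single v (1::nat) + m = 0"
    then have "Poly_Mapping.lookup (Poly_Mapping.single v (1::nat) + m) v = Poly_Mapping.lookup 0 v" by (rule arg_cong)
    then show False by (simp add: lookup_add)
  qed
  ultimately show ?thesis by (simp add: lookup_sum lookup_single when_def)
qed

text \<open>The adjointness relation that is not built in. For a product with a variable w both
  sides split by the Leibniz rule, and the scalars from exchanging v and w agree by
  \<open>weighted_form_commute\<close>. At p = 1 both sides are 0, as a multiple of a variable has
  no constant term.\<close>

lemma mono_form_ann:
  assumes p: "p \<in> fock G" and v: "v \<in> fock_vars G"
  shows "mono_form (ann v p) q = mono_form p (pvar v * q)"
  using p
proof (induction p arbitrary: q rule: fock_induct)
  case one
  have "mono_form 1 (pvar v * q) = 0"
    using mono_form_single[of 0 1 "pvar v * q"] by (simp add: lookup_var_mult_zero)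
  moreover have "mono_form 0 q = 0" by (simp add: mono_form_def)
  ultimately show ?case by (simp add: ann_one)
next
  case (var w p)
  let ?s = "\<lambda>v w. if fst v = fst w then of_nat (fst v) / 2 * weighted_form G \<xi> (snd v) (snd w) else 0"
  have s: "?s v w = ?s w v" using weighted_form_commute by simp
  have "mono_form (ann v (pvar w * p)) q = ?s v w * mono_form p q + mono_form (ann v p) (ann w q)"
    unfolding annihilation_derivation ann_var[OF var(1)] mono_form_linear mono_form_var ..
  also have "\<dots> = mono_form p (ann w (pvar v * q))"
    unfolding annihilation_derivation ann_var[OF v] mono_form_linear var(3) s ..
  finally show ?case unfolding mono_form_var .
qed (simp_all add: annihilation_linear mono_form_linear)

text \<open>Exhibiting one form justifies the choice in \<open>fock_form\<close>; from here on only
  the defining relations of the form are used.\<close>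

theorem is_fock_form_fock_form: "is_fock_form G \<xi> (fock_form G \<xi>)"
  unfolding fock_form_def
proof (rule someI[of _ mono_form])
  have "mono_form 1 1 = 1" using mono_form_single[of 0 1 1] by simp
  moreover have "(n, \<gamma>) \<in> fock_vars G" if "odd n" "\<gamma> \<in> irr_chars G" for n \<gamma>
    using that by (simp add: fock_vars_def)
  ultimately show "is_fock_form G \<xi> mono_form"
    unfolding is_fock_form_def
    using mono_form_linear mono_form_var[of "(_, _)"] mono_form_ann[where v = "(_, _)"] by simp
qed

end

section \<open>Odd partition-valued functions, their duals and their monomials\<close>

definition odd_part_fun :: "('a, 'b) monoid_scheme \<Rightarrow> 'a part_fun \<Rightarrow> bool" where
  "odd_part_fun G \<rho> \<longleftrightarrow> (\<forall>c. c \<notin> conj_classes G \<longrightarrow> \<rho> c = {#}) \<and> (\<forall>c. \<forall>k\<in>#\<rho> c. odd k)"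

definition part_fun_weight :: "('a, 'b) monoid_scheme \<Rightarrow> 'a part_fun \<Rightarrow> nat" where
  "part_fun_weight G \<rho> = (\<Sum>c\<in>conj_classes G. sum_mset (\<rho> c))"

text \<open>The type of the inverse of an element of type \<rho>, by \<open>spin_type_inv\<close>.
  On the polynomial side it indexes the monomial that can pair nontrivially with
  \<open>a_part_fun G \<rho>\<close>.\<close>

definition dual_part_fun :: "('a, 'b) monoid_scheme \<Rightarrow> 'a part_fun \<Rightarrow> 'a part_fun" where
  "dual_part_fun G \<rho> = (\<lambda>c. if c \<in> conj_classes G then \<rho> (set_inv\<^bsub>G\<^esub> c) else {#})"

lemma odd_part_funs_iff: "\<rho> \<in> odd_part_funs G n \<longleftrightarrow> odd_part_fun G \<rho> \<and> part_fun_weight G \<rho> = n"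
  by (auto simp: odd_part_funs_def odd_part_fun_def part_fun_weight_def)

context finite_group
begin

lemma sum_fun_upd_class:
  assumes "c \<in> conj_classes G"
  shows "(\<Sum>d\<in>conj_classes G. f ((\<rho>(c := \<mu>)) d)) + f (\<rho> c) = (\<Sum>d\<in>conj_classes G. f (\<rho> d)) + (f \<mu> :: nat)"
  using assms by (simp add: sum.remove[OF finite_conj_classes assms])

lemma odd_part_fun_add:
  "c \<in> conj_classes G \<Longrightarrow> odd k \<Longrightarrow> odd_part_fun G \<rho> \<Longrightarrow> odd_part_fun G (\<rho>(c := add_mset k (\<rho> c)))"
  by (auto simp: odd_part_fun_def)

lemma odd_part_fun_remove: "odd_part_fun G \<rho> \<Longrightarrow> odd_part_fun G (\<rho>(c := \<rho> c - {#k#}))"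
  by (auto simp: odd_part_fun_def dest: in_diffD)

lemma odd_part_fun_induct [consumes 1, case_names empty add]:
  assumes "odd_part_fun G \<rho>" and empty: "P (\<lambda>_. {#})"
    and add: "\<And>\<rho> c k. odd_part_fun G \<rho> \<Longrightarrow> c \<in> conj_classes G \<Longrightarrow> odd k \<Longrightarrow> P \<rho> \<Longrightarrow> P (\<rho>(c := add_mset k (\<rho> c)))"
  shows "P \<rho>"
  using assms(1)
proof (induction "part_fun_length G \<rho>" arbitrary: \<rho> rule: less_induct)
  case less
  show ?case
  proof (cases "\<forall>c. \<rho> c = {#}")
    case True
    then have "\<rho> = (\<lambda>_. {#})" by (intro ext) simp
    then show ?thesis using empty by simp
  next
    case False
    then obtain c where "\<rho> c \<noteq> {#}" by auto
    then obtain k where k: "k \<in># \<rho> c" by auto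
    have c: "c \<in> conj_classes G" "odd k" using less(2) k by (auto simp: odd_part_fun_def)
    let ?r = "\<rho>(c := \<rho> c - {#k#})"
    have s: "Suc (size (\<rho> c - {#k#})) = size (\<rho> c)" using k by (rule size_Suc_Diff1)
    have "part_fun_length G ?r < part_fun_length G \<rho>"
      using sum_fun_upd_class[OF c(1), of size \<rho> "\<rho> c - {#k#}"] s by (simp add: part_fun_length_def)
    from less(1)[OF this odd_part_fun_remove[OF less(2)]]
    have "P (?r(c := add_mset k (?r c)))" by (rule add[OF odd_part_fun_remove[OF less(2)] c])
    moreover have "?r(c := add_mset k (?r c)) = \<rho>" using k by (auto simp: fun_eq_iff)
    ultimately show ?thesis by simp
  qed
qed

lemma dual_part_fun_add:
  assumes "c \<in> conj_classes G"
  shows "dual_part_fun G (\<rho>(c := add_mset k (\<rho> c))) = (dual_part_fun G \<rho>)(set_inv c := add_mset k (dual_part_fun G \<rho> (set_inv c)))"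
proof
  fix d
  have "set_inv d = c \<longleftrightarrow> d = set_inv c" if "d \<in> conj_classes G"
    using set_inv_set_inv[OF assms] set_inv_set_inv[OF that] by auto
  then show "dual_part_fun G (\<rho>(c := add_mset k (\<rho> c))) d = ((dual_part_fun G \<rho>)(set_inv c := add_mset k (dual_part_fun G \<rho> (set_inv c)))) d"
    using set_inv_conj_classes[OF assms] set_inv_set_inv[OF assms] by (auto simp: dual_part_fun_def)
qed

lemma dual_part_fun_empty [simp]: "dual_part_fun G (\<lambda>_. {#}) = (\<lambda>_. {#})"
  by (simp add: dual_part_fun_def)

lemma a_part_fun_empty [simp]: "a_part_fun G (\<lambda>_. {#}) = 1"
  by (simp add: a_part_fun_def)

lemma a_part_fun_add:
  assumes "c \<in> conj_classes G"
  shows "a_part_fun G (\<rho>(c := add_mset k (\<rho> c))) = a_class G k c * a_part_fun G \<rho>"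
  by (simp add: a_part_fun_def prod.remove[OF finite_conj_classes assms] mult.assoc)

lemma class_value_inv:
  assumes "\<gamma> \<in> irr_chars G" "c \<in> conj_classes G" "x \<in> c"
  shows "class_value \<gamma> (set_inv c) = \<gamma> (inv x)"
  using assms by (intro class_value_mem irr_char_class_function set_inv_conj_classes) (auto simp: SET_INV_def)

text \<open>\<open>irr_chars_column_orthogonal\<close> with the class size divided out, since |G| is
  the class size times the centralizer order.\<close>

lemma column_orthogonal:
  assumes c: "c \<in> conj_classes G" and y: "y \<in> carrier G"
  shows "(\<Sum>\<gamma>\<in>irr_chars G. class_value \<gamma> (set_inv c) * \<gamma> y) = (if y \<in> c then of_nat (centralizer_order G c) else 0)"
proof -
  obtain x where x: "x \<in> carrier G" "c = conj_class G x" using c by (auto simp: conj_classes_def)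
  have xc: "x \<in> c" using x conj_class_self by simp
  let ?S = "\<Sum>\<gamma>\<in>irr_chars G. class_value \<gamma> (set_inv c) * \<gamma> y"
  have "?S = (\<Sum>\<gamma>\<in>irr_chars G. \<gamma> (inv x) * \<gamma> y)"
    by (rule sum.cong) (simp_all add: class_value_inv[OF _ c xc])
  then have S: "of_nat (card c) * ?S = (if y \<in> c then of_nat (Coset.order G) else 0)"
    using irr_chars_column_orthogonal[OF x(1) y] unfolding x(2) by simp
  have "card c * centralizer_order G c = Coset.order G" by (rule card_conj_class_centralizer[OF c])
  then have z: "of_nat (Coset.order G) = of_nat (card c) * (of_nat (centralizer_order G c) :: complex)" by (metis of_nat_mult)
  have "card c \<noteq> 0" using z order_gt_0_iff_finite fin by (intro notI) simp
  then have "(of_nat (card c) :: complex) \<noteq> 0" by simp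
  from mult_left_cancel[OF this] show ?thesis using S unfolding z by (cases "y \<in> c") simp_all
qed

lemma card_set_inv:
  assumes "c \<in> conj_classes G"
  shows "card (set_inv c) = card c"
proof -
  have "c \<subseteq> carrier G" using conj_classes_eq(1)[OF assms] by blast
  then have "inj_on (\<lambda>x. inv x) c" by (auto intro!: inj_onI dest: inv_inj[THEN inj_onD])
  moreover have "set_inv c = (\<lambda>x. inv x) ` c" by (auto simp: SET_INV_def)
  ultimately show ?thesis by (simp add: card_image)
qed

lemma centralizer_order_set_inv:
  assumes c: "c \<in> conj_classes G"
  shows "centralizer_order G (set_inv c) = centralizer_order G c"
proof -
  have "card c * centralizer_order G (set_inv c) = card c * centralizer_order G c" "card c * centralizer_order G c > 0"
    using card_conj_class_centralizer[OF set_inv_conj_classes[OF c]] card_conj_class_centralizer[OF c] card_set_inv[OF c]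
      order_gt_0_iff_finite fin by simp_all
  then show ?thesis by simp
qed

end

lemma pdiff_fock: "p \<in> fock G \<Longrightarrow> pdiff v p \<in> fock G"
proof (induction p rule: fock_induct)
  case one
  then show ?case using pdiff_const[of v 1] by simp
next
  case (var w p)
  then show ?case by (simp add: pdiff_mult pdiff_var fock_add fock_mult fock_var)
next
  case (add p q)
  then show ?case by (simp add: pdiff_add fock_add)
next
  case (scale a p)
  then show ?case by (simp add: pdiff_mult pdiff_const fock_mult)
qed

lemma annihilation_fock: "p \<in> fock G \<Longrightarrow> annihilation G \<xi> n \<gamma> p \<in> fock G"
  unfolding annihilation_def by (intro fock_sum fock_mult fock_const pdiff_fock)

lemma a_class_fock: "odd n \<Longrightarrow> a_class G n c \<in> fock G"
  unfolding a_class_def by (intro fock_sum fock_mult fock_const fock_var) (simp add: fock_vars_def)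

context weighted_group
begin

abbreviation form :: "'a fock_poly \<Rightarrow> 'a fock_poly \<Rightarrow> complex" where
  "form \<equiv> fock_form G \<xi>"

lemma form_linear:
  assumes "p \<in> fock G" "q \<in> fock G"
  shows "r \<in> fock G \<Longrightarrow> form (p + q) r = form p r + form q r"
    "r \<in> fock G \<Longrightarrow> form r (p + q) = form r p + form r q"
    "form (pconst a * p) q = a * form p q" "form p (pconst a * q) = a * form p q"
  using is_fock_form_fock_form assms unfolding is_fock_form_def by simp_all

lemma form_one: "form 1 1 = 1"
  using is_fock_form_fock_form unfolding is_fock_form_def by simp

lemma form_var:
  assumes "odd n" "\<gamma> \<in> irr_chars G" "p \<in> fock G" "q \<in> fock G"
  shows "form (pvar (n, \<gamma>) * p) q = form p (annihilation G \<xi> n \<gamma> q)"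
    "form (annihilation G \<xi> n \<gamma> p) q = form p (pvar (n, \<gamma>) * q)"
  using is_fock_form_fock_form assms unfolding is_fock_form_def by simp_all

lemma form_zero:
  assumes "p \<in> fock G"
  shows "form 0 p = 0" "form p 0 = 0"
  using form_linear(3)[of 0 p 0] form_linear(4)[of p 0 0] assms by simp_all

lemma form_sum:
  assumes "q \<in> fock G" "\<And>i. i \<in> I \<Longrightarrow> p i \<in> fock G"
  shows "form (\<Sum>i\<in>I. p i) q = (\<Sum>i\<in>I. form (p i) q)" "form q (\<Sum>i\<in>I. p i) = (\<Sum>i\<in>I. form q (p i))"
  using assms(2)
  by (induction I rule: infinite_finite_induct) (simp_all add: form_zero form_linear fock_sum assms(1))

text \<open>The adjoint of multiplication by \<open>a_class G n c\<close>. The coefficients stay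
  unconjugated because the form is bilinear.\<close>

definition class_ann :: "nat \<Rightarrow> 'a set \<Rightarrow> 'a fock_poly \<Rightarrow> 'a fock_poly" where
  "class_ann n c p = (\<Sum>\<gamma>\<in>irr_chars G. pconst (class_value \<gamma> (set_inv c)) * annihilation G \<xi> n \<gamma> p)"

lemma class_ann_one: "class_ann n c 1 = 0"
  by (simp add: class_ann_def ann_one)

lemma class_ann_derivation: "class_ann n c (p * q) = class_ann n c p * q + p * class_ann n c q"
  by (simp add: class_ann_def annihilation_derivation distrib_left sum.distrib sum_distrib_left
      sum_distrib_right mult.assoc mult.left_commute)

lemma form_class:
  assumes n: "odd n" and p: "p \<in> fock G" and q: "q \<in> fock G"
  shows "form (a_class G n c * p) q = form p (class_ann n c q)"
    "form (class_ann n c p) q = form p (a_class G n c * q)"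
proof -
  have e: "a_class G n c * p = (\<Sum>\<gamma>\<in>irr_chars G. pconst (class_value \<gamma> (set_inv c)) * (pvar (n, \<gamma>) * p))" for p
    by (simp add: a_class_def sum_distrib_right mult.assoc)
  have v: "pvar (n, \<gamma>) \<in> fock G" if "\<gamma> \<in> irr_chars G" for \<gamma>
    by (rule fock_var) (use that n in \<open>simp add: fock_vars_def\<close>)
  show "form (a_class G n c * p) q = form p (class_ann n c q)"
    unfolding e class_ann_def
    by (simp add: form_sum form_linear form_var p q n v fock_mult annihilation_fock)
  show "form (class_ann n c p) q = form p (a_class G n c * q)"
    unfolding e class_ann_def
    by (simp add: form_sum form_linear form_var p q n v fock_mult annihilation_fock)
qed

text \<open>Expanding the weighted form turns the double sum over characters into a sum over x of
  two column sums, which forces x into c and x^-1 into d. What remains is |c| times the square of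
  the centralizer order, and the division by |G| leaves a single centralizer order.\<close>

lemma class_ann_class:
  assumes c: "c \<in> conj_classes G" and d: "d \<in> conj_classes G" and m: "odd m"
  shows "class_ann n c (a_class G m d) =
    pconst (if n = m \<and> d = set_inv c then of_nat n / 2 * of_nat (centralizer_order G c) * class_value \<xi> c else 0)"
proof -
  let ?I = "irr_chars G" and ?z = "centralizer_order G"
  have ann: "annihilation G \<xi> n \<gamma> (pvar (m, \<beta>)) = pconst (if n = m then of_nat n / 2 * weighted_form G \<xi> \<gamma> \<beta> else 0)"
    if "\<beta> \<in> ?I" for \<gamma> \<beta> using annihilation_var[OF finite_irr_chars that] by simp
  have ann2: "annihilation G \<xi> n \<gamma> (a_class G m d) = pconst (\<Sum>\<beta>\<in>?I. class_value \<beta> (set_inv d) * (if n = m then of_nat n / 2 * weighted_form G \<xi> \<gamma> \<beta> else 0))" for \<gamma>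
  proof -
    have s: "annihilation G \<xi> n \<gamma> (\<Sum>\<beta>\<in>S. p \<beta>) = (\<Sum>\<beta>\<in>S. annihilation G \<xi> n \<gamma> (p \<beta>))" for S p
      by (induction S rule: infinite_finite_induct) (simp_all add: annihilation_linear, simp_all add: annihilation_def)
    show ?thesis unfolding a_class_def s annihilation_linear pconst_sum
      by (rule sum.cong) (simp_all only: ann pconst_mult)
  qed
  have e: "class_ann n c (a_class G m d) = pconst (\<Sum>\<gamma>\<in>?I. \<Sum>\<beta>\<in>?I. class_value \<gamma> (set_inv c) * (class_value \<beta> (set_inv d) *
      (if n = m then of_nat n / 2 * weighted_form G \<xi> \<gamma> \<beta> else 0)))"
    unfolding class_ann_def ann2 pconst_sum[symmetric] pconst_mult[symmetric] sum_distrib_left ..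
  show ?thesis
  proof (cases "n = m")
    case False
    then show ?thesis unfolding e by simp
  next
    case True
    let ?f = "\<lambda>\<gamma> x. class_value \<gamma> (set_inv c) * \<gamma> x" and ?g = "\<lambda>\<beta> x. class_value \<beta> (set_inv d) * \<beta> x"
    have cc: "c \<subseteq> carrier G" using conj_classes_eq(1)[OF c] by blast
    have mem: "x \<in> c \<and> inv x \<in> d \<longleftrightarrow> x \<in> c \<and> d = set_inv c" if "x \<in> carrier G" for x
    proof -
      have "inv x \<in> set_inv c" if "x \<in> c" using that by (auto simp: SET_INV_def)
      then show ?thesis using conj_classes_disjoint[OF d set_inv_conj_classes[OF c]] by blast
    qed
    have wf: "weighted_form G \<xi> \<gamma> \<beta> * of_nat (Coset.order G) = (\<Sum>x\<in>carrier G. \<xi> x * \<gamma> x * \<beta> (inv x))" for \<gamma> \<beta>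
      using order_gt_0_iff_finite fin by (simp add: weighted_form_def)
    have "(\<Sum>\<gamma>\<in>?I. \<Sum>\<beta>\<in>?I. class_value \<gamma> (set_inv c) * (class_value \<beta> (set_inv d) * weighted_form G \<xi> \<gamma> \<beta>)) * of_nat (Coset.order G)
        = (\<Sum>\<gamma>\<in>?I. \<Sum>\<beta>\<in>?I. \<Sum>x\<in>carrier G. \<xi> x * ?f \<gamma> x * ?g \<beta> (inv x))"
      by (simp only: sum_distrib_right mult.assoc wf) (simp only: sum_distrib_left mult_ac)
    also have "\<dots> = (\<Sum>\<gamma>\<in>?I. \<Sum>x\<in>carrier G. \<Sum>\<beta>\<in>?I. \<xi> x * ?f \<gamma> x * ?g \<beta> (inv x))"
      by (intro sum.cong refl sum.swap)
    also have "\<dots> = (\<Sum>x\<in>carrier G. \<Sum>\<gamma>\<in>?I. \<Sum>\<beta>\<in>?I. \<xi> x * ?f \<gamma> x * ?g \<beta> (inv x))"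
      by (rule sum.swap)
    also have "\<dots> = (\<Sum>x\<in>carrier G. \<xi> x * (\<Sum>\<gamma>\<in>?I. ?f \<gamma> x) * (\<Sum>\<beta>\<in>?I. ?g \<beta> (inv x)))"
      by (intro sum.cong refl) (simp add: sum_distrib_left sum_distrib_right mult_ac)
    also have "\<dots> = (\<Sum>x\<in>carrier G. if x \<in> c \<and> inv x \<in> d then \<xi> x * of_nat (?z c) * of_nat (?z d) else 0)"
      by (intro sum.cong refl) (simp add: column_orthogonal[OF c] column_orthogonal[OF d])
    also have "\<dots> = (\<Sum>x\<in>carrier G. if x \<in> c then (if d = set_inv c then class_value \<xi> c * of_nat (?z c) * of_nat (?z d) else 0) else 0)"
      by (intro sum.cong refl) (simp add: mem class_value_mem[OF weight_class c] del: of_nat_mult)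
    also have "\<dots> = (if d = set_inv c then of_nat (card c * ?z c) * (of_nat (?z c) * class_value \<xi> c) else 0)"
      using cc by (simp add: sum.If_cases fin Int_absorb1 centralizer_order_set_inv[OF c] mult_ac)
    also have "\<dots> = (if d = set_inv c then of_nat (?z c) * class_value \<xi> c else 0) * of_nat (Coset.order G)"
      using card_conj_class_centralizer[OF c] by (simp del: of_nat_mult)
    finally have main: "(\<Sum>\<gamma>\<in>?I. \<Sum>\<beta>\<in>?I. class_value \<gamma> (set_inv c) * (class_value \<beta> (set_inv d) * weighted_form G \<xi> \<gamma> \<beta>))
        = (if d = set_inv c then of_nat (?z c) * class_value \<xi> c else 0)"
      using order_gt_0_iff_finite fin by simp
    have "(\<Sum>\<gamma>\<in>?I. \<Sum>\<beta>\<in>?I. class_value \<gamma> (set_inv c) * (class_value \<beta> (set_inv d) * (of_nat n / 2 * weighted_form G \<xi> \<gamma> \<beta>)))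
        = of_nat n / 2 * (\<Sum>\<gamma>\<in>?I. \<Sum>\<beta>\<in>?I. class_value \<gamma> (set_inv c) * (class_value \<beta> (set_inv d) * weighted_form G \<xi> \<gamma> \<beta>))"
      by (simp only: sum_distrib_left mult.left_commute)
    note s = this[unfolded main]
    show ?thesis unfolding e by (simp only: if_P[OF True] s) (simp add: True mult.assoc)
  qed
qed

end

context finite_group
begin

lemma a_part_fun_fock: "odd_part_fun G \<rho> \<Longrightarrow> a_part_fun G \<rho> \<in> fock G"
proof (induction \<rho> rule: odd_part_fun_induct)
  case (add \<rho> c k)
  show ?case unfolding a_part_fun_add[OF add(2)] by (rule fock_mult[OF a_class_fock[OF add(3)] add(4)])
qed simp

lemma part_fun_length_add:
  "c \<in> conj_classes G \<Longrightarrow> part_fun_length G (\<rho>(c := add_mset k (\<rho> c))) = Suc (part_fun_length G \<rho>)"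
  using sum_fun_upd_class[of c size \<rho> "add_mset k (\<rho> c)"] by (simp add: part_fun_length_def)

lemma part_fun_length_empty [simp]: "part_fun_length G (\<lambda>_. {#}) = 0"
  by (simp add: part_fun_length_def)

lemma centralizer_order_pos:
  assumes "c \<in> conj_classes G"
  shows "0 < centralizer_order G c"
  using card_conj_class_centralizer[OF assms] order_gt_0_iff_finite fin by (intro gr0I) simp

lemma Z_part_fun_pos: "odd_part_fun G \<rho> \<Longrightarrow> 0 < Z_part_fun G \<rho>"
proof (induction \<rho> rule: odd_part_fun_induct)
  case empty
  then show ?case by (simp add: Z_part_fun_empty)
next
  case (add \<rho> c k)
  show ?case unfolding Z_part_fun_add[OF add(2)] using add(4) centralizer_order_pos[OF add(2)] odd_pos[OF add(3)] by simp
qed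

lemma odd_part_fun_dual: "odd_part_fun G \<rho> \<Longrightarrow> odd_part_fun G (dual_part_fun G \<rho>)"
  by (auto simp: odd_part_fun_def dual_part_fun_def)

lemma dual_dual_part_fun:
  assumes "odd_part_fun G \<rho>"
  shows "dual_part_fun G (dual_part_fun G \<rho>) = \<rho>"
  using assms set_inv_conj_classes set_inv_set_inv by (auto simp: odd_part_fun_def dual_part_fun_def fun_eq_iff)

lemma sum_conj_classes:
  assumes "\<And>x. x \<in> carrier G \<Longrightarrow> h x = k (conj_class G x)"
  shows "(\<Sum>c\<in>conj_classes G. of_nat (card c) * k c) = (\<Sum>x\<in>carrier G. h x :: complex)"
proof -
  have f: "finite c" if "c \<in> conj_classes G" for c
    using conj_classes_eq(1)[OF that] by (intro finite_subset[OF _ fin]) blast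
  have U: "\<Union>(conj_classes G) = carrier G"
  proof (intro equalityI subsetI)
    fix x assume "x \<in> \<Union>(conj_classes G)"
    then show "x \<in> carrier G" by (rule UnionE) (rule conj_classes_eq(1))
  next
    fix x assume x: "x \<in> carrier G"
    show "x \<in> \<Union>(conj_classes G)" by (rule UnionI[OF conj_class_in[OF x] conj_class_self[OF x]])
  qed
  have "(\<Sum>x\<in>carrier G. h x) = (\<Sum>c\<in>conj_classes G. \<Sum>x\<in>c. h x)"
    unfolding U[symmetric] using f conj_classes_disjoint
    by (subst sum.Union_disjoint) (blast, meson disjoint_iff, simp)
  also have "\<dots> = (\<Sum>c\<in>conj_classes G. \<Sum>x\<in>c. k c)"
  proof (intro sum.cong refl)
    fix c x assume c: "c \<in> conj_classes G" "x \<in> c"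
    show "h x = k c" using assms[OF conj_classes_eq(1)[OF c]] conj_classes_eq(2)[OF c] by simp
  qed
  finally show ?thesis by simp
qed

text \<open>Row orthogonality inverts the definition of \<open>a_class\<close>: the weight |c| / |G|
  turns the sum over classes into an average over the group.\<close>

lemma pvar_a_class:
  assumes \<gamma>: "\<gamma> \<in> irr_chars G"
  shows "pvar (n, \<gamma>) = (\<Sum>c\<in>conj_classes G. pconst (of_nat (card c) * class_value \<gamma> c / of_nat (Coset.order G)) * a_class G n c)"
proof -
  let ?N = "of_nat (Coset.order G) :: complex"
  have O: "Coset.order G \<noteq> 0" using order_gt_0_iff_finite fin by simp
  have s: "(\<Sum>c\<in>conj_classes G. of_nat (card c) * (class_value \<gamma> c * class_value \<beta> (set_inv c))) = (if \<gamma> = \<beta> then ?N else 0)"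
    if b: "\<beta> \<in> irr_chars G" for \<beta>
  proof -
    have "(\<Sum>c\<in>conj_classes G. of_nat (card c) * (class_value \<gamma> c * class_value \<beta> (set_inv c))) = (\<Sum>x\<in>carrier G. \<gamma> x * \<beta> (inv x))"
    proof (rule sum_conj_classes)
      fix x assume x: "x \<in> carrier G"
      show "\<gamma> x * \<beta> (inv x) = class_value \<gamma> (conj_class G x) * class_value \<beta> (set_inv (conj_class G x))"
        using class_value_mem[OF irr_char_class_function[OF \<gamma>] conj_class_in[OF x] conj_class_self[OF x]]
          class_value_inv[OF b conj_class_in[OF x] conj_class_self[OF x]] by simp
    qed
    then show ?thesis using irr_chars_orthogonal[OF \<gamma> b] by simp
  qed
  have "(\<Sum>c\<in>conj_classes G. pconst (of_nat (card c) * class_value \<gamma> c / ?N) * a_class G n c)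
      = (\<Sum>c\<in>conj_classes G. \<Sum>\<beta>\<in>irr_chars G. pconst (of_nat (card c) * (class_value \<gamma> c * class_value \<beta> (set_inv c)) / ?N) * pvar (n, \<beta>))"
    unfolding a_class_def sum_distrib_left mult.assoc[symmetric] pconst_mult[symmetric] by (simp add: mult.assoc)
  also have "\<dots> = (\<Sum>\<beta>\<in>irr_chars G. pconst ((\<Sum>c\<in>conj_classes G. of_nat (card c) * (class_value \<gamma> c * class_value \<beta> (set_inv c))) / ?N) * pvar (n, \<beta>))"
    by (subst sum.swap) (simp only: sum_distrib_right pconst_sum sum_divide_distrib)
  also have "\<dots> = (\<Sum>\<beta>\<in>irr_chars G. if \<gamma> = \<beta> then pvar (n, \<beta>) else 0)"
    by (intro sum.cong refl) (simp add: s O)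
  finally show ?thesis using \<gamma> by (simp add: finite_irr_chars)
qed

section \<open>The monomials \<open>a_part_fun\<close>: spanning, pairing and independence\<close>

definition part_span :: "'a fock_poly set" where
  "part_span = {\<Sum>\<rho>\<in>S. pconst (d \<rho>) * a_part_fun G \<rho> | S d. finite S \<and> S \<subseteq> Collect (odd_part_fun G)}"

lemma part_span_term: "odd_part_fun G \<rho> \<Longrightarrow> pconst a * a_part_fun G \<rho> \<in> part_span"
  unfolding part_span_def by (intro CollectI exI[of _ "{\<rho>}"] exI[of _ "\<lambda>_. a"]) simp

lemma part_span_add:
  assumes "p \<in> part_span" "q \<in> part_span"
  shows "p + q \<in> part_span"
proof -
  obtain S d where S: "finite S" "S \<subseteq> Collect (odd_part_fun G)" "p = (\<Sum>\<rho>\<in>S. pconst (d \<rho>) * a_part_fun G \<rho>)"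
    using assms(1) unfolding part_span_def by blast
  obtain T e where T: "finite T" "T \<subseteq> Collect (odd_part_fun G)" "q = (\<Sum>\<rho>\<in>T. pconst (e \<rho>) * a_part_fun G \<rho>)"
    using assms(2) unfolding part_span_def by blast
  have "p = (\<Sum>\<rho>\<in>S \<union> T. pconst (if \<rho> \<in> S then d \<rho> else 0) * a_part_fun G \<rho>)"
    unfolding S(3) by (rule sum.mono_neutral_cong_left) (use S T in auto)
  moreover have "q = (\<Sum>\<rho>\<in>S \<union> T. pconst (if \<rho> \<in> T then e \<rho> else 0) * a_part_fun G \<rho>)"
    unfolding T(3) by (rule sum.mono_neutral_cong_left) (use S T in auto)
  ultimately have "p + q = (\<Sum>\<rho>\<in>S \<union> T. pconst ((if \<rho> \<in> S then d \<rho> else 0) + (if \<rho> \<in> T then e \<rho> else 0)) * a_part_fun G \<rho>)"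
    by (simp only: sum.distrib[symmetric] pconst_add distrib_right)
  then show ?thesis
    unfolding part_span_def using S T
    by (intro CollectI exI[of _ "S \<union> T"] exI[of _ "\<lambda>\<rho>. (if \<rho> \<in> S then d \<rho> else 0) + (if \<rho> \<in> T then e \<rho> else 0)"]) simp
qed

lemma part_span_zero: "0 \<in> part_span"
  unfolding part_span_def by (intro CollectI exI[of _ "{}"]) simp

lemma part_span_sum: "(\<And>i. i \<in> I \<Longrightarrow> p i \<in> part_span) \<Longrightarrow> (\<Sum>i\<in>I. p i) \<in> part_span"
  by (induction I rule: infinite_finite_induct) (simp_all add: part_span_add part_span_zero)

lemma part_span_scale:
  assumes "p \<in> part_span"
  shows "pconst a * p \<in> part_span"
proof -
  obtain S d where S: "S \<subseteq> Collect (odd_part_fun G)" "p = (\<Sum>\<rho>\<in>S. pconst (d \<rho>) * a_part_fun G \<rho>)"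
    using assms unfolding part_span_def by blast
  have "pconst a * p = (\<Sum>\<rho>\<in>S. pconst (a * d \<rho>) * a_part_fun G \<rho>)"
    unfolding S(2) by (simp add: sum_distrib_left pconst_mult mult.assoc)
  also have "\<dots> \<in> part_span" by (intro part_span_sum part_span_term) (use S(1) in blast)
  finally show ?thesis .
qed

lemma part_span_class:
  assumes "p \<in> part_span" "odd n" "c \<in> conj_classes G"
  shows "a_class G n c * p \<in> part_span"
proof -
  obtain S d where S: "S \<subseteq> Collect (odd_part_fun G)" "p = (\<Sum>\<rho>\<in>S. pconst (d \<rho>) * a_part_fun G \<rho>)"
    using assms(1) unfolding part_span_def by blast
  have "a_class G n c * p = (\<Sum>\<rho>\<in>S. pconst (d \<rho>) * a_part_fun G (\<rho>(c := add_mset n (\<rho> c))))"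
    unfolding S(2) a_part_fun_add[OF assms(3)] by (simp add: sum_distrib_left mult.left_commute)
  also have "\<dots> \<in> part_span" by (intro part_span_sum part_span_term odd_part_fun_add assms) (use S(1) in blast)
  finally show ?thesis .
qed

text \<open>By \<open>pvar_a_class\<close> each variable is a combination of elements
  \<open>a_class\<close>, and multiplying by such an element adds one part to a monomial.\<close>

theorem fock_spanned: "p \<in> fock G \<Longrightarrow> p \<in> part_span"
proof (induction p rule: fock_induct)
  case one
  have "odd_part_fun G (\<lambda>_. {#})" by (simp add: odd_part_fun_def)
  from part_span_term[OF this, of 1] show ?case by simp
next
  case (var v p)
  obtain n \<gamma> where v: "v = (n, \<gamma>)" by force
  have n: "odd n" "\<gamma> \<in> irr_chars G" using var(1) v by (simp_all add: fock_vars_def)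
  show ?case
    unfolding v pvar_a_class[OF n(2)] sum_distrib_right mult.assoc
    by (intro part_span_sum part_span_scale part_span_class var(3) n(1))
qed (simp_all add: part_span_add part_span_scale)

end

context weighted_group
begin

definition class_prod :: "'a part_fun \<Rightarrow> complex" where
  "class_prod \<rho> = (\<Prod>c\<in>conj_classes G. class_value \<xi> c ^ size (\<rho> c))"

lemma class_prod_add:
  "c \<in> conj_classes G \<Longrightarrow> class_prod (\<rho>(c := add_mset k (\<rho> c))) = class_value \<xi> c * class_prod \<rho>"
  by (simp add: class_prod_def prod.remove[OF finite_conj_classes] mult.assoc)

text \<open>A derivation that kills every generator except a_{-n}(c^-1) acts like a partial
  derivative: it yields the multiplicity of that part times the monomial with one copy removed. When
  the part is absent the coefficient is 0, so the truncated subtraction of multisets does no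
  harm.\<close>

lemma class_ann_part_fun:
  assumes c: "c \<in> conj_classes G" and \<mu>: "odd_part_fun G \<mu>"
  shows "class_ann n c (a_part_fun G \<mu>) = pconst (of_nat n / 2 * of_nat (centralizer_order G c) * class_value \<xi> c * of_nat (count (\<mu> (set_inv c)) n))
    * a_part_fun G (\<mu>(set_inv c := \<mu> (set_inv c) - {#n#}))"
  using \<mu>
proof (induction \<mu> rule: odd_part_fun_induct)
  case empty
  then show ?case by (simp add: class_ann_one)
next
  case (add \<mu> d m)
  let ?e = "set_inv c" and ?K = "of_nat n / 2 * of_nat (centralizer_order G c) * class_value \<xi> c :: complex"
  let ?\<mu>' = "\<mu>(d := add_mset m (\<mu> d))" and ?r = "\<lambda>\<mu>. \<mu>(?e := \<mu> ?e - {#n#})"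
  have L: "class_ann n c (a_part_fun G ?\<mu>') = pconst (if n = m \<and> d = ?e then ?K else 0) * a_part_fun G \<mu>
      + a_class G m d * (pconst (?K * of_nat (count (\<mu> ?e) n)) * a_part_fun G (?r \<mu>))"
    unfolding a_part_fun_add[OF add(2)] class_ann_derivation class_ann_class[OF c add(2,3)] add(4) ..
  show ?case
  proof (cases "n = m \<and> d = ?e")
    case True
    have A1: "a_class G m d * (pconst (?K * of_nat (count (\<mu> ?e) n)) * a_part_fun G (?r \<mu>))
        = pconst (?K * of_nat (count (\<mu> ?e) n)) * a_part_fun G \<mu>"
    proof (cases "n \<in># \<mu> ?e")
      case n: True
      have "(?r \<mu>)(d := add_mset m (?r \<mu> d)) = \<mu>" using True n by (auto simp: fun_eq_iff)
      then have "a_class G m d * a_part_fun G (?r \<mu>) = a_part_fun G \<mu>"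
        using a_part_fun_add[OF add(2), of "?r \<mu>" m] by simp
      then show ?thesis by (simp only: mult.left_commute[of "a_class G m d"])
    qed (simp add: not_in_iff)
    have A2: "?r ?\<mu>' = \<mu>" using True by (auto simp: fun_eq_iff)
    have A3: "count (?\<mu>' ?e) n = Suc (count (\<mu> ?e) n)" using True by simp
    show ?thesis
      unfolding L A1 A2 A3 if_P[OF True] distrib_right[symmetric] pconst_add[symmetric] by (simp add: distrib_left)
  next
    case nf: False
    have e1: "count (?\<mu>' ?e) n = count (\<mu> ?e) n" using nf by auto
    have e2: "?r ?\<mu>' = (?r \<mu>)(d := add_mset m (?r \<mu> d))" if "n \<in># \<mu> ?e"
      using nf that by (auto simp: fun_eq_iff)
    show ?thesis
    proof (cases "n \<in># \<mu> ?e")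
      case True
      show ?thesis
        unfolding L e1 e2[OF True] if_not_P[OF nf] unfolding a_part_fun_add[OF add(2)]
        by (simp only: pconst_simps mult_zero_left add_0 mult.left_commute[of "a_class G m d"])
    next
      case False
      then have "count (\<mu> ?e) n = 0" by (simp add: not_in_iff)
      then show ?thesis
        unfolding L e1 if_not_P[OF nf] by (simp only: of_nat_0 mult_zero_right mult_zero_left pconst_simps add_0)
    qed
  qed
qed

text \<open>Moving one generator across the form removes a part from the other monomial. The factors
  k/2, \<zeta>_c, \<xi>(c) and the multiplicity that this produces are those of the recursions for
  \<open>part_fun_length\<close>, \<open>Z_part_fun\<close> and \<open>class_prod\<close>.\<close>

lemma form_part_fun:
  assumes "odd_part_fun G \<rho>" "odd_part_fun G \<mu>"
  shows "form (a_part_fun G \<rho>) (a_part_fun G \<mu>) =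
    (if \<mu> = dual_part_fun G \<rho> then of_nat (Z_part_fun G \<rho>) * class_prod \<rho> / 2 ^ part_fun_length G \<rho> else 0)"
  using assms
proof (induction \<rho> arbitrary: \<mu> rule: odd_part_fun_induct)
  case empty
  show ?case
  proof (cases "\<mu> = (\<lambda>_. {#})")
    case True
    then show ?thesis by (simp add: form_one Z_part_fun_empty class_prod_def)
  next
    case False
    have "form 1 (a_part_fun G \<mu>) = 0"
      using empty False
    proof (induction \<mu> rule: odd_part_fun_induct)
      case (add \<mu> c k)
      have "form 1 (a_part_fun G (\<mu>(c := add_mset k (\<mu> c)))) = form (class_ann k c 1) (a_part_fun G \<mu>)"
        unfolding a_part_fun_add[OF add(2)] by (rule form_class(2)[symmetric]) (use add a_part_fun_fock in auto)
      then show ?case unfolding class_ann_one form_zero(1)[OF a_part_fun_fock[OF add(1)]] .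
    qed simp
    then show ?thesis using False by simp
  qed
next
  case (add \<rho> c k)
  let ?e = "set_inv c" and ?K = "of_nat k / 2 * of_nat (centralizer_order G c) * class_value \<xi> c :: complex"
  let ?\<rho>' = "\<rho>(c := add_mset k (\<rho> c))" and ?\<mu> = "\<mu>(?e := \<mu> ?e - {#k#})"
  have o: "odd_part_fun G ?\<mu>" by (rule odd_part_fun_remove[OF add(5)])
  have L: "form (a_part_fun G ?\<rho>') (a_part_fun G \<mu>) = ?K * of_nat (count (\<mu> ?e) k) * form (a_part_fun G \<rho>) (a_part_fun G ?\<mu>)"
    unfolding a_part_fun_add[OF add(2)] form_class(1)[OF add(3) a_part_fun_fock[OF add(1)] a_part_fun_fock[OF add(5)]]
      class_ann_part_fun[OF add(2,5)]
    by (rule form_linear(4)[OF a_part_fun_fock[OF add(1)] a_part_fun_fock[OF o]])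
  have de: "dual_part_fun G \<rho> ?e = \<rho> c"
    using set_inv_conj_classes[OF add(2)] set_inv_set_inv[OF add(2)] by (simp add: dual_part_fun_def)
  note d = dual_part_fun_add[OF add(2), of \<rho> k, unfolded de]
  show ?case
  proof (cases "\<mu> = dual_part_fun G ?\<rho>'")
    case True
    have m: "?\<mu> = dual_part_fun G \<rho>" unfolding True d using de by (auto simp: fun_eq_iff)
    have n: "count (\<mu> ?e) k = Suc (count (\<rho> c) k)" unfolding True d by simp
    show ?thesis
      unfolding L add(4)[OF o] if_P[OF m] if_P[OF True] n Z_part_fun_add[OF add(2)] class_prod_add[OF add(2)] part_fun_length_add[OF add(2)]
      by (simp add: field_simps)
  next
    case False
    \<comment> \<open>If the part were present and the rest dual to \<rho>, restoring the part would
      make \<mu> dual to the enlarged function. So the coefficient or the smaller pairing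
      vanishes.\<close>
    have "count (\<mu> ?e) k = 0 \<or> ?\<mu> \<noteq> dual_part_fun G \<rho>"
    proof (rule ccontr)
      assume a: "\<not> (count (\<mu> ?e) k = 0 \<or> ?\<mu> \<noteq> dual_part_fun G \<rho>)"
      then have k: "k \<in># \<mu> ?e" by (simp add: not_in_iff)
      have "\<mu> x = dual_part_fun G ?\<rho>' x" for x
      proof (cases "x = ?e")
        case True
        have "?\<mu> ?e = \<rho> c" using a de by simp
        then have "add_mset k (\<rho> c) = \<mu> ?e" using insert_DiffM[OF k] by simp
        then show ?thesis unfolding True d by simp
      next
        case False
        have "?\<mu> = dual_part_fun G \<rho>" using a by blast
        from fun_cong[OF this, of x] show ?thesis using False unfolding d by simp
      qed
      then show False using False by blast
    qed
    then show ?thesis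
    proof
      assume "count (\<mu> ?e) k = 0"
      then show ?thesis unfolding L if_not_P[OF False] by (simp only: of_nat_0 mult_zero_right mult_zero_left)
    next
      assume n: "?\<mu> \<noteq> dual_part_fun G \<rho>"
      show ?thesis unfolding L add(4)[OF o] if_not_P[OF False] if_not_P[OF n] by simp
    qed
  qed
qed

end

context finite_group
begin

text \<open>The statement concerns polynomials only, so the weight may be chosen freely. For the
  constant 1 the pairing of each \<rho> with its dual is nonzero, whereas for a general weight it
  may vanish.\<close>

lemma part_funs_independent:
  assumes S: "finite S" "S \<subseteq> Collect (odd_part_fun G)" and z: "(\<Sum>\<rho>\<in>S. pconst (d \<rho>) * a_part_fun G \<rho>) = 0"
    and r: "\<rho> \<in> S"
  shows "d \<rho> = 0"
proof -
  let ?\<xi> = "\<lambda>x. if x \<in> carrier G then 1 else 0 :: complex"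
  have cf: "?\<xi> \<in> class_functions G" by (simp add: class_functions_def)
  have v: "class_value ?\<xi> c = 1" if c: "c \<in> conj_classes G" for c
  proof -
    obtain x where x: "x \<in> carrier G" "x \<in> c" using c conj_class_self by (auto simp: conj_classes_def)
    then show ?thesis using class_value_mem[OF cf c x(2)] by simp
  qed
  interpret w: weighted_group G ?\<xi>
    by unfold_locales (use cf v set_inv_conj_classes in \<open>auto simp: self_dual_def\<close>)
  have o: "odd_part_fun G \<rho>" using S r by blast
  let ?m = "dual_part_fun G \<rho>"
  have o': "odd_part_fun G ?m" by (rule odd_part_fun_dual[OF o])
  have of': "odd_part_fun G \<sigma>" if "\<sigma> \<in> S" for \<sigma> using S that by blast
  have "0 = w.form (\<Sum>\<rho>\<in>S. pconst (d \<rho>) * a_part_fun G \<rho>) (a_part_fun G ?m)"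
    unfolding z by (rule w.form_zero(1)[symmetric, OF a_part_fun_fock[OF o']])
  also have "\<dots> = (\<Sum>\<sigma>\<in>S. d \<sigma> * w.form (a_part_fun G \<sigma>) (a_part_fun G ?m))"
    by (subst w.form_sum(1)[OF a_part_fun_fock[OF o']])
      (auto intro!: sum.cong w.form_linear(3) fock_mult a_part_fun_fock of' o')
  also have "\<dots> = (\<Sum>\<sigma>\<in>S. if \<sigma> = \<rho> then d \<rho> * w.form (a_part_fun G \<rho>) (a_part_fun G ?m) else 0)"
  proof (rule sum.cong[OF refl])
    fix \<sigma> assume s: "\<sigma> \<in> S"
    show "d \<sigma> * w.form (a_part_fun G \<sigma>) (a_part_fun G ?m) = (if \<sigma> = \<rho> then d \<rho> * w.form (a_part_fun G \<rho>) (a_part_fun G ?m) else 0)"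
    proof (cases "\<sigma> = \<rho>")
      case False
      have n: "?m \<noteq> dual_part_fun G \<sigma>"
        using dual_dual_part_fun[OF of'[OF s]] dual_dual_part_fun[OF o] False by metis
      show ?thesis unfolding w.form_part_fun[OF of'[OF s] o'] if_not_P[OF n] if_not_P[OF False] by simp
    qed simp
  qed
  also have "\<dots> = d \<rho> * w.form (a_part_fun G \<rho>) (a_part_fun G ?m)" using S r by simp
  finally have "d \<rho> * w.form (a_part_fun G \<rho>) (a_part_fun G ?m) = 0" by simp
  moreover have "w.class_prod \<rho> = 1" by (simp add: w.class_prod_def v)
  ultimately show ?thesis using w.form_part_fun[OF o o'] Z_part_fun_pos[OF o] by simp
qed

end

section \<open>The characteristic map\<close>

context finite_group
begin

lemma prod_dual_part_fun:
  "(\<Prod>c\<in>conj_classes G. h c (dual_part_fun G \<rho> c)) = (\<Prod>c\<in>conj_classes G. h (set_inv c) (\<rho> c) :: nat)"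
  by (rule prod.reindex_bij_witness[where i = "\<lambda>c. set_inv c" and j = "\<lambda>c. set_inv c"])
    (simp_all add: dual_part_fun_def set_inv_conj_classes set_inv_set_inv)

lemma sum_dual_part_fun:
  "(\<Sum>c\<in>conj_classes G. h (dual_part_fun G \<rho> c)) = (\<Sum>c\<in>conj_classes G. h (\<rho> c) :: nat)"
  by (rule sum.reindex_bij_witness[where i = "\<lambda>c. set_inv c" and j = "\<lambda>c. set_inv c"])
    (simp_all add: dual_part_fun_def set_inv_conj_classes set_inv_set_inv)

lemma part_fun_weight_dual: "part_fun_weight G (dual_part_fun G \<rho>) = part_fun_weight G \<rho>"
  unfolding part_fun_weight_def by (rule sum_dual_part_fun)

lemma part_fun_length_dual: "part_fun_length G (dual_part_fun G \<rho>) = part_fun_length G \<rho>"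
  unfolding part_fun_length_def by (rule sum_dual_part_fun)

lemma Z_part_fun_dual: "Z_part_fun G (dual_part_fun G \<rho>) = Z_part_fun G \<rho>"
  unfolding Z_part_fun_def
  by (subst prod_dual_part_fun) (simp add: centralizer_order_set_inv)

lemma dual_odd_part_funs: "\<rho> \<in> odd_part_funs G n \<Longrightarrow> dual_part_fun G \<rho> \<in> odd_part_funs G n"
  by (simp add: odd_part_funs_iff odd_part_fun_dual part_fun_weight_dual)

lemma spin_type_inv:
  assumes x: "x \<in> carrier (spin_wreath G n)"
  shows "spin_type G n (inv\<^bsub>spin_wreath G n\<^esub> x) = dual_part_fun G (spin_type G n x)"
proof
  fix c
  interpret W: group "spin_wreath G n" by (rule wreath_group)
  show "spin_type G n (inv\<^bsub>spin_wreath G n\<^esub> x) c = dual_part_fun G (spin_type G n x) c"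
  proof (cases "c \<in> conj_classes G")
    case True
    show ?thesis
      using spin_type_inverse[OF x set_inv_conj_classes[OF True]] True
      by (simp add: dual_part_fun_def set_inv_set_inv)
  next
    case False
    then show ?thesis using spin_type_sum(2)[OF W.inv_closed[OF x]] by (simp add: dual_part_fun_def)
  qed
qed

lemma zero_spin_function: "(\<lambda>_. 0) \<in> spin_functions G n"
  by (simp add: spin_functions_def class_functions_def)

lemma spin_functions_add: "f \<in> spin_functions G n \<Longrightarrow> g \<in> spin_functions G n \<Longrightarrow> (\<lambda>x. f x + g x) \<in> spin_functions G n"
  by (simp add: spin_functions_def class_functions_def)

lemma spin_functions_scale: "f \<in> spin_functions G n \<Longrightarrow> (\<lambda>x. a * f x) \<in> spin_functions G n"
  by (simp add: spin_functions_def class_functions_def)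

lemma spin_space_add:
  assumes "F \<in> spin_space G" "H \<in> spin_space G"
  shows "(\<lambda>n x. F n x + H n x) \<in> spin_space G"
proof -
  have "{n. (\<lambda>x. F n x + H n x) \<noteq> (\<lambda>_. 0)} \<subseteq> {n. F n \<noteq> (\<lambda>_. 0)} \<union> {n. H n \<noteq> (\<lambda>_. 0)}" by auto
  then show ?thesis using assms by (auto simp: spin_space_def spin_functions_add intro: finite_subset)
qed

lemma spin_space_scale:
  assumes "F \<in> spin_space G"
  shows "(\<lambda>n x. a * F n x) \<in> spin_space G"
proof -
  have "{n. (\<lambda>x. a * F n x) \<noteq> (\<lambda>_. 0)} \<subseteq> {n. F n \<noteq> (\<lambda>_. 0)}" by auto
  then show ?thesis using assms by (auto simp: spin_space_def spin_functions_scale intro: finite_subset)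
qed

end

section \<open>Linearity and bijectivity of the characteristic map\<close>

locale ordered_classes = finite_group G for G :: "('a, 'b) monoid_scheme" (structure) +
  fixes cs :: "'a set list"
  assumes cs: "distinct cs" "set cs = conj_classes G"
begin

abbreviation val :: "nat \<Rightarrow> ('a spin_wreath_elt \<Rightarrow> complex) \<Rightarrow> 'a part_fun \<Rightarrow> complex" where
  "val n f \<rho> \<equiv> class_value f (D_plus G cs n \<rho>)"

lemma val_eq:
  assumes "f \<in> spin_functions G n" "\<rho> \<in> odd_part_funs G n" "x \<in> D_plus G cs n \<rho>"
  shows "val n f \<rho> = f x"
proof -
  have x: "x \<in> carrier (spin_wreath G n)" "spin_type G n x = \<rho>" "0 < spin_tr (snd x)"
    using D_plus_props(2)[OF cs assms(2,3)] by simp_all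
  show ?thesis using D_plus_value(1)[OF cs assms(2,1) x(1,2)] x(3) by simp
qed

lemma D_plus_obtain:
  assumes "\<rho> \<in> odd_part_funs G n"
  obtains x where "x \<in> D_plus G cs n \<rho>"
  using D_plus_props(1)[OF cs assms] by (rule_tac that[OF some_in_eq[THEN iffD2]])

lemma val_add:
  assumes f: "f \<in> spin_functions G n" and g: "g \<in> spin_functions G n" and r: "\<rho> \<in> odd_part_funs G n"
  shows "val n (\<lambda>x. f x + g x) \<rho> = val n f \<rho> + val n g \<rho>"
proof -
  obtain x where x: "x \<in> D_plus G cs n \<rho>" by (rule D_plus_obtain[OF r])
  show ?thesis unfolding val_eq[OF f r x] val_eq[OF g r x] val_eq[OF spin_functions_add[OF f g] r x] ..
qed

lemma val_scale:
  assumes f: "f \<in> spin_functions G n" and r: "\<rho> \<in> odd_part_funs G n"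
  shows "val n (\<lambda>x. a * f x) \<rho> = a * val n f \<rho>"
proof -
  obtain x where x: "x \<in> D_plus G cs n \<rho>" by (rule D_plus_obtain[OF r])
  show ?thesis unfolding val_eq[OF f r x] val_eq[OF spin_functions_scale[OF f] r x] ..
qed

lemma val_zero: "\<rho> \<in> odd_part_funs G n \<Longrightarrow> val n (\<lambda>_. 0) \<rho> = 0"
  using val_scale[OF zero_spin_function, of \<rho> n 0] by simp

lemma spin_function_eq:
  assumes f: "f \<in> spin_functions G n" and x: "x \<in> carrier (spin_wreath G n)"
  shows "f x = (if spin_type G n x \<in> odd_part_funs G n
    then of_real (sgn (spin_tr (snd x))) * val n f (spin_type G n x) else 0)"
proof (cases "spin_type G n x \<in> odd_part_funs G n")
  case True
  then show ?thesis using D_plus_value(1)[OF cs True f x refl] by simp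
next
  case False
  then have "\<exists>c. \<exists>k\<in>#spin_type G n x c. even k"
    using spin_type_sum[OF x] by (simp add: odd_part_funs_def)
  then obtain c k where "k \<in># spin_type G n x c" "even k" by (elim exE bexE)
  then show ?thesis using spin_function_vanishes[OF f x] False by simp
qed

lemma finite_odd_part_funs: "finite (odd_part_funs G n)"
proof (rule finite_subset[OF _ finite_imageI[OF finite_wreath]])
  show "odd_part_funs G n \<subseteq> spin_type G n ` carrier (spin_wreath G n)"
  proof
    fix \<rho> assume r: "\<rho> \<in> odd_part_funs G n"
    obtain x where x: "x \<in> D_plus G cs n \<rho>" by (rule D_plus_obtain[OF r])
    show "\<rho> \<in> spin_type G n ` carrier (spin_wreath G n)"
      using D_plus_props(2)[OF cs r x] by (intro image_eqI[of _ _ x]) simp_all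
  qed
qed

text \<open>Prescribes the values on the classes D+; the sign of the trace extends them to all
  elements so that z reverses the sign.\<close>

definition spin_of :: "('a part_fun \<Rightarrow> complex) \<Rightarrow> 'a spin_family" where
  "spin_of v n x = (if x \<in> carrier (spin_wreath G n) \<and> spin_type G n x \<in> odd_part_funs G n
    then of_real (sgn (spin_tr (snd x))) * v (spin_type G n x) else 0)"

lemma spin_of_spin_function: "spin_of v n \<in> spin_functions G n"
proof -
  interpret W: group "spin_wreath G n" by (rule wreath_group)
  have s: "snd x \<in> carrier (spin_group n)" if "x \<in> carrier (spin_wreath G n)" for x
    using that unfolding wreath_carrier by blast
  have conj: "spin_of v n (y \<otimes>\<^bsub>spin_wreath G n\<^esub> x \<otimes>\<^bsub>spin_wreath G n\<^esub> inv\<^bsub>spin_wreath G n\<^esub> y) = spin_of v n x"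
    if x: "x \<in> carrier (spin_wreath G n)" and y: "y \<in> carrier (spin_wreath G n)" for x y
  proof -
    have "y \<otimes>\<^bsub>spin_wreath G n\<^esub> x \<otimes>\<^bsub>spin_wreath G n\<^esub> inv\<^bsub>spin_wreath G n\<^esub> y \<in> carrier (spin_wreath G n)"
      using x y by simp
    then show ?thesis
      unfolding spin_of_def spin_type_conj[OF x y] wreath_conj_snd(1)[OF x y] spin_tr_conj[OF s[OF x] s[OF y]] using x by simp
  qed
  have z: "spin_of v n (spin_z G n \<otimes>\<^bsub>spin_wreath G n\<^esub> x) = - spin_of v n x" if x: "x \<in> carrier (spin_wreath G n)" for x
  proof -
    have c: "spin_z G n \<otimes>\<^bsub>spin_wreath G n\<^esub> x \<in> carrier (spin_wreath G n)" using x spin_z_carrier by simp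
    have t: "spin_tr (snd (spin_z G n \<otimes>\<^bsub>spin_wreath G n\<^esub> x)) = - spin_tr (snd x)"
      unfolding spin_z_mult[OF x] snd_conv by (rule spin_tr_Zs[OF s[OF x]])
    show ?thesis
      unfolding spin_of_def spin_type_proj[OF spin_z_proj[OF x]] t using x c by (simp add: sgn_minus)
  qed
  \<comment> \<open>Elements whose type has only odd parts are even. \<open>D_plus_value\<close> is
    applied to the zero function just to extract this fact.\<close>
  have p: "spin_of v n x = 0" if x: "x \<in> carrier (spin_wreath G n)" and "spin_parity (snd x) = 1" for x
    using D_plus_value(3)[OF cs _ zero_spin_function x refl] that by (auto simp: spin_of_def)
  show ?thesis
    unfolding spin_functions_def class_functions_def using conj z p by (auto simp: spin_of_def)
qed

lemma val_spin_of:
  assumes r: "\<rho> \<in> odd_part_funs G n"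
  shows "val n (spin_of v n) \<rho> = v \<rho>"
proof -
  obtain x where x: "x \<in> D_plus G cs n \<rho>" by (rule D_plus_obtain[OF r])
  show ?thesis unfolding val_eq[OF spin_of_spin_function r x]
    using D_plus_props(2)[OF cs r x] r by (simp add: spin_of_def)
qed

definition ch_scale :: "'a part_fun \<Rightarrow> complex" where
  "ch_scale \<rho> = complex_of_real (2 powr (real (part_fun_length G \<rho>) / 2)) / of_nat (Z_part_fun G \<rho>)"

text \<open>The degree is recovered from \<rho> as its weight. So the coefficient is a function of
  \<rho>, and several degrees can be treated in one sum over \<open>indices\<close>.\<close>

definition ch_coeff :: "'a spin_family \<Rightarrow> 'a part_fun \<Rightarrow> complex" where
  "ch_coeff F \<rho> = ch_scale \<rho> * val (part_fun_weight G \<rho>) (F (part_fun_weight G \<rho>)) \<rho>"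

lemma ch_scale_nonzero: "odd_part_fun G \<rho> \<Longrightarrow> ch_scale \<rho> \<noteq> 0"
  using Z_part_fun_pos[of \<rho>] by (simp add: ch_scale_def)

text \<open>\<rho> and its dual have the same length and the same Z. The two factors 2^(l/2) cancel
  the 2^-l from \<open>form_part_fun\<close>, and one of the two denominators Z cancels.\<close>

lemma ch_scale_dual:
  assumes "odd_part_fun G \<rho>"
  shows "ch_scale \<rho> * ch_scale (dual_part_fun G \<rho>) * of_nat (Z_part_fun G \<rho>) / 2 ^ part_fun_length G \<rho> = 1 / of_nat (Z_part_fun G \<rho>)"
proof -
  let ?l = "part_fun_length G \<rho>"
  have "(2::real) powr (real ?l / 2) * 2 powr (real ?l / 2) = 2 ^ ?l"
    unfolding powr_add[symmetric] by (simp add: powr_realpow)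
  then have "complex_of_real (2 powr (real ?l / 2)) * complex_of_real (2 powr (real ?l / 2)) = 2 ^ ?l"
    unfolding of_real_mult[symmetric] by simp
  then show ?thesis
    using Z_part_fun_pos[OF assms] by (simp add: ch_scale_def part_fun_length_dual Z_part_fun_dual)
qed

abbreviation indices :: "nat set \<Rightarrow> 'a part_fun set" where
  "indices N \<equiv> (\<Union>n\<in>N. odd_part_funs G n)"

lemma finite_indices: "finite N \<Longrightarrow> finite (indices N)"
  using finite_odd_part_funs by blast

lemma indices_odd: "\<rho> \<in> indices N \<Longrightarrow> odd_part_fun G \<rho>"
  by (auto simp: odd_part_funs_iff)

lemma sum_indices:
  assumes "finite N"
  shows "(\<Sum>\<rho>\<in>indices N. h \<rho>) = (\<Sum>n\<in>N. \<Sum>\<rho>\<in>odd_part_funs G n. h \<rho>)"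
  by (rule sum.UNION_disjoint) (use assms finite_odd_part_funs in \<open>auto simp: odd_part_funs_iff\<close>)

text \<open>An arbitrary finite N that contains the support lets two families be expanded over a
  common index set.\<close>

lemma ch_eq:
  assumes F: "F \<in> spin_space G" and N: "finite N" "{n. F n \<noteq> (\<lambda>_. 0)} \<subseteq> N"
  shows "ch G cs F = (\<Sum>\<rho>\<in>indices N. pconst (ch_coeff F \<rho>) * a_part_fun G \<rho>)"
proof -
  let ?t = "\<lambda>n \<rho>. pconst (complex_of_real (2 powr (real (part_fun_length G \<rho>) / 2))
                / of_nat (Z_part_fun G \<rho>) * val n (F n) \<rho>) * a_part_fun G \<rho>"
  have "ch G cs F = (\<Sum>n\<in>N. \<Sum>\<rho>\<in>odd_part_funs G n. ?t n \<rho>)"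
    unfolding ch_def
  proof (rule sum.mono_neutral_left[OF N])
    show "\<forall>n\<in>N - {n. F n \<noteq> (\<lambda>_. 0)}. (\<Sum>\<rho>\<in>odd_part_funs G n. ?t n \<rho>) = 0"
    proof (intro ballI sum.neutral)
      fix n \<rho> assume "n \<in> N - {n. F n \<noteq> (\<lambda>_. 0)}" and r: "\<rho> \<in> odd_part_funs G n"
      then have "F n = (\<lambda>_. 0)" by blast
      then show "?t n \<rho> = 0" using val_zero[OF r] by simp
    qed
  qed
  also have "\<dots> = (\<Sum>n\<in>N. \<Sum>\<rho>\<in>odd_part_funs G n. pconst (ch_coeff F \<rho>) * a_part_fun G \<rho>)"
    by (intro sum.cong refl) (simp add: ch_coeff_def ch_scale_def odd_part_funs_iff)
  finally show ?thesis unfolding sum_indices[OF N(1)] .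
qed

lemma ch_coeff_add:
  assumes "F \<in> spin_space G" "H \<in> spin_space G" "odd_part_fun G \<rho>"
  shows "ch_coeff (\<lambda>n x. F n x + H n x) \<rho> = ch_coeff F \<rho> + ch_coeff H \<rho>"
  using assms val_add[of "F (part_fun_weight G \<rho>)" "part_fun_weight G \<rho>" "H (part_fun_weight G \<rho>)" \<rho>]
  by (simp add: ch_coeff_def spin_space_def odd_part_funs_iff distrib_left)

lemma ch_coeff_scale:
  assumes "F \<in> spin_space G" "odd_part_fun G \<rho>"
  shows "ch_coeff (\<lambda>n x. a * F n x) \<rho> = a * ch_coeff F \<rho>"
  using assms val_scale[of "F (part_fun_weight G \<rho>)" "part_fun_weight G \<rho>" \<rho> a]
  by (simp add: ch_coeff_def spin_space_def odd_part_funs_iff)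

lemma spin_space_support: "F \<in> spin_space G \<Longrightarrow> finite {n. F n \<noteq> (\<lambda>_. 0)}"
  by (simp add: spin_space_def)

lemma ch_add:
  assumes F: "F \<in> spin_space G" and H: "H \<in> spin_space G"
  shows "ch G cs (\<lambda>n x. F n x + H n x) = ch G cs F + ch G cs H"
proof -
  let ?N = "{n. F n \<noteq> (\<lambda>_. 0)} \<union> {n. H n \<noteq> (\<lambda>_. 0)}"
  have N: "finite ?N" using F H by (simp add: spin_space_support)
  have "ch G cs (\<lambda>n x. F n x + H n x) = (\<Sum>\<rho>\<in>indices ?N. pconst (ch_coeff (\<lambda>n x. F n x + H n x) \<rho>) * a_part_fun G \<rho>)"
    by (rule ch_eq[OF spin_space_add[OF F H] N]) auto
  also have "\<dots> = (\<Sum>\<rho>\<in>indices ?N. pconst (ch_coeff F \<rho>) * a_part_fun G \<rho> + pconst (ch_coeff H \<rho>) * a_part_fun G \<rho>)"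
    by (rule sum.cong[OF refl]) (simp only: ch_coeff_add[OF F H indices_odd] pconst_add distrib_right)
  finally show ?thesis
    by (simp only: sum.distrib ch_eq[OF F N Un_upper1] ch_eq[OF H N Un_upper2])
qed

lemma ch_mult_const:
  assumes F: "F \<in> spin_space G"
  shows "ch G cs (\<lambda>n x. a * F n x) = pconst a * ch G cs F"
proof -
  let ?N = "{n. F n \<noteq> (\<lambda>_. 0)}"
  have N: "finite ?N" using F by (rule spin_space_support)
  have "ch G cs (\<lambda>n x. a * F n x) = (\<Sum>\<rho>\<in>indices ?N. pconst (ch_coeff (\<lambda>n x. a * F n x) \<rho>) * a_part_fun G \<rho>)"
    by (rule ch_eq[OF spin_space_scale[OF F] N]) auto
  also have "\<dots> = (\<Sum>\<rho>\<in>indices ?N. pconst a * (pconst (ch_coeff F \<rho>) * a_part_fun G \<rho>))"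
    by (rule sum.cong[OF refl]) (simp only: ch_coeff_scale[OF F indices_odd] pconst_mult mult.assoc)
  finally show ?thesis by (simp only: sum_distrib_left ch_eq[OF F N subset_refl])
qed

lemma ch_fock: "F \<in> spin_space G \<Longrightarrow> ch G cs F \<in> fock G"
  by (subst ch_eq[OF _ _ subset_refl])
    (auto simp: spin_space_support odd_part_funs_iff intro!: fock_sum fock_mult a_part_fun_fock)

text \<open>Independence recovers the coefficients, \<open>ch_scale_nonzero\<close> the values on
  D+, and \<open>spin_function_eq\<close> the whole function from these values.\<close>

lemma ch_inj: "inj_on (ch G cs) (spin_space G)"
proof (rule inj_onI)
  fix F H assume F: "F \<in> spin_space G" and H: "H \<in> spin_space G" and e: "ch G cs F = ch G cs H"
  let ?N = "{n. F n \<noteq> (\<lambda>_. 0)} \<union> {n. H n \<noteq> (\<lambda>_. 0)}"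
  have N: "finite ?N" using F H by (simp add: spin_space_support)
  let ?I = "indices ?N"
  have a: "ch_coeff F \<rho> + - ch_coeff H \<rho> = 0" if r: "\<rho> \<in> ?I" for \<rho>
  proof (rule part_funs_independent[OF finite_indices[OF N] _ _ r])
    show "?I \<subseteq> Collect (odd_part_fun G)" by (auto simp: odd_part_funs_iff)
    have m: "pconst (- c) * p = - (pconst c * p)" for c and p :: "'a fock_poly"
    proof -
      have "pconst (- c) * p + pconst c * p = 0" by (simp flip: distrib_right pconst_add)
      then show ?thesis by (simp add: eq_neg_iff_add_eq_0)
    qed
    show "(\<Sum>\<rho>\<in>?I. pconst (ch_coeff F \<rho> + - ch_coeff H \<rho>) * a_part_fun G \<rho>) = 0"
      using e unfolding ch_eq[OF F N Un_upper1] ch_eq[OF H N Un_upper2]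
      by (simp only: pconst_add distrib_right m sum.distrib sum_negf add.right_inverse)
  qed
  have c: "ch_coeff F \<rho> = ch_coeff H \<rho>" if "\<rho> \<in> ?I" for \<rho> using a[OF that] by simp
  have "F n x = H n x" for n x
  proof (cases "n \<in> ?N \<and> x \<in> carrier (spin_wreath G n)")
    case True
    have f: "F n \<in> spin_functions G n" "H n \<in> spin_functions G n" using F H by (simp_all add: spin_space_def)
    have "val n (F n) \<rho> = val n (H n) \<rho>" if r: "\<rho> \<in> odd_part_funs G n" for \<rho>
    proof -
      have "\<rho> \<in> ?I" using r True by blast
      note c[OF this]
      moreover have "odd_part_fun G \<rho>" "part_fun_weight G \<rho> = n" using r by (simp_all add: odd_part_funs_iff)
      ultimately show ?thesis using ch_scale_nonzero[of \<rho>] by (simp add: ch_coeff_def)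
    qed
    then show ?thesis
      using True by (simp add: spin_function_eq[OF f(1)] spin_function_eq[OF f(2)])
  next
    case False
    show ?thesis
    proof (cases "n \<in> ?N")
      case True
      then have x: "x \<notin> carrier (spin_wreath G n)" using False by blast
      have f: "F n \<in> spin_functions G n" "H n \<in> spin_functions G n" using F H by (simp_all add: spin_space_def)
      show ?thesis unfolding spin_functionD(4)[OF f(1) x] spin_functionD(4)[OF f(2) x] ..
    qed simp
  qed
  then show "F = H" by (intro ext)
qed

lemma ch_surj:
  assumes "p \<in> fock G"
  shows "p \<in> ch G cs ` spin_space G"
proof -
  obtain S d where S: "finite S" "S \<subseteq> Collect (odd_part_fun G)" "p = (\<Sum>\<rho>\<in>S. pconst (d \<rho>) * a_part_fun G \<rho>)"
    using fock_spanned[OF assms] unfolding part_span_def by blast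
  \<comment> \<open>Division by \<open>ch_scale\<close> undoes the factor in the characteristic map;
    the value 0 outside S confines the family to finitely many degrees.\<close>
  let ?v = "\<lambda>\<rho>. if \<rho> \<in> S then d \<rho> / ch_scale \<rho> else 0"
  let ?F = "spin_of ?v" and ?N = "part_fun_weight G ` S"
  have N: "finite ?N" using S(1) by simp
  have sub: "{n. ?F n \<noteq> (\<lambda>_. 0)} \<subseteq> ?N"
  proof (rule subsetI, rule ccontr)
    fix n assume n: "n \<in> {n. ?F n \<noteq> (\<lambda>_. 0)}" "n \<notin> ?N"
    have "\<rho> \<notin> S" if "\<rho> \<in> odd_part_funs G n" for \<rho>
      using n(2) that by (auto simp: odd_part_funs_iff)
    then have "?F n x = 0" for x by (simp add: spin_of_def)
    then have "?F n = (\<lambda>_. 0)" by (intro ext)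
    then show False using n(1) by simp
  qed
  have F: "?F \<in> spin_space G"
    using spin_of_spin_function finite_subset[OF sub N] by (simp add: spin_space_def)
  have c: "ch_coeff ?F \<rho> = (if \<rho> \<in> S then d \<rho> else 0)" if r: "odd_part_fun G \<rho>" for \<rho>
    using val_spin_of[of \<rho> "part_fun_weight G \<rho>" ?v] ch_scale_nonzero[OF r] r
    by (simp add: ch_coeff_def odd_part_funs_iff)
  have "p = (\<Sum>\<rho>\<in>indices ?N. pconst (ch_coeff ?F \<rho>) * a_part_fun G \<rho>)"
    unfolding S(3)
  proof (rule sum.mono_neutral_cong_left[OF finite_indices[OF N]])
    show "S \<subseteq> indices ?N" using S(2) by (auto simp: odd_part_funs_iff)
    show "\<forall>\<rho>\<in>indices ?N - S. pconst (ch_coeff ?F \<rho>) * a_part_fun G \<rho> = 0"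
    proof
      fix \<rho> assume r: "\<rho> \<in> indices ?N - S"
      then have "odd_part_fun G \<rho>" using indices_odd by blast
      from c[OF this] show "pconst (ch_coeff ?F \<rho>) * a_part_fun G \<rho> = 0" using r by simp
    qed
    show "pconst (d \<rho>) * a_part_fun G \<rho> = pconst (ch_coeff ?F \<rho>) * a_part_fun G \<rho>" if "\<rho> \<in> S" for \<rho>
      using c[of \<rho>] that S(2) by (simp add: subset_iff)
  qed
  then have "p = ch G cs ?F" using ch_eq[OF F N sub] by simp
  then show ?thesis using F by (rule image_eqI)
qed

end

section \<open>Preservation of the forms\<close>

locale weighted_ordered_classes = weighted_group G \<xi> + ordered_classes G cs
  for G :: "('a, 'b) monoid_scheme" (structure) and \<xi> cs
begin

text \<open>The sum over the group is grouped by type. By \<open>spin_tr_inv\<close> the sign of the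
  trace enters f(x) and g(x^-1) alike, so the summand depends on the type only, and
  \<open>card_spin_type\<close> counts the elements of each type.\<close>

lemma weighted_form_spin:
  assumes f: "f \<in> spin_functions G n" and g: "g \<in> spin_functions G n"
  shows "weighted_form (spin_wreath G n) (eta G n \<xi>) f g =
    (\<Sum>\<rho>\<in>odd_part_funs G n. class_prod \<rho> * val n f \<rho> * val n g (dual_part_fun G \<rho>) / of_nat (Z_part_fun G \<rho>))"
proof -
  interpret W: group "spin_wreath G n" by (rule wreath_group)
  let ?W = "carrier (spin_wreath G n)" and ?OP = "odd_part_funs G n"
  let ?k = "\<lambda>\<rho>. class_prod \<rho> * val n f \<rho> * val n g (dual_part_fun G \<rho>)"
  let ?X = "{x \<in> ?W. spin_type G n x \<in> ?OP}"
  have t: "eta G n \<xi> x * f x * g (inv\<^bsub>spin_wreath G n\<^esub> x) = (if spin_type G n x \<in> ?OP then ?k (spin_type G n x) else 0)"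
    if x: "x \<in> ?W" for x
  proof (cases "spin_type G n x \<in> ?OP")
    case True
    have s: "snd x \<in> carrier (spin_group n)" using x unfolding wreath_carrier by blast
    have "spin_tr (snd x) \<noteq> 0" by (rule D_plus_value(2)[OF cs True f x refl])
    then have "sgn (spin_tr (snd x)) * sgn (spin_tr (snd x)) = 1" by (simp add: sgn_if)
    then have q: "of_real (sgn (spin_tr (snd x))) * of_real (sgn (spin_tr (snd x))) = (1 :: complex)"
      unfolding of_real_mult[symmetric] by simp
    have fx: "f x = of_real (sgn (spin_tr (snd x))) * val n f (spin_type G n x)"
      using spin_function_eq[OF f x] True by simp
    have gx: "g (inv\<^bsub>spin_wreath G n\<^esub> x) = of_real (sgn (spin_tr (snd x))) * val n g (dual_part_fun G (spin_type G n x))"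
      using spin_function_eq[OF g W.inv_closed[OF x]] dual_odd_part_funs[OF True]
      unfolding spin_type_inv[OF x] wreath_conj_snd(2)[OF x x] spin_tr_inv[OF s] by simp
    have "eta G n \<xi> x * f x * g (inv\<^bsub>spin_wreath G n\<^esub> x)
        = (of_real (sgn (spin_tr (snd x))) * of_real (sgn (spin_tr (snd x)))) * ?k (spin_type G n x)"
      unfolding fx gx by (simp add: eta_def class_prod_def mult_ac)
    then show ?thesis using q True by simp
  next
    case False
    then show ?thesis using spin_function_eq[OF f x] by simp
  qed
  have card: "of_nat (card {x \<in> ?X. spin_type G n x = \<rho>}) = of_nat (card ?W) / (of_nat (Z_part_fun G \<rho>) :: complex)"
    if r: "\<rho> \<in> ?OP" for \<rho>
  proof -
    obtain x0 where "x0 \<in> D_plus G cs n \<rho>" by (rule D_plus_obtain[OF r])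
    then have x0: "x0 \<in> ?W" "spin_type G n x0 = \<rho>" using D_plus_props(2)[OF cs r] by simp_all
    have e: "{x \<in> ?X. spin_type G n x = \<rho>} = {x \<in> ?W. spin_type G n x = spin_type G n x0}" using x0 r by auto
    have m: "of_nat (card {x \<in> ?X. spin_type G n x = \<rho>}) * (of_nat (Z_part_fun G \<rho>) :: complex) = of_nat (card ?W)"
      using card_spin_type[OF x0(1)] unfolding e x0(2) of_nat_mult[symmetric] by (simp only:)
    have "0 < Z_part_fun G \<rho>" using r by (intro Z_part_fun_pos) (simp add: odd_part_funs_iff)
    then have "(of_nat (Z_part_fun G \<rho>) :: complex) \<noteq> 0" by simp
    from nonzero_eq_divide_eq[THEN iffD2, OF this m] show ?thesis .
  qed
  have "0 < card ?W"
    by (rule card_gt_0_iff[THEN iffD2], rule conjI[OF _ finite_wreath], rule notI) (use W.one_closed in simp)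
  then have c0: "(of_nat (card ?W) :: complex) \<noteq> 0" by simp
  have "(\<Sum>x\<in>?W. eta G n \<xi> x * f x * g (inv\<^bsub>spin_wreath G n\<^esub> x)) = (\<Sum>x\<in>?W. if spin_type G n x \<in> ?OP then ?k (spin_type G n x) else 0)"
    by (rule sum.cong[OF refl t])
  also have "\<dots> = (\<Sum>x\<in>?X. ?k (spin_type G n x))"
    by (rule sum.mono_neutral_cong_right) (use finite_wreath in auto)
  also have "\<dots> = (\<Sum>\<rho>\<in>?OP. \<Sum>x\<in>{x \<in> ?X. spin_type G n x = \<rho>}. ?k (spin_type G n x))"
    by (rule sum.group[symmetric]) (use finite_wreath finite_odd_part_funs in auto)
  also have "\<dots> = (\<Sum>\<rho>\<in>?OP. of_nat (card {x \<in> ?X. spin_type G n x = \<rho>}) * ?k \<rho>)"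
    by (intro sum.cong refl) simp
  also have "\<dots> = (\<Sum>\<rho>\<in>?OP. of_nat (card ?W) * (?k \<rho> / of_nat (Z_part_fun G \<rho>)))"
    by (intro sum.cong refl) (simp only: card times_divide_eq_left times_divide_eq_right)
  finally have s: "(\<Sum>x\<in>?W. eta G n \<xi> x * f x * g (inv\<^bsub>spin_wreath G n\<^esub> x))
      = (\<Sum>\<rho>\<in>?OP. of_nat (card ?W) * (?k \<rho> / of_nat (Z_part_fun G \<rho>)))" .
  show ?thesis
    unfolding weighted_form_def Coset.order_def s sum_distrib_left[symmetric] using c0 by (rule nonzero_mult_div_cancel_left)
qed

text \<open>In the double sum over \<rho> and \<mu> only the dual of \<rho> survives. It has the
  same weight as \<rho>, so different degrees are orthogonal on the polynomial side too, and each
  degree reproduces the sum of \<open>weighted_form_spin\<close>.\<close>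

lemma ch_isometric:
  assumes F: "F \<in> spin_space G" and H: "H \<in> spin_space G"
  shows "form (ch G cs F) (ch G cs H) = spin_form G \<xi> F H"
proof -
  let ?N = "{n. F n \<noteq> (\<lambda>_. 0)} \<union> {n. H n \<noteq> (\<lambda>_. 0)}"
  have N: "finite ?N" using F H by (simp add: spin_space_support)
  let ?I = "indices ?N"
  have fI: "finite ?I" by (rule finite_indices[OF N])
  let ?s = "\<lambda>F \<rho>. pconst (ch_coeff F \<rho>) * a_part_fun G \<rho>"
  have a: "a_part_fun G \<rho> \<in> fock G" if "\<rho> \<in> ?I" for \<rho> using indices_odd[OF that] by (rule a_part_fun_fock)
  have sf: "?s F \<rho> \<in> fock G" if "\<rho> \<in> ?I" for F \<rho> using a[OF that] by (intro fock_mult fock_const)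
  have "form (ch G cs F) (ch G cs H) = (\<Sum>\<rho>\<in>?I. \<Sum>\<mu>\<in>?I. form (?s F \<rho>) (?s H \<mu>))"
    unfolding ch_eq[OF F N Un_upper1] ch_eq[OF H N Un_upper2]
    by (subst form_sum(1)) (auto intro!: fock_sum sf sum.cong form_sum(2) simp del: UN_iff)
  also have "\<dots> = (\<Sum>\<rho>\<in>?I. \<Sum>\<mu>\<in>?I. ch_coeff F \<rho> * (ch_coeff H \<mu> * form (a_part_fun G \<rho>) (a_part_fun G \<mu>)))"
    by (intro sum.cong refl) (simp only: form_linear(3)[OF a sf] form_linear(4)[OF a a])
  also have "\<dots> = (\<Sum>\<rho>\<in>?I. \<Sum>\<mu>\<in>?I. if \<mu> = dual_part_fun G \<rho> then ch_coeff F \<rho> * (ch_coeff H (dual_part_fun G \<rho>) *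
      (of_nat (Z_part_fun G \<rho>) * class_prod \<rho> / 2 ^ part_fun_length G \<rho>)) else 0)"
  proof (intro sum.cong refl)
    fix \<rho> \<mu> assume r: "\<rho> \<in> ?I" and m: "\<mu> \<in> ?I"
    show "ch_coeff F \<rho> * (ch_coeff H \<mu> * form (a_part_fun G \<rho>) (a_part_fun G \<mu>))
      = (if \<mu> = dual_part_fun G \<rho> then ch_coeff F \<rho> * (ch_coeff H (dual_part_fun G \<rho>) *
        (of_nat (Z_part_fun G \<rho>) * class_prod \<rho> / 2 ^ part_fun_length G \<rho>)) else 0)"
      unfolding form_part_fun[OF indices_odd[OF r] indices_odd[OF m]] by simp
  qed
  also have "\<dots> = (\<Sum>\<rho>\<in>?I. ch_coeff F \<rho> * (ch_coeff H (dual_part_fun G \<rho>) *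
      (of_nat (Z_part_fun G \<rho>) * class_prod \<rho> / 2 ^ part_fun_length G \<rho>)))"
  proof (rule sum.cong[OF refl])
    fix \<rho> assume "\<rho> \<in> ?I"
    then have d: "dual_part_fun G \<rho> \<in> ?I" using dual_odd_part_funs by blast
    show "(\<Sum>\<mu>\<in>?I. if \<mu> = dual_part_fun G \<rho> then ch_coeff F \<rho> * (ch_coeff H (dual_part_fun G \<rho>) *
        (of_nat (Z_part_fun G \<rho>) * class_prod \<rho> / 2 ^ part_fun_length G \<rho>)) else 0)
      = ch_coeff F \<rho> * (ch_coeff H (dual_part_fun G \<rho>) * (of_nat (Z_part_fun G \<rho>) * class_prod \<rho> / 2 ^ part_fun_length G \<rho>))"
      unfolding sum.delta[OF fI] using d by simp
  qed
  also have "\<dots> = (\<Sum>n\<in>?N. \<Sum>\<rho>\<in>odd_part_funs G n. ch_coeff F \<rho> * (ch_coeff H (dual_part_fun G \<rho>) *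
      (of_nat (Z_part_fun G \<rho>) * class_prod \<rho> / 2 ^ part_fun_length G \<rho>)))"
    by (rule sum_indices[OF N])
  also have "\<dots> = (\<Sum>n\<in>?N. \<Sum>\<rho>\<in>odd_part_funs G n. class_prod \<rho> * val n (F n) \<rho> * val n (H n) (dual_part_fun G \<rho>) / of_nat (Z_part_fun G \<rho>))"
  proof (intro sum.cong refl)
    fix n \<rho> assume "\<rho> \<in> odd_part_funs G n"
    then have r: "odd_part_fun G \<rho>" "part_fun_weight G \<rho> = n" by (simp_all add: odd_part_funs_iff)
    have "ch_coeff F \<rho> * (ch_coeff H (dual_part_fun G \<rho>) * (of_nat (Z_part_fun G \<rho>) * class_prod \<rho> / 2 ^ part_fun_length G \<rho>))
        = (ch_scale \<rho> * ch_scale (dual_part_fun G \<rho>) * of_nat (Z_part_fun G \<rho>) / 2 ^ part_fun_length G \<rho>)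
          * (class_prod \<rho> * val n (F n) \<rho> * val n (H n) (dual_part_fun G \<rho>))"
      unfolding ch_coeff_def part_fun_weight_dual r(2) by (simp add: mult_ac)
    then show "ch_coeff F \<rho> * (ch_coeff H (dual_part_fun G \<rho>) * (of_nat (Z_part_fun G \<rho>) * class_prod \<rho> / 2 ^ part_fun_length G \<rho>))
        = class_prod \<rho> * val n (F n) \<rho> * val n (H n) (dual_part_fun G \<rho>) / of_nat (Z_part_fun G \<rho>)"
      unfolding ch_scale_dual[OF r(1)] by simp
  qed
  also have "\<dots> = (\<Sum>n\<in>?N. weighted_form (spin_wreath G n) (eta G n \<xi>) (F n) (H n))"
    using F H by (intro sum.cong refl weighted_form_spin[symmetric]) (simp_all add: spin_space_def)
  \<comment> \<open>The left side runs over the union of the two supports and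
    \<open>spin_form\<close> over their intersection; a degree in which one family vanishes
    contributes 0.\<close>
  also have "\<dots> = spin_form G \<xi> F H"
    unfolding spin_form_def
    by (rule sum.mono_neutral_right[OF N]) (auto simp: weighted_form_def)
  finally show ?thesis .
qed

theorem ch_isometry: "is_isometry (spin_space G) (spin_form G \<xi>) (fock G) (fock_form G \<xi>) (ch G cs)"
  unfolding is_isometry_def bij_betw_def
  using ch_add ch_mult_const ch_inj ch_fock ch_surj ch_isometric by (intro conjI ballI allI) auto

end

theorem theorem6p6:
  fixes G :: "('a, 'b) monoid_scheme" and \<xi> :: "'a \<Rightarrow> complex" and cs :: "'a set list"
  assumes "group G" and "finite (carrier G)"
    and "\<xi> \<in> class_functions G" and "self_dual G \<xi>"
    and "distinct cs" and "set cs = conj_classes G" and "cs ! 0 = {\<one>\<^bsub>G\<^esub>}"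
  shows "is_isometry (spin_space G) (spin_form G \<xi>) (fock G) (fock_form G \<xi>) (ch G cs)"
proof -
  interpret group G by fact
  interpret weighted_ordered_classes G \<xi> cs
    by unfold_locales (use assms in auto)
  show ?thesis by (rule ch_isometry)
qed

end
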